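(* Let $\bar u$ be a nonconstant $T$-periodic stationary solution of $u_t+f(u)_x=(B(u)u_x)_x$, with associated rest point $u_-$, linearized operator $L$, transversality coefficient $\gamma$, mass derivative $\partial\bar u_m/\partial u_-$ and $\Delta=\det(\partial\bar u_m/\partial u_-)$ as defined in the context. Assume: (i) $f,B\in C^2$; (ii) $\operatorname{Re}\sigma(B(\bar u(x)))>0$ for all $x$; (iii) $df(u_-)$ is invertible; (iv) $\gamma\neq 0$; and suppose in addition that (v) the traveling-wave ODE is quasi-Hamiltonian for the value of $s$ associated with $\bar u$ (i.e. $s=0$). (a) If $\Delta\ne0$, then, for $k$, $\lambda$ sufficiently small, the spectrum of $L$ (that is, the zero set of $D(k,\lambda)$) consists of $n+1$ smooth curves $$\lambda_0(k)=o(k),\qquad \lambda_j(k)=-i\alpha_jkT+o(k),\quad j=1,\dots,n,$$ where $\alpha_1,\dots,\alpha_n$ are the eigenvalues of $df(u_-)(\partial\bar u_m/\partial u_-)^{-1}$. In particular, the condition that $\sigma\big(df(u_-)(\partial\bar u_m/\partial u_-)^{-1}\big)$ be real is necessary for weak spectral stability of $\bar u$. (b) If $\Delta=0$, then there is again a curve $\lambda_0(k)=o(k)$, and, with $\beta_1,\dots,\beta_n$ the eigenvalues of $(\partial\bar u_m/\partial u_-)df(u_-)^{-1}$, there are curves $\lambda_j(k)=-i\alpha_jkT+o(k)$ with $\alpha_j=\beta_j^{-1}$ for all $j$ such that $\beta_j\neq0$. Associated with vanishing $\beta_j$, however, are nonsmooth curves $\lambda(k)\sim k^{p/q}$ with $p/q$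 not an integer; in particular, $\det(\partial\bar u_m/\partial u_-)=0$ implies spectral instability of $\bar u$.
   Context: Setting. Consider $u_t+f(u)_x=(B(u)u_x)_x$, $x\in\mathbb R$, $u,f(u)\in\mathbb R^n$, $B(u)\in\mathbb R^{n\times n}$. Periodic traveling waves $\bar u(x-st)$ are taken, in their rest frame (replacing $f(u)$ by $f(u)-su$), to have speed $s=0$. Thus $\bar u(x)$ is a nonconstant $T$-periodic solution of $B(u)u'=f(u)-f(u_-)$ with $\bar u(0)=\bar u(T)=u_0$, where $u_-\in\mathbb R^n$ is a rest point of this ODE. Coordinates in $\mathbb R^n$ are chosen so that $\bar u'(0)=e_1$, the first standard basis vector. Linearized operator: $Lv=(Bv_x)_x-(Av)_x$, where $B=B(\bar u(x))$ and $A(x)v=df(\bar u(x))v-(dB(\bar u(x))v)\bar u'(x)$ are $T$-periodic. Weak spectral stability of $\bar u$ means $\sigma(L)\subset\{\operatorname{Re}\lambda\le 0\}$, $L$ acting on $L^p(\mathbb R)$; spectral instability means its failure. Evans function: the eigenvalue equation $(Bw')'=(Aw)'+\lambda w$ is written as $W'=\mathbb A(\lambda,x)W$, $W=(w,w')^t$, $\mathbb A=\begin{pmatrix}0&I\\ B^{-1}(\lambda I+A')&B^{-1}(A-B')\end{pmatrix}$. Let $\Psi'=\mathbb A\Psi$, $\Psi(0,\lambda)=I$, $M(\lambda)=\Psi(T,\lambda)$, and $D(k,\lambda)=\det(M(\lambda)-e^{ikT}I)$ for $k\in\mathbb R$, $\lambda\in\mathbb C$. The spectrum of $L$ is the set of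 $\lambda$ with $D(k,\lambda)=0$ for some $k\in\mathbb R$; curves of spectrum are described as roots $\lambda(k)$ of $D(k,\lambda(k))=0$ near $(k,\lambda)=(0,0)$. Variations: for parameters $(u_-,u_0,s)$ near the base values (with $s=0$), let $\bar u^{(u_-,u_0,s)}(x)$ solve $B(u)u'=f(u)-f(u_-)-s(u-u_-)$, $u(0)=u_0$. At the base values put $w_j=(\partial\bar u/\partial u_0)e_j$, $w_{n+j}=(\partial\bar u/\partial u_-)e_j$ ($1\le j\le n$), $\tilde z_1=-\partial\bar u/\partial s$. Write $[g]=g(T)-g(0)$. The transversality coefficient is $\gamma=\det([\tilde z_1],[w_2],\dots,[w_n])$. Mass derivative: if $\gamma\ne0$, then by the Implicit Function Theorem, near the base point the parameters for which $\bar u^{(u_-,u_0,s)}(T)=u_0$ form an $(n+1)$-dimensional surface parametrized by $(u_-,u_0^1)$, $u_0^1=u_0\cdot e_1$. On it define $\bar u_m=\int_0^T\bar u^{(u_-,u_0,s)}(y)\,dy$ (independent of $u_0^1$), and let $\partial\bar u_m/\partial u_-$ be its $n\times n$ derivative at the base point with $u_0^1$ fixed. Equivalently its $j$-th column is $\int_0^T\tilde w_{n+j}$, where $\tilde w_{n+j}$ is the unique element of $w_{n+j}+\operatorname{Span}(\tilde z_1,w_2,\dots,w_n)$ with $[\tilde w_{n+j}]=0$. Quasi-Hamiltonian: the traveling-wave ODE $B(u)u'=f(u)-f(u_-)-s(u-u_-)$, with $s$ held fixed at the base value ($s=0$), admits an integral of motion $H(u_-,u)$ for each $(u_-,u_0)$,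 i.e. $H(u_-,u(x))\equiv H(u_-,u_0)$ for all solutions $u(\cdot)$ with $u(0)=u_0$.
   Formalization: The integral of motion H is also required to be C^1 near (u_-,u_0) with nonzero u-gradient there (a constant H would make the claim false); "smooth" curves means C^1, and C-infinity when the slope is simple. *)

theory Defs
  imports
    "HOL-Complex_Analysis.Complex_Analysis"
    "HOL-Probability.Essential_Supremum"
    "HOL-Library.Landau_Symbols"
begin

subsection \<open>Matrices\<close>

definition cmat :: "real^'n^'m \<Rightarrow> complex^'n^'m" where
  "cmat M = (\<chi> i j. complex_of_real (M $ i $ j))"

definition mat_spectrum :: "complex^'n^'n \<Rightarrow> complex set" where
  "mat_spectrum M = {z. \<exists>v. v \<noteq> 0 \<and> M *v v = z *s v}"

text \<open>\<open>\<alpha>\<close> lists the eigenvalues of \<open>M\<close>, repeated according to algebraic multiplicity.\<close>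
definition eigenvalue_list :: "complex^'n^'n \<Rightarrow> ('n \<Rightarrow> complex) \<Rightarrow> bool" where
  "eigenvalue_list M \<alpha> \<longleftrightarrow> (\<forall>z. det (mat z - M) = (\<Prod>j\<in>UNIV. z - \<alpha> j))"

definition C2 :: "('a::real_normed_vector \<Rightarrow> 'b::real_normed_vector) \<Rightarrow> bool" where
  "C2 g \<longleftrightarrow> (\<exists>(g' :: 'a \<Rightarrow> 'a \<Rightarrow>\<^sub>L 'b) (g'' :: 'a \<Rightarrow> 'a \<Rightarrow>\<^sub>L 'a \<Rightarrow>\<^sub>L 'b).
     (\<forall>u. (g has_derivative blinfun_apply (g' u)) (at u)) \<and>
     (\<forall>u. (g' has_derivative blinfun_apply (g'' u)) (at u)) \<and>
     continuous_on UNIV g'')"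

subsection \<open>Traveling waves\<close>

text \<open>\<open>B(u) u' = f(u) - f(u\<^sub>-) - s (u - u\<^sub>-)\<close> on \<open>S\<close>, with \<open>um\<close> standing for \<open>u\<^sub>-\<close>.\<close>
definition tw_solution ::
  "(real^'n \<Rightarrow> real^'n) \<Rightarrow> (real^'n \<Rightarrow> real^'n^'n) \<Rightarrow> real^'n \<Rightarrow> real \<Rightarrow> real set
    \<Rightarrow> (real \<Rightarrow> real^'n) \<Rightarrow> bool" where
  "tw_solution f B um s S u \<longleftrightarrow>
     (\<forall>x\<in>S. \<exists>v. (u has_vector_derivative v) (at x within S) \<and>
        B (u x) *v v = f (u x) - f um - s *\<^sub>R (u x - um))"

text \<open>
  \<open>U (um, u0, s)\<close> solves the initial value problem on \<open>[0, T]\<close>, for all parameters near \<open>q0\<close>.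
\<close>
definition tw_family ::
  "(real^'n \<Rightarrow> real^'n) \<Rightarrow> (real^'n \<Rightarrow> real^'n^'n) \<Rightarrow> real
    \<Rightarrow> (real^'n) \<times> (real^'n) \<times> real
    \<Rightarrow> ((real^'n) \<times> (real^'n) \<times> real \<Rightarrow> real \<Rightarrow> real^'n) \<Rightarrow> bool" where
  "tw_family f B T q0 U \<longleftrightarrow>
     (\<forall>\<^sub>F (um, u0, s) in nhds q0.
        tw_solution f B um s {0..T} (U (um, u0, s)) \<and> U (um, u0, s) 0 = u0)"

definition variation ::
  "('p::real_normed_vector \<Rightarrow> real \<Rightarrow> real^'n) \<Rightarrow> 'p \<Rightarrow> 'p \<Rightarrow> real \<Rightarrow> real^'n" where
  "variation U q0 dq x = frechet_derivative (\<lambda>q. U q x) (at q0) dq"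

definition jump :: "real \<Rightarrow> (real \<Rightarrow> real^'n) \<Rightarrow> real^'n" where
  "jump T g = g T - g 0"

text \<open>
  The index \<open>i1\<close> plays the role of the first coordinate: column \<open>i1\<close> is \<open>[z\<^sub>1]\<close> with
  \<open>z\<^sub>1 = -\<partial>u/\<partial>s\<close>, and every other column \<open>j\<close> is \<open>[w\<^sub>j]\<close> with \<open>w\<^sub>j = (\<partial>u/\<partial>u\<^sub>0) e\<^sub>j\<close>.
\<close>
definition transversality ::
  "((real^'n) \<times> (real^'n) \<times> real \<Rightarrow> real \<Rightarrow> real^'n) \<Rightarrow> (real^'n) \<times> (real^'n) \<times> real
    \<Rightarrow> real \<Rightarrow> 'n \<Rightarrow> real" where
  "transversality U q0 T i1 =
     det (\<chi> i j. (if j = i1 then jump T (\<lambda>x. - variation U q0 (0, 0, 1) x)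
                  else jump T (variation U q0 (0, axis j 1, 0))) $ i)"

text \<open>
  \<open>\<phi> (um, a) = (u0, s)\<close> parametrizes, near the base point, the surface of parameters whose
  solution satisfies \<open>u(T) = u(0) = u0\<close>, by \<open>um\<close> and the coordinate \<open>a\<close> of \<open>u0\<close> along \<open>i1\<close>.
\<close>
definition periodic_surface ::
  "((real^'n) \<times> (real^'n) \<times> real \<Rightarrow> real \<Rightarrow> real^'n) \<Rightarrow> (real^'n) \<times> (real^'n) \<times> real
    \<Rightarrow> real \<Rightarrow> 'n \<Rightarrow> ((real^'n) \<times> real \<Rightarrow> (real^'n) \<times> real) \<Rightarrow> bool" where
  "periodic_surface U q0 T i1 \<phi> \<longleftrightarrow>
     (case q0 of (um0, u00, s0) \<Rightarrow>
        \<phi> (um0, u00 $ i1) = (u00, s0) \<and>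
        isCont \<phi> (um0, u00 $ i1) \<and>
        (\<forall>\<^sub>F (um, a) in nhds (um0, u00 $ i1).
           fst (\<phi> (um, a)) $ i1 = a \<and> U (um, \<phi> (um, a)) T = fst (\<phi> (um, a))))"

definition mass ::
  "((real^'n) \<times> (real^'n) \<times> real \<Rightarrow> real \<Rightarrow> real^'n) \<Rightarrow> real
    \<Rightarrow> ((real^'n) \<times> real \<Rightarrow> (real^'n) \<times> real) \<Rightarrow> real \<Rightarrow> real^'n \<Rightarrow> real^'n" where
  "mass U T \<phi> a um = integral {0..T} (U (um, \<phi> (um, a)))"

text \<open>
  Conservation of \<open>H\<close> alone is satisfied by constants. What makes \<open>H\<close> an integral of motion is
  that it is \<open>C\<^sup>1\<close> near the base point with nonvanishing gradient in \<open>u\<close> there.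
\<close>
definition quasi_hamiltonian ::
  "(real^'n \<Rightarrow> real^'n) \<Rightarrow> (real^'n \<Rightarrow> real^'n^'n) \<Rightarrow> real \<Rightarrow> real^'n \<Rightarrow> real^'n \<Rightarrow> bool" where
  "quasi_hamiltonian f B s um0 u00 \<longleftrightarrow>
     (\<exists>H :: (real^'n) \<times> (real^'n) \<Rightarrow> real.
        (\<forall>um I u. is_interval I \<and> 0 \<in> I \<and> tw_solution f B um s I u \<longrightarrow>
           (\<forall>x\<in>I. H (um, u x) = H (um, u 0))) \<and>
        (\<exists>S (H' :: (real^'n) \<times> (real^'n) \<Rightarrow> ((real^'n) \<times> (real^'n)) \<Rightarrow>\<^sub>L real).
           open S \<and> (um0, u00) \<in> S \<and>
           (\<forall>z\<in>S. (H has_derivative blinfun_apply (H' z)) (at z)) \<and>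
           continuous_on S H' \<and>
           (\<exists>v. blinfun_apply (H' (um0, u00)) (0, v) \<noteq> 0)))"

subsection \<open>The linearized operator on \<open>L\<^sup>p\<close>\<close>

definition lin_B :: "(real^'n \<Rightarrow> real^'n^'n) \<Rightarrow> (real \<Rightarrow> real^'n) \<Rightarrow> real \<Rightarrow> real^'n^'n" where
  "lin_B B ubar x = B (ubar x)"

definition lin_A ::
  "(real^'n \<Rightarrow> real^'n) \<Rightarrow> (real^'n \<Rightarrow> real^'n^'n) \<Rightarrow> (real \<Rightarrow> real^'n) \<Rightarrow> real \<Rightarrow> real^'n^'n" where
  "lin_A f B ubar x =
     matrix (\<lambda>v. frechet_derivative f (at (ubar x)) v
        - frechet_derivative B (at (ubar x)) v *v vector_derivative ubar (at x))"

definition Lp :: "ennreal \<Rightarrow> (real \<Rightarrow> complex^'n) set" where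
  "Lp p = {g \<in> borel_measurable lborel.
     if p = \<infinity> then \<exists>C. AE x in lborel. norm (g x) \<le> C
     else integrable lborel (\<lambda>x. norm (g x) powr enn2real p)}"

definition Lp_norm :: "ennreal \<Rightarrow> (real \<Rightarrow> complex^'n) \<Rightarrow> real" where
  "Lp_norm p g =
     (if p = \<infinity> then real_of_ereal (esssup lborel (\<lambda>x. ereal (norm (g x))))
      else (LINT x|lborel. norm (g x) powr enn2real p) powr (1 / enn2real p))"

text \<open>
  The graph of \<open>L v = (B v\<^sub>x)\<^sub>x - (A v)\<^sub>x\<close> with domain \<open>W\<^sup>2\<^sup>,\<^sup>p\<close>, whose elements are represented
  by \<open>C\<^sup>1\<close> functions. Weak derivatives enter through the fundamental theorem of calculus.
\<close>
definition L_graph ::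
  "ennreal \<Rightarrow> (real \<Rightarrow> real^'n^'n) \<Rightarrow> (real \<Rightarrow> real^'n^'n)
    \<Rightarrow> ((real \<Rightarrow> complex^'n) \<times> (real \<Rightarrow> complex^'n)) set" where
  "L_graph p Bx Ax = {(v, w). v \<in> Lp p \<and> w \<in> Lp p \<and>
     (\<exists>v1 \<in> Lp p. \<exists>v2 \<in> Lp p.
        (\<forall>x. (v has_vector_derivative v1 x) (at x)) \<and>
        (\<forall>x y. x \<le> y \<longrightarrow> (v2 has_integral v1 y - v1 x) {x..y}) \<and>
        (\<forall>x y. x \<le> y \<longrightarrow>
           (w has_integral (cmat (Bx y) *v v1 y - cmat (Ax y) *v v y)
                         - (cmat (Bx x) *v v1 x - cmat (Ax x) *v v x)) {x..y}))}"

definition L_resolvent_set ::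
  "ennreal \<Rightarrow> (real \<Rightarrow> real^'n^'n) \<Rightarrow> (real \<Rightarrow> real^'n^'n) \<Rightarrow> complex set" where
  "L_resolvent_set p Bx Ax = {l.
     (\<forall>g \<in> Lp p. \<exists>(v, w) \<in> L_graph p Bx Ax. \<forall>x. w x - l *s v x = g x) \<and>
     (\<exists>C. \<forall>(v, w) \<in> L_graph p Bx Ax. Lp_norm p v \<le> C * Lp_norm p (\<lambda>x. w x - l *s v x))}"

definition L_spectrum ::
  "ennreal \<Rightarrow> (real \<Rightarrow> real^'n^'n) \<Rightarrow> (real \<Rightarrow> real^'n^'n) \<Rightarrow> complex set" where
  "L_spectrum p Bx Ax = - L_resolvent_set p Bx Ax"

definition weakly_spectrally_stable ::
  "ennreal \<Rightarrow> (real^'n \<Rightarrow> real^'n) \<Rightarrow> (real^'n \<Rightarrow> real^'n^'n) \<Rightarrow> (real \<Rightarrow> real^'n) \<Rightarrow> bool" where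
  "weakly_spectrally_stable p f B ubar \<longleftrightarrow>
     L_spectrum p (lin_B B ubar) (lin_A f B ubar) \<subseteq> {l. Re l \<le> 0}"

subsection \<open>The Evans function\<close>

definition evans_matrix ::
  "(real \<Rightarrow> real^'n^'n) \<Rightarrow> (real \<Rightarrow> real^'n^'n) \<Rightarrow> complex \<Rightarrow> real \<Rightarrow> complex^('n+'n)^('n+'n)" where
  "evans_matrix Bx Ax l x =
     (let Binv = cmat (matrix_inv (Bx x));
          P = Binv ** (mat l + cmat (vector_derivative Ax (at x)));
          Q = Binv ** cmat (Ax x - vector_derivative Bx (at x))
      in \<chi> i j. case i of
           Inl a \<Rightarrow> (case j of Inl b \<Rightarrow> 0 | Inr b \<Rightarrow> if a = b then 1 else 0)
         | Inr a \<Rightarrow> (case j of Inl b \<Rightarrow> P $ a $ b | Inr b \<Rightarrow> Q $ a $ b))"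

definition fundamental_solution ::
  "(complex \<Rightarrow> real \<Rightarrow> complex^'m^'m) \<Rightarrow> (real \<Rightarrow> complex \<Rightarrow> complex^'m^'m) \<Rightarrow> bool" where
  "fundamental_solution \<A> \<Psi> \<longleftrightarrow>
     (\<forall>l. \<Psi> 0 l = mat 1 \<and>
        (\<forall>x. ((\<lambda>y. \<Psi> y l) has_vector_derivative \<A> l x ** \<Psi> x l) (at x)))"

definition evans_function ::
  "(real \<Rightarrow> complex \<Rightarrow> complex^'m^'m) \<Rightarrow> real \<Rightarrow> real \<Rightarrow> complex \<Rightarrow> complex" where
  "evans_function \<Psi> T k l = det (\<Psi> T l - mat (exp (\<i> * of_real k * of_real T)))"

subsection \<open>Curves of spectrum\<close>

text \<open>
  Near \<open>(k, \<lambda>) = (0, 0)\<close> the zeros of \<open>D k\<close> are exactly the points of the curves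
  \<open>c j\<close>, \<open>j \<in> J\<close>, the order of each zero being the number of curves through it.
\<close>
definition consists_of_curves ::
  "(real \<Rightarrow> complex \<Rightarrow> complex) \<Rightarrow> 'i set \<Rightarrow> ('i \<Rightarrow> real \<Rightarrow> complex) \<Rightarrow> bool" where
  "consists_of_curves D J c \<longleftrightarrow>
     (\<forall>j\<in>J. c j 0 = 0 \<and> (\<exists>\<epsilon>>0. continuous_on {-\<epsilon><..<\<epsilon>} (c j))) \<and>
     (\<exists>\<epsilon>>0. \<exists>\<delta>>0. \<forall>k l. \<bar>k\<bar> < \<epsilon> \<and> norm l < \<delta> \<longrightarrow>
        (D k l = 0 \<longleftrightarrow> (\<exists>j\<in>J. c j k = l)) \<and>
        (D k l = 0 \<longrightarrow> zorder (D k) l = int (card {j\<in>J. c j k = l})))"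

definition C1_curve :: "(real \<Rightarrow> complex) \<Rightarrow> bool" where
  "C1_curve c \<longleftrightarrow> (\<exists>\<epsilon>>0. c C1_differentiable_on {-\<epsilon><..<\<epsilon>})"

text \<open>Infinitely differentiable near \<open>0\<close>; \<open>g m\<close> is the \<open>m\<close>-th derivative.\<close>
definition Cinf_curve :: "(real \<Rightarrow> complex) \<Rightarrow> bool" where
  "Cinf_curve c \<longleftrightarrow>
     (\<exists>\<epsilon>>0. \<exists>g :: nat \<Rightarrow> real \<Rightarrow> complex. g 0 = c \<and>
        (\<forall>m. \<forall>k\<in>{-\<epsilon><..<\<epsilon>}. (g m has_vector_derivative g (Suc m) k) (at k)))"

text \<open>
  \<open>c(k) \<sim> b k\<^sup>r\<close> for a nonzero constant \<open>b\<close> and a nonintegral rational \<open>r\<close>. For \<open>k < 0\<close> the power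
  is the principal complex one.
\<close>
definition fractional_power_curve :: "(real \<Rightarrow> complex) \<Rightarrow> bool" where
  "fractional_power_curve c \<longleftrightarrow>
     (\<exists>b r. b \<noteq> 0 \<and> r \<in> \<rat> \<and> r \<notin> \<int> \<and>
        c \<sim>[at 0] (\<lambda>k. b * of_real k powr of_real (r::real)))"

end

theory Submission
  imports Defs "HOL-Computational_Algebra.Computational_Algebra" "HOL-Real_Asymp.Real_Asymp"
begin

no_notation fps_nth (infixl "$" 75)

text \<open>
  The Evans function has the form \<open>\<Sum>i. a\<^sub>i(w) b\<^sub>i(\<lambda>)\<close> with entire \<open>a\<^sub>i\<close>, \<open>b\<^sub>i\<close> and \<open>w = k\<close>, and it is not
  identically zero in \<open>\<lambda>\<close> at \<open>k = 0\<close>, because for large positive \<open>\<lambda>\<close> a periodic eigenfunction would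
  blow up to a bounded solution of a hyperbolic system with constant coefficients. Its small zeros are
  therefore finitely many Puiseux series in \<open>k\<close>. Their slopes are read off from the limit
  of \<open>D(\<epsilon> a, \<epsilon> b) / \<epsilon>\<^sup>n\<^sup>+\<^sup>1\<close> as \<open>\<epsilon> \<rightarrow> 0\<close>, which is \<open>\<gamma> / det (- df(u\<^sub>-))\<close> times
  \<open>b det (b \<partial>u\<^sub>m/\<partial>u\<^sub>- + i a T df(u\<^sub>-))\<close>. The integral of motion enters through its gradient \<open>\<eta>\<close>
  in \<open>u\<close>, which annihilates \<open>[w\<^sub>2], \<dots>, [w\<^sub>n]\<close>, the wave direction and \<open>[w\<^sub>n\<^sub>+\<^sub>1], \<dots>, [w\<^sub>2\<^sub>n]\<close>, so that \<open>s\<close> is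
  stationary along the surface of periodic waves to first order.

  Roots of this limit polynomial give curves with that slope, analytic in \<open>k\<close> if the slope is simple. The
  remaining zeros, present exactly if \<open>\<Delta> = 0\<close>, grow faster than \<open>k\<close>, hence with an exponent
  strictly between 0 and 1; the branches of \<open>k\<^sup>p\<^sup>/\<^sup>q\<close> for both signs of \<open>k\<close> cannot all stay in a
  half-plane. That a zero of the Evans function belongs to the spectrum on \<open>L\<^sup>p\<close> is seen by truncating
  the Bloch wave.
\<close>

section \<open>Puiseux expansions\<close>

text \<open>Slopes may coincide, and for \<open>\<Delta>\<close> = 0 the order of the zero of
  \<open>D 0\<close> at the origin is finite but not known beforehand, so the implicit function
  theorem does not describe the zeros. Puiseux series do, together with a count of exponents. With
  \<open>k = w^q\<close>, a zero of order \<open>p_j < q\<close> in \<open>w\<close> contributes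
  only \<open>p_j\<close> instead of \<open>q\<close> to the order of \<open>D\<close> along
  \<open>\<lambda> = k \<mu>\<close>. That order has to be \<open>q (n + 1)\<close>, and the limit
  is an explicit polynomial in \<open>\<mu>\<close>; so its roots, with multiplicities, are the
  slopes of the zeros with \<open>p_j \<ge> q\<close>, and whatever remains is steep. Equal slopes
  still give \<open>C1\<close> curves, because \<open>k h(k^(1/q))\<close> is continuously
  differentiable although \<open>k^(1/q)\<close> is not.

  The coordinates \<open>(w, B w' - A w)\<close> are decisive for the limit. The flux is conserved
  at \<open>\<lambda> = 0\<close>, which makes its \<open>n\<close> rows of first order, and the
  derivative of the wave, having zero flux and zero mean, costs one order more: hence the power
  \<open>n + 1\<close>. As \<open>f\<close> and \<open>B\<close> are only \<open>C2\<close>,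
  dependence on parameters is controlled by quadratic remainder estimates.\<close>

definition monic_hol :: "complex set \<Rightarrow> nat \<Rightarrow> (complex \<Rightarrow> complex poly) \<Rightarrow> bool" where
  "monic_hol S d p \<longleftrightarrow> (\<forall>i. (\<lambda>w. coeff (p w) i) holomorphic_on S) \<and>
     (\<forall>w\<in>S. degree (p w) = d \<and> coeff (p w) d = 1)"

text \<open>Newton's identities in logarithmic form: \<open>Q' / Q\<close> is minus the sum of
  \<open>x / (1 - x X)\<close>, and the geometric expansions of these terms add up to the power
  sums.\<close>

lemma fps_deriv_prod_one_minus:
  fixes R :: "complex multiset"
  defines "Q \<equiv> fps_of_poly (\<Prod>x\<in>#R. [:1, - x:])"
  shows "fps_deriv Q = - Q * Abs_fps (\<lambda>n. \<Sum>x\<in>#R. x ^ Suc n)"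
  unfolding Q_def
proof (induction R)
  case empty
  then show ?case by (simp add: fps_zero_def)
next
  case (add a R)
  let ?Q = "fps_of_poly (\<Prod>x\<in>#R. [:1, - x:])" and ?S = "Abs_fps (\<lambda>n. \<Sum>x\<in>#R. x ^ Suc n)"
  have lin: "fps_of_poly [:1, - a:] = 1 - fps_const a * fps_X"
    by (simp add: fps_of_poly_pCons fps_const_neg[symmetric] mult.commute del: fps_const_neg)
  have geo: "(1 - fps_const a * fps_X) * Abs_fps (\<lambda>n. a ^ Suc n) = fps_const a"
  proof (rule fps_ext)
    fix n
    show "fps_nth ((1 - fps_const a * fps_X) * Abs_fps (\<lambda>n. a ^ Suc n)) n = fps_nth (fps_const a) n"
      by (cases n) (simp_all add: ring_distribs mult.assoc)
  qed
  have S: "Abs_fps (\<lambda>n. \<Sum>x\<in>#add_mset a R. x ^ Suc n) = Abs_fps (\<lambda>n. a ^ Suc n) + ?S"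
    by (rule fps_ext) simp
  have Q: "fps_of_poly (\<Prod>x\<in>#add_mset a R. [:1, - x:]) = (1 - fps_const a * fps_X) * ?Q"
    by (simp add: fps_of_poly_mult lin)
  have gen: "- (L * G * Q) + L * (- Q * S) = - (L * Q) * (G + S)" for L G Q S :: "complex fps"
    by (simp add: algebra_simps)
  have "fps_deriv ((1 - fps_const a * fps_X) * ?Q) =
      - (fps_const a * ?Q) + (1 - fps_const a * fps_X) * (- ?Q * ?S)"
    by (simp add: add.IH)
  also have "\<dots> = - ((1 - fps_const a * fps_X) * Abs_fps (\<lambda>n. a ^ Suc n) * ?Q) + (1 - fps_const a * fps_X) * (- ?Q * ?S)"
    by (simp only: geo)
  also have "\<dots> = - ((1 - fps_const a * fps_X) * ?Q) * (Abs_fps (\<lambda>n. a ^ Suc n) + ?S)"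
    by (rule gen)
  finally show ?case by (simp only: Q S)
qed

lemma coeff_prod_roots_reflect:
  fixes R :: "complex multiset"
  shows "degree (\<Prod>x\<in>#R. [:- x, 1:]) = size R"
    and "reflect_poly (\<Prod>x\<in>#R. [:- x, 1:]) = (\<Prod>x\<in>#R. [:1, - x:])"
    and "coeff (\<Prod>x\<in>#R. [:- x, 1:]) (size R) = 1"
proof -
  have ne: "(\<Prod>x\<in>#R. [:- x, 1:]) \<noteq> 0" for R :: "complex multiset"
    by (auto simp: prod_mset_zero_iff)
  show d: "degree (\<Prod>x\<in>#R. [:- x, 1:]) = size R" for R :: "complex multiset"
  proof (induction R)
    case (add x R)
    have "degree ([:- x, 1:] * (\<Prod>x\<in>#R. [:- x, 1:])) = degree [:- x, 1:] + degree (\<Prod>x\<in>#R. [:- x, 1:])"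
      by (rule degree_mult_eq) (use ne in auto)
    then show ?case using add.IH by (simp del: mult_pCons_left)
  qed simp
  show "reflect_poly (\<Prod>x\<in>#R. [:- x, 1:]) = (\<Prod>x\<in>#R. [:1, - x:])"
  proof (induction R)
    case (add x R)
    have "reflect_poly [:- x, 1:] = [:1, - x:]"
      by (simp add: reflect_poly_def cCons_def)
    then show ?case by (simp add: reflect_poly_mult add.IH del: mult_pCons_left)
  qed simp
  have "lead_coeff (\<Prod>x\<in>#R. [:- x, 1:]) = 1" for R :: "complex multiset"
    by (induction R) (auto simp: lead_coeff_mult simp del: mult_pCons_left)
  from this[of R] show "coeff (\<Prod>x\<in>#R. [:- x, 1:]) (size R) = 1" by (simp only: d)
qed

text \<open>Power sums are what contour integrals deliver. In Newton's recursion the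
  \<open>n\<close>-th coefficient is multiplied by \<open>n\<close>, which can be divided out, so
  every coefficient is a polynomial in power sums; reflection passes from factors
  \<open>1 - x X\<close> to monic ones.\<close>

lemma monic_hol_power_sums:
  fixes R :: "complex \<Rightarrow> complex multiset"
  assumes size: "\<And>w. w \<in> S \<Longrightarrow> size (R w) = d"
    and hol: "\<And>m. (\<lambda>w. \<Sum>x\<in>#R w. x ^ m) holomorphic_on S"
  shows "monic_hol S d (\<lambda>w. \<Prod>x\<in>#R w. [:- x, 1:])"
proof -
  let ?Q = "\<lambda>w. fps_of_poly (\<Prod>x\<in>#R w. [:1, - x:])"
  have Q: "(\<lambda>w. fps_nth (?Q w) n) holomorphic_on S" for n
  proof (induction n rule: less_induct)
    case (less n)
    show ?case
    proof (cases n)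
      case 0
      have "poly (\<Prod>x\<in>#M. [:1, - x:]) 0 = 1" for M :: "complex multiset"
        by (induction M) auto
      then have "fps_nth (?Q w) n = 1" for w
        using 0 by (simp add: poly_0_coeff_0)
      then show ?thesis by simp
    next
      case (Suc m)
      have "fps_nth (?Q w) n = - (\<Sum>i=0..m. fps_nth (?Q w) i * (\<Sum>x\<in>#R w. x ^ Suc (m - i))) / of_nat n" for w
      proof -
        have "fps_nth (fps_deriv (?Q w)) m = fps_nth (- ?Q w * Abs_fps (\<lambda>n. \<Sum>x\<in>#R w. x ^ Suc n)) m"
          by (simp only: fps_deriv_prod_one_minus)
        then have eq: "of_nat n * fps_nth (?Q w) n = - (\<Sum>i=0..m. fps_nth (?Q w) i * (\<Sum>x\<in>#R w. x ^ Suc (m - i)))"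
          using Suc by (simp add: fps_mult_nth sum_negf del: power_Suc)
        moreover have "of_nat n \<noteq> (0::complex)" unfolding Suc by (rule of_nat_neq_0)
        moreover have "x = - y / c" if "c * x = - y" "c \<noteq> 0" for x y c :: complex
          using that by (auto simp: field_simps)
        ultimately show ?thesis using eq by blast
      qed
      moreover have "(\<lambda>w. - (\<Sum>i=0..m. fps_nth (?Q w) i * (\<Sum>x\<in>#R w. x ^ Suc (m - i))) / of_nat n) holomorphic_on S"
        using Suc by (intro holomorphic_intros less.IH hol) auto
      ultimately show ?thesis by simp
    qed
  qed
  have "coeff (\<Prod>x\<in>#R w. [:- x, 1:]) i = (if i \<le> d then fps_nth (?Q w) (d - i) else 0)" if "w \<in> S" for w i
  proof (cases "i \<le> d")
    case True
    have "fps_nth (?Q w) (d - i) = coeff (reflect_poly (\<Prod>x\<in>#R w. [:- x, 1:])) (d - i)"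
      by (simp add: coeff_prod_roots_reflect(2))
    also have "\<dots> = coeff (\<Prod>x\<in>#R w. [:- x, 1:]) i"
      using True size[OF that] by (simp add: coeff_reflect_poly coeff_prod_roots_reflect(1))
    finally show ?thesis using True by simp
  next
    case False
    then show ?thesis using size[OF that] by (simp add: coeff_eq_0 coeff_prod_roots_reflect(1))
  qed
  note ceq = this
  have "(\<lambda>w. coeff (\<Prod>x\<in>#R w. [:- x, 1:]) i) holomorphic_on S" for i
  proof -
    have "(\<lambda>w. if i \<le> d then fps_nth (?Q w) (d - i) else 0) holomorphic_on S"
      by (cases "i \<le> d") (simp_all only: if_True if_False Q holomorphic_on_const)
    then show ?thesis by (rule holomorphic_transform) (rule ceq[symmetric])
  qed
  then show ?thesis
    unfolding monic_hol_def using coeff_prod_roots_reflect(1,3) size by metis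
qed

text \<open>Division by a monic polynomial requires no inverses: the coefficient of index
  \<open>i + m\<close> of the product expresses \<open>coeff (V w) i\<close> through coefficients of
  \<open>V\<close> of larger index, so the induction descends from the top.\<close>

lemma monic_hol_quotient:
  assumes p: "\<And>i. (\<lambda>w. coeff (p w) i) holomorphic_on S" and W: "monic_hol S m W"
    and eq: "\<And>w. w \<in> S \<Longrightarrow> p w = W w * V w" and V: "\<And>w. w \<in> S \<Longrightarrow> degree (V w) = e \<and> coeff (V w) e = 1"
  shows "monic_hol S e V"
proof -
  have "(\<lambda>w. coeff (V w) i) holomorphic_on S" for i
  proof (induction "e + 1 - i" arbitrary: i rule: less_induct)
    case less
    show ?case
    proof (cases "i > e")
      case True
      then have "coeff (V w) i = 0" if "w \<in> S" for w using V[OF that] by (simp add: coeff_eq_0)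
      then show ?thesis by (subst holomorphic_cong[OF refl, where g="\<lambda>_. 0"]) auto
    next
      case False
      have "coeff (V w) i = coeff (p w) (i + m) - (\<Sum>j<m. coeff (W w) j * coeff (V w) (i + m - j))" if "w \<in> S" for w
      proof -
        have "coeff (p w) (i + m) = (\<Sum>j\<le>i+m. coeff (W w) j * coeff (V w) (i + m - j))"
          by (simp add: eq[OF that] coeff_mult)
        also have "\<dots> = (\<Sum>j\<le>m. coeff (W w) j * coeff (V w) (i + m - j))"
          using W that by (intro sum.mono_neutral_right) (auto simp: monic_hol_def coeff_eq_0)
        also have "\<dots> = (\<Sum>j<m. coeff (W w) j * coeff (V w) (i + m - j)) + coeff (V w) i"
          using W that by (simp add: lessThan_Suc_atMost[symmetric] monic_hol_def)
        finally show ?thesis by simp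
      qed
      moreover have "(\<lambda>w. coeff (p w) (i + m) - (\<Sum>j<m. coeff (W w) j * coeff (V w) (i + m - j))) holomorphic_on S"
        using W p False by (intro holomorphic_intros less) (auto simp: monic_hol_def)
      ultimately show ?thesis by (subst holomorphic_cong[OF refl]) auto
    qed
  qed
  then show ?thesis using V by (simp add: monic_hol_def)
qed


text \<open>Weierstrass preparation. The power sums of the zeros inside a fixed circle are contour
  integrals of \<open>z^m F' / F\<close>, hence holomorphic in \<open>w\<close> as long as no zero
  crosses the circle, and Newton's identities turn them into coefficients. The form
  \<open>\<Sum> a_i(w) b_i(z)\<close> makes joint continuity and differentiation in \<open>w\<close>
  under the integral immediate.\<close>

lemma zero_cluster:
  fixes a b :: "nat \<Rightarrow> complex \<Rightarrow> complex" and F :: "complex \<Rightarrow> complex \<Rightarrow> complex"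
  assumes r: "r > 0" and a: "\<And>i. a i holomorphic_on ball 0 r" and b: "\<And>i. b i holomorphic_on UNIV"
    and F: "\<And>w z. F w z = (\<Sum>i<K. a i w * b i z)"
    and \<delta>: "\<delta> > 0" and nz: "\<And>z. norm (z - c) \<le> \<delta> \<Longrightarrow> z \<noteq> c \<Longrightarrow> F 0 z \<noteq> 0"
  obtains \<epsilon> p d where "0 < \<epsilon>" "\<epsilon> \<le> r" "monic_hol (ball 0 \<epsilon>) d p"
    "\<And>w z. w \<in> ball 0 \<epsilon> \<Longrightarrow> order z (p w) = (if z \<in> ball c \<delta> \<and> F w z = 0 then nat (zorder (F w) z) else 0)"
    "\<And>w z. w \<in> ball 0 \<epsilon> \<Longrightarrow> z \<in> ball c \<delta> \<Longrightarrow> F w z = 0 \<Longrightarrow> zorder (F w) z > 0"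
    "\<And>w z. w \<in> ball 0 \<epsilon> \<Longrightarrow> norm (z - c) = \<delta> \<Longrightarrow> F w z \<noteq> 0"
proof -
  have ca: "continuous_on (ball 0 r) (a i)" for i using a by (rule holomorphic_on_imp_continuous_on)
  have cb: "continuous_on UNIV (b i)" for i using b by (rule holomorphic_on_imp_continuous_on)
  have b': "deriv (b i) holomorphic_on UNIV" for i by (rule holomorphic_deriv[OF b]) simp
  have cb': "continuous_on UNIV (deriv (b i))" for i using b' by (rule holomorphic_on_imp_continuous_on)
  have a': "deriv (a i) holomorphic_on ball 0 r" for i by (rule holomorphic_deriv[OF a]) simp
  have ca': "continuous_on (ball 0 r) (deriv (a i))" for i using a' by (rule holomorphic_on_imp_continuous_on)
  have Fhol: "F w holomorphic_on UNIV" for w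
    unfolding F[abs_def] by (intro holomorphic_intros b)
  have Fderiv: "deriv (F w) z = (\<Sum>i<K. a i w * deriv (b i) z)" for w z
  proof -
    have "(b i has_field_derivative deriv (b i) z) (at z)" for i
      using holomorphic_derivI[OF b] by auto
    then have "((\<lambda>z. \<Sum>i<K. a i w * b i z) has_field_derivative (\<Sum>i<K. a i w * deriv (b i) z)) (at z)"
      by (intro DERIV_sum DERIV_cmult) auto
    then show ?thesis unfolding F[abs_def] by (rule DERIV_imp_deriv)
  qed
  \<comment> \<open>Uniform continuity on a compact product: the positive minimum of
    \<open>norm (F 0 z)\<close> on the circle prevents zeros there for small
    \<open>w\<close>.\<close>
  obtain \<epsilon> where \<epsilon>: "0 < \<epsilon>" "\<epsilon> \<le> r"
    and sph: "\<And>w z. w \<in> ball 0 \<epsilon> \<Longrightarrow> norm (z - c) = \<delta> \<Longrightarrow> F w z \<noteq> 0"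
  proof -
    have cont: "continuous_on (cball 0 (r/2) \<times> sphere c \<delta>) (\<lambda>x. F (fst x) (snd x))"
      unfolding F using r
      by (intro continuous_intros continuous_on_compose2[OF ca] continuous_on_compose2[OF cb]) auto
    have comp: "compact (cball (0::complex) (r/2) \<times> sphere c \<delta>)" by (intro compact_Times) auto
    have "uniformly_continuous_on (cball 0 (r/2) \<times> sphere c \<delta>) (\<lambda>x. F (fst x) (snd x))"
      by (rule compact_uniformly_continuous[OF cont comp])
    moreover obtain \<eta> where \<eta>: "\<eta> > 0" "\<And>z. z \<in> sphere c \<delta> \<Longrightarrow> norm (F 0 z) \<ge> \<eta>"
    proof -
      have ne: "sphere c \<delta> \<noteq> {}" using \<delta> by simp
      have "continuous_on (sphere c \<delta>) (\<lambda>z. norm (F 0 z))"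
        using Fhol[of 0] holomorphic_on_imp_continuous_on holomorphic_on_subset by (intro continuous_intros) blast
      from continuous_attains_inf[OF compact_sphere ne this]
      obtain z0 where z0: "z0 \<in> sphere c \<delta>" "\<And>z. z \<in> sphere c \<delta> \<Longrightarrow> norm (F 0 z0) \<le> norm (F 0 z)" by blast
      moreover have "F 0 z0 \<noteq> 0"
        using z0(1) \<delta> by (intro nz) (auto simp: dist_norm norm_minus_commute)
      ultimately show thesis using that[of "norm (F 0 z0)"] by auto
    qed
    ultimately obtain d where d: "d > 0" "\<And>x y. x \<in> cball 0 (r/2) \<times> sphere c \<delta> \<Longrightarrow> y \<in> cball 0 (r/2) \<times> sphere c \<delta> \<Longrightarrow> dist x y < d \<Longrightarrow>
        dist (F (fst x) (snd x)) (F (fst y) (snd y)) < \<eta>"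
      unfolding uniformly_continuous_on_def by metis
    show thesis
    proof (rule that[of "min d (r/2)"])
      fix w z assume w: "w \<in> ball (0::complex) (min d (r/2))" and z: "norm (z - c) = \<delta>"
      then have zs: "z \<in> sphere c \<delta>" by (simp add: dist_norm norm_minus_commute)
      have "dist (F w z) (F 0 z) < \<eta>"
        using d(2)[of "(w, z)" "(0, z)"] w zs r by (auto simp: dist_Pair_Pair dist_commute)
      with \<eta>(2)[OF zs] show "F w z \<noteq> 0" by (auto simp: dist_norm)
    qed (use r d in auto)
  qed
  define Z where "Z w = {z \<in> ball c \<delta>. F w z = 0}" for w
  define R where "R w = (\<Sum>z\<in>Z w. replicate_mset (nat (zorder (F w) z)) z)" for w
  define \<gamma> where "\<gamma> = circlepath c \<delta>"
  \<comment> \<open>A constant \<open>F w\<close> with a zero inside would vanish on the circle too,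
    against the choice of \<open>\<epsilon>\<close>. So either the zeros inside are isolated or
    there are none.\<close>
  have nconst: "\<not> F w constant_on ball c (2*\<delta>) \<or> Z w = {}" if w: "w \<in> ball 0 \<epsilon>" for w
  proof (rule ccontr)
    assume *: "\<not> ?thesis"
    then obtain z where z: "z \<in> ball c \<delta>" "F w z = 0" by (auto simp: Z_def)
    from * obtain k where k: "\<And>z. z \<in> ball c (2*\<delta>) \<Longrightarrow> F w z = k" unfolding constant_on_def by blast
    have "F w (c + \<delta>) = 0" using k[of "c + \<delta>"] k[of z] z \<delta> by (auto simp: dist_norm)
    with sph[OF w, of "c + \<delta>"] \<delta> show False by simp
  qed
  have Zfin: "finite {z \<in> cball c \<delta>. F w z = 0}" if w: "w \<in> ball 0 \<epsilon>" for w
  proof (cases "Z w = {}")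
    case True
    then have "{z \<in> cball c \<delta>. F w z = 0} = {}"
      using sph[OF w] by (force simp: Z_def dist_norm norm_minus_commute order_le_less)
    then show ?thesis by (simp only: finite.emptyI)
  next
    case False
    with nconst[OF w] show ?thesis
      using \<delta> by (intro holomorphic_compact_finite_zeros[of _ "ball c (2*\<delta>)"] holomorphic_on_subset[OF Fhol]) auto
  qed
  have Zeq: "{z \<in> cball c \<delta>. F w z = 0} = Z w" if "w \<in> ball 0 \<epsilon>" for w
    using sph[OF that] by (force simp: Z_def dist_norm norm_minus_commute order_le_less)
  have zpos: "zorder (F w) z > 0" if w: "w \<in> ball 0 \<epsilon>" and z: "z \<in> Z w" for w z
  proof -
    have nc: "\<not> F w constant_on ball c (2*\<delta>)" using nconst[OF w] z by auto
    have zz: "z \<in> ball c (2*\<delta>)" "F w z = 0" using z \<delta> by (auto simp: Z_def)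
    obtain g r' n where g: "0 < n" "0 < r'" "g holomorphic_on ball z r'"
        "\<And>x. x \<in> ball z r' \<Longrightarrow> F w x = (x - z) ^ n * g x" "\<And>x. x \<in> ball z r' \<Longrightarrow> g x \<noteq> 0"
      by (rule holomorphic_factor_zero_nonconstant[OF holomorphic_on_subset[OF Fhol] open_ball connected_ball zz nc]) auto
    have "zorder (F w) z = int n"
      by (rule zorder_eqI[where S="ball z r'" and g=g]) (use g in \<open>auto simp: power_int_def mult.commute\<close>)
    then show ?thesis using g(1) by simp
  qed
  \<comment> \<open>The argument principle with weight \<open>z^m\<close>. The larger disc
    \<open>S\<close> may contain further zeros, but these lie outside the circle and have winding
    number 0.\<close>
  have power_sum: "(\<Sum>x\<in>#R w. x ^ m) = contour_integral \<gamma> (\<lambda>z. deriv (F w) z * z ^ m / F w z) / (2 * pi * \<i>)"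
    if w: "w \<in> ball 0 \<epsilon>" for w m
  proof -
    define S where "S = ball c (\<delta> + 1)"
    have finS: "finite {z\<in>S. F w z = 0 \<or> z \<in> {}}"
    proof (cases "F w constant_on S")
      case True
      then obtain k where k: "\<And>z. z \<in> S \<Longrightarrow> F w z = k" by (auto simp: constant_on_def)
      have "c + \<delta> \<in> S" using \<delta> by (simp add: S_def dist_norm)
      then have "k \<noteq> 0" using k sph[OF w, of "c + \<delta>"] \<delta> by force
      then have "{z\<in>S. F w z = 0 \<or> z \<in> {}} = {}" using k by auto
      then show ?thesis by (simp only: finite.emptyI)
    next
      case False
      have "\<not> F w constant_on UNIV" using False constant_on_subset[of "F w" UNIV S] by auto
      then have "finite {z\<in>cball c (\<delta>+1). F w z = 0}"
        by (intro holomorphic_compact_finite_zeros[OF Fhol]) auto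
      then show ?thesis by (rule rev_finite_subset) (auto simp: S_def)
    qed
    have "contour_integral \<gamma> (\<lambda>z. deriv (F w) z * z ^ m / F w z) = 2 * pi * \<i> *
        (\<Sum>p\<in>{z\<in>S. F w z = 0 \<or> z \<in> {}}. winding_number \<gamma> p * p ^ m * zorder (F w) p)"
    proof (rule argument_principle[OF _ _ _ _ _ _ _ _ finS])
      show "path_image \<gamma> \<subseteq> S - {z \<in> S. F w z = 0 \<or> z \<in> {}}"
        using sph[OF w] \<delta> by (auto simp: S_def \<gamma>_def dist_norm norm_minus_commute)
      show "\<forall>z. z \<notin> S \<longrightarrow> winding_number \<gamma> z = 0"
        using \<delta> unfolding S_def \<gamma>_def
        by (intro allI impI winding_number_zero_outside[of _ "cball c \<delta>"]) auto
    qed (auto simp: S_def \<gamma>_def intro!: holomorphic_intros holomorphic_on_subset[OF Fhol])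
    also have "(\<Sum>p\<in>{z\<in>S. F w z = 0 \<or> z \<in> {}}. winding_number \<gamma> p * p ^ m * zorder (F w) p)
       = (\<Sum>p\<in>Z w. p ^ m * zorder (F w) p)"
    proof (rule sum.mono_neutral_cong_right[OF finS])
      show "Z w \<subseteq> {z \<in> S. F w z = 0 \<or> z \<in> {}}" by (auto simp: Z_def S_def)
      show "\<forall>i\<in>{z \<in> S. F w z = 0 \<or> z \<in> {}} - Z w. winding_number \<gamma> i * i ^ m * zorder (F w) i = 0"
      proof
        fix z assume z: "z \<in> {z \<in> S. F w z = 0 \<or> z \<in> {}} - Z w"
        then have "z \<notin> cball c \<delta>" using Zeq[OF w] by auto
        then have "winding_number \<gamma> z = 0"
          using \<delta> unfolding \<gamma>_def by (intro winding_number_zero_outside[of _ "cball c \<delta>"]) auto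
        then show "winding_number \<gamma> z * z ^ m * zorder (F w) z = 0" by simp
      qed
      show "winding_number \<gamma> x * x ^ m * zorder (F w) x = x ^ m * zorder (F w) x" if "x \<in> Z w" for x
        using that by (simp add: \<gamma>_def Z_def winding_number_circlepath dist_norm norm_minus_commute)
    qed
    also have "(\<Sum>p\<in>Z w. p ^ m * zorder (F w) p) = (\<Sum>x\<in>#R w. x ^ m)"
    proof -
      have sums: "(\<Sum>x\<in>#(\<Sum>z\<in>A. N z). x ^ m) = (\<Sum>z\<in>A. \<Sum>x\<in>#N z. x ^ m)" for A N
        by (induction A rule: infinite_finite_induct) auto
      have "(\<Sum>x\<in>#R w. x ^ m) = (\<Sum>z\<in>Z w. \<Sum>x\<in>#replicate_mset (nat (zorder (F w) z)) z. x ^ m)"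
        unfolding R_def by (rule sums)
      also have "\<dots> = (\<Sum>z\<in>Z w. z ^ m * zorder (F w) z)"
        using zpos[OF w] by (intro sum.cong) (auto simp: less_imp_le)
      finally show ?thesis by simp
    qed
    finally show ?thesis by simp
  qed
  have hol: "(\<lambda>w. \<Sum>x\<in>#R w. x ^ m) holomorphic_on ball 0 \<epsilon>" for m
  proof -
    \<comment> \<open>\<open>G\<close> is the derivative of \<open>F\<close> in \<open>z\<close>,
      while \<open>FA\<close> and \<open>GA\<close> are the derivatives of \<open>F\<close> and
      \<open>G\<close> in \<open>w\<close>.\<close>
    define G where "G w z = (\<Sum>i<K. a i w * deriv (b i) z)" for w z
    define FA where "FA w z = (\<Sum>i<K. deriv (a i) w * b i z)" for w z
    define GA where "GA w z = (\<Sum>i<K. deriv (a i) w * deriv (b i) z)" for w z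
    define \<gamma>' where "\<gamma>' t = 2 * pi * \<i> * \<delta> * exp (2 * pi * \<i> * t)" for t :: real
    have \<gamma>: "norm (\<gamma> t - c) = \<delta>" for t using \<delta> by (simp add: \<gamma>_def circlepath norm_mult)
    have c\<gamma>: "continuous_on UNIV \<gamma>" unfolding \<gamma>_def circlepath by (intro continuous_intros)
    have c\<gamma>': "continuous_on UNIV \<gamma>'" unfolding \<gamma>'_def by (intro continuous_intros)
    let ?X = "ball (0::complex) \<epsilon> \<times> cbox (0::real) 1"
    have fs: "fst ` ?X \<subseteq> ball 0 r" using \<epsilon> by auto
    have c\<gamma>2: "continuous_on ?X (\<lambda>x. \<gamma> (snd x))" "continuous_on ?X (\<lambda>x. \<gamma>' (snd x))"
      by (rule continuous_on_compose2[OF c\<gamma> continuous_on_snd[OF continuous_on_id]]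
               continuous_on_compose2[OF c\<gamma>' continuous_on_snd[OF continuous_on_id]]; simp)+
    have c2: "continuous_on ?X (\<lambda>x. a i (fst x))" "continuous_on ?X (\<lambda>x. deriv (a i) (fst x))"
       "continuous_on ?X (\<lambda>x. b i (\<gamma> (snd x)))" "continuous_on ?X (\<lambda>x. deriv (b i) (\<gamma> (snd x)))" for i
      by (rule continuous_on_compose2[OF ca continuous_on_fst[OF continuous_on_id] fs]
               continuous_on_compose2[OF ca' continuous_on_fst[OF continuous_on_id] fs]
               continuous_on_compose2[OF cb c\<gamma>2(1) subset_UNIV] continuous_on_compose2[OF cb' c\<gamma>2(1) subset_UNIV])+
    have F2: "continuous_on ?X (\<lambda>x. F (fst x) (\<gamma> (snd x)))"
        "continuous_on ?X (\<lambda>x. G (fst x) (\<gamma> (snd x)))"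
        "continuous_on ?X (\<lambda>x. FA (fst x) (\<gamma> (snd x)))"
        "continuous_on ?X (\<lambda>x. GA (fst x) (\<gamma> (snd x)))"
          unfolding F G_def FA_def GA_def by (intro continuous_intros c2)+
    have dF: "((\<lambda>w. F w z) has_field_derivative FA w z) (at w within ball 0 \<epsilon>)"
      and dG: "((\<lambda>w. G w z) has_field_derivative GA w z) (at w within ball 0 \<epsilon>)" if "w \<in> ball 0 \<epsilon>" for w z
    proof -
      have "(a i has_field_derivative deriv (a i) w) (at w within ball 0 \<epsilon>)" for i
        using holomorphic_derivI[OF a] that \<epsilon> by (auto intro: DERIV_subset)
      then show "((\<lambda>w. F w z) has_field_derivative FA w z) (at w within ball 0 \<epsilon>)"
         "((\<lambda>w. G w z) has_field_derivative GA w z) (at w within ball 0 \<epsilon>)"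
        unfolding F FA_def G_def GA_def by (auto intro!: DERIV_sum DERIV_cmult_right)
    qed
    have "(\<lambda>w. integral (cbox 0 1) (\<lambda>t. G w (\<gamma> t) * \<gamma> t ^ m / F w (\<gamma> t) * \<gamma>' t)) holomorphic_on ball 0 \<epsilon>"
    proof (rule leibniz_rule_holomorphic[where fx="\<lambda>w t. (GA w (\<gamma> t) * F w (\<gamma> t) - G w (\<gamma> t) * FA w (\<gamma> t)) / (F w (\<gamma> t))\<^sup>2 * \<gamma> t ^ m * \<gamma>' t"])
      show "((\<lambda>w. G w (\<gamma> t) * \<gamma> t ^ m / F w (\<gamma> t) * \<gamma>' t) has_field_derivative
          (GA w (\<gamma> t) * F w (\<gamma> t) - G w (\<gamma> t) * FA w (\<gamma> t)) / (F w (\<gamma> t))\<^sup>2 * \<gamma> t ^ m * \<gamma>' t) (at w within ball 0 \<epsilon>)"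
        if "w \<in> ball 0 \<epsilon>" "t \<in> cbox 0 1" for w t
        by (rule derivative_eq_intros dF dG refl that sph[OF that(1) \<gamma>] | simp)+
           (use sph[OF that(1) \<gamma>] in \<open>simp add: field_simps power2_eq_square\<close>)
      show "(\<lambda>t. G w (\<gamma> t) * \<gamma> t ^ m / F w (\<gamma> t) * \<gamma>' t) integrable_on cbox 0 1" if "w \<in> ball 0 \<epsilon>" for w
        unfolding G_def F using sph[OF that \<gamma>, unfolded F]
        by (intro integrable_continuous continuous_intros continuous_on_compose2[OF cb continuous_on_subset[OF c\<gamma>]]
          continuous_on_compose2[OF cb' continuous_on_subset[OF c\<gamma>]] continuous_on_subset[OF c\<gamma>] continuous_on_subset[OF c\<gamma>']) auto
      show "continuous_on (ball 0 \<epsilon> \<times> cbox 0 1) (\<lambda>(w, t). (GA w (\<gamma> t) * F w (\<gamma> t) - G w (\<gamma> t) * FA w (\<gamma> t)) / (F w (\<gamma> t))\<^sup>2 * \<gamma> t ^ m * \<gamma>' t)"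
        unfolding case_prod_unfold using sph[OF _ \<gamma>]
        by (intro continuous_intros F2 c\<gamma>2) auto
    qed auto
    then have "(\<lambda>w. integral (cbox 0 1) (\<lambda>t. G w (\<gamma> t) * \<gamma> t ^ m / F w (\<gamma> t) * \<gamma>' t) / (2 * pi * \<i>)) holomorphic_on ball 0 \<epsilon>"
      by (intro holomorphic_intros) auto
    moreover have "(\<Sum>x\<in>#R w. x ^ m) = integral (cbox 0 1) (\<lambda>t. G w (\<gamma> t) * \<gamma> t ^ m / F w (\<gamma> t) * \<gamma>' t) / (2 * pi * \<i>)"
      if "w \<in> ball 0 \<epsilon>" for w
      unfolding power_sum[OF that] contour_integral_integral G_def Fderiv
      by (simp add: \<gamma>_def \<gamma>'_def vector_derivative_circlepath)
    ultimately show ?thesis by (subst holomorphic_cong[OF refl]) auto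
  qed
  \<comment> \<open>The number of zeros is the power sum with exponent 0: continuous in
    \<open>w\<close> and integer valued, hence constant on the disc.\<close>
  obtain d where d: "\<And>w. w \<in> ball 0 \<epsilon> \<Longrightarrow> size (R w) = d"
  proof -
    have sz: "(\<Sum>x\<in>#R w. x ^ 0) = complex_of_nat (size (R w))" for w
      by (simp add: sum_mset.distrib)
    have "(\<lambda>w. complex_of_nat (size (R w))) constant_on ball 0 \<epsilon>"
    proof (rule continuous_discrete_range_constant[OF connected_ball])
      show "continuous_on (ball 0 \<epsilon>) (\<lambda>w. complex_of_nat (size (R w)))"
        using holomorphic_on_imp_continuous_on[OF hol[of 0]] by (simp add: sz)
      show "\<exists>e>0. \<forall>y. y \<in> ball 0 \<epsilon> \<and> of_nat (size (R y)) \<noteq> complex_of_nat (size (R x)) \<longrightarrow> e \<le> norm (of_nat (size (R y)) - complex_of_nat (size (R x)))" for x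
      proof (intro exI[of _ 1] conjI allI impI)
        fix y assume "y \<in> ball 0 \<epsilon> \<and> of_nat (size (R y)) \<noteq> complex_of_nat (size (R x))"
        then have "int (size (R y)) - int (size (R x)) \<noteq> 0" by auto
        then have "1 \<le> \<bar>real_of_int (int (size (R y)) - int (size (R x)))\<bar>" by linarith
        also have "\<dots> = norm (complex_of_int (int (size (R y)) - int (size (R x))))" by (metis norm_of_int)
        finally show "1 \<le> norm (of_nat (size (R y)) - complex_of_nat (size (R x)))" by simp
      qed simp
    qed
    then obtain k where "\<And>w. w \<in> ball 0 \<epsilon> \<Longrightarrow> complex_of_nat (size (R w)) = k" by (auto simp: constant_on_def)
    then show thesis using that[of "size (R 0)"] \<epsilon>(1) by (metis centre_in_ball of_nat_eq_iff)
  qed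
  have cnt: "order z (\<Prod>x\<in>#R w. [:- x, 1:]) = (if z \<in> ball c \<delta> \<and> F w z = 0 then nat (zorder (F w) z) else 0)"
    if w: "w \<in> ball 0 \<epsilon>" for w z
  proof -
    have fin: "finite (Z w)" using Zfin[OF w] Zeq[OF w] by simp
    have "proots (\<Prod>x\<in>#M. [:- x, 1:]) = M" for M :: "complex multiset"
    proof (induction M)
      case (add x M)
      have "proots ([:- x, 1:] * (\<Prod>x\<in>#M. [:- x, 1:])) = proots [:- x, 1:] + proots (\<Prod>x\<in>#M. [:- x, 1:])"
        by (rule proots_mult) (auto simp: prod_mset_zero_iff)
      then show ?case using add.IH by (simp del: mult_pCons_left)
    qed simp
    moreover have "(\<Prod>x\<in>#R w. [:- x, 1:]) \<noteq> 0" by (auto simp: prod_mset_zero_iff)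
    ultimately have "order z (\<Prod>x\<in>#R w. [:- x, 1:]) = count (R w) z" by (metis count_proots)
    also have "\<dots> = (\<Sum>x\<in>Z w. if x = z then nat (zorder (F w) x) else 0)"
      unfolding R_def by (auto simp: count_sum intro!: sum.cong)
    also have "\<dots> = (if z \<in> Z w then nat (zorder (F w) z) else 0)"
      using fin by (simp add: sum.delta)
    finally show ?thesis by (simp add: Z_def)
  qed
  show thesis
  proof (rule that[OF \<epsilon> monic_hol_power_sums[of _ R, OF d hol]])
    show "order z (\<Prod>x\<in>#R w. [:- x, 1:]) = (if z \<in> ball c \<delta> \<and> F w z = 0 then nat (zorder (F w) z) else 0)"
      if "w \<in> ball 0 \<epsilon>" for w z using that by (rule cnt)
    show "zorder (F w) z > 0" if "w \<in> ball 0 \<epsilon>" "z \<in> ball c \<delta>" "F w z = 0" for w z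
      using zpos[OF that(1)] that(2,3) unfolding Z_def by blast
    show "F w z \<noteq> 0" if "w \<in> ball 0 \<epsilon>" "norm (z - c) = \<delta>" for w z using that by (rule sph)
  qed
qed

section \<open>Factorization of monic polynomials with holomorphic coefficients\<close>

lemma dvd_from_order:
  fixes p q :: "complex poly"
  assumes "p \<noteq> 0" "q \<noteq> 0" "\<And>z. order z p \<le> order z q"
  shows "p dvd q"
proof -
  have "proots p \<subseteq># proots q" using assms by (simp add: subseteq_mset_def)
  then have "image_mset (\<lambda>x. [:- x, 1:]) (proots p) \<subseteq># image_mset (\<lambda>x. [:- x, 1:]) (proots q)"
    by (rule image_mset_subseteq_mono)
  then obtain M where "image_mset (\<lambda>x. [:- x, 1:]) (proots q) = image_mset (\<lambda>x. [:- x, 1:]) (proots p) + M"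
    by (metis subset_mset.less_eqE)
  then have "(\<Prod>x\<in>#proots p. [:- x, 1:]) dvd (\<Prod>x\<in>#proots q. [:- x, 1:])"
    by simp
  then have "smult (lead_coeff p) (\<Prod>x\<in>#proots p. [:- x, 1:]) dvd smult (lead_coeff q) (\<Prod>x\<in>#proots q. [:- x, 1:])"
    using assms by (simp add: smult_dvd_iff dvd_smult)
  then show ?thesis by (simp only: complex_poly_decompose_multiset)
qed

lemma zorder_poly_eq_order:
  fixes p :: "complex poly"
  assumes "p \<noteq> 0"
  shows "zorder (poly p) z = int (order z p)"
proof -
  obtain q where q: "p = [:- z, 1:] ^ order z p * q" "\<not> [:- z, 1:] dvd q"
    using order_decomp[OF assms] by blast
  have "poly p w = poly q w * (w - z) powi int (order z p)" for w
    by (subst q(1)) (simp add: power_int_def poly_power mult.commute)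
  moreover have "poly q z \<noteq> 0" using q(2) by (simp add: poly_eq_0_iff_dvd)
  ultimately show ?thesis
    by (intro zorder_eqI[where S=UNIV and g="poly q"]) (auto intro!: holomorphic_intros)
qed

text \<open>The roots that start at \<open>c\<close> are collected by Weierstrass preparation into a
  factor \<open>W\<close>; comparing orders of roots shows that \<open>W w\<close> divides
  \<open>P w\<close>, and division by a monic polynomial keeps the cofactor holomorphic.\<close>

lemma monic_hol_Hensel:
  assumes r: "r > 0" and P: "monic_hol (ball 0 r) d P"
  obtains \<epsilon> W V where "0 < \<epsilon>" "\<epsilon> \<le> r" "monic_hol (ball 0 \<epsilon>) (order c (P 0)) W"
    "monic_hol (ball 0 \<epsilon>) (d - order c (P 0)) V" "\<And>w. w \<in> ball 0 \<epsilon> \<Longrightarrow> P w = W w * V w"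
proof -
  have nz: "P w \<noteq> 0" if "w \<in> ball 0 r" for w
    using P that unfolding monic_hol_def by (metis coeff_0 zero_neq_one)
  have P0: "P 0 \<noteq> 0" using nz r by simp
  obtain \<delta>0 where \<delta>0: "\<delta>0 > 0" "\<forall>z\<in>{z. poly (P 0) z = 0}. z \<noteq> c \<longrightarrow> \<delta>0 \<le> dist c z"
    using finite_set_avoid[OF poly_roots_finite[OF P0]] by metis
  define \<delta> where "\<delta> = \<delta>0 / 2"
  have \<delta>: "\<delta> > 0" using \<delta>0 by (simp add: \<delta>_def)
  have iso: "poly (P 0) z \<noteq> 0" if "norm (z - c) \<le> \<delta>" "z \<noteq> c" for z
    using \<delta>0 that by (force simp: \<delta>_def dist_norm norm_minus_commute)
  define a where "a i w = (if i \<le> d then coeff (P w) i else 0)" for i w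
  define b where "b i z = z ^ i" for i and z :: complex
  define F where "F w z = (\<Sum>i<Suc d. a i w * b i z)" for w z
  have FP: "F w z = poly (P w) z" if "w \<in> ball 0 r" for w z
    using P that by (simp add: F_def a_def b_def poly_altdef monic_hol_def lessThan_Suc_atMost)
  have FP': "F w = poly (P w)" if "w \<in> ball 0 r" for w using FP[OF that] by auto
  have a: "a i holomorphic_on ball 0 r" for i
    using P by (cases "i \<le> d") (simp_all add: a_def[abs_def] monic_hol_def)
  have b: "b i holomorphic_on UNIV" for i unfolding b_def[abs_def] by (intro holomorphic_intros)
  obtain \<epsilon> W m where \<epsilon>: "0 < \<epsilon>" "\<epsilon> \<le> r" and W: "monic_hol (ball 0 \<epsilon>) m W" and
    ord: "\<And>w z. w \<in> ball 0 \<epsilon> \<Longrightarrow> order z (W w) = (if z \<in> ball c \<delta> \<and> F w z = 0 then nat (zorder (F w) z) else 0)"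
    by (rule zero_cluster[of r a b F "Suc d" \<delta> c]) (use r \<delta> a b iso FP in \<open>auto simp: F_def\<close>)
  have ord': "order z (W w) = (if z \<in> ball c \<delta> then order z (P w) else 0)" if w: "w \<in> ball 0 \<epsilon>" for w z
    using w \<epsilon> nz[of w] ord[OF w, of z] FP'[of w] zorder_poly_eq_order[of "P w" z]
    by (auto simp: order_eq_0_iff)
  have Wnz: "W w \<noteq> 0" if "w \<in> ball 0 \<epsilon>" for w using W that unfolding monic_hol_def by (metis coeff_0 zero_neq_one)
  have "W w dvd P w" if w: "w \<in> ball 0 \<epsilon>" for w
    using w \<epsilon> nz[of w] Wnz[OF w] by (intro dvd_from_order) (auto simp: ord'[OF w])
  then obtain V where V: "\<And>w. w \<in> ball 0 \<epsilon> \<Longrightarrow> P w = W w * V w"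
    unfolding dvd_def by metis
  have degP: "degree (P w) = d \<and> coeff (P w) d = 1" if "w \<in> ball 0 \<epsilon>" for w
    using P that \<epsilon> by (auto simp: monic_hol_def)
  have degW: "degree (W w) = m \<and> coeff (W w) m = 1" if "w \<in> ball 0 \<epsilon>" for w
    using W that by (auto simp: monic_hol_def)
  have V2: "degree (V w) = d - m \<and> coeff (V w) (d - m) = 1" if w: "w \<in> ball 0 \<epsilon>" for w
  proof -
    have "V w \<noteq> 0" using V[OF w] nz[of w] w \<epsilon> by auto
    then have "d = m + degree (V w)"
      using degree_mult_eq[OF Wnz[OF w], of "V w"] degP[OF w] degW[OF w] V[OF w] by auto
    moreover have "lead_coeff (P w) = lead_coeff (W w) * lead_coeff (V w)"
      by (simp add: V[OF w] lead_coeff_mult)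
    ultimately show ?thesis using degP[OF w] degW[OF w] by simp
  qed
  \<comment> \<open>At \<open>w = 0\<close> the disc contains no root but \<open>c\<close>, so
    \<open>W 0\<close> is a power of one linear factor and its degree can be read off.\<close>
  have m: "m = order c (P 0)"
  proof -
    have 0: "0 \<in> ball 0 \<epsilon>" using \<epsilon> by simp
    have "proots (W 0) = replicate_mset (order c (P 0)) c"
    proof (rule multiset_eqI)
      fix z
      have "z \<in> ball c \<delta> \<Longrightarrow> z \<noteq> c \<Longrightarrow> order z (P 0) = 0"
        using iso[of z] by (intro order_0I) (auto simp: dist_norm norm_minus_commute)
      then show "count (proots (W 0)) z = count (replicate_mset (order c (P 0)) c) z"
        using ord'[OF 0, of z] Wnz[OF 0] \<delta> by (auto simp: dist_norm)
    qed
    then have "W 0 = [:- c, 1:] ^ order c (P 0)"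
      using complex_poly_decompose_multiset[of "W 0"] degW[OF 0] by simp
    then show ?thesis using degW[OF 0] by (simp add: degree_power_eq)
  qed
  have "monic_hol (ball 0 \<epsilon>) (d - m) V"
  proof (rule monic_hol_quotient[OF _ W V V2])
    fix i
    have "(\<lambda>w. coeff (P w) i) holomorphic_on ball 0 r" using P by (simp add: monic_hol_def)
    then show "(\<lambda>w. coeff (P w) i) holomorphic_on ball 0 \<epsilon>"
      by (rule holomorphic_on_subset) (rule subset_ball[OF \<epsilon>(2)])
  qed
  with W have "monic_hol (ball 0 \<epsilon>) (order c (P 0)) W" "monic_hol (ball 0 \<epsilon>) (d - order c (P 0)) V"
    by (simp_all only: m)
  from that[OF \<epsilon> this V] show thesis .
qed

text \<open>Puiseux series without fractional powers: all roots are holomorphic in one common root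
  \<open>w\<close> of the parameter \<open>w^q\<close>, so that no branch has to be chosen.\<close>

definition puiseux_split :: "nat \<Rightarrow> (complex \<Rightarrow> complex poly) \<Rightarrow> bool" where
  "puiseux_split d p \<longleftrightarrow> (\<exists>q\<ge>1. \<exists>\<epsilon>>0. \<exists>g. (\<forall>j<d. g j holomorphic_on ball 0 \<epsilon>) \<and>
     (\<forall>w\<in>ball 0 \<epsilon>. p (w ^ q) = (\<Prod>j<d. [:- g j w, 1:])))"

lemma power_in_ball:
  fixes w :: complex
  assumes "w \<in> ball 0 (min 1 \<epsilon>)" "q \<ge> 1"
  shows "w ^ q \<in> ball 0 (min 1 \<epsilon>)"
proof -
  have "norm w ^ q \<le> norm w ^ 1" using assms by (intro power_decreasing) auto
  then show ?thesis using assms by (auto simp: norm_power)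
qed

text \<open>Both ramification indices are refined to their product: the first family of roots is
  read at \<open>w^q2\<close>, the second at \<open>w^q1\<close>.\<close>

lemma puiseux_split_mult:
  assumes W: "puiseux_split m W" and V: "puiseux_split n V" and "\<epsilon>0 > 0"
    and eq: "\<And>w. w \<in> ball 0 \<epsilon>0 \<Longrightarrow> p w = W w * V w"
  shows "puiseux_split (m + n) p"
proof -
  obtain q1 e1 g1 where 1: "q1 \<ge> 1" "e1 > 0" "\<And>j. j < m \<Longrightarrow> g1 j holomorphic_on ball 0 e1"
    "\<And>w. w \<in> ball 0 e1 \<Longrightarrow> W (w ^ q1) = (\<Prod>j<m. [:- g1 j w, 1:])"
    using W unfolding puiseux_split_def by metis
  obtain q2 e2 g2 where 2: "q2 \<ge> 1" "e2 > 0" "\<And>j. j < n \<Longrightarrow> g2 j holomorphic_on ball 0 e2"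
    "\<And>w. w \<in> ball 0 e2 \<Longrightarrow> V (w ^ q2) = (\<Prod>j<n. [:- g2 j w, 1:])"
    using V unfolding puiseux_split_def by metis
  define \<epsilon> where "\<epsilon> = min 1 (min \<epsilon>0 (min e1 e2))"
  define g where "g j w = (if j < m then g1 j (w ^ q2) else g2 (j - m) (w ^ q1))" for j w
  have pw: "w ^ q \<in> ball 0 e1" "w ^ q \<in> ball 0 e2" "w ^ q \<in> ball 0 \<epsilon>0" if "w \<in> ball 0 \<epsilon>" "q \<ge> 1" for w :: complex and q
    using power_in_ball[of w "min \<epsilon>0 (min e1 e2)" q] that by (auto simp: \<epsilon>_def)
  have "g j holomorphic_on ball 0 \<epsilon>" if "j < m + n" for j
  proof (cases "j < m")
    case True
    have "g1 j \<circ> (\<lambda>w. w ^ q2) holomorphic_on ball 0 \<epsilon>"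
      by (rule holomorphic_on_compose_gen[OF _ 1(3)[OF True]]) (use pw 2(1) in \<open>auto intro!: holomorphic_intros\<close>)
    with True show ?thesis by (simp add: g_def[abs_def] o_def)
  next
    case False
    have "g2 (j - m) \<circ> (\<lambda>w. w ^ q1) holomorphic_on ball 0 \<epsilon>"
      by (rule holomorphic_on_compose_gen[OF _ 2(3)]) (use pw 1(1) that False in \<open>auto intro!: holomorphic_intros\<close>)
    with False show ?thesis by (simp add: g_def[abs_def] o_def)
  qed
  moreover have "p (w ^ (q1 * q2)) = (\<Prod>j<m+n. [:- g j w, 1:])" if w: "w \<in> ball 0 \<epsilon>" for w
  proof -
    have "q1 * q2 \<ge> 1" using 1(1) 2(1) by (simp add: Suc_le_eq)
    then have "p (w ^ (q1 * q2)) = W ((w ^ q2) ^ q1) * V ((w ^ q1) ^ q2)"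
      using eq[OF pw(3)[OF w]] by (simp add: power_mult[symmetric] mult.commute)
    also have "\<dots> = (\<Prod>j<m. [:- g1 j (w ^ q2), 1:]) * (\<Prod>j<n. [:- g2 j (w ^ q1), 1:])"
      using 1(4)[OF pw(1)[OF w 2(1)]] 2(4)[OF pw(2)[OF w 1(1)]] by simp
    also have "(\<Prod>j<m. [:- g1 j (w ^ q2), 1:]) = (\<Prod>j<m. [:- g j w, 1:])"
      by (rule prod.cong) (auto simp: g_def)
    also have "(\<Prod>j<n. [:- g2 j (w ^ q1), 1:]) = (\<Prod>j\<in>{m..<m+n}. [:- g j w, 1:])"
      by (rule prod.reindex_bij_witness[of _ "\<lambda>j. j - m" "\<lambda>j. j + m"]) (auto simp: g_def)
    also have "(\<Prod>j<m. [:- g j w, 1:]) * (\<Prod>j\<in>{m..<m+n}. [:- g j w, 1:]) = (\<Prod>j<m+n. [:- g j w, 1:])"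
      by (subst prod.union_disjoint[symmetric]) (auto intro!: prod.cong)
    finally show ?thesis .
  qed
  ultimately show ?thesis
    unfolding puiseux_split_def using 1(1,2) 2(1,2) assms(3)
    by (intro exI[of _ "q1 * q2"] conjI exI[of _ \<epsilon>] exI[of _ g]) (auto simp: \<epsilon>_def Suc_le_eq)
qed

text \<open>The coefficient of index \<open>i\<close> is homogeneous of degree \<open>d - i\<close>
  in the roots. The case \<open>t = 0\<close> is separate because the calculation substitutes
  \<open>y / t\<close>.\<close>

lemma scale_roots:
  fixes Q :: "complex poly" and x :: "nat \<Rightarrow> complex"
  assumes "Q = (\<Prod>j<d. [:- x j, 1:])"
  shows "(\<Sum>i\<le>d. monom (t ^ (d - i) * coeff Q i) i) = (\<Prod>j<d. [:- (t * x j), 1:])"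
proof -
  have deg: "degree Q = d" and lc: "coeff Q d = 1"
  proof -
    have "degree Q = (\<Sum>j<d. degree [:- x j, 1:])"
      unfolding assms by (rule degree_prod_eq_sum_degree) auto
    then show "degree Q = d" by simp
    have "lead_coeff Q = 1" unfolding assms by (simp add: lead_coeff_prod)
    then show "coeff Q d = 1" by (simp only: \<open>degree Q = d\<close>)
  qed
  have "poly (\<Sum>i\<le>d. monom (t ^ (d - i) * coeff Q i) i) y = poly (\<Prod>j<d. [:- (t * x j), 1:]) y" for y
  proof (cases "t = 0")
    case True
    have "(\<Sum>i\<le>d. t ^ (d - i) * coeff Q i * y ^ i) = (\<Sum>i\<in>{d}. t ^ (d - i) * coeff Q i * y ^ i)"
      by (rule sum.mono_neutral_right) (auto simp: True)
    then show ?thesis using True lc by (simp add: poly_sum poly_monom poly_prod)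
  next
    case False
    have "(\<Sum>i\<le>d. t ^ (d - i) * coeff Q i * y ^ i) = t ^ d * (\<Sum>i\<le>d. coeff Q i * (y / t) ^ i)"
      unfolding sum_distrib_left using False
      by (intro sum.cong refl) (simp add: power_diff power_divide)
    also have "(\<Sum>i\<le>d. coeff Q i * (y / t) ^ i) = poly Q (y / t)"
      by (simp add: poly_altdef deg)
    also have "t ^ d * poly Q (y / t) = (\<Prod>j<d. t * (y / t - x j))"
      by (simp add: assms poly_prod prod.distrib)
    also have "\<dots> = (\<Prod>j<d. y - t * x j)"
      using False by (intro prod.cong) (auto simp: field_simps)
    finally show ?thesis by (simp add: poly_sum poly_monom poly_prod)
  qed
  then show ?thesis by (simp add: poly_eq_poly_eq_iff[symmetric] fun_eq_iff)
qed


lemma puiseux_split_shift: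
  assumes p': "puiseux_split d p'" and "r > 0" and h: "h holomorphic_on ball 0 r"
    and eq: "\<And>w. w \<in> ball 0 r \<Longrightarrow> p w = pcompose (p' w) [:- h w, 1:]"
  shows "puiseux_split d p"
proof -
  obtain q e g where q: "q \<ge> 1" "e > 0" "\<And>j. j < d \<Longrightarrow> g j holomorphic_on ball 0 e"
    "\<And>w. w \<in> ball 0 e \<Longrightarrow> p' (w ^ q) = (\<Prod>j<d. [:- g j w, 1:])"
    using p' unfolding puiseux_split_def by metis
  define \<epsilon> where "\<epsilon> = min 1 (min r e)"
  have pw: "w ^ q \<in> ball 0 r" "w \<in> ball 0 e" if "w \<in> ball 0 \<epsilon>" for w :: complex
    using power_in_ball[of w "min r e" q] that q(1) by (auto simp: \<epsilon>_def)
  have "h \<circ> (\<lambda>w. w ^ q) holomorphic_on ball 0 \<epsilon>"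
    by (rule holomorphic_on_compose_gen[OF _ h]) (use pw in \<open>auto intro!: holomorphic_intros\<close>)
  note hq = this
  have hol: "(\<lambda>w. g j w + h (w ^ q)) holomorphic_on ball 0 \<epsilon>" if "j < d" for j
  proof (rule holomorphic_on_add)
    have "ball 0 \<epsilon> \<subseteq> ball (0::complex) e" by (auto simp: \<epsilon>_def)
    then show "g j holomorphic_on ball 0 \<epsilon>" by (rule holomorphic_on_subset[OF q(3)[OF that]])
  qed (use hq in \<open>simp add: o_def\<close>)
  have "p (w ^ q) = (\<Prod>j<d. [:- (g j w + h (w ^ q)), 1:])" if w: "w \<in> ball 0 \<epsilon>" for w
  proof -
    have "p (w ^ q) = pcompose (\<Prod>j<d. [:- g j w, 1:]) [:- h (w ^ q), 1:]"
      by (simp add: eq[OF pw(1)[OF w]] q(4)[OF pw(2)[OF w]])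
    also have "\<dots> = (\<Prod>j<d. [:- (g j w + h (w ^ q)), 1:])"
      by (simp add: pcompose_prod pcompose_pCons)
    finally show ?thesis .
  qed
  then show ?thesis
    unfolding puiseux_split_def using q(1,2) \<open>r > 0\<close> hol
    by (intro exI[of _ q] conjI exI[of _ \<epsilon>] exI[of _ "\<lambda>j w. g j w + h (w ^ q)"]) (auto simp: \<epsilon>_def)
qed

lemma coeff_pcompose_shift:
  fixes Q :: "complex poly"
  assumes "degree Q \<le> d"
  shows "coeff (pcompose Q [:h, 1:]) k = (\<Sum>i\<le>d. coeff Q i * (of_nat (i choose k) * h ^ (i - k)))"
proof -
  have "poly (pcompose Q [:h, 1:]) y = poly (\<Sum>i\<le>d. smult (coeff Q i) ([:h, 1:] ^ i)) y" for y
  proof -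
    have "poly Q (h + y) = (\<Sum>i\<le>d. coeff Q i * (h + y) ^ i)"
      unfolding poly_altdef using assms by (intro sum.mono_neutral_left) (auto simp: coeff_eq_0)
    then show ?thesis by (simp add: poly_pcompose poly_sum poly_power)
  qed
  then have "pcompose Q [:h, 1:] = (\<Sum>i\<le>d. smult (coeff Q i) ([:h, 1:] ^ i))"
    by (simp add: poly_eq_poly_eq_iff[symmetric] fun_eq_iff)
  moreover have "coeff ([:h, 1:] ^ i) k = of_nat (i choose k) * h ^ (i - k)" for i
    by (cases "k \<le> i") (auto simp: coeff_linear_poly_power coeff_eq_0 degree_linear_power)
  ultimately show ?thesis by (simp add: coeff_sum)
qed

lemma monic_hol_shift:
  assumes p: "monic_hol S d p" and h: "h holomorphic_on S"
  shows "monic_hol S d (\<lambda>w. pcompose (p w) [:h w, 1:])"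
  unfolding monic_hol_def
proof (intro conjI allI ballI)
  fix i
  have "(\<lambda>w. \<Sum>j\<le>d. coeff (p w) j * (of_nat (j choose i) * h w ^ (j - i))) holomorphic_on S"
    using p h unfolding monic_hol_def by (intro holomorphic_intros) auto
  then show "(\<lambda>w. coeff (pcompose (p w) [:h w, 1:]) i) holomorphic_on S"
    by (rule holomorphic_transform) (rule coeff_pcompose_shift[symmetric], use p in \<open>auto simp: monic_hol_def\<close>)
next
  fix w assume w: "w \<in> S"
  then have d: "degree (p w) = d" "coeff (p w) d = 1" using p by (auto simp: monic_hol_def)
  show d': "degree (pcompose (p w) [:h w, 1:]) = d" by (simp add: degree_pcompose d)
  have "lead_coeff (pcompose (p w) [:h w, 1:]) = 1" by (subst lead_coeff_comp) (simp_all add: d)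
  then show "coeff (pcompose (p w) [:h w, 1:]) d = 1" by (simp only: d')
qed

text \<open>If all \<open>d\<close> roots coincided, their vanishing sum would force them to be 0
  and the polynomial to be \<open>y^d\<close>, which a nonzero lower coefficient excludes.\<close>

lemma centered_poly_two_roots:
  fixes Q :: "complex poly"
  assumes Q: "degree Q = d" "coeff Q d = 1" and "d \<ge> 1" and c: "coeff Q (d - 1) = 0"
    and i: "i < d" "coeff Q i \<noteq> 0"
  obtains z where "0 < order z Q" "order z Q < d"
proof -
  obtain z where z: "poly Q z = 0" using alg_closed_imp_poly_has_root[of Q] Q \<open>d \<ge> 1\<close> by auto
  have Q0: "Q \<noteq> 0" using Q by auto
  have pos: "0 < order z Q" using z Q0 by (simp add: order_gt_0_iff)
  have "order z Q \<noteq> d"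
  proof
    assume d: "order z Q = d"
    obtain q where q: "Q = [:- z, 1:] ^ d * q" "\<not> [:- z, 1:] dvd q"
      using order_decomp[OF Q0, of z] d by metis
    have "q \<noteq> 0" using q Q0 by auto
    then have "degree q = 0" using Q(1) by (simp add: q(1) degree_mult_eq degree_power_eq)
    then obtain a where a: "q = [:a:]" by (metis degree_eq_zeroE)
    have Qa: "Q = smult a ([:- z, 1:] ^ d)" by (simp add: q(1) a mult.commute)
    have "a = 1" using Q(2) by (simp add: Qa coeff_linear_poly_power)
    then have "of_nat d * (- z) = (0::complex)"
      using c \<open>d \<ge> 1\<close> binomial_symmetric[of "d - 1" d] \<open>a = 1\<close>
      by (auto simp: Qa coeff_linear_poly_power)
    then have "z = 0" using \<open>d \<ge> 1\<close> by simp
    then have "Q = monom 1 d" using \<open>a = 1\<close> by (simp add: Qa monom_altdef)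
    then show False using i by simp
  qed
  moreover have "order z Q \<le> d" using order_degree[OF Q0] Q(1) by simp
  ultimately show thesis using pos by (intro that[of z]) auto
qed

lemma holomorphic_factor_at_0:
  assumes f: "f holomorphic_on ball 0 r" and r: "r > 0" and nz: "\<exists>w\<in>ball 0 r. f w \<noteq> 0"
  obtains n g r' where "0 < r'" "r' \<le> r" "g holomorphic_on ball 0 r'" "g 0 \<noteq> (0::complex)"
    "\<And>w. w \<in> ball 0 r' \<Longrightarrow> f w = w ^ n * g w"
proof (cases "f 0 = 0")
  case False
  show thesis by (rule that[of r f 0]) (use False r f in auto)
next
  case True
  have nc: "\<not> f constant_on ball 0 r"
  proof
    assume "f constant_on ball 0 r"
    then obtain k where "\<And>w. w \<in> ball 0 r \<Longrightarrow> f w = k" unfolding constant_on_def by blast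
    with True r nz show False by (metis centre_in_ball)
  qed
  have r0: "0 \<in> ball 0 r" using r by simp
  show thesis
  proof (rule holomorphic_factor_zero_nonconstant[OF f open_ball connected_ball r0 True nc])
    fix g e and n :: nat
    assume g: "0 < n" "0 < e" "ball 0 e \<subseteq> ball 0 r" "g holomorphic_on ball 0 e"
      "\<And>w. w \<in> ball 0 e \<Longrightarrow> f w = (w - 0) ^ n * g w" "\<And>w. w \<in> ball 0 e \<Longrightarrow> g w \<noteq> 0"
    then show thesis using r holomorphic_on_subset[OF g(4), of "ball 0 (min e r)"]
      by (intro that[of "min e r" g n]) auto
  qed
qed

text \<open>After subtracting the mean of the roots and scaling, the polynomial at \<open>w = 0\<close> has two different
  roots, so that Hensel's lemma lowers the degree.\<close>
theorem puiseux:
  assumes "r > 0" "monic_hol (ball 0 r) d p"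
  shows "puiseux_split d p"
  using assms
proof (induction d arbitrary: r p rule: less_induct)
  case (less d)
  have step: "puiseux_split d Q" if e: "e > 0" and Q: "monic_hol (ball 0 e) d Q" and z: "0 < order z (Q 0)" "order z (Q 0) < d" for Q e z
  proof -
    obtain e' W V where WV: "0 < e'" "e' \<le> e" "monic_hol (ball 0 e') (order z (Q 0)) W"
        "monic_hol (ball 0 e') (d - order z (Q 0)) V" "\<And>w. w \<in> ball 0 e' \<Longrightarrow> Q w = W w * V w"
      by (rule monic_hol_Hensel[OF e Q, of z]) blast
    have "puiseux_split (order z (Q 0)) W" "puiseux_split (d - order z (Q 0)) V"
      using less.IH[OF _ WV(1)] WV(3,4) z by auto
    from puiseux_split_mult[OF this WV(1) WV(5)] z show ?thesis by simp
  qed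
  show ?case
  proof (cases "d = 0")
    case True
    have "p w = 1" if "w \<in> ball 0 r" for w
    proof -
      have "degree (p w) = 0" "coeff (p w) 0 = 1" using less.prems(2) True that by (auto simp: monic_hol_def)
      then show ?thesis by (metis degree_eq_zeroE coeff_pCons_0 one_pCons)
    qed
    then show ?thesis unfolding puiseux_split_def using less.prems(1) True
      by (intro exI[of _ 1] conjI exI[of _ r] exI[of _ "\<lambda>_ _. 0"]) auto
  next
    case False
    define h where "h w = - coeff (p w) (d - 1) / of_nat d" for w
    have h: "h holomorphic_on ball 0 r"
      using less.prems(2) False unfolding h_def[abs_def] monic_hol_def by (intro holomorphic_intros) auto
    define P where "P w = pcompose (p w) [:h w, 1:]" for w
    have P: "monic_hol (ball 0 r) d P" unfolding P_def by (rule monic_hol_shift[OF less.prems(2) h])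
    have Pd: "degree (P w) = d" "coeff (P w) d = 1" if "w \<in> ball 0 r" for w
      using P that by (auto simp: monic_hol_def)
    have Pc: "coeff (P w) (d - 1) = 0" if "w \<in> ball 0 r" for w
    proof -
      have d: "degree (p w) = d" "coeff (p w) d = 1" using less.prems(2) that by (auto simp: monic_hol_def)
      have "coeff (P w) (d - 1) = (\<Sum>i\<le>d. coeff (p w) i * (of_nat (i choose (d - 1)) * h w ^ (i - (d - 1))))"
        unfolding P_def by (rule coeff_pcompose_shift) (simp add: d)
      also have "\<dots> = (\<Sum>i\<in>{d - 1, d}. coeff (p w) i * (of_nat (i choose (d - 1)) * h w ^ (i - (d - 1))))"
        using False by (intro sum.mono_neutral_right) (auto intro!: binomial_eq_0)
      also have "\<dots> = coeff (p w) (d - 1) + of_nat d * h w"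
        using False binomial_symmetric[of "d - 1" d] by (simp add: d)
      also have "\<dots> = 0" using False by (simp add: h_def)
      finally show ?thesis .
    qed
    have "puiseux_split d P"
    proof (cases "\<forall>i<d. \<forall>w\<in>ball 0 r. coeff (P w) i = 0")
      case True
      have "P w = (\<Prod>j<d. [:- 0, 1:])" if w: "w \<in> ball 0 r" for w
      proof -
        have "P w = monom 1 d"
        proof (rule poly_eqI)
          fix i show "coeff (P w) i = coeff (monom 1 d) i"
            using True w Pd[OF w] by (cases i d rule: linorder_cases) (auto simp: coeff_eq_0)
        qed
        then show ?thesis by (simp add: monom_altdef)
      qed
      then show ?thesis unfolding puiseux_split_def using less.prems(1)
        by (intro exI[of _ 1] conjI exI[of _ r] exI[of _ "\<lambda>_ _. 0"]) auto
    next
      case nonzero: False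
      define I where "I = {i. i < d \<and> (\<exists>w\<in>ball 0 r. coeff (P w) i \<noteq> 0)}"
      have finI: "finite I" "I \<noteq> {}" using nonzero by (auto simp: I_def)
      have "\<exists>n g r'. 0 < r' \<and> r' \<le> r \<and> g holomorphic_on ball 0 r' \<and> g 0 \<noteq> (0::complex) \<and>
          (\<forall>w\<in>ball 0 r'. coeff (P w) i = w ^ n * g w)" if "i \<in> I" for i
      proof -
        have "(\<lambda>w. coeff (P w) i) holomorphic_on ball 0 r" "\<exists>w\<in>ball 0 r. coeff (P w) i \<noteq> 0"
          using that P by (auto simp: monic_hol_def I_def)
        from holomorphic_factor_at_0[OF this(1) less.prems(1) this(2)] show ?thesis by metis
      qed
      then have "\<forall>i\<in>I. \<exists>x. 0 < snd (snd x) \<and> snd (snd x) \<le> r \<and> fst (snd x) holomorphic_on ball 0 (snd (snd x)) \<and>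
          fst (snd x) 0 \<noteq> (0::complex) \<and> (\<forall>w\<in>ball 0 (snd (snd x)). coeff (P w) i = w ^ fst x * fst (snd x) w)"
        by (simp add: split_paired_Ex)
      from bchoice[OF this] obtain X where X: "\<forall>i\<in>I. 0 < snd (snd (X i)) \<and> snd (snd (X i)) \<le> r \<and> fst (snd (X i)) holomorphic_on ball 0 (snd (snd (X i))) \<and>
          fst (snd (X i)) 0 \<noteq> (0::complex) \<and> (\<forall>w\<in>ball 0 (snd (snd (X i))). coeff (P w) i = w ^ fst (X i) * fst (snd (X i)) w)"
        by blast
      define n b \<rho> where "n i = fst (X i)" and "b i = fst (snd (X i))" and "\<rho> i = snd (snd (X i))" for i
      have nb: "0 < \<rho> i" "\<rho> i \<le> r" "b i holomorphic_on ball 0 (\<rho> i)" "b i 0 \<noteq> (0::complex)"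
        "w \<in> ball 0 (\<rho> i) \<Longrightarrow> coeff (P w) i = w ^ (n i) * b i w" if "i \<in> I" for i w
        using X that unfolding n_def b_def \<rho>_def by blast+
      define e where "e = min 1 (min r (Min (\<rho> ` I)))"
      have e: "e > 0" "e \<le> 1" "e \<le> r" "\<And>i. i \<in> I \<Longrightarrow> e \<le> \<rho> i"
      proof -
        have "0 < Min (\<rho> ` I)" using finI nb(1) by (subst Min_gr_iff) auto
        then show "e > 0" "e \<le> 1" "e \<le> r" using less.prems(1) by (auto simp: e_def)
        fix i assume "i \<in> I"
        then have "Min (\<rho> ` I) \<le> \<rho> i" using finI by (intro Min_le) auto
        then show "e \<le> \<rho> i" by (simp add: e_def)
      qed
      \<comment> \<open>The Newton polygon: with \<open>n i\<close> the order of vanishing of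
        coefficient \<open>i\<close>, the index \<open>m\<close> realizes the least slope
        \<open>n i / (d - i)\<close>. The roots are of size at most \<open>w\<close> to this power,
        and some attain it.\<close>
      obtain m where m: "m \<in> I" "\<And>i. i \<in> I \<Longrightarrow> real (n m) / real (d - m) \<le> real (n i) / real (d - i)"
      proof -
        obtain m where "is_arg_min (\<lambda>i. real (n i) / real (d - i)) (\<lambda>i. i \<in> I) m"
          using ex_is_arg_min_if_finite[OF finI] by blast
        then show thesis using that[of m] unfolding is_arg_min_def not_less[symmetric] by blast
      qed
      define s k where "s = d - m" and "k = n m"
      have md: "m < d" using m(1) by (simp add: I_def)
      have s: "s \<ge> 1" using md by (simp add: s_def)
      have key: "k * (d - i) \<le> s * n i" if "i \<in> I" for i
      proof -
        have "i < d" using that by (simp add: I_def)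
        then have "real (n m) * real (d - i) \<le> real (n i) * real (d - m)"
          using m(2)[OF that] md by (simp add: field_simps)
        then have "real (n m * (d - i)) \<le> real (n i * (d - m))" by (simp only: of_nat_mult)
        then show ?thesis unfolding of_nat_le_iff by (simp add: s_def k_def mult.commute)
      qed
      \<comment> \<open>With \<open>w = v^s\<close> and all roots divided by \<open>v^k\<close>,
        coefficient \<open>i\<close> is divided by \<open>v^(k (d - i))\<close>. By
        \<open>key\<close> the truncated subtraction in the exponent is exact, and for
        \<open>i = m\<close> the exponent is 0, so this coefficient does not vanish at
        \<open>v = 0\<close>.\<close>
      define c where "c i v = (if i = d then 1 else if i \<in> I then v ^ (s * n i - k * (d - i)) * b i (v ^ s) else 0)" for i v
      define G where "G v = (\<Sum>i\<le>d. monom (c i v) i)" for v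
      have pw: "v ^ s \<in> ball 0 e" if "v \<in> ball 0 e" for v :: complex
        using power_in_ball[of v e s] that s e(2) by (simp add: min_absorb2)
      have coG: "coeff (G v) i = (if i \<le> d then c i v else 0)" for i v
        by (simp add: G_def coeff_sum)
      have chol: "c i holomorphic_on ball 0 e" for i
      proof (cases "i = d \<or> i \<notin> I")
        case True
        have "c i = (\<lambda>_. if i = d then 1 else 0)" using True by (auto simp: c_def fun_eq_iff)
        then show ?thesis by simp
      next
        case False
        have "(\<lambda>v. v ^ s) ` ball (0::complex) e \<subseteq> ball 0 (\<rho> i)"
        proof (rule image_subsetI)
          fix v :: complex assume "v \<in> ball 0 e"
          from pw[OF this] show "v ^ s \<in> ball 0 (\<rho> i)" using e(4)[of i] False by auto
        qed
        then have "b i \<circ> (\<lambda>v. v ^ s) holomorphic_on ball 0 e"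
          using False by (intro holomorphic_on_compose_gen[OF _ nb(3)[of i]] holomorphic_on_power holomorphic_on_ident) auto
        then have "(\<lambda>v. v ^ (s * n i - k * (d - i)) * b i (v ^ s)) holomorphic_on ball 0 e"
          by (intro holomorphic_on_mult holomorphic_on_power holomorphic_on_ident) (simp add: o_def)
        moreover have "c i = (\<lambda>v. v ^ (s * n i - k * (d - i)) * b i (v ^ s))" using False by (auto simp: c_def fun_eq_iff)
        ultimately show ?thesis by simp
      qed
      have dG: "degree (G v) = d" for v
      proof (rule antisym)
        show "degree (G v) \<le> d" by (rule degree_le) (simp add: coG)
        show "d \<le> degree (G v)" by (rule le_degree) (simp add: coG c_def)
      qed
      have Gm: "monic_hol (ball 0 e) d G"
      proof -
        have "(\<lambda>w. if i \<le> d then c i w else 0) holomorphic_on ball 0 e" for i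
          by (cases "i \<le> d") (simp_all add: chol)
        then show ?thesis unfolding monic_hol_def coG dG by (simp add: c_def)
      qed
      \<comment> \<open>Scaling the roots keeps their sum equal to 0, so the rescaled polynomial is
        still centered.\<close>
      have dI: "d - 1 \<notin> I" using Pc by (auto simp: I_def)
      have "coeff (G 0) (d - 1) = 0" using dI False by (simp add: coG c_def)
      moreover have "coeff (G 0) m \<noteq> 0"
        using m(1) md s nb(4)[OF m(1)] by (simp add: coG c_def k_def s_def mult.commute zero_power)
      moreover have "coeff (G 0) d = 1" "1 \<le> d" using False by (simp_all add: coG c_def)
      ultimately obtain z where z: "0 < order z (G 0)" "order z (G 0) < d"
        using centered_poly_two_roots[OF dG[of 0]] md by blast
      have "puiseux_split d G" by (rule step[OF e(1) Gm z])
      then obtain q e1 g where g: "q \<ge> 1" "e1 > 0" "\<And>j. j < d \<Longrightarrow> g j holomorphic_on ball 0 e1"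
          "\<And>w. w \<in> ball 0 e1 \<Longrightarrow> G (w ^ q) = (\<Prod>j<d. [:- g j w, 1:])"
        unfolding puiseux_split_def by metis
      define \<epsilon> where "\<epsilon> = min e1 e"
      have pq: "w ^ q \<in> ball 0 e" if "w \<in> ball 0 \<epsilon>" for w :: complex
        using power_in_ball[of w e q] that g(1) e(2) by (simp add: min_absorb2 \<epsilon>_def)
      \<comment> \<open>Undoing the scaling: two ramifications have been composed, \<open>q\<close>
        from the rescaled polynomial and \<open>s\<close> from the slope.\<close>
      have "P (w ^ (q * s)) = (\<Prod>j<d. [:- ((w ^ q) ^ k * g j w), 1:])" if w: "w \<in> ball 0 \<epsilon>" for w
      proof -
        let ?v = "w ^ q"
        have vs: "?v ^ s \<in> ball 0 r" using pw[OF pq[OF w]] e(3) by auto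
        have "(\<Sum>i\<le>d. monom ((?v ^ k) ^ (d - i) * coeff (G ?v) i) i) = (\<Prod>j<d. [:- (?v ^ k * g j w), 1:])"
          by (rule scale_roots[OF g(4)]) (use w in \<open>auto simp: \<epsilon>_def\<close>)
        moreover have "P (?v ^ s) = (\<Sum>i\<le>d. monom ((?v ^ k) ^ (d - i) * coeff (G ?v) i) i)"
        proof (rule poly_eqI)
          fix i
          have co: "coeff (\<Sum>i\<le>d. monom ((?v ^ k) ^ (d - i) * coeff (G ?v) i) i) i =
             (if i \<le> d then (?v ^ k) ^ (d - i) * c i ?v else 0)"
            by (simp add: coeff_sum coG)
          consider "i > d" | "i = d" | "i < d" "i \<notin> I" | "i \<in> I" by force
          then show "coeff (P (?v ^ s)) i = coeff (\<Sum>i\<le>d. monom ((?v ^ k) ^ (d - i) * coeff (G ?v) i) i) i"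
          proof cases
            case 4
            have "?v ^ s \<in> ball 0 (\<rho> i)" using pw[OF pq[OF w]] e(4)[OF 4] by auto
            then have "coeff (P (?v ^ s)) i = (?v ^ s) ^ n i * b i (?v ^ s)" by (rule nb(5)[OF 4])
            also have "(?v ^ s) ^ n i = (?v ^ k) ^ (d - i) * ?v ^ (s * n i - k * (d - i))"
            proof -
              have "(x ^ s) ^ a = (x ^ k) ^ b * x ^ (s * a - k * b)" if "k * b \<le> s * a" for x :: complex and a b
                using that by (metis le_add_diff_inverse power_add power_mult)
              from this[OF key[OF 4]] show ?thesis .
            qed
            finally show ?thesis unfolding co using 4 by (simp add: c_def I_def mult.assoc)
          next
            case 1
            then show ?thesis unfolding co using Pd[OF vs] by (simp add: coeff_eq_0)
          next
            case 2
            then show ?thesis unfolding co using Pd[OF vs] by (simp add: c_def)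
          next
            case 3
            then show ?thesis unfolding co using vs by (auto simp: c_def I_def)
          qed
        qed
        ultimately show ?thesis by (simp add: power_mult)
      qed
      moreover have "(\<lambda>w. (w ^ q) ^ k * g j w) holomorphic_on ball 0 \<epsilon>" if "j < d" for j
        by (intro holomorphic_intros holomorphic_on_subset[OF g(3)[OF that]]) (auto simp: \<epsilon>_def)
      ultimately show ?thesis
        unfolding puiseux_split_def using g(1,2) e(1) s
        by (intro exI[of _ "q * s"] conjI exI[of _ \<epsilon>] exI[of _ "\<lambda>j w. (w ^ q) ^ k * g j w"]) (auto simp: \<epsilon>_def Suc_le_eq)
    qed
    then show ?thesis
    proof (rule puiseux_split_shift[OF _ less.prems(1) h])
      fix w :: complex assume "w \<in> ball 0 r"
      show "p w = pcompose (P w) [:- h w, 1:]"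
        unfolding P_def by (simp add: pcompose_assoc[symmetric] pcompose_pCons)
    qed
  qed
qed

section \<open>Zeros of analytic families\<close>

text \<open>Both \<open>f\<close> and the product have the same zeros with the same orders, so their
  quotient has removable singularities only and no zeros.\<close>

lemma factor_out_zeros:
  fixes x :: "nat \<Rightarrow> complex"
  assumes B: "open B" "connected B" "infinite B" and f: "f holomorphic_on B"
    and zeros: "\<And>z. z \<in> B \<Longrightarrow> f z = 0 \<longleftrightarrow> (\<exists>j<d. x j = z)"
    and ord: "\<And>z. z \<in> B \<Longrightarrow> f z = 0 \<Longrightarrow> zorder f z = int (card {j. j < d \<and> x j = z})"
  obtains u where "u holomorphic_on B" "\<And>z. z \<in> B \<Longrightarrow> u z \<noteq> 0"
    "\<And>z. z \<in> B \<Longrightarrow> f z = u z * (\<Prod>j<d. z - x j)"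
proof -
  have "\<exists>w\<in>B. f w \<noteq> 0"
  proof (rule ccontr)
    assume "\<not> ?thesis"
    then have "B \<subseteq> x ` {..<d}" using zeros by force
    then have "finite B" by (rule finite_subset) simp
    with B(3) show False by simp
  qed
  note nz = this
  define R where "R p z = (\<Prod>j | j < d \<and> x j \<noteq> p. z - x j)" for p z
  \<comment> \<open>At a zero the removable singularity is filled by the leading coefficient of
    \<open>f\<close>, which is \<open>zor_poly f z z\<close>, divided by the product over the roots
    different from \<open>z\<close>.\<close>
  define u where "u z = (if f z = 0 then zor_poly f z z / R z z else f z / (\<Prod>j<d. z - x j))" for z
  have split: "(\<Prod>j<d. z - x j) = (z - p) ^ card {j. j < d \<and> x j = p} * R p z" for z p
  proof -
    have "(\<Prod>j<d. z - x j) = (\<Prod>j | j < d \<and> x j = p. z - x j) * (\<Prod>j | j < d \<and> x j \<noteq> p. z - x j)"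
    proof -
      have "(\<Prod>j\<in>{j. j < d \<and> x j = p} \<union> {j. j < d \<and> x j \<noteq> p}. z - x j) =
          (\<Prod>j | j < d \<and> x j = p. z - x j) * (\<Prod>j | j < d \<and> x j \<noteq> p. z - x j)"
        by (rule prod.union_disjoint) auto
      moreover have "{j. j < d \<and> x j = p} \<union> {j. j < d \<and> x j \<noteq> p} = {..<d}" by auto
      ultimately show ?thesis by (simp only:)
    qed
    also have "(\<Prod>j | j < d \<and> x j = p. z - x j) = (\<Prod>j | j < d \<and> x j = p. z - p)" by (rule prod.cong) auto
    finally show ?thesis by (simp add: R_def)
  qed
  have local: "\<exists>h e. e > 0 \<and> ball p e \<subseteq> B \<and> h holomorphic_on ball p e \<and> (\<forall>z\<in>ball p e. u z = h z \<and> h z \<noteq> 0 \<and> f z = u z * (\<Prod>j<d. z - x j))"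
    if p: "p \<in> B" for p
  proof -
    have "finite (x ` {..<d})" by simp
    then obtain e1 where e1: "e1 > 0" "\<And>z. z \<in> x ` {..<d} \<Longrightarrow> z \<noteq> p \<Longrightarrow> e1 \<le> dist p z"
      using finite_set_avoid by metis
    obtain e2 where e2: "e2 > 0" "ball p e2 \<subseteq> B" using B(1) p openE by blast
    have noroot: "x j = p" if "j < d" "x j \<in> ball p e1" for j
      using e1(2)[of "x j"] that by auto
    show ?thesis
    proof (cases "f p = 0")
      case False
      define e where "e = min e1 e2"
      have "\<forall>j<d. x j \<noteq> p" using zeros[OF p] False by auto
      then have nr: "(\<Prod>j<d. z - x j) \<noteq> 0" if "z \<in> ball p e" for z
        using noroot that by (auto simp: e_def)
      have fz: "f z \<noteq> 0" if z: "z \<in> ball p e" for z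
      proof -
        have "z \<in> B" using z e2 by (auto simp: e_def)
        from zeros[OF this] nr[OF z] show ?thesis by auto
      qed
      have "(\<lambda>z. f z / (\<Prod>j<d. z - x j)) holomorphic_on ball p e"
        using nr e2 by (intro holomorphic_intros holomorphic_on_subset[OF f]) (auto simp: e_def)
      moreover have "\<forall>z\<in>ball p e. u z = f z / (\<Prod>j<d. z - x j) \<and> f z / (\<Prod>j<d. z - x j) \<noteq> 0 \<and> f z = u z * (\<Prod>j<d. z - x j)"
        using fz nr by (auto simp: u_def simp del: prod_zero_iff)
      moreover have "e > 0" "ball p e \<subseteq> B" using e1(1) e2 by (auto simp: e_def)
      ultimately show ?thesis by blast
    next
      case True
      define n where "n = zorder f p"
      from zorder_exist_zero[OF f B(1,2) p nz] obtain r where r: "r > 0" "cball p r \<subseteq> B" "zor_poly f p holomorphic_on cball p r"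
        "\<And>w. w \<in> cball p r \<Longrightarrow> f w = zor_poly f p w * (w - p) ^ nat (zorder f p)" "\<And>w. w \<in> cball p r \<Longrightarrow> zor_poly f p w \<noteq> 0"
        by blast
      define e where "e = min e1 r"
      have ord': "nat (zorder f p) = card {j. j < d \<and> x j = p}" using ord[OF p True] by simp
      have Rz: "R p z \<noteq> 0" if "z \<in> ball p e" for z
        using noroot that by (auto simp: R_def e_def)
      have uz: "u z = zor_poly f p z / R p z" if z: "z \<in> ball p e" for z
      proof (cases "z = p")
        case False
        have "f z = zor_poly f p z * (z - p) ^ card {j. j < d \<and> x j = p}" "zor_poly f p z \<noteq> 0"
          using r(4)[of z] r(5)[of z] z ord' by (auto simp: e_def)
        then show ?thesis using False by (simp add: u_def split[of z p])
      qed (simp add: u_def True)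
      have eq: "f z = u z * (\<Prod>j<d. z - x j)" if z: "z \<in> ball p e" for z
        unfolding uz[OF z] split[of z p] using r(4)[of z] z Rz[OF z] ord' by (auto simp: e_def)
      have "(\<lambda>z. zor_poly f p z / R p z) holomorphic_on ball p e"
        using Rz unfolding R_def by (intro holomorphic_intros holomorphic_on_subset[OF r(3)]) (auto simp: e_def)
      moreover have "e > 0" "ball p e \<subseteq> B" using e1(1) r(1,2) by (auto simp: e_def)
      moreover have "u z = zor_poly f p z / R p z \<and> zor_poly f p z / R p z \<noteq> 0 \<and> f z = u z * (\<Prod>j<d. z - x j)" if "z \<in> ball p e" for z
        using uz[OF that] eq[OF that] Rz[OF that] r(5)[of z] that by (auto simp: e_def)
      ultimately show ?thesis by blast
    qed
  qed
  show thesis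
  proof (rule that)
    show "u holomorphic_on B" unfolding holomorphic_on_def
    proof
      fix p assume p: "p \<in> B"
      obtain h e where h: "e > 0" "ball p e \<subseteq> B" "h holomorphic_on ball p e" "\<forall>z\<in>ball p e. u z = h z"
        using local[OF p] by blast
      have "u holomorphic_on ball p e" by (rule holomorphic_transform[OF h(3)]) (use h(4) in auto)
      then have "u field_differentiable at p" using h(1) by (auto simp: holomorphic_on_open field_differentiable_def)
      then show "u field_differentiable at p within B" by (rule field_differentiable_at_within)
    qed
    fix z assume "z \<in> B"
    from local[OF this] show "u z \<noteq> 0" "f z = u z * (\<Prod>j<d. z - x j)" by (metis centre_in_ball)+
  qed
qed

section \<open>Zeros of analytic families in separated variables\<close>

locale analytic_family =
  fixes a b :: "nat \<Rightarrow> complex \<Rightarrow> complex" and K :: nat and F :: "complex \<Rightarrow> complex \<Rightarrow> complex"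
  assumes a: "\<And>i. a i holomorphic_on UNIV" and b: "\<And>i. b i holomorphic_on UNIV"
    and F: "\<And>w z. F w z = (\<Sum>i<K. a i w * b i z)"
    and nontrivial: "\<exists>z. F 0 z \<noteq> 0"
begin

lemma F_hol: "F w holomorphic_on UNIV"
  unfolding F[abs_def] by (intro holomorphic_intros b)

lemma isolated: obtains \<delta> where "\<delta> > 0" "\<And>z. norm z \<le> \<delta> \<Longrightarrow> z \<noteq> 0 \<Longrightarrow> F 0 z \<noteq> 0"
proof (cases "F 0 0 = 0")
  case True
  obtain r where "0 < r" "\<And>z. z \<in> ball 0 r - {0} \<Longrightarrow> F 0 z \<noteq> 0"
    using isolated_zeros[OF F_hol open_UNIV connected_UNIV UNIV_I True UNIV_I] nontrivial by (metis UNIV_I)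
  then show thesis by (intro that[of "r / 2"]) auto
next
  case False
  have "continuous (at 0) (F 0)"
    using holomorphic_on_imp_continuous_on[OF F_hol[of 0]] by (simp add: continuous_on_eq_continuous_at)
  then obtain e where "e > 0" "\<And>z. dist 0 z < e \<Longrightarrow> F 0 z \<noteq> 0"
    using continuous_at_avoid[where f="F 0" and x=0 and a=0] False by blast
  then show thesis by (intro that[of "e / 2"]) auto
qed

text \<open>Besides the branches, the low-frequency analysis needs the unit \<open>u\<close> left
  after dividing them out: it must tend to a nonzero value along
  \<open>\<lambda> = w^q \<mu>\<close>, so that the order of \<open>F\<close> on this line is
  determined by the branches alone.\<close>

lemma puiseux_zeros:
  obtains q \<epsilon> \<delta> g u and d :: nat where "q \<ge> 1" "\<epsilon> > 0" "\<delta> > 0" "\<And>j. j < d \<Longrightarrow> g j holomorphic_on ball 0 \<epsilon>" "\<And>j. j < d \<Longrightarrow> g j 0 = 0"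
    "\<And>w z. w \<in> ball 0 \<epsilon> \<Longrightarrow> norm z < \<delta> \<Longrightarrow> F (w ^ q) z = 0 \<longleftrightarrow> (\<exists>j<d. g j w = z)"
    "\<And>w z. w \<in> ball 0 \<epsilon> \<Longrightarrow> norm z < \<delta> \<Longrightarrow> F (w ^ q) z = 0 \<Longrightarrow> zorder (F (w ^ q)) z = int (card {j. j < d \<and> g j w = z})"
    "\<And>w j. w \<in> ball 0 \<epsilon> \<Longrightarrow> j < d \<Longrightarrow> norm (g j w) < \<delta>"
    "\<And>w z. w \<in> ball 0 \<epsilon> \<Longrightarrow> norm z < \<delta> \<Longrightarrow> F (w ^ q) z = u w z * (\<Prod>j<d. z - g j w)"
    "u 0 0 \<noteq> 0" "\<And>\<mu>. ((\<lambda>w. u w (w ^ q * \<mu>)) \<longlongrightarrow> u 0 0) (at 0)" "(u 0 \<longlongrightarrow> u 0 0) (at 0)"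
proof -
  obtain \<delta> where \<delta>: "\<delta> > 0" "\<And>z. norm z \<le> \<delta> \<Longrightarrow> z \<noteq> 0 \<Longrightarrow> F 0 z \<noteq> 0" using isolated by blast
  obtain \<epsilon>1 p d where p: "0 < \<epsilon>1" "\<epsilon>1 \<le> 1" "monic_hol (ball 0 \<epsilon>1) d p"
    and ord: "\<And>w z. w \<in> ball 0 \<epsilon>1 \<Longrightarrow> order z (p w) = (if z \<in> ball 0 \<delta> \<and> F w z = 0 then nat (zorder (F w) z) else 0)"
    and pos: "\<And>w z. w \<in> ball 0 \<epsilon>1 \<Longrightarrow> z \<in> ball 0 \<delta> \<Longrightarrow> F w z = 0 \<Longrightarrow> zorder (F w) z > 0"
    and sph: "\<And>w z. w \<in> ball 0 \<epsilon>1 \<Longrightarrow> norm (z - 0) = \<delta> \<Longrightarrow> F w z \<noteq> 0"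
  proof (rule zero_cluster[of 1 a b F K \<delta> 0])
    show "a i holomorphic_on ball 0 1" for i using a holomorphic_on_subset by blast
    show "F w z = (\<Sum>i<K. a i w * b i z)" for w z by (rule F)
  qed (use \<delta> b in auto)
  have "puiseux_split d p" by (rule puiseux[OF p(1,3)])
  then obtain q \<epsilon>2 g where g: "q \<ge> 1" "\<epsilon>2 > 0" "\<And>j. j < d \<Longrightarrow> g j holomorphic_on ball 0 \<epsilon>2"
    "\<And>w. w \<in> ball 0 \<epsilon>2 \<Longrightarrow> p (w ^ q) = (\<Prod>j<d. [:- g j w, 1:])"
    unfolding puiseux_split_def by metis
  define \<epsilon> where "\<epsilon> = min 1 (min \<epsilon>1 \<epsilon>2)"
  have \<epsilon>: "\<epsilon> > 0" using p g by (simp add: \<epsilon>_def)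
  have pw: "w ^ q \<in> ball 0 \<epsilon>1" "w \<in> ball 0 \<epsilon>2" if "w \<in> ball 0 \<epsilon>" for w :: complex
    using power_in_ball[of w "min \<epsilon>1 \<epsilon>2" q] that g(1) by (auto simp: \<epsilon>_def)
  have gh: "g j holomorphic_on ball 0 \<epsilon>" if "j < d" for j
    by (rule holomorphic_on_subset[OF g(3)[OF that]]) (auto simp: \<epsilon>_def)
  have ordp: "order z (p (w ^ q)) = card {j. j < d \<and> g j w = z}" if w: "w \<in> ball 0 \<epsilon>" for w z
  proof -
    have "order z (\<Prod>j<d. [:- g j w, 1:]) = count (proots (\<Prod>j<d. [:- g j w, 1:])) z"
      by (subst count_proots) auto
    also have "\<dots> = (\<Sum>j<d. if g j w = z then 1 else 0)"
      by (subst proots_prod) (auto simp: count_sum intro!: sum.cong)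
    also have "\<dots> = card {j. j < d \<and> g j w = z}"
      by (simp add: sum.If_cases lessThan_def Collect_conj_eq)
    finally show ?thesis using g(4)[OF pw(2)[OF w]] by simp
  qed
  have zer: "F (w ^ q) z = 0 \<longleftrightarrow> (\<exists>j<d. g j w = z)" and zo: "F (w ^ q) z = 0 \<Longrightarrow> zorder (F (w ^ q)) z = int (card {j. j < d \<and> g j w = z})"
    if w: "w \<in> ball 0 \<epsilon>" and z: "norm z < \<delta>" for w z
  proof -
    have "order z (p (w ^ q)) > 0 \<longleftrightarrow> F (w ^ q) z = 0"
      using ord[OF pw(1)[OF w], of z] pos[OF pw(1)[OF w], of z] z by auto
    moreover have "card {j. j < d \<and> g j w = z} > 0 \<longleftrightarrow> (\<exists>j<d. g j w = z)" by (auto simp: card_gt_0_iff)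
    ultimately show "F (w ^ q) z = 0 \<longleftrightarrow> (\<exists>j<d. g j w = z)" using ordp[OF w] by simp
    show "zorder (F (w ^ q)) z = int (card {j. j < d \<and> g j w = z})" if "F (w ^ q) z = 0"
      using ord[OF pw(1)[OF w], of z] pos[OF pw(1)[OF w], of z] z that ordp[OF w, of z] by auto
  qed
  have gs: "norm (g j w) < \<delta>" if w: "w \<in> ball 0 \<epsilon>" and j: "j < d" for w j
  proof (rule ccontr)
    assume "\<not> norm (g j w) < \<delta>"
    then have "order (g j w) (p (w ^ q)) = 0" using ord[OF pw(1)[OF w], of "g j w"] by auto
    then have "card {j'. j' < d \<and> g j' w = g j w} = 0" using ordp[OF w] by simp
    then show False using j by auto
  qed
  have g0: "g j 0 = 0" if j: "j < d" for j
  proof (rule ccontr)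
    assume n: "g j 0 \<noteq> 0"
    have "(0::complex) ^ q = 0" using g(1) by (simp add: power_0_left)
    note zq = this
    have "F (0 ^ q) (g j 0) = 0" using zer[of 0 "g j 0"] gs[of 0 j] j \<epsilon> by auto
    then have "F 0 (g j 0) = 0" unfolding zq .
    then show False using \<delta>(2)[OF _ n] gs[of 0 j] j \<epsilon> by auto
  qed
  have infB: "infinite (ball (0::complex) \<delta>)" using \<delta>(1) uncountable_ball uncountable_infinite by blast
  have "\<exists>u. u holomorphic_on ball 0 \<delta> \<and> (\<forall>z\<in>ball 0 \<delta>. u z \<noteq> 0 \<and> F (w ^ q) z = u z * (\<Prod>j<d. z - g j w))" if w: "w \<in> ball 0 \<epsilon>" for w
  proof -
    have "F (w ^ q) holomorphic_on ball 0 \<delta>" by (rule holomorphic_on_subset[OF F_hol subset_UNIV])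
    moreover have "F (w ^ q) z = 0 \<longleftrightarrow> (\<exists>j<d. g j w = z)" if "z \<in> ball 0 \<delta>" for z
      by (rule zer[OF w]) (use that in simp)
    moreover have "zorder (F (w ^ q)) z = int (card {j. j < d \<and> g j w = z})" if "z \<in> ball 0 \<delta>" "F (w ^ q) z = 0" for z
      by (rule zo[OF w _ that(2)]) (use that in simp)
    ultimately show ?thesis
      by (rule factor_out_zeros[OF open_ball connected_ball infB]) blast+
  qed
  then obtain u where u: "\<And>w. w \<in> ball 0 \<epsilon> \<Longrightarrow> u w holomorphic_on ball 0 \<delta>"
     "\<And>w z. w \<in> ball 0 \<epsilon> \<Longrightarrow> norm z < \<delta> \<Longrightarrow> u w z \<noteq> 0 \<and> F (w ^ q) z = u w z * (\<Prod>j<d. z - g j w)"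
    by (metis mem_ball_0)
  have u00: "u 0 0 \<noteq> 0" using u(2)[of 0 0] \<epsilon> \<delta> by auto
  \<comment> \<open>An intermediate circle. For small \<open>w\<close> all branches stay strictly
    inside it, so on this circle \<open>u\<close> is the jointly continuous quotient
    \<open>Q\<close>.\<close>
  define R where "R = \<delta> / 2"
  have R: "0 < R" "R < \<delta>" using \<delta> by (auto simp: R_def)
  have cg: "continuous_on (ball 0 \<epsilon>) (g j)" if "j < d" for j using gh[OF that] by (rule holomorphic_on_imp_continuous_on)
  obtain \<rho> where \<rho>: "0 < \<rho>" "\<rho> < \<epsilon>" "\<And>w j. norm w \<le> \<rho> \<Longrightarrow> j < d \<Longrightarrow> norm (g j w) < R"
  proof -
    have "\<forall>\<^sub>F w in nhds 0. norm (g j w) < R" if "j < d" for j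
    proof -
      have "isCont (g j) 0" using cg[OF that] \<epsilon> by (auto simp: continuous_on_eq_continuous_at)
      then have "((\<lambda>w. norm (g j w)) \<longlongrightarrow> norm (g j 0)) (nhds 0)"
        by (intro tendsto_norm) (simp add: isCont_def tendsto_at_iff_tendsto_nhds)
      from order_tendstoD(2)[OF this, of R] show ?thesis using R g0[OF that] by simp
    qed
    then have "\<forall>\<^sub>F w in nhds 0. \<forall>j\<in>{..<d}. norm (g j w) < R" by (intro eventually_ball_finite) auto
    then obtain e where e: "e > 0" "\<And>w. norm w < e \<Longrightarrow> \<forall>j<d. norm (g j w) < R"
      unfolding eventually_nhds_metric by auto
    show thesis by (rule that[of "min e \<epsilon> / 2"]) (use e \<epsilon> in auto)
  qed
  define Q where "Q w z = F (w ^ q) z / (\<Prod>j<d. z - g j w)" for w z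
  let ?X = "cball (0::complex) \<rho> \<times> sphere (0::complex) R"
  have nzp: "(\<Prod>j<d. z - g j w) \<noteq> 0" if "norm w \<le> \<rho>" "norm z = R" for w z
    using \<rho>(3)[OF that(1)] that(2) by auto
  have uQ: "u w z = Q w z" if "norm w \<le> \<rho>" "norm z = R" for w z
    using u(2)[of w z] \<rho> R that nzp[OF that] by (auto simp: Q_def)
  have cX: "continuous_on ?X (\<lambda>x. Q (fst x) (snd x))"
    unfolding Q_def F using \<rho> nzp
    by (intro continuous_intros continuous_on_compose2[OF holomorphic_on_imp_continuous_on[OF a]]
          continuous_on_compose2[OF holomorphic_on_imp_continuous_on[OF b]] continuous_on_compose2[OF cg]) auto
  have "compact ?X" by (intro compact_Times) auto
  from compact_uniformly_continuous[OF cX this]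
  have uc: "\<And>\<eta>. \<eta> > 0 \<Longrightarrow> \<exists>e>0. \<forall>x\<in>?X. \<forall>y\<in>?X. dist y x < e \<longrightarrow> dist (Q (fst y) (snd y)) (Q (fst x) (snd x)) < \<eta>"
    unfolding uniformly_continuous_on_def by blast
  \<comment> \<open>Closeness of \<open>u w\<close> to \<open>u 0\<close> is evident only on the
    circle; the maximum modulus principle carries it inside, across the zeros.\<close>
  have close: "\<exists>e>0. \<forall>w z. norm w < e \<longrightarrow> norm z < R \<longrightarrow> norm (u w z - u 0 z) \<le> \<eta>" if \<eta>: "\<eta> > 0" for \<eta>
  proof -
    obtain e where e: "e > 0" "\<And>x y. x \<in> ?X \<Longrightarrow> y \<in> ?X \<Longrightarrow> dist y x < e \<Longrightarrow> dist (Q (fst y) (snd y)) (Q (fst x) (snd x)) < \<eta>"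
      using uc[OF \<eta>] by blast
    have "norm (u w z - u 0 z) \<le> \<eta>" if w: "norm w < min e \<rho>" and z: "norm z < R" for w z
    proof (rule maximum_modulus_frontier[where S="ball 0 R" and f="\<lambda>z. u w z - u 0 z"])
      have w': "w \<in> ball 0 \<epsilon>" using w \<rho> by auto
      have h: "(\<lambda>z. u w z - u 0 z) holomorphic_on ball 0 \<delta>"
        using u(1)[OF w'] u(1)[of 0] \<epsilon> by (intro holomorphic_intros) auto
      then show "(\<lambda>z. u w z - u 0 z) holomorphic_on interior (ball 0 R)"
        using R by (auto intro: holomorphic_on_subset)
      show "continuous_on (closure (ball 0 R)) (\<lambda>z. u w z - u 0 z)"
        using R by (intro continuous_on_subset[OF holomorphic_on_imp_continuous_on[OF h]]) auto
      fix x assume "x \<in> frontier (ball (0::complex) R)"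
      then have x: "norm x = R" using R by (simp add: frontier_ball)
      have "dist (Q w x) (Q 0 x) < \<eta>"
        using e(2)[of "(0, x)" "(w, x)"] w x \<rho> by (auto simp: dist_Pair_Pair)
      then show "norm (u w x - u 0 x) \<le> \<eta>"
        using uQ[of w x] uQ[of 0 x] w x \<rho> by (simp add: dist_norm)
    qed (use z in auto)
    then show ?thesis using e(1) \<rho>(1) by (intro exI[of _ "min e \<rho>"]) auto
  qed
  have "isCont (u 0) 0" using holomorphic_on_imp_continuous_on[OF u(1)[of 0]] \<epsilon> \<delta>
    by (auto simp: continuous_on_eq_continuous_at)
  then have u0: "(u 0 \<longlongrightarrow> u 0 0) (nhds 0)" "(u 0 \<longlongrightarrow> u 0 0) (at 0)"
    by (simp_all add: isCont_def tendsto_at_iff_tendsto_nhds)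
  have lim: "((\<lambda>w. u w (w ^ q * \<mu>)) \<longlongrightarrow> u 0 0) (at 0)" for \<mu>
  proof -
    have "((\<lambda>w. w ^ q * \<mu>) \<longlongrightarrow> 0 ^ q * \<mu>) (at 0)" by (intro tendsto_intros)
    then have z0: "((\<lambda>w. w ^ q * \<mu>) \<longlongrightarrow> 0) (at 0)" using g(1) by (simp add: zero_power)
    have l0: "((\<lambda>w. u 0 (w ^ q * \<mu>)) \<longlongrightarrow> u 0 0) (at 0)"
      by (rule filterlim_compose[OF u0(1)]) (use z0 in \<open>simp add: filterlim_def\<close>)
    have "((\<lambda>w. u w (w ^ q * \<mu>) - u 0 (w ^ q * \<mu>)) \<longlongrightarrow> 0) (at 0)"
    proof (rule tendstoI)
      fix \<eta> :: real assume \<eta>: "\<eta> > 0"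
      obtain e where e: "e > 0" "\<forall>w z. norm w < e \<longrightarrow> norm z < R \<longrightarrow> norm (u w z - u 0 z) \<le> \<eta> / 2"
        using close[of "\<eta> / 2"] \<eta> by auto
      have "\<forall>\<^sub>F w in at 0. norm (w ^ q * \<mu>) < R" using tendstoD[OF z0 R(1)] by simp
      moreover have "\<forall>\<^sub>F w in at (0::complex). norm w < e" using e(1) by (auto simp: eventually_at)
      ultimately show "\<forall>\<^sub>F w in at 0. dist (u w (w ^ q * \<mu>) - u 0 (w ^ q * \<mu>)) 0 < \<eta>"
      proof eventually_elim
        case (elim w)
        with e(2) have "norm (u w (w ^ q * \<mu>) - u 0 (w ^ q * \<mu>)) \<le> \<eta> / 2" by blast
        then show ?case using \<eta> by simp
      qed
    qed
    from tendsto_add[OF this l0] show ?thesis by simp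
  qed
  have uF: "F (w ^ q) z = u w z * (\<Prod>j<d. z - g j w)" if "w \<in> ball 0 \<epsilon>" "norm z < \<delta>" for w z
    using u(2)[OF that] by blast
  show thesis by (rule that[of q \<epsilon> \<delta> d g u, OF g(1) \<epsilon> \<delta>(1) gh g0 zer zo gs uF u00 lim u0(2)])
qed

end

section \<open>Curves given by holomorphic functions of a root of the real parameter\<close>

definition rt :: "nat \<Rightarrow> real \<Rightarrow> complex" where
  "rt q k = complex_of_real k powr (1 / of_nat q)"

lemma rt_power:
  assumes "p \<ge> 1"
  shows "rt q k ^ p = complex_of_real k powr (of_real (real p / real q))"
proof (cases "k = 0")
  case True
  then show ?thesis using assms by (simp add: rt_def power_0_left)
next
  case False
  then show ?thesis
    by (simp add: rt_def powr_def exp_of_nat_mult[symmetric])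
qed

lemma rt_power_q: "q \<ge> 1 \<Longrightarrow> rt q k ^ q = of_real k"
  by (simp add: rt_power)

lemma norm_rt: "q \<ge> 1 \<Longrightarrow> norm (rt q k) ^ q = \<bar>k\<bar>"
  by (metis norm_power rt_power_q norm_of_real)

lemma rt_in_ball:
  assumes "q \<ge> 1" "e > 0" "\<bar>k\<bar> < e ^ q"
  shows "rt q k \<in> ball 0 e"
proof -
  have "norm (rt q k) ^ q < e ^ q" using assms norm_rt by simp
  then have "norm (rt q k) < e" by (rule power_less_imp_less_base) (use assms in auto)
  then show ?thesis by simp
qed

lemma rt_0 [simp]: "rt q 0 = 0" by (simp add: rt_def)

lemma rt_neg:
  assumes "k < 0"
  shows "rt q k = exp (\<i> * pi / of_nat q) * rt q (- k)"
proof -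
  have "Ln (- of_real x) = of_real (ln x) + \<i> * pi" if "x > 0" for x :: real
    using that by (subst Ln_minus) (auto simp: Ln_of_real)
  from this[of "- k"] have L: "Ln (of_real k) = of_real (ln (- k)) + \<i> * pi" using assms by simp
  have L': "Ln (of_real (- k)) = of_real (ln (- k))" using assms by (intro Ln_of_real) simp
  have "rt q k = exp (1 / of_nat q * (of_real (ln (- k)) + \<i> * pi))"
    using assms by (simp only: rt_def powr_def L) simp
  also have "1 / of_nat q * (of_real (ln (- k)) + \<i> * pi) = \<i> * pi / of_nat q + 1 / of_nat q * of_real (ln (- k))"
    by (simp add: distrib_left divide_inverse)
  also have "exp \<dots> = exp (\<i> * pi / of_nat q) * exp (1 / of_nat q * of_real (ln (- k)))" by (rule exp_add)
  also have "exp (1 / of_nat q * of_real (ln (- k))) = rt q (- k)"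
    using assms by (simp only: rt_def powr_def L') simp
  finally show ?thesis .
qed

lemma rt_has_derivative:
  assumes "k \<noteq> 0"
  shows "(rt q has_vector_derivative rt q k / (of_nat q * of_real k)) (at k)"
proof -
  have pos: "(rt q has_vector_derivative rt q k / (of_nat q * of_real k)) (at k)" if "k > 0" for k
  proof -
    have "((\<lambda>z. z powr (1 / of_nat q)) has_field_derivative (1 / of_nat q) * of_real k powr (1 / of_nat q - 1)) (at (complex_of_real k))"
      using that by (intro has_field_derivative_powr) (auto simp: complex_nonpos_Reals_iff)
    from has_vector_derivative_real_field[OF this]
    have "((\<lambda>x. complex_of_real x powr (1 / of_nat q)) has_vector_derivative (1 / of_nat q) * of_real k powr (1 / of_nat q - 1)) (at k)" .
    then show ?thesis using that by (simp add: rt_def[abs_def] powr_diff)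
  qed
  show ?thesis
  proof (cases "k > 0")
    case False
    then have k: "k < 0" using assms by simp
    have "((rt q \<circ> uminus) has_vector_derivative (-1) *\<^sub>R (rt q (- k) / (of_nat q * of_real (- k)))) (at k)"
      by (rule vector_diff_chain_at[OF _ pos]) (use k in \<open>auto intro!: derivative_eq_intros\<close>)
    then have "((\<lambda>x. exp (\<i> * pi / of_nat q) * rt q (- x)) has_vector_derivative exp (\<i> * pi / of_nat q) * ((-1) *\<^sub>R (rt q (- k) / (of_nat q * of_real (- k))))) (at k)"
      by (intro has_vector_derivative_mult_right) (simp add: o_def)
    then have "((\<lambda>x. exp (\<i> * pi / of_nat q) * rt q (- x)) has_vector_derivative rt q k / (of_nat q * of_real k)) (at k)"
      by (simp add: rt_neg[OF k])
    then show ?thesis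
      by (rule has_vector_derivative_transform_within_open[where S="{..<0}"]) (use k in \<open>auto simp: rt_neg\<close>)
  qed (rule pos)
qed

lemma isCont_rt:
  assumes q: "q \<ge> 1"
  shows "isCont (rt q) k"
proof (cases "k = 0")
  case True
  have "\<exists>d>0. \<forall>x. x \<noteq> 0 \<and> dist x 0 < d \<longrightarrow> dist (rt q x) 0 < e" if "e > 0" for e
    using rt_in_ball[OF q that] that by (intro exI[of _ "e ^ q"]) (auto simp: dist_norm)
  then show ?thesis using True by (auto simp: isCont_def LIM_def)
next
  case False
  then show ?thesis using rt_has_derivative has_vector_derivative_continuous by blast
qed

text \<open>Although \<open>rt q\<close> is not differentiable at 0, \<open>k\<close> times its
  derivative is \<open>rt q k / q\<close>. Hence the derivative \<open>D\<close> of the curve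
  extends continuously to \<open>k = 0\<close>, with value \<open>h 0\<close>.\<close>

lemma C1_root_curve:
  assumes q: "q \<ge> 1" and e: "e > 0" and h: "h holomorphic_on ball 0 e"
    and c: "\<And>k. \<bar>k\<bar> < e ^ q \<Longrightarrow> c k = of_real k * h (rt q k)"
  shows "C1_curve c" "(\<lambda>k. c k - h 0 * of_real k) \<in> o[at 0](\<lambda>k. of_real k)"
proof -
  define S where "S = {- (e ^ q)<..<e ^ q}"
  have S: "k \<in> S \<longleftrightarrow> \<bar>k\<bar> < e ^ q" for k by (auto simp: S_def)
  have S0: "0 \<in> S" using e by (simp add: S)
  have oS: "open S" by (simp add: S_def)
  have rS: "rt q k \<in> ball 0 e" if "k \<in> S" for k using rt_in_ball[OF q e] that by (simp add: S)
  have crt: "continuous_on A (rt q)" for A using isCont_rt[OF q] by (simp add: continuous_at_imp_continuous_on)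
  have h': "deriv h holomorphic_on ball 0 e" by (rule holomorphic_deriv[OF h]) simp
  have ch: "continuous_on S (\<lambda>k. h (rt q k))" "continuous_on S (\<lambda>k. deriv h (rt q k))"
    using rS by (intro continuous_on_compose2[OF holomorphic_on_imp_continuous_on[OF h] crt]
        continuous_on_compose2[OF holomorphic_on_imp_continuous_on[OF h'] crt]; auto)+
  define D where "D k = h (rt q k) + deriv h (rt q k) * rt q k / of_nat q" for k
  have "(c has_vector_derivative D k) (at k)" if k: "k \<in> S" for k
  proof (rule has_vector_derivative_transform_within_open[OF _ oS k])
    show "of_real k * h (rt q k) = c k" if "k \<in> S" for k using c that by (simp add: S)
    show "((\<lambda>k. of_real k * h (rt q k)) has_vector_derivative D k) (at k)"
    proof (cases "k = 0")
      case False
      have "(h has_field_derivative deriv h (rt q k)) (at (rt q k))"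
        by (rule holomorphic_derivI[OF h open_ball rS[OF k]])
      then have "((h \<circ> rt q) has_vector_derivative (rt q k / (of_nat q * of_real k)) * deriv h (rt q k)) (at k)"
        by (intro field_vector_diff_chain_at[OF rt_has_derivative[OF False]])
      then have "((\<lambda>k. of_real k * h (rt q k)) has_vector_derivative of_real k * ((rt q k / (of_nat q * of_real k)) * deriv h (rt q k)) + 1 * h (rt q k)) (at k)"
        by (intro has_vector_derivative_mult) (auto intro!: derivative_eq_intros simp: o_def)
      then show ?thesis using False by (simp add: D_def mult.commute add.commute)
    next
      case True
      have "((\<lambda>y. h (rt q y)) \<longlongrightarrow> h (rt q 0)) (at 0)"
        using ch(1) S0 oS by (auto simp: continuous_on_eq_continuous_at isCont_def)
      then have "((\<lambda>y. norm (h (rt q y) - h 0)) \<longlongrightarrow> 0) (at 0)"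
        by (simp add: tendsto_norm_zero_iff LIM_zero_iff)
      then have "((\<lambda>y. norm (of_real y * h (rt q y) - of_real 0 * h (rt q 0) - y *\<^sub>R h 0) / norm y) \<longlongrightarrow> 0) (at 0)"
        by (rule Lim_transform_within[where d=1]) (auto simp: scaleR_conv_of_real right_diff_distrib[symmetric] norm_mult)
      then have "((\<lambda>k. of_real k * h (rt q k)) has_derivative (\<lambda>y. y *\<^sub>R h 0)) (at 0)"
        by (simp add: has_derivative_at bounded_linear_scaleR_left)
      then show ?thesis using True by (simp add: has_vector_derivative_def D_def)
    qed
  qed
  moreover have "continuous_on S D" unfolding D_def
    by (intro continuous_intros ch crt) (use q in auto)
  ultimately have "c C1_differentiable_on S" unfolding C1_differentiable_on_def by blast
  then show "C1_curve c" unfolding C1_curve_def S_def using e by (intro exI[of _ "e ^ q"]) auto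
  show "(\<lambda>k. c k - h 0 * of_real k) \<in> o[at 0](\<lambda>k. of_real k)"
  proof (rule smalloI_tendsto)
    have "((\<lambda>y. h (rt q y)) \<longlongrightarrow> h (rt q 0)) (at 0)"
      using ch(1) S0 oS by (auto simp: continuous_on_eq_continuous_at isCont_def)
    then have "((\<lambda>y. h (rt q y) - h 0) \<longlongrightarrow> 0) (at 0)" by (simp add: LIM_zero_iff)
    then show "((\<lambda>k. (c k - h 0 * of_real k) / of_real k) \<longlongrightarrow> 0) (at 0)"
      by (rule Lim_transform_within_open[where s=S]) (use oS S0 in \<open>auto simp: S c field_simps\<close>)
    show "\<forall>\<^sub>F k in at 0. complex_of_real k \<noteq> 0" by (simp add: eventually_at_filter)
  qed
qed

text \<open>Invariance under the primitive rotation \<open>\<omega>\<close> multiplies the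
  \<open>n\<close>-th Taylor coefficient by \<open>\<omega>^n\<close>, so it vanishes unless
  \<open>q\<close> divides \<open>n\<close>; the series is then one in \<open>w^q\<close>.\<close>

lemma holomorphic_of_rotation_invariant:
  assumes q: "q \<ge> 1" and e: "e > 0" and h: "h holomorphic_on ball 0 e"
    and inv: "\<And>w. w \<in> ball 0 e \<Longrightarrow> h (exp (2 * pi * \<i> / of_nat q) * w) = h w"
  obtains H where "H holomorphic_on ball 0 (e ^ q)" "\<And>w. w \<in> ball 0 e \<Longrightarrow> H (w ^ q) = h w"
proof -
  define \<omega> where "\<omega> = exp (2 * pi * \<i> / of_nat q)"
  define a where "a n = (deriv ^^ n) h 0 / fact n" for n
  have sums: "(\<lambda>n. a n * w ^ n) sums h w" if "w \<in> ball 0 e" for w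
    using holomorphic_power_series[OF h that] by (simp add: a_def)
  have n\<omega>: "norm \<omega> = 1" by (simp add: \<omega>_def)
  have a0: "a n = 0" if n: "\<not> q dvd n" for n
  proof -
    have "(deriv ^^ n) (\<lambda>w. h (\<omega> * w)) 0 = \<omega> ^ n * (deriv ^^ n) h (\<omega> * 0)"
      by (rule higher_deriv_compose_linear[where S="ball 0 e", OF h open_ball open_ball]) (use e n\<omega> in \<open>auto simp: norm_mult\<close>)
    moreover have "(deriv ^^ n) (\<lambda>w. h (\<omega> * w)) 0 = (deriv ^^ n) h 0"
    proof (rule higher_deriv_cong_ev)
      have "\<forall>\<^sub>F w in nhds 0. w \<in> ball 0 e" using e by (intro eventually_nhds_in_open) auto
      then show "\<forall>\<^sub>F w in nhds 0. h (\<omega> * w) = h w" by eventually_elim (rule inv[folded \<omega>_def])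
    qed simp
    ultimately have "(\<omega> ^ n - 1) * (deriv ^^ n) h 0 = 0" by (simp add: algebra_simps)
    moreover have "\<omega> ^ n \<noteq> 1"
    proof
      assume "\<omega> ^ n = 1"
      then have "exp (of_nat n * (2 * pi * \<i> / of_nat q)) = 1" by (simp only: \<omega>_def exp_of_nat_mult)
      moreover have "of_nat n * (2 * pi * \<i> / of_nat q) = of_real (2 * pi * (real n / real q)) * \<i>" by simp
      ultimately have "exp (of_real (2 * pi * (real n / real q)) * \<i>) = 1" by (simp only:)
      then obtain m :: int where "Im (of_real (2 * pi * (real n / real q)) * \<i>) = of_int (2 * m) * pi"
        unfolding exp_eq_1 by blast
      then have "2 * pi * (real n / real q) = of_int (2 * m) * pi" by simp
      then have "(2 * pi) * (real n / real q) = (2 * pi) * of_int m" by (simp only: of_int_mult of_int_numeral mult_ac)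
      then have "real n / real q = of_int m" using pi_gt_zero by (metis mult_cancel_left mult_eq_0_iff pi_neq_zero zero_neq_numeral)
      then have "real_of_int (int n) = real_of_int (m * int q)" using q by (simp add: field_simps)
      then have "int n = m * int q" by (simp only: of_int_eq_iff)
      then have "int q dvd int n" by simp
      then have "q dvd n" by (simp only: int_dvd_int_iff)
      then show False using n by simp
    qed
    ultimately show ?thesis by (simp add: a_def)
  qed
  define H where "H z = (\<Sum>n. a (q * n) * z ^ n)" for z
  have Hs: "(\<lambda>n. a (q * n) * (w ^ q) ^ n) sums h w" if w: "w \<in> ball 0 e" for w
  proof -
    have "strict_mono (\<lambda>n. q * n)" using q by (intro strict_monoI) simp
    then have "(\<lambda>n. a (q * n) * w ^ (q * n)) sums h w \<longleftrightarrow> (\<lambda>n. a n * w ^ n) sums h w"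
    proof (rule sums_mono_reindex)
      fix n assume "n \<notin> range (\<lambda>n. q * n)"
      then have "\<not> q dvd n" by (auto simp: dvd_def)
      then show "a n * w ^ n = 0" by (simp add: a0)
    qed
    then show ?thesis using sums[OF w] by (simp add: power_mult)
  qed
  have root: "\<exists>w\<in>ball 0 e. w ^ q = z" if "z \<in> ball 0 (e ^ q)" for z :: complex
  proof -
    have zq: "(z powr (1 / of_nat q)) ^ q = z"
      using q by (cases "z = 0") (auto simp: powr_def exp_of_nat_mult[symmetric] power_0_left)
    then have "norm (z powr (1 / of_nat q)) ^ q < e ^ q" using that by (simp add: norm_power[symmetric])
    then have "norm (z powr (1 / of_nat q)) < e" by (rule power_less_imp_less_base) (use e in auto)
    then show ?thesis using zq by auto
  qed
  have Hh: "H (w ^ q) = h w" if "w \<in> ball 0 e" for w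
    using Hs[OF that] by (simp add: H_def sums_iff)
  show thesis
  proof (rule that[OF _ Hh])
    show "H holomorphic_on ball 0 (e ^ q)"
    proof (rule power_series_holomorphic[where a="\<lambda>n. a (q * n)"])
      fix z :: complex assume "z \<in> ball 0 (e ^ q)"
      from root[OF this] obtain w where "w \<in> ball 0 e" "w ^ q = z" by blast
      then show "(\<lambda>n. a (q * n) * (z - 0) ^ n) sums H z" using Hs[of w] Hh[of w] by simp
    qed
  qed auto
qed

text \<open>By rotation invariance \<open>h (rt q k)\<close> is a holomorphic function of
  \<open>k\<close> itself, and the curve is the restriction of a holomorphic function to the real
  axis.\<close>

lemma Cinf_root_curve:
  assumes q: "q \<ge> 1" and e: "e > 0" and h: "h holomorphic_on ball 0 e"
    and inv: "\<And>w. w \<in> ball 0 e \<Longrightarrow> h (exp (2 * pi * \<i> / of_nat q) * w) = h w"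
    and c: "\<And>k. \<bar>k\<bar> < e ^ q \<Longrightarrow> c k = of_real k * h (rt q k)"
  shows "Cinf_curve c"
proof -
  obtain H where H: "H holomorphic_on ball 0 (e ^ q)" "\<And>w. w \<in> ball 0 e \<Longrightarrow> H (w ^ q) = h w"
  proof (rule holomorphic_of_rotation_invariant[OF q e h inv])
    fix H assume "H holomorphic_on ball 0 (e ^ q)" "\<And>w. w \<in> ball 0 e \<Longrightarrow> H (w ^ q) = h w"
    then show thesis by (rule that)
  qed
  define G where "G z = z * H z" for z
  have G: "G holomorphic_on ball 0 (e ^ q)" unfolding G_def[abs_def] by (intro holomorphic_intros H)
  define g where "g m = (if m = 0 then c else (\<lambda>k. (deriv ^^ m) G (complex_of_real k)))" for m
  have gG: "g m k = (deriv ^^ m) G (of_real k)" if "\<bar>k\<bar> < e ^ q" for m k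
    using c[OF that] H(2)[OF rt_in_ball[OF q e that]] by (simp add: g_def G_def rt_power_q[OF q])
  have "(g m has_vector_derivative g (Suc m) k) (at k)" if k: "k \<in> {- (e ^ q)<..<e ^ q}" for m k
  proof (rule has_vector_derivative_transform_within_open[OF _ open_greaterThanLessThan k])
    have "((deriv ^^ m) G has_field_derivative (deriv ^^ Suc m) G (of_real k)) (at (of_real k))"
      using holomorphic_derivI[OF holomorphic_higher_deriv[OF G open_ball], of "of_real k" m] k by auto
    then show "((\<lambda>k. (deriv ^^ m) G (of_real k)) has_vector_derivative g (Suc m) k) (at k)"
      unfolding g_def by (auto intro: has_vector_derivative_real_field)
    show "(deriv ^^ m) G (of_real x) = g m x" if "x \<in> {- (e ^ q)<..<e ^ q}" for x
      using gG[of x m] that by auto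
  qed
  then show ?thesis unfolding Cinf_curve_def using e
    by (intro exI[of _ "e ^ q"] conjI exI[of _ g]) (auto simp: g_def)
qed

text \<open>For either sign of \<open>k\<close> the power \<open>rt q k ^ p\<close> is exactly the
  principal power with exponent \<open>p / q\<close>, and this exponent lies strictly between 0 and
  1.\<close>

lemma fractional_root_curve:
  assumes q: "1 \<le> p" "p < q" and e: "e > 0" and h: "h holomorphic_on ball 0 e" "h 0 \<noteq> 0"
    and c: "\<And>k. \<bar>k\<bar> < e ^ q \<Longrightarrow> c k = rt q k ^ p * h (rt q k)"
  shows "fractional_power_curve c"
  unfolding fractional_power_curve_def
proof (intro exI conjI)
  let ?r = "real p / real q"
  show "h 0 \<noteq> 0" by fact
  show "?r \<in> \<rat>" by simp
  show "?r \<notin> \<int>"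
  proof
    assume "?r \<in> \<int>"
    then obtain m :: int where m: "?r = of_int m" by (auto elim: Ints_cases)
    have "0 < ?r" "?r < 1" using q by auto
    then show False unfolding m by simp
  qed
  have q1: "q \<ge> 1" using q by simp
  show "c \<sim>[at 0] (\<lambda>k. h 0 * of_real k powr of_real ?r)"
  proof (rule asymp_equivI')
    have "isCont h 0" using holomorphic_on_imp_continuous_on[OF h(1)] e by (auto simp: continuous_on_eq_continuous_at)
    then have "((\<lambda>k. h (rt q k)) \<longlongrightarrow> h (rt q 0)) (at 0)"
      using isCont_o2[OF isCont_rt[OF q1, of 0], of h] by (simp add: isCont_def)
    then have "((\<lambda>k. h (rt q k) / h 0) \<longlongrightarrow> h 0 / h 0) (at 0)" by (intro tendsto_intros) (use h in auto)
    then have "((\<lambda>k. h (rt q k) / h 0) \<longlongrightarrow> 1) (at 0)" using h by simp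
    then show "((\<lambda>k. c k / (h 0 * of_real k powr of_real ?r)) \<longlongrightarrow> 1) (at 0)"
    proof (rule Lim_transform_within_open[where s="{- (e ^ q)<..<e ^ q}"])
      fix k assume k: "k \<in> {- (e ^ q)<..<e ^ q}" "k \<noteq> 0"
      then have "\<bar>k\<bar> < e ^ q" by auto
      from c[OF this] have "c k = of_real k powr of_real ?r * h (rt q k)" by (simp only: rt_power[OF q(1)])
      then show "h (rt q k) / h 0 = c k / (h 0 * of_real k powr of_real ?r)" using k(2) by simp
    qed (use e in auto)
  qed
qed

text \<open>The rotations add up to 0 over \<open>2 q\<close> steps. If no real part were positive,
  all would vanish, and the two for \<open>l = 0, 1\<close> already force \<open>b = 0\<close>,
  because the angle \<open>\<pi> p / q\<close> lies strictly between 0 and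
  \<open>\<pi>\<close>.\<close>

lemma unstable_rotation:
  assumes pq: "1 \<le> p" "p < q" and b: "b \<noteq> 0"
  obtains l :: nat where "Re (exp (\<i> * pi * of_nat p / of_nat q) ^ l * b) > 0"
proof (rule ccontr)
  assume "\<not> thesis"
  then have le: "Re (exp (\<i> * pi * of_nat p / of_nat q) ^ l * b) \<le> 0" for l using that not_less by blast
  define \<zeta> where "\<zeta> = exp (\<i> * pi * of_nat p / of_nat q)"
  have q0: "real q > 0" using pq by simp
  have "0 < pi * real p / real q" using pq q0 by simp
  moreover have "pi * real p / real q < pi" using pq q0 by (simp add: field_simps)
  ultimately have s: "sin (pi * real p / real q) > 0" by (rule sin_gt_zero)
  have \<zeta>: "\<zeta> = cis (pi * real p / real q)" by (simp add: \<zeta>_def cis_conv_exp mult_ac)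
  have ne: "\<zeta> \<noteq> 1" using s by (auto simp: \<zeta> complex_eq_iff)
  have "\<zeta> ^ (2 * q) = exp (of_nat (2 * q) * (\<i> * pi * of_nat p / of_nat q))"
    by (simp only: \<zeta>_def exp_of_nat_mult)
  also have "of_nat (2 * q) * (\<i> * pi * of_nat p / of_nat q) = 2 * of_nat p * pi * \<i>"
    using pq by (simp add: field_simps)
  also have "exp \<dots> = 1" by (simp add: exp_eq_1) (metis of_int_of_nat_eq)
  finally have "(\<Sum>l<2*q. \<zeta> ^ l) = 0" using ne by (simp add: sum_gp_strict)
  then have "(\<Sum>l<2*q. Re (\<zeta> ^ l * b)) = 0"
    by (metis Re_sum mult_zero_left sum_distrib_right zero_complex.simps(1))
  then have "(\<Sum>l<2*q. - Re (\<zeta> ^ l * b)) = 0" by (simp only: sum_negf minus_zero)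
  then have z: "\<forall>l\<in>{..<2*q}. - Re (\<zeta> ^ l * b) = 0"
    by (subst (asm) sum_nonneg_eq_0_iff) (use le in \<open>auto simp: \<zeta>_def\<close>)
  have "Re b = 0" "Re (\<zeta> * b) = 0" using z[rule_format, of 0] z[rule_format, of 1] pq by auto
  then have "sin (pi * real p / real q) * Im b = 0" by (simp add: \<zeta>)
  then have "Im b = 0" using s by simp
  with \<open>Re b = 0\<close> b show False by (simp add: complex_eq_iff)
qed

section \<open>Slopes and exponents of the zeros\<close>

lemma power_quotient_limit:
  assumes "((\<lambda>z. z ^ m / z ^ n) \<longlongrightarrow> (L::complex)) (at 0)"
  shows "n \<le> m" "L \<noteq> 0 \<Longrightarrow> m = n"
proof -
  show nm: "n \<le> m"
  proof (rule ccontr)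
    assume "\<not> n \<le> m"
    then have d: "n - m > 0" by simp
    have "((\<lambda>z. z ^ (n - m) * (z ^ m / z ^ n)) \<longlongrightarrow> 0 ^ (n - m) * L) (at 0)"
      by (intro tendsto_intros assms)
    then have "((\<lambda>z. z ^ (n - m) * (z ^ m / z ^ n)) \<longlongrightarrow> 0) (at (0::complex))" using d by (simp add: power_0_left)
    moreover have "\<forall>\<^sub>F z in at (0::complex). z ^ (n - m) * (z ^ m / z ^ n) = 1"
      using \<open>\<not> n \<le> m\<close> by (auto simp: eventually_at_filter power_add[symmetric])
    ultimately have "((\<lambda>z. 1) \<longlongrightarrow> (0::complex)) (at (0::complex))" by (rule Lim_transform_eventually)
    from tendsto_unique[OF at_neq_bot this tendsto_const] show False by simp
  qed
  show "m = n" if "L \<noteq> 0"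
  proof (rule ccontr)
    assume "m \<noteq> n"
    then have d: "m - n > 0" using nm by simp
    have "((\<lambda>z. z ^ (m - n)) \<longlongrightarrow> (0::complex) ^ (m - n)) (at 0)" by (intro tendsto_intros)
    then have "((\<lambda>z. z ^ (m - n)) \<longlongrightarrow> (0::complex)) (at 0)" using d by (simp add: power_0_left)
    moreover have "\<forall>\<^sub>F z in at (0::complex). z ^ (m - n) = z ^ m / z ^ n"
      using nm by (auto simp: eventually_at_filter power_diff)
    ultimately have "((\<lambda>z. z ^ m / z ^ n) \<longlongrightarrow> (0::complex)) (at 0)" by (rule Lim_transform_eventually)
    from tendsto_unique[OF at_neq_bot assms this] that show False by simp
  qed
qed

lemma bij_betw_same_values:
  assumes "finite I" "finite J" "image_mset s (mset_set I) = image_mset t (mset_set J)"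
  obtains \<sigma> where "bij_betw \<sigma> I J" "\<And>i. i \<in> I \<Longrightarrow> t (\<sigma> i) = s i"
  using assms
proof (induction I arbitrary: J thesis rule: finite_induct)
  case empty
  then have "J = {}" by (simp add: mset_set_empty_iff)
  then show ?case by (intro empty.prems(1)[of "\<lambda>_. undefined"]) (auto simp: bij_betw_def)
next
  case (insert i I)
  have "s i \<in># image_mset t (mset_set J)" using insert.hyps by (simp flip: insert.prems(3))
  then obtain j where j: "j \<in> J" "t j = s i" using insert.prems(2) by auto
  then have "mset_set J = add_mset j (mset_set (J - {j}))"
    using insert.prems(2) by (metis finite_Diff insert_Diff mset_set.insert Diff_iff singletonI)
  then have "image_mset s (mset_set I) = image_mset t (mset_set (J - {j}))"
    using insert.prems(3) insert.hyps j by simp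
  then obtain \<sigma> where \<sigma>: "bij_betw \<sigma> I (J - {j})" "\<And>i. i \<in> I \<Longrightarrow> t (\<sigma> i) = s i"
    using insert.IH[of "J - {j}"] insert.prems(2) by blast
  have "bij_betw (\<sigma>(i := j)) I (J - {j})"
    using \<sigma>(1) insert.hyps by (subst bij_betw_cong[where g=\<sigma>]) auto
  moreover have "bij_betw (\<sigma>(i := j)) {i} {j}" by (simp add: bij_betw_def)
  ultimately have "bij_betw (\<sigma>(i := j)) (I \<union> {i}) ((J - {j}) \<union> {j})"
    by (rule bij_betw_combine) auto
  moreover have "I \<union> {i} = insert i I" "(J - {j}) \<union> {j} = J" using j(1) by auto
  ultimately have "bij_betw (\<sigma>(i := j)) (insert i I) J" by simp
  then show ?case
    by (rule insert.prems(1)) (use \<sigma>(2) j(2) insert.hyps in auto)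
qed

lemma fsigma_ball: "fsigma (ball (0::complex) e)"
proof -
  have "ball (0::complex) e = (\<Union>n. cball 0 (e - inverse (real (Suc n))))"
  proof (intro equalityI subsetI)
    fix x :: complex assume "x \<in> ball 0 e"
    then have "0 < e - norm x" by simp
    then obtain n where "inverse (real (Suc n)) < e - norm x" using reals_Archimedean by blast
    then have "x \<in> cball 0 (e - inverse (real (Suc n)))" by simp
    then show "x \<in> (\<Union>n. cball 0 (e - inverse (real (Suc n))))" by blast
  next
    fix x :: complex assume "x \<in> (\<Union>n. cball 0 (e - inverse (real (Suc n))))"
    then obtain n where "norm x \<le> e - inverse (real (Suc n))" by auto
    moreover have "inverse (real (Suc n)) > 0" by simp
    ultimately have "norm x < e" by linarith
    then show "x \<in> ball 0 e" by simp
  qed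
  then show ?thesis by (metis closed_cball fsigma.intros)
qed

context analytic_family begin

text \<open>Along \<open>k = w^q\<close>, \<open>\<lambda> = w^q \<mu>\<close> a regular branch
  contributes \<open>w^q (\<mu> - h_j)\<close> to the factorization of \<open>F\<close> and a steep
  one \<open>w^(p_j)\<close> times a factor tending to \<open>- H_j(0)\<close>. Existence of a
  nonzero limit after division by \<open>k^N\<close> fixes the total exponent, and equality of the
  limits as polynomials in \<open>\<mu>\<close> identifies the slopes.\<close>

theorem curves_of_zeros:
  assumes I: "finite I" and C: "C \<noteq> 0"
    and lim: "\<And>\<mu>. ((\<lambda>k. F k (k * \<mu>) / k ^ N) \<longlongrightarrow> C * (\<Prod>i\<in>I. \<mu> - s i)) (at 0)"
    and lim0: "((\<lambda>z. F 0 z / z ^ N) \<longlongrightarrow> Q) (at 0)"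
  obtains c mu and m :: nat where
    "consists_of_curves (\<lambda>k. F (of_real k)) (I <+> {..<m}) (case_sum c mu)"
    "\<And>i. i \<in> I \<Longrightarrow> C1_curve (c i)"
    "\<And>i. i \<in> I \<Longrightarrow> (\<lambda>k. c i k - s i * of_real k) \<in> o[at 0](\<lambda>k. of_real k)"
    "\<And>i. i \<in> I \<Longrightarrow> (\<And>i'. i' \<in> I \<Longrightarrow> i' \<noteq> i \<Longrightarrow> s i' \<noteq> s i) \<Longrightarrow> Cinf_curve (c i)"
    "N \<le> card I + m" "Q \<noteq> 0 \<Longrightarrow> card I + m = N"
    "\<And>l. l < m \<Longrightarrow> fractional_power_curve (mu l)"
    "m > 0 \<Longrightarrow> \<exists>k z. F (of_real k) z = 0 \<and> Re z > 0"
proof -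
  obtain q \<epsilon> \<delta> g u and d :: nat where q: "q \<ge> 1" and \<epsilon>: "\<epsilon> > 0" and \<delta>: "\<delta> > 0"
    and gh: "\<And>j. j < d \<Longrightarrow> g j holomorphic_on ball 0 \<epsilon>" and g0: "\<And>j. j < d \<Longrightarrow> g j 0 = 0"
    and zer: "\<And>w z. w \<in> ball 0 \<epsilon> \<Longrightarrow> norm z < \<delta> \<Longrightarrow> F (w ^ q) z = 0 \<longleftrightarrow> (\<exists>j<d. g j w = z)"
    and zo: "\<And>w z. w \<in> ball 0 \<epsilon> \<Longrightarrow> norm z < \<delta> \<Longrightarrow> F (w ^ q) z = 0 \<Longrightarrow> zorder (F (w ^ q)) z = int (card {j. j < d \<and> g j w = z})"
    and gs: "\<And>w j. w \<in> ball 0 \<epsilon> \<Longrightarrow> j < d \<Longrightarrow> norm (g j w) < \<delta>"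
    and uF: "\<And>w z. w \<in> ball 0 \<epsilon> \<Longrightarrow> norm z < \<delta> \<Longrightarrow> F (w ^ q) z = u w z * (\<Prod>j<d. z - g j w)"
    and u00: "u 0 0 \<noteq> 0" and ul: "\<And>\<mu>. ((\<lambda>w. u w (w ^ q * \<mu>)) \<longlongrightarrow> u 0 0) (at 0)" and u0: "(u 0 \<longlongrightarrow> u 0 0) (at 0)"
    by (rule puiseux_zeros) blast
  have zq: "(0::complex) ^ q = 0" using q by (simp add: power_0_left)
  \<comment> \<open>At \<open>k = 0\<close> all branches vanish, so \<open>F 0\<close> has a zero of
    order exactly \<open>d\<close>; comparison with \<open>z^N\<close> gives
    \<open>N \<le> d\<close>, with equality if \<open>Q \<noteq> 0\<close>.\<close>
  have dN: "((\<lambda>z. z ^ d / z ^ N) \<longlongrightarrow> Q / u 0 0) (at 0)"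
  proof -
    have "((\<lambda>z. F 0 z / z ^ N / u 0 z) \<longlongrightarrow> Q / u 0 0) (at 0)" by (intro tendsto_divide lim0 u0 u00)
    moreover have "\<forall>\<^sub>F z in at 0. u 0 z \<noteq> 0" using tendsto_imp_eventually_ne[OF u0 u00] .
    then have "\<forall>\<^sub>F z in at 0. F 0 z / z ^ N / u 0 z = z ^ d / z ^ N"
    proof (rule eventually_elim2)
      show "\<forall>\<^sub>F z in at (0::complex). norm z < \<delta>" using \<delta> by (auto simp: eventually_at)
      fix z assume "u 0 z \<noteq> 0" "norm z < \<delta>"
      then show "F 0 z / z ^ N / u 0 z = z ^ d / z ^ N" using uF[of 0 z] \<epsilon> g0 by (simp add: zq)
    qed
    ultimately show ?thesis by (rule Lim_transform_eventually)
  qed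
  have Nd: "N \<le> d" using power_quotient_limit(1)[OF dN] .
  have NdQ: "d = N" if "Q \<noteq> 0" using power_quotient_limit(2)[OF dN] that u00 by simp
  \<comment> \<open>Regular branches are of order at least \<open>q\<close> in \<open>w\<close>,
    that is, at most linear in \<open>k\<close>. This includes a branch that vanishes
    identically.\<close>
  define reg where "reg j \<longleftrightarrow> (\<exists>h e. 0 < e \<and> h holomorphic_on ball 0 e \<and> (\<forall>w\<in>ball 0 e. g j w = w ^ q * h w))" for j
  have steep: "\<exists>p h e. 1 \<le> p \<and> p < q \<and> h 0 \<noteq> 0 \<and> 0 < e \<and> h holomorphic_on ball 0 e \<and> (\<forall>w\<in>ball 0 e. g j w = w ^ p * h w)"
    if j: "j < d" and nr: "\<not> reg j" for j
  proof -
    have "\<exists>w\<in>ball 0 \<epsilon>. g j w \<noteq> 0"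
    proof (rule ccontr)
      assume "\<not> ?thesis"
      then have "\<forall>w\<in>ball 0 \<epsilon>. g j w = w ^ q * 0" by auto
      then have "reg j" unfolding reg_def using \<epsilon> by (intro exI[of _ "\<lambda>_. 0"] exI[of _ \<epsilon>]) auto
      with nr show False by simp
    qed
    from holomorphic_factor_at_0[OF gh[OF j] \<epsilon> this] obtain p h e where h: "0 < e" "e \<le> \<epsilon>" "h holomorphic_on ball 0 e" "h 0 \<noteq> 0"
      "\<And>w. w \<in> ball 0 e \<Longrightarrow> g j w = w ^ p * h w" by metis
    have "p \<ge> 1"
    proof (rule ccontr)
      assume "\<not> 1 \<le> p"
      then have "p = 0" by simp
      then show False using h(5)[of 0] h(1,4) g0[OF j] by simp
    qed
    moreover have "p < q"
    proof (rule ccontr)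
      assume "\<not> p < q"
      then have "\<forall>w\<in>ball 0 e. g j w = w ^ q * (w ^ (p - q) * h w)"
        using h(5) by (simp add: mult.assoc[symmetric] power_add[symmetric])
      moreover have "(\<lambda>w. w ^ (p - q) * h w) holomorphic_on ball 0 e" by (intro holomorphic_intros h)
      ultimately have "reg j" unfolding reg_def using h(1) by blast
      with nr show False by simp
    qed
    ultimately show ?thesis using h by blast
  qed
  define J1 where "J1 = {j. j < d \<and> reg j}"
  define J0 where "J0 = {j. j < d \<and> \<not> reg j}"
  have J: "finite J1" "finite J0" "J1 \<inter> J0 = {}" "J1 \<union> J0 = {..<d}" by (auto simp: J1_def J0_def)
  define h where "h = (\<lambda>j. SOME h. \<exists>e. 0 < e \<and> h holomorphic_on ball 0 e \<and> (\<forall>w\<in>ball 0 e. g j w = w ^ q * h w))"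
  have h: "\<exists>e. 0 < e \<and> h j holomorphic_on ball 0 e \<and> (\<forall>w\<in>ball 0 e. g j w = w ^ q * h j w)" if "j \<in> J1" for j
  proof -
    have "\<exists>h. \<exists>e. 0 < e \<and> h holomorphic_on ball 0 e \<and> (\<forall>w\<in>ball 0 e. g j w = w ^ q * h w)"
      using that by (simp add: J1_def reg_def)
    then show ?thesis unfolding h_def by (rule someI_ex)
  qed
  define ph where "ph = (\<lambda>j. SOME x. 1 \<le> fst x \<and> fst x < q \<and> snd x 0 \<noteq> (0::complex) \<and> (\<exists>e. 0 < e \<and> snd x holomorphic_on ball 0 e \<and> (\<forall>w\<in>ball 0 e. g j w = w ^ fst x * snd x w)))"
  define p H where "p j = fst (ph j)" and "H j = snd (ph j)" for j
  have H: "1 \<le> p j \<and> p j < q \<and> H j 0 \<noteq> 0 \<and> (\<exists>e. 0 < e \<and> H j holomorphic_on ball 0 e \<and> (\<forall>w\<in>ball 0 e. g j w = w ^ p j * H j w))" if "j \<in> J0" for j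
  proof -
    have "\<exists>x. 1 \<le> fst x \<and> fst x < q \<and> snd x 0 \<noteq> (0::complex) \<and> (\<exists>e. 0 < e \<and> snd x holomorphic_on ball 0 e \<and> (\<forall>w\<in>ball 0 e. g j w = w ^ fst x * snd x w))"
      using steep[of j] that by (auto simp: J0_def)
    from someI_ex[OF this] show ?thesis unfolding p_def H_def ph_def by blast
  qed
  have hc: "(h j \<longlongrightarrow> h j 0) (at 0)" if j: "j \<in> J1" for j
  proof -
    obtain e where "0 < e" "h j holomorphic_on ball 0 e" using h[OF j] by blast
    then have "isCont (h j) 0" using holomorphic_on_imp_continuous_on[of "h j" "ball 0 e"] by (auto simp: continuous_on_eq_continuous_at)
    then show ?thesis by (simp add: isCont_def)
  qed
  have Hc: "(H j \<longlongrightarrow> H j 0) (at 0)" if j: "j \<in> J0" for j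
  proof -
    obtain e where "0 < e" "H j holomorphic_on ball 0 e" using H[OF j] by blast
    then have "isCont (H j) 0" using holomorphic_on_imp_continuous_on[of "H j" "ball 0 e"] by (auto simp: continuous_on_eq_continuous_at)
    then show ?thesis by (simp add: isCont_def)
  qed
  have ev_ball: "\<forall>\<^sub>F w in at (0::complex). w \<in> ball 0 e" if "e > 0" for e
    using that by (auto simp: eventually_at)
  have ev1: "\<forall>\<^sub>F w in at 0. \<forall>j\<in>J1. g j w = w ^ q * h j w"
  proof (rule eventually_ball_finite[OF J(1)])
    show "\<forall>j\<in>J1. \<forall>\<^sub>F w in at 0. g j w = w ^ q * h j w"
    proof
      fix j assume "j \<in> J1"
      from h[OF this] obtain e where e: "0 < e" "\<forall>w\<in>ball 0 e. g j w = w ^ q * h j w" by blast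
      show "\<forall>\<^sub>F w in at 0. g j w = w ^ q * h j w" by (rule eventually_mono[OF ev_ball[OF e(1)]]) (use e(2) in blast)
    qed
  qed
  have ev0: "\<forall>\<^sub>F w in at 0. \<forall>j\<in>J0. g j w = w ^ p j * H j w"
  proof (rule eventually_ball_finite[OF J(2)])
    show "\<forall>j\<in>J0. \<forall>\<^sub>F w in at 0. g j w = w ^ p j * H j w"
    proof
      fix j assume "j \<in> J0"
      from H[OF this] obtain e where e: "0 < e" "\<forall>w\<in>ball 0 e. g j w = w ^ p j * H j w" by blast
      show "\<forall>\<^sub>F w in at 0. g j w = w ^ p j * H j w" by (rule eventually_mono[OF ev_ball[OF e(1)]]) (use e(2) in blast)
    qed
  qed
  \<comment> \<open>The power of \<open>w\<close> that splits off from the product over all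
    branches; \<open>G\<close> is what remains.\<close>
  define M where "M = q * card J1 + (\<Sum>j\<in>J0. p j)"
  define G where "G \<mu> w = u w (w ^ q * \<mu>) * (\<Prod>j\<in>J1. \<mu> - h j w) * (\<Prod>j\<in>J0. w ^ (q - p j) * \<mu> - H j w)" for \<mu> w
  define C' where "C' = u 0 0 * (\<Prod>j\<in>J0. - H j 0)"
  have C': "C' \<noteq> 0" using u00 H J(2) by (auto simp: C'_def)
  have Glim: "(G \<mu> \<longlongrightarrow> C' * (\<Prod>j\<in>J1. \<mu> - h j 0)) (at 0)" for \<mu>
  proof -
    have "((\<lambda>w. w ^ (q - p j) * \<mu> - H j w) \<longlongrightarrow> 0 ^ (q - p j) * \<mu> - H j 0) (at 0)" if "j \<in> J0" for j
      by (intro tendsto_intros Hc that)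
    moreover have "0 ^ (q - p j) * \<mu> - H j 0 = - H j 0" if "j \<in> J0" for j
      using H[OF that] by (simp add: power_0_left)
    ultimately have "((\<lambda>w. w ^ (q - p j) * \<mu> - H j w) \<longlongrightarrow> - H j 0) (at 0)" if "j \<in> J0" for j
      using that by metis
    then have "(G \<mu> \<longlongrightarrow> u 0 0 * (\<Prod>j\<in>J1. \<mu> - h j 0) * (\<Prod>j\<in>J0. - H j 0)) (at 0)"
      unfolding G_def[abs_def] by (intro tendsto_intros ul hc) auto
    then show ?thesis by (simp add: C'_def mult_ac)
  qed
  have GF: "((\<lambda>w. G \<mu> w * (w ^ M / w ^ (q * N))) \<longlongrightarrow> C * (\<Prod>i\<in>I. \<mu> - s i)) (at 0)" for \<mu>
  proof -
    have "filterlim (\<lambda>w. w ^ q) (at 0) (at (0::complex))"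
    proof (rule filterlim_atI)
      have "((\<lambda>w. w ^ q) \<longlongrightarrow> 0 ^ q) (at (0::complex))" by (intro tendsto_intros)
      then show "((\<lambda>w. w ^ q) \<longlongrightarrow> 0) (at (0::complex))" by (simp only: zq)
      show "\<forall>\<^sub>F w in at (0::complex). w ^ q \<noteq> 0"
        by (rule eventually_mono[OF eventually_neq_at_within[of 0]]) simp
    qed
    from filterlim_compose[OF lim this]
    have "((\<lambda>w. F (w ^ q) (w ^ q * \<mu>) / (w ^ q) ^ N) \<longlongrightarrow> C * (\<Prod>i\<in>I. \<mu> - s i)) (at 0)" .
    moreover have "\<forall>\<^sub>F w in at 0. F (w ^ q) (w ^ q * \<mu>) / (w ^ q) ^ N = G \<mu> w * (w ^ M / w ^ (q * N))"
    proof -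
      have "((\<lambda>w. w ^ q * \<mu>) \<longlongrightarrow> 0 ^ q * \<mu>) (at 0)" by (intro tendsto_intros)
      then have "((\<lambda>w. w ^ q * \<mu>) \<longlongrightarrow> 0) (at 0)" by (simp add: zq)
      then have "\<forall>\<^sub>F w in at 0. norm (w ^ q * \<mu>) < \<delta>" using tendstoD[OF _ \<delta>] by force
      then show ?thesis using ev_ball[OF \<epsilon>] ev1 ev0
      proof eventually_elim
        case (elim w)
        have "(\<Prod>j<d. w ^ q * \<mu> - g j w) = (\<Prod>j\<in>J1. w ^ q * \<mu> - g j w) * (\<Prod>j\<in>J0. w ^ q * \<mu> - g j w)"
          using prod.union_disjoint[OF J(1-3)] J(4) by metis
        also have "(\<Prod>j\<in>J1. w ^ q * \<mu> - g j w) = (\<Prod>j\<in>J1. w ^ q * (\<mu> - h j w))"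
          using elim by (intro prod.cong) (auto simp: right_diff_distrib)
        also have "\<dots> = w ^ (q * card J1) * (\<Prod>j\<in>J1. \<mu> - h j w)" by (simp add: prod.distrib power_mult)
        also have "(\<Prod>j\<in>J0. w ^ q * \<mu> - g j w) = (\<Prod>j\<in>J0. w ^ p j * (w ^ (q - p j) * \<mu> - H j w))"
        proof (rule prod.cong[OF refl])
          fix j assume j: "j \<in> J0"
          have "w ^ q = w ^ p j * w ^ (q - p j)" using H[OF j] by (simp add: power_add[symmetric])
          then show "w ^ q * \<mu> - g j w = w ^ p j * (w ^ (q - p j) * \<mu> - H j w)"
            using elim j by (simp add: right_diff_distrib)
        qed
        also have "\<dots> = w ^ (\<Sum>j\<in>J0. p j) * (\<Prod>j\<in>J0. w ^ (q - p j) * \<mu> - H j w)" by (simp add: prod.distrib power_sum)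
        finally have "(\<Prod>j<d. w ^ q * \<mu> - g j w) = w ^ M * (\<Prod>j\<in>J1. \<mu> - h j w) * (\<Prod>j\<in>J0. w ^ (q - p j) * \<mu> - H j w)"
          by (simp add: M_def power_add mult_ac)
        then have "F (w ^ q) (w ^ q * \<mu>) = G \<mu> w * w ^ M"
          using uF[of w "w ^ q * \<mu>"] elim by (simp add: G_def mult_ac)
        then show ?case by (simp add: power_mult)
      qed
    qed
    ultimately show ?thesis by (rule Lim_transform_eventually)
  qed
  \<comment> \<open>For \<open>\<mu>\<close> away from the finitely many roots on either side both
    limits are nonzero, so the powers of \<open>w\<close> must balance.\<close>
  have MqN: "M = q * N"
  proof -
    have "finite (s ` I \<union> (\<lambda>j. h j 0) ` J1)" using I J by simp
    then obtain \<mu> where \<mu>: "\<mu> \<notin> s ` I \<union> (\<lambda>j. h j 0) ` J1" using ex_new_if_finite[OF infinite_UNIV_char_0] by blast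
    let ?L = "C' * (\<Prod>j\<in>J1. \<mu> - h j 0)"
    have L: "?L \<noteq> 0" "C * (\<Prod>i\<in>I. \<mu> - s i) \<noteq> 0" using \<mu> C C' I J by auto
    have "((\<lambda>w. G \<mu> w * (w ^ M / w ^ (q * N)) / G \<mu> w) \<longlongrightarrow> C * (\<Prod>i\<in>I. \<mu> - s i) / ?L) (at 0)"
      by (intro tendsto_divide GF Glim L)
    moreover have "\<forall>\<^sub>F w in at 0. G \<mu> w * (w ^ M / w ^ (q * N)) / G \<mu> w = w ^ M / w ^ (q * N)"
      using tendsto_imp_eventually_ne[OF Glim L(1)] by eventually_elim simp
    ultimately have "((\<lambda>w. w ^ M / w ^ (q * N)) \<longlongrightarrow> C * (\<Prod>i\<in>I. \<mu> - s i) / ?L) (at 0)"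
      by (rule Lim_transform_eventually)
    from power_quotient_limit(2)[OF this] L show ?thesis by simp
  qed
  have prods: "C * (\<Prod>i\<in>I. \<mu> - s i) = C' * (\<Prod>j\<in>J1. \<mu> - h j 0)" for \<mu>
  proof -
    have "\<forall>\<^sub>F w in at 0. G \<mu> w * (w ^ M / w ^ (q * N)) = G \<mu> w"
      by (auto simp: eventually_at_filter MqN)
    with GF[of \<mu>] have "(G \<mu> \<longlongrightarrow> C * (\<Prod>i\<in>I. \<mu> - s i)) (at 0)" by (rule Lim_transform_eventually)
    from tendsto_unique[OF _ this Glim] show ?thesis by simp
  qed
  \<comment> \<open>Two polynomials in \<open>\<mu>\<close> agree everywhere, hence so do their
    multisets of roots: the prescribed \<open>s i\<close> and the slopes of the regular
    branches.\<close>
  have ms: "image_mset s (mset_set I) = image_mset (\<lambda>j. h j 0) (mset_set J1)"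
  proof -
    have pr: "proots (smult c (\<Prod>i\<in>A. [:- t i, 1:])) = image_mset t (mset_set A)" if "c \<noteq> 0" "finite A" for c :: complex and t and A :: "'z set"
    proof -
      have "proots (smult c (\<Prod>i\<in>A. [:- t i, 1:])) = (\<Sum>i\<in>A. {#t i#})"
        using that by (simp add: proots_prod)
      also have "\<dots> = image_mset t (mset_set A)" using that(2) by (induction A rule: finite_induct) auto
      finally show ?thesis .
    qed
    have "smult C (\<Prod>i\<in>I. [:- s i, 1:]) = smult C' (\<Prod>j\<in>J1. [:- h j 0, 1:])"
      using prods by (simp add: poly_eq_poly_eq_iff[symmetric] fun_eq_iff poly_prod)
    then have "proots (smult C (\<Prod>i\<in>I. [:- s i, 1:])) = proots (smult C' (\<Prod>j\<in>J1. [:- h j 0, 1:]))" by simp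
    then show ?thesis by (simp only: pr[OF C I] pr[OF C' J(1)])
  qed
  obtain \<sigma> where \<sigma>: "bij_betw \<sigma> I J1" "\<And>i. i \<in> I \<Longrightarrow> h (\<sigma> i) 0 = s i"
    using bij_betw_same_values[OF I J(1) ms] by blast
  define m where "m = card J0"
  obtain \<tau> where \<tau>: "bij_betw \<tau> {..<m} J0"
    using ex_bij_betw_nat_finite[OF J(2)] by (auto simp: m_def atLeast0LessThan)
  \<comment> \<open>Inserting one chosen root of \<open>k\<close> for each sign loses nothing: for
    every \<open>w\<close> with \<open>w^q = k\<close> the values \<open>g j w\<close> list all the
    small zeros of \<open>F k\<close>.\<close>
  define c where "c i k = g (\<sigma> i) (rt q k)" for i k
  define mu where "mu l k = g (\<tau> l) (rt q k)" for l k
  have \<sigma>J: "\<sigma> i \<in> J1" "\<sigma> i < d" if "i \<in> I" for i using \<sigma>(1) that by (auto simp: bij_betw_def J1_def)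
  have \<tau>J: "\<tau> l \<in> J0" "\<tau> l < d" if "l < m" for l using \<tau> that by (auto simp: bij_betw_def J0_def)
  define \<kappa> where "\<kappa> = case_sum \<sigma> \<tau>"
  have \<kappa>: "bij_betw \<kappa> (I <+> {..<m}) {..<d}"
  proof -
    have "inj_on \<kappa> (I <+> {..<m})"
    proof (rule inj_onI)
      fix x y assume xy: "x \<in> I <+> {..<m}" "y \<in> I <+> {..<m}" "\<kappa> x = \<kappa> y"
      have i\<sigma>: "inj_on \<sigma> I" and i\<tau>: "inj_on \<tau> {..<m}" using \<sigma>(1) \<tau> by (simp_all add: bij_betw_def)
      have "\<sigma> i \<noteq> \<tau> l" if "i \<in> I" "l < m" for i l using \<sigma>J(1)[OF that(1)] \<tau>J(1)[OF that(2)] J(3) by auto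
      note ne = this this[symmetric]
      show "x = y" using xy inj_onD[OF i\<sigma>] inj_onD[OF i\<tau>] ne
        by (cases x; cases y) (auto simp: \<kappa>_def)
    qed
    moreover have "\<kappa> ` (I <+> {..<m}) = \<sigma> ` I \<union> \<tau> ` {..<m}" by (auto simp: \<kappa>_def image_iff) (metis InlI InrI lessThan_iff sum.case)+
    moreover have "\<sigma> ` I \<union> \<tau> ` {..<m} = {..<d}" using \<sigma>(1) \<tau> J(4) by (simp add: bij_betw_def)
    ultimately show ?thesis by (simp add: bij_betw_def)
  qed
  have cs: "case_sum c mu x k = g (\<kappa> x) (rt q k)" for x k
    by (cases x) (auto simp: c_def mu_def \<kappa>_def)
  have \<kappa>d: "\<kappa> x < d" if "x \<in> I <+> {..<m}" for x using \<kappa> that by (auto simp: bij_betw_def)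
  show thesis
  proof (rule that[of m c mu])
    show "consists_of_curves (\<lambda>k. F (of_real k)) (I <+> {..<m}) (case_sum c mu)"
      unfolding consists_of_curves_def
    proof (intro conjI ballI)
      fix x assume x: "x \<in> I <+> {..<m}"
      show "case_sum c mu x 0 = 0" using g0[OF \<kappa>d[OF x]] by (simp add: cs)
      have "continuous_on {- (\<epsilon> ^ q)<..<\<epsilon> ^ q} (\<lambda>k. g (\<kappa> x) (rt q k))"
        using rt_in_ball[OF q \<epsilon>]
        by (intro continuous_on_compose2[OF holomorphic_on_imp_continuous_on[OF gh[OF \<kappa>d[OF x]]]] continuous_at_imp_continuous_on ballI isCont_rt q) auto
      moreover have "case_sum c mu x = (\<lambda>k. g (\<kappa> x) (rt q k))" by (rule ext) (rule cs)
      ultimately show "\<exists>\<epsilon>>0. continuous_on {- \<epsilon><..<\<epsilon>} (case_sum c mu x)"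
        using \<epsilon> by (intro exI[of _ "\<epsilon> ^ q"]) auto
    next
      have "(F (of_real k) l = 0 \<longleftrightarrow> (\<exists>x\<in>I <+> {..<m}. case_sum c mu x k = l)) \<and>
        (F (of_real k) l = 0 \<longrightarrow> zorder (F (of_real k)) l = int (card {x\<in>I <+> {..<m}. case_sum c mu x k = l}))"
        if kl: "\<bar>k\<bar> < \<epsilon> ^ q" "norm l < \<delta>" for k l
      proof -
        let ?w = "rt q k"
        have w: "?w \<in> ball 0 \<epsilon>" by (rule rt_in_ball[OF q \<epsilon> kl(1)])
        have "bij_betw \<kappa> {x\<in>I <+> {..<m}. case_sum c mu x k = l} {j. j < d \<and> g j ?w = l}"
          unfolding cs using \<kappa> by (auto simp: bij_betw_def inj_on_def)
        then have "card {x\<in>I <+> {..<m}. case_sum c mu x k = l} = card {j. j < d \<and> g j ?w = l}" by (rule bij_betw_same_card)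
        moreover have "(\<exists>x\<in>I <+> {..<m}. case_sum c mu x k = l) \<longleftrightarrow> (\<exists>j<d. g j ?w = l)"
          unfolding cs using \<kappa> by (metis (no_types, lifting) bij_betw_def image_iff lessThan_iff)
        ultimately show ?thesis using zer[OF w kl(2)] zo[OF w kl(2)] by (simp add: rt_power_q[OF q])
      qed
      then show "\<exists>\<epsilon>>0. \<exists>\<delta>>0. \<forall>k l. \<bar>k\<bar> < \<epsilon> \<and> norm l < \<delta> \<longrightarrow>
         (F (of_real k) l = 0 \<longleftrightarrow> (\<exists>j\<in>I <+> {..<m}. case_sum c mu j k = l)) \<and>
         (F (of_real k) l = 0 \<longrightarrow> zorder (F (of_real k)) l = int (card {j\<in>I <+> {..<m}. case_sum c mu j k = l}))"
        using \<epsilon> \<delta> by (intro exI[of _ "\<epsilon> ^ q"] conjI exI[of _ \<delta>]) auto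
    qed
  next
    fix i assume i: "i \<in> I"
    obtain e where e: "0 < e" "h (\<sigma> i) holomorphic_on ball 0 e" "\<And>w. w \<in> ball 0 e \<Longrightarrow> g (\<sigma> i) w = w ^ q * h (\<sigma> i) w"
      using h[OF \<sigma>J(1)[OF i]] by blast
    have ci: "c i k = of_real k * h (\<sigma> i) (rt q k)" if "\<bar>k\<bar> < e ^ q" for k
      using e(3)[OF rt_in_ball[OF q e(1) that]] by (simp add: c_def rt_power_q[OF q])
    show "C1_curve (c i)" by (rule C1_root_curve(1)[OF q e(1,2) ci])
    have "(\<lambda>k. c i k - h (\<sigma> i) 0 * of_real k) \<in> o[at 0](\<lambda>k. of_real k)" by (rule C1_root_curve(2)[OF q e(1,2) ci])
    then show "(\<lambda>k. c i k - s i * of_real k) \<in> o[at 0](\<lambda>k. of_real k)" by (simp add: \<sigma>(2)[OF i])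
    assume uniq: "\<And>i'. i' \<in> I \<Longrightarrow> i' \<noteq> i \<Longrightarrow> s i' \<noteq> s i"
    define \<omega> where "\<omega> = exp (2 * pi * \<i> / of_nat q)"
    have \<omega>: "\<omega> ^ q = 1" "norm \<omega> = 1"
    proof -
      have "\<omega> ^ q = exp (of_nat q * (2 * pi * \<i> / of_nat q))" by (simp only: \<omega>_def exp_of_nat_mult)
      then show "\<omega> ^ q = 1" using q by simp
      show "norm \<omega> = 1" by (simp add: \<omega>_def)
    qed
    have \<omega>b: "\<omega> * w \<in> ball 0 \<epsilon>" if "w \<in> ball 0 \<epsilon>" for w using that by (simp add: norm_mult \<omega>)
    \<comment> \<open>Turning \<open>w\<close> by a \<open>q\<close>-th root of unity leaves
      \<open>w^q\<close> unchanged and therefore permutes the zeros; at first the index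
      \<open>j\<close> depends on \<open>w\<close>.\<close>
    have rot: "\<exists>j<d. g (\<sigma> i) (\<omega> * w) = g j w" if w: "w \<in> ball 0 \<epsilon>" for w
    proof -
      have "(\<omega> * w) ^ q = w ^ q" by (simp add: power_mult_distrib \<omega>)
      then have "F (w ^ q) (g (\<sigma> i) (\<omega> * w)) = 0"
        using zer[OF \<omega>b[OF w] gs[OF \<omega>b[OF w] \<sigma>J(2)[OF i]]] \<sigma>J(2)[OF i] by auto
      then show ?thesis using zer[OF w gs[OF \<omega>b[OF w] \<sigma>J(2)[OF i]]] by metis
    qed
    have gr: "(\<lambda>w. g (\<sigma> i) (\<omega> * w)) holomorphic_on ball 0 \<epsilon>"
    proof -
      have "(\<lambda>w. \<omega> * w) ` ball 0 \<epsilon> \<subseteq> ball 0 \<epsilon>" using \<omega>b by blast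
      then have "g (\<sigma> i) \<circ> (\<lambda>w. \<omega> * w) holomorphic_on ball 0 \<epsilon>"
        by (intro holomorphic_on_compose_gen[OF _ gh[OF \<sigma>J(2)[OF i]]] holomorphic_intros)
      then show ?thesis by (simp add: o_def)
    qed
    \<comment> \<open>Finitely many coincidence sets cover the uncountable disc, so the turned
      branch agrees with one \<open>g j\<close> at uncountably many points and hence
      everywhere.\<close>
    obtain j where j: "j < d" "\<And>w. w \<in> ball 0 \<epsilon> \<Longrightarrow> g (\<sigma> i) (\<omega> * w) = g j w"
    proof -
      have "ball 0 \<epsilon> = (\<Union>j<d. {w\<in>ball 0 \<epsilon>. g (\<sigma> i) (\<omega> * w) = g j w})" (is "_ = ?U")
      proof (intro equalityI subsetI)
        fix w :: complex assume w: "w \<in> ball 0 \<epsilon>"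
        from rot[OF w] w show "w \<in> ?U" by blast
      qed blast
      moreover have "uncountable (ball (0::complex) \<epsilon>)" using \<epsilon> by (rule uncountable_ball)
      ultimately obtain j where j: "j < d" "uncountable {w\<in>ball 0 \<epsilon>. g (\<sigma> i) (\<omega> * w) = g j w}"
        by (metis (no_types, lifting) countable_UN countable_finite finite_lessThan lessThan_iff)
      have "ball 0 \<epsilon> \<subseteq> {w\<in>ball 0 \<epsilon>. g (\<sigma> i) (\<omega> * w) = g j w}"
        by (rule holomorphic_countable_equal[OF gr gh[OF j(1)] open_ball connected_ball _ j(2)]) (rule fsigma_ball)
      then show thesis by (intro that[OF j(1)]) auto
    qed
    \<comment> \<open>Since \<open>\<omega>^q = 1\<close>, turning preserves the slope. This
      excludes a steep \<open>g j\<close>, and a simple slope leaves only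
      \<open>j = \<sigma> i\<close>: the branch is invariant.\<close>
    have lim_rot: "((\<lambda>w. g j w / w ^ q) \<longlongrightarrow> s i) (at 0)"
    proof -
      have "filterlim (\<lambda>w. \<omega> * w) (at 0) (at (0::complex))"
      proof (rule filterlim_atI)
        have "((\<lambda>w. \<omega> * w) \<longlongrightarrow> \<omega> * 0) (at (0::complex))" by (intro tendsto_intros)
        then show "((\<lambda>w. \<omega> * w) \<longlongrightarrow> 0) (at (0::complex))" by simp
        show "\<forall>\<^sub>F w in at (0::complex). \<omega> * w \<noteq> 0"
          by (rule eventually_mono[OF eventually_neq_at_within[of 0]]) (use \<omega>(2) in auto)
      qed
      from filterlim_compose[OF hc[OF \<sigma>J(1)[OF i]] this]
      have "((\<lambda>w. h (\<sigma> i) (\<omega> * w)) \<longlongrightarrow> s i) (at 0)" by (simp add: \<sigma>(2)[OF i])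
      moreover have "\<forall>\<^sub>F w in at 0. h (\<sigma> i) (\<omega> * w) = g j w / w ^ q"
        using ev_ball[OF \<epsilon>] ev_ball[OF e(1)] eventually_neq_at_within[of "0::complex"]
      proof eventually_elim
        case (elim w)
        have "\<omega> * w \<in> ball 0 e" using elim by (simp add: norm_mult \<omega>)
        then have "g j w = (\<omega> * w) ^ q * h (\<sigma> i) (\<omega> * w)" using e(3) j(2)[of w] elim by simp
        then show ?case using elim by (simp add: power_mult_distrib \<omega>)
      qed
      ultimately show ?thesis by (rule Lim_transform_eventually)
    qed
    have jJ: "j \<in> J1"
    proof (rule ccontr)
      assume "j \<notin> J1"
      then have j0: "j \<in> J0" using j(1) by (auto simp: J1_def J0_def)
      have "((\<lambda>w. w ^ (q - p j) * (g j w / w ^ q)) \<longlongrightarrow> 0 ^ (q - p j) * s i) (at 0)"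
        by (intro tendsto_intros lim_rot)
      then have "((\<lambda>w. w ^ (q - p j) * (g j w / w ^ q)) \<longlongrightarrow> 0) (at 0)" using H[OF j0] by (simp add: power_0_left)
      moreover have "\<forall>\<^sub>F w in at 0. w ^ (q - p j) * (g j w / w ^ q) = H j w"
        using ev0 eventually_neq_at_within[of "0::complex"]
      proof eventually_elim
        case (elim w)
        have "w ^ q = w ^ (q - p j) * w ^ p j" using H[OF j0] by (simp add: power_add[symmetric])
        then show ?case using elim j0 by simp
      qed
      ultimately have "(H j \<longlongrightarrow> 0) (at 0)" by (rule Lim_transform_eventually)
      then have "H j 0 = 0" by (rule tendsto_unique[OF at_neq_bot Hc[OF j0]])
      then show False using H[OF j0] by simp
    qed
    have "h j 0 = s i"
    proof -
      have "\<forall>\<^sub>F w in at 0. g j w / w ^ q = h j w"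
        using ev1 eventually_neq_at_within[of "0::complex"] by eventually_elim (use jJ in auto)
      then have "(h j \<longlongrightarrow> s i) (at 0)" by (rule Lim_transform_eventually[OF lim_rot])
      then show ?thesis by (metis tendsto_unique[OF at_neq_bot hc[OF jJ]])
    qed
    moreover obtain i' where i': "i' \<in> I" "j = \<sigma> i'" using jJ \<sigma>(1) by (auto simp: bij_betw_def)
    ultimately have "s i' = s i" using \<sigma>(2)[OF i'(1)] by simp
    then have ji: "j = \<sigma> i" using uniq i' by metis
    define e' where "e' = min e \<epsilon>"
    have e': "0 < e'" using e(1) \<epsilon> by (simp add: e'_def)
    show "Cinf_curve (c i)"
    proof (rule Cinf_root_curve[OF q e'])
      show "h (\<sigma> i) holomorphic_on ball 0 e'" by (rule holomorphic_on_subset[OF e(2)]) (auto simp: e'_def)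
      show "c i k = of_real k * h (\<sigma> i) (rt q k)" if "\<bar>k\<bar> < e' ^ q" for k
      proof (rule ci)
        have "e' ^ q \<le> e ^ q" using e' by (intro power_mono) (auto simp: e'_def)
        then show "\<bar>k\<bar> < e ^ q" using that by simp
      qed
      show "h (\<sigma> i) (exp (2 * pi * \<i> / of_nat q) * w) = h (\<sigma> i) w" if w: "w \<in> ball 0 e'" for w
      proof (cases "w = 0")
        case False
        have "\<omega> * w \<in> ball 0 e" "w \<in> ball 0 e" "w \<in> ball 0 \<epsilon>" using w by (auto simp: norm_mult \<omega> e'_def)
        then have "(\<omega> * w) ^ q * h (\<sigma> i) (\<omega> * w) = w ^ q * h (\<sigma> i) w"
          using e(3)[of w] e(3)[of "\<omega> * w"] j(2)[of w] ji by simp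
        then show ?thesis using False by (simp add: power_mult_distrib \<omega>(1)) (simp add: \<omega>_def)
      qed simp
    qed
  next
    have "card J1 = card I" using bij_betw_same_card[OF \<sigma>(1)] by simp
    then have "card I + m = d"
      using card_Un_disjoint[OF J(1-3)] J(4) by (simp add: m_def)
    then show "N \<le> card I + m" "Q \<noteq> 0 \<Longrightarrow> card I + m = N" using Nd NdQ by simp_all
  next
    fix l assume l: "l < m"
    obtain e where e: "0 < e" "H (\<tau> l) holomorphic_on ball 0 e" "\<And>w. w \<in> ball 0 e \<Longrightarrow> g (\<tau> l) w = w ^ p (\<tau> l) * H (\<tau> l) w"
      using H[OF \<tau>J(1)[OF l]] by blast
    show "fractional_power_curve (mu l)"
    proof (rule fractional_root_curve[of "p (\<tau> l)" q e "H (\<tau> l)"])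
      show "mu l k = rt q k ^ p (\<tau> l) * H (\<tau> l) (rt q k)" if "\<bar>k\<bar> < e ^ q" for k
        using e(3)[OF rt_in_ball[OF q e(1) that]] by (simp add: mu_def)
    qed (use e H[OF \<tau>J(1)[OF l]] in auto)
  next
    assume "m > 0"
    then obtain j where j: "j \<in> J0" by (auto simp: m_def card_gt_0_iff)
    have jd: "j < d" using j by (simp add: J0_def)
    obtain e where e: "0 < e" "H j holomorphic_on ball 0 e" "\<And>w. w \<in> ball 0 e \<Longrightarrow> g j w = w ^ p j * H j w"
      using H[OF j] by blast
    obtain l :: nat where l: "Re (exp (\<i> * pi * of_nat (p j) / of_nat q) ^ l * H j 0) > 0"
      using unstable_rotation[of "p j" q "H j 0"] H[OF j] by blast
    \<comment> \<open>On the ray through \<open>\<eta>\<close> the parameter \<open>w^q\<close> is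
      real, negative for odd \<open>l\<close>, while the leading coefficient of the steep branch is
      turned \<open>l\<close> times. The \<open>l\<close> obtained above moves it into the right
      half-plane.\<close>
    define \<eta> where "\<eta> = exp (\<i> * pi * of_nat l / of_nat q)"
    have \<eta>1: "norm \<eta> = 1" by (simp add: \<eta>_def)
    have \<eta>p: "\<eta> ^ p j = exp (\<i> * pi * of_nat (p j) / of_nat q) ^ l"
      unfolding \<eta>_def by (simp only: exp_of_nat_mult[symmetric]) (simp add: mult_ac)
    have \<eta>q: "\<eta> ^ q = of_real ((-1) ^ l)"
    proof -
      have "\<eta> ^ q = exp (of_nat l * (\<i> * pi))"
        unfolding \<eta>_def using q by (simp only: exp_of_nat_mult[symmetric]) (simp add: mult_ac)
      also have "\<dots> = (-1) ^ l" by (simp only: exp_of_nat_mult) (simp add: exp_pi_i')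
      finally show ?thesis by simp
    qed
    have "((\<lambda>t. \<eta> * of_real t) \<longlongrightarrow> \<eta> * of_real 0) (at_right (0::real))" by (intro tendsto_intros)
    then have t0: "((\<lambda>t. \<eta> * of_real t) \<longlongrightarrow> 0) (at_right (0::real))" by simp
    have "filterlim (\<lambda>t. \<eta> * of_real t) (at 0) (at_right (0::real))"
    proof (rule filterlim_atI[OF t0])
      show "\<forall>\<^sub>F t in at_right 0. \<eta> * complex_of_real t \<noteq> 0"
        by (rule eventually_mono[OF eventually_neq_at_within[of 0]]) (use \<eta>1 in auto)
    qed
    from filterlim_compose[OF Hc[OF j] this]
    have "((\<lambda>t. Re (\<eta> ^ p j * H j (\<eta> * of_real t))) \<longlongrightarrow> Re (\<eta> ^ p j * H j 0)) (at_right 0)"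
      by (intro tendsto_intros)
    then have "\<forall>\<^sub>F t in at_right 0. Re (\<eta> ^ p j * H j (\<eta> * of_real t)) > 0"
      by (rule order_tendstoD(1)) (use l in \<open>simp only: \<eta>p\<close>)
    moreover have "\<forall>\<^sub>F t in at_right 0. 0 < t \<and> t < min e \<epsilon>"
      unfolding eventually_at_right_field using e(1) \<epsilon> by (intro exI[of _ "min e \<epsilon>"]) auto
    ultimately have "\<forall>\<^sub>F t in at_right 0. Re (\<eta> ^ p j * H j (\<eta> * of_real t)) > 0 \<and> 0 < t \<and> t < min e \<epsilon>"
      by (rule eventually_conj)
    from eventually_happens[OF this] obtain t where t: "Re (\<eta> ^ p j * H j (\<eta> * of_real t)) > 0" "0 < t" "t < min e \<epsilon>"
      by (auto simp: trivial_limit_at_right_real)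
    let ?w = "\<eta> * of_real t"
    have w: "?w \<in> ball 0 e" "?w \<in> ball 0 \<epsilon>" using t by (auto simp: norm_mult \<eta>1)
    have "F (?w ^ q) (g j ?w) = 0" using zer[OF w(2) gs[OF w(2) jd]] jd by auto
    moreover have "?w ^ q = of_real ((-1) ^ l * t ^ q)" by (simp add: power_mult_distrib \<eta>q)
    moreover have "Re (g j ?w) > 0"
    proof -
      have "g j ?w = of_real (t ^ p j) * (\<eta> ^ p j * H j ?w)" using e(3)[OF w(1)] by (simp add: power_mult_distrib mult_ac)
      then have "Re (g j ?w) = t ^ p j * Re (\<eta> ^ p j * H j ?w)" by simp
      then show ?thesis using t by simp
    qed
    ultimately show "\<exists>k z. F (of_real k) z = 0 \<and> Re z > 0" by metis
  qed
qed

end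

section \<open>Linear differential equations\<close>

lemma bilinear_mv: "bounded_bilinear ((*v) :: 'a::{real_normed_field,euclidean_space}^'n^'m \<Rightarrow> 'a^'n \<Rightarrow> 'a^'m)"
  unfolding bilinear_conv_bounded_bilinear[symmetric] bilinear_def
  by (auto intro!: linearI simp: matrix_vector_mult_def vec_eq_iff sum.distrib algebra_simps scaleR_sum_right)

lemma bilinear_mm: "bounded_bilinear ((**) :: 'a::{real_normed_field,euclidean_space}^'n^'m \<Rightarrow> 'a^'k^'n \<Rightarrow> 'a^'k^'m)"
  unfolding bilinear_conv_bounded_bilinear[symmetric] bilinear_def
  by (auto intro!: linearI simp: matrix_matrix_mult_def vec_eq_iff sum.distrib algebra_simps scaleR_sum_right)

lemma norm_axis_vec: "norm (axis i x :: 'a::real_normed_vector^'n) = norm x"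
proof -
  have "(norm (axis i x $ j))\<^sup>2 = (if j = i then (norm x)\<^sup>2 else 0)" for j by (simp add: axis_def)
  then show ?thesis by (simp add: norm_vec_def L2_set_def)
qed

lemma bounded_linear_axis: "bounded_linear (axis i :: 'a::real_normed_vector \<Rightarrow> 'a^'n)"
  by (rule bounded_linear_intro[where K=1]) (simp_all add: norm_axis_vec, simp_all add: axis_def vec_eq_iff)

lemma vec_sum_axis: "(v :: 'a::comm_monoid_add^'n) = (\<Sum>i\<in>UNIV. axis i (v $ i))"
  by (simp add: vec_eq_iff axis_def)

lemma has_vector_derivative_vec:
  fixes f :: "real \<Rightarrow> 'a::real_normed_vector^'n"
  assumes "\<And>i. ((\<lambda>x. f x $ i) has_vector_derivative f' $ i) F"
  shows "(f has_vector_derivative f') F"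
proof -
  have "((\<lambda>x. \<Sum>i\<in>UNIV. axis i (f x $ i)) has_vector_derivative (\<Sum>i\<in>UNIV. axis i (f' $ i))) F"
    by (intro has_vector_derivative_sum bounded_linear.has_vector_derivative[OF bounded_linear_axis] assms)
  then show ?thesis by (simp add: vec_sum_axis[symmetric])
qed

lemma has_vector_derivative_vec_nth:
  "(f has_vector_derivative f') F \<Longrightarrow> ((\<lambda>x. f x $ i) has_vector_derivative f' $ i) F"
  by (rule bounded_linear.has_vector_derivative[OF bounded_linear_vec_nth])

lemmas hvd_mv = bounded_bilinear.has_vector_derivative[OF bilinear_mv]
lemmas hvd_mm = bounded_bilinear.has_vector_derivative[OF bilinear_mm]
lemmas cont_mv = bounded_bilinear.continuous_on[OF bilinear_mv]
lemmas cont_mm = bounded_bilinear.continuous_on[OF bilinear_mm]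

lemma bounded_mv_on_compact:
  fixes A :: "real \<Rightarrow> 'a::{real_normed_field,euclidean_space}^'n^'m"
  assumes "continuous_on S A" "compact S"
  obtains K where "K \<ge> 0" "\<And>x v. x \<in> S \<Longrightarrow> norm (A x *v v) \<le> K * norm v"
proof -
  obtain K1 where K1: "K1 > 0" "\<And>(a::'a^'n^'m) b. norm (a *v b) \<le> norm a * norm b * K1"
    using bounded_bilinear.pos_bounded[OF bilinear_mv] by blast
  have "bounded (A ` S)" by (intro compact_imp_bounded compact_continuous_image assms)
  then obtain K2 where K2: "K2 > 0" "\<And>x. x \<in> S \<Longrightarrow> norm (A x) \<le> K2" by (auto simp: bounded_pos)
  show thesis
  proof (rule that[of "K1 * K2"])
    fix x v assume "x \<in> S"
    have "norm (A x *v v) \<le> norm (A x) * norm v * K1" by (rule K1)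
    also have "\<dots> \<le> K2 * norm v * K1" using K1 K2(2)[OF \<open>x \<in> S\<close>] by (intro mult_right_mono) auto
    finally show "norm (A x *v v) \<le> K1 * K2 * norm v" by (simp add: algebra_simps)
  qed (use K1 K2 in auto)
qed

text \<open>The estimate is run on \<open>exp (- c x) (\<bar>z x\<bar>\<^sup>2 + b\<^sup>2)\<close>, which decreases as long as the growth bound
  is available; being small, \<open>z\<close> never leaves the ball in which the bound is assumed.\<close>
lemma gronwall_local:
  fixes z z' :: "real \<Rightarrow> 'a::real_inner"
  assumes z: "\<And>x. x \<in> {0..T} \<Longrightarrow> (z has_vector_derivative z' x) (at x within {0..T})"
    and bound: "\<And>x. x \<in> {0..T} \<Longrightarrow> norm (z x) \<le> \<rho> \<Longrightarrow> norm (z' x) \<le> L * norm (z x) + b"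
    and L: "L \<ge> 0" "b \<ge> 0" and z0: "norm (z 0) \<le> a"
    and small: "exp ((2 * L + 1) * T) * (a\<^sup>2 + b\<^sup>2) < \<rho>\<^sup>2" and \<rho>: "\<rho> > 0" and t: "t \<in> {0..T}"
  shows "norm (z t) < \<rho>" "norm (z t) \<le> exp ((2 * L + 1) * T) * (a + b)"
proof -
  define c where "c = 2 * L + 1"
  have a: "a \<ge> 0" using z0 norm_ge_zero order_trans by blast
  have claim: "(norm (z t))\<^sup>2 \<le> exp (c * T) * (a\<^sup>2 + b\<^sup>2)"
    if t: "t \<in> {0..T}" and in_ball: "\<And>x. x \<in> {0<..<t} \<Longrightarrow> norm (z x) \<le> \<rho>" for t
  proof (cases "t = 0")
    case True
    have "(norm (z 0))\<^sup>2 \<le> a\<^sup>2" using z0 by (intro power_mono) auto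
    also have "\<dots> \<le> 1 * (a\<^sup>2 + b\<^sup>2)" by simp
    also have "\<dots> \<le> exp (c * T) * (a\<^sup>2 + b\<^sup>2)" using t L by (intro mult_right_mono) (auto simp: c_def)
    finally show ?thesis using True by simp
  next
    case False
    then have t0: "0 < t" using t by auto
    define \<psi> where "\<psi> x = exp (- c * x) * (z x \<bullet> z x + b\<^sup>2)" for x
    have "\<exists>x\<in>{0<..<t}. \<psi> t - \<psi> 0 = (t - 0) * (exp (- c * x) * (2 * (z x \<bullet> z' x)) + (- c * exp (- c * x)) * (z x \<bullet> z x + b\<^sup>2))"
    proof (rule mvt_simple[OF t0, where f=\<psi> and f'="\<lambda>x h. h * (exp (- c * x) * (2 * (z x \<bullet> z' x)) + (- c * exp (- c * x)) * (z x \<bullet> z x + b\<^sup>2))"])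
      fix x assume "0 \<le> x" "x \<le> t"
      then have x: "x \<in> {0..t}" by simp
      have zx: "(z has_derivative (\<lambda>h. h *\<^sub>R z' x)) (at x within {0..t})"
        using has_vector_derivative_within_subset[OF z, of x "{0..t}"] x t by (auto simp: has_vector_derivative_def)
      show "(\<psi> has_derivative (\<lambda>h. h * (exp (- c * x) * (2 * (z x \<bullet> z' x)) + (- c * exp (- c * x)) * (z x \<bullet> z x + b\<^sup>2)))) (at x within {0..t})"
        unfolding \<psi>_def[abs_def]
        by (rule derivative_eq_intros has_derivative_inner[OF zx zx] refl)+
           (auto simp: fun_eq_iff algebra_simps inner_commute)
    qed
    then obtain x where x: "x \<in> {0<..<t}" and eq: "\<psi> t - \<psi> 0 = t * (exp (- c * x) * (2 * (z x \<bullet> z' x) - c * (z x \<bullet> z x + b\<^sup>2)))"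
      by (auto simp: algebra_simps)
    have "2 * (z x \<bullet> z' x) \<le> 2 * (norm (z x) * norm (z' x))" using norm_cauchy_schwarz by simp
    also have "\<dots> \<le> 2 * (norm (z x) * (L * norm (z x) + b))"
      using bound[of x] x t in_ball[of x] by (intro mult_left_mono) auto
    also have "\<dots> \<le> c * (z x \<bullet> z x + b\<^sup>2)"
    proof -
      have "0 \<le> (norm (z x) - b)\<^sup>2" by simp
      moreover have "0 \<le> 2 * L * b\<^sup>2" using L by simp
      ultimately show ?thesis
        by (simp add: c_def dot_square_norm power2_eq_square algebra_simps)
    qed
    finally have "\<psi> t - \<psi> 0 \<le> 0"
      unfolding eq using t0 by (intro mult_nonneg_nonpos) (auto intro!: mult_nonneg_nonpos)
    then have "exp (- c * t) * (z t \<bullet> z t + b\<^sup>2) \<le> z 0 \<bullet> z 0 + b\<^sup>2" by (simp add: \<psi>_def)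
    then have "exp (c * t) * (exp (- c * t) * (z t \<bullet> z t + b\<^sup>2)) \<le> exp (c * t) * (z 0 \<bullet> z 0 + b\<^sup>2)"
      by (intro mult_left_mono) auto
    then have "z t \<bullet> z t + b\<^sup>2 \<le> exp (c * t) * (z 0 \<bullet> z 0 + b\<^sup>2)"
      by (simp add: mult.assoc[symmetric] exp_add[symmetric])
    also have "\<dots> \<le> exp (c * T) * (a\<^sup>2 + b\<^sup>2)"
    proof (rule mult_mono)
      show "exp (c * t) \<le> exp (c * T)" using t L by (auto simp: c_def intro!: mult_left_mono)
      show "z 0 \<bullet> z 0 + b\<^sup>2 \<le> a\<^sup>2 + b\<^sup>2" using z0 by (simp add: dot_square_norm power_mono)
    qed auto
    finally show ?thesis using zero_le_power2[of b] unfolding power2_norm_eq_inner by linarith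
  qed
  have cz: "continuous_on {0..T} z" by (rule continuous_on_vector_derivative[OF z])
  have all: "norm (z x) < \<rho>" if x: "x \<in> {0..T}" for x
  proof (rule ccontr)
    assume "\<not> norm (z x) < \<rho>"
    define S where "S = {x \<in> {0..T}. \<rho> \<le> norm (z x)}"
    have "S = {0..T} \<inter> (\<lambda>x. norm (z x)) -` {\<rho>..}" by (auto simp: S_def)
    moreover have "closed ({0..T} \<inter> (\<lambda>x. norm (z x)) -` {\<rho>..})"
      by (intro continuous_closed_preimage continuous_intros cz)
    ultimately have "closed S" by simp
    moreover have "S \<noteq> {}" using x \<open>\<not> norm (z x) < \<rho>\<close> by (auto simp: S_def)
    moreover have bdd: "bdd_below S" by (rule bdd_belowI[of _ 0]) (auto simp: S_def)
    ultimately have mem: "Inf S \<in> S" by (intro closed_contains_Inf)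
    then have "(norm (z (Inf S)))\<^sup>2 \<le> exp (c * T) * (a\<^sup>2 + b\<^sup>2)"
    proof (intro claim)
      fix y assume y: "y \<in> {0<..<Inf S}"
      then have "y \<notin> S" using cInf_lower[OF _ bdd] by force
      then show "norm (z y) \<le> \<rho>" using y mem by (auto simp: S_def)
    qed (auto simp: S_def)
    also have "\<dots> < \<rho>\<^sup>2" using small by (simp add: c_def)
    finally have "norm (z (Inf S)) < \<rho>" using \<rho> by (simp add: power_less_imp_less_base)
    then show False using mem by (simp add: S_def)
  qed
  show "norm (z t) < \<rho>" by (rule all[OF t])
  have "(norm (z t))\<^sup>2 \<le> exp (c * T) * (a\<^sup>2 + b\<^sup>2)"
    using all t by (intro claim) (auto intro!: less_imp_le)
  also have "\<dots> \<le> (exp (c * T))\<^sup>2 * (a + b)\<^sup>2"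
  proof (rule mult_mono)
    have "0 \<le> T" using t by simp
    then have "0 \<le> c * T" using L by (simp add: c_def)
    then have "1 \<le> exp (c * T)" by simp
    then show "exp (c * T) \<le> (exp (c * T))\<^sup>2" by (simp add: power2_eq_square)
    show "a\<^sup>2 + b\<^sup>2 \<le> (a + b)\<^sup>2" using a L(2) by (simp add: power2_sum)
  qed auto
  finally have "(norm (z t))\<^sup>2 \<le> (exp (c * T) * (a + b))\<^sup>2" by (simp add: power_mult_distrib)
  then show "norm (z t) \<le> exp ((2 * L + 1) * T) * (a + b)"
    unfolding c_def[symmetric] by (rule power2_le_imp_le) (use a L in auto)
qed

text \<open>With the growth bound available everywhere, a ball of radius \<open>?s + 1\<close>
  satisfies the smallness condition of the local version automatically, since
  \<open>s < (s + 1)^2\<close>.\<close>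

lemma gronwall:
  fixes z z' :: "real \<Rightarrow> 'a::real_inner"
  assumes z: "\<And>x. x \<in> {0..T} \<Longrightarrow> (z has_vector_derivative z' x) (at x within {0..T})"
    and bound: "\<And>x. x \<in> {0..T} \<Longrightarrow> norm (z' x) \<le> L * norm (z x) + b"
    and L: "L \<ge> 0" "b \<ge> 0" and z0: "norm (z 0) \<le> a" and t: "t \<in> {0..T}"
  shows "norm (z t) \<le> exp ((2 * L + 1) * T) * (a + b)"
proof -
  let ?s = "exp ((2 * L + 1) * T) * (a\<^sup>2 + b\<^sup>2)"
  have "0 \<le> ?s" by simp
  moreover have "s < (s + 1)\<^sup>2" if "0 \<le> s" for s :: real
    using that mult_nonneg_nonneg[OF that that] by (simp add: power2_eq_square algebra_simps add_pos_nonneg)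
  ultimately have "?s < (?s + 1)\<^sup>2" by blast
  then show ?thesis
    using bound L z0 t add_nonneg_pos[OF \<open>0 \<le> ?s\<close> zero_less_one] by (intro gronwall_local(2)[OF z, where \<rho>="?s + 1"]) auto
qed

section \<open>Uniqueness, inverses and variation of constants\<close>

lemma linear_ode_unique_right:
  fixes A :: "real \<Rightarrow> 'a::{real_normed_field,euclidean_space}^'n^'n"
  assumes A: "continuous_on {0..T} A"
    and z: "\<And>x. x \<in> {0..T} \<Longrightarrow> (z has_vector_derivative A x *v z x) (at x within {0..T})"
    and z0: "z 0 = 0" and t: "t \<in> {0..T}"
  shows "z t = 0"
proof -
  obtain K where K: "K \<ge> 0" "\<And>x v. x \<in> {0..T} \<Longrightarrow> norm (A x *v v) \<le> K * norm v"
    by (rule bounded_mv_on_compact[OF A compact_Icc]) blast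
  have "norm (z t) \<le> exp ((2 * K + 1) * T) * (0 + 0)"
    using K z0 t by (intro gronwall[OF z, where L=K]) auto
  then show ?thesis by simp
qed

lemma linear_ode_unique:
  fixes A :: "real \<Rightarrow> 'a::{real_normed_field,euclidean_space}^'n^'n"
  assumes A: "continuous_on UNIV A"
    and z: "\<And>x. (z has_vector_derivative A x *v z x) (at x)" and z0: "z x0 = 0"
  shows "z t = 0"
proof (cases "t \<ge> x0")
  case True
  have "(\<lambda>x. z (x0 + x)) (t - x0) = 0"
  proof (rule linear_ode_unique_right[where z="\<lambda>x. z (x0 + x)" and T="t - x0" and A="\<lambda>x. A (x0 + x)"])
    show "continuous_on {0..t - x0} (\<lambda>x. A (x0 + x))"
      by (intro continuous_on_compose2[OF A] continuous_intros) auto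
    fix x
    have "((z \<circ> (\<lambda>x. x0 + x)) has_vector_derivative (1 *\<^sub>R (A (x0 + x) *v z (x0 + x)))) (at x)"
      by (rule vector_diff_chain_at) (auto intro!: derivative_eq_intros z)
    then show "((\<lambda>x. z (x0 + x)) has_vector_derivative A (x0 + x) *v z (x0 + x)) (at x within {0..t - x0})"
      by (auto simp: o_def intro: has_vector_derivative_at_within)
  qed (use True z0 in auto)
  then show ?thesis by simp
next
  case False
  have "(\<lambda>x. z (x0 - x)) (x0 - t) = 0"
  proof (rule linear_ode_unique_right[where z="\<lambda>x. z (x0 - x)" and T="x0 - t" and A="\<lambda>x. - A (x0 - x)"])
    show "continuous_on {0..x0 - t} (\<lambda>x. - A (x0 - x))"
      by (intro continuous_on_minus continuous_on_compose2[OF A] continuous_intros) auto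
    fix x
    have "((z \<circ> (\<lambda>x. x0 - x)) has_vector_derivative ((-1) *\<^sub>R (A (x0 - x) *v z (x0 - x)))) (at x)"
      by (rule vector_diff_chain_at) (auto intro!: derivative_eq_intros z)
    moreover have "- A (x0 - x) *v z (x0 - x) = (-1) *\<^sub>R (A (x0 - x) *v z (x0 - x))"
      by (simp add: bounded_bilinear.minus_left[OF bilinear_mv])
    ultimately show "((\<lambda>x. z (x0 - x)) has_vector_derivative - A (x0 - x) *v z (x0 - x)) (at x within {0..x0 - t})"
      by (auto simp: o_def intro: has_vector_derivative_at_within)
  qed (use False z0 in auto)
  then show ?thesis by simp
qed

text \<open>A kernel vector at time \<open>t\<close> spans a solution that vanishes at
  \<open>t\<close>, hence also at 0, where the matrix is the identity.\<close>

lemma fundamental_matrix_invertible: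
  fixes A :: "real \<Rightarrow> 'a::{real_normed_field,euclidean_space}^'n^'n"
  assumes A: "continuous_on UNIV A" and \<Phi>0: "\<Phi> 0 = mat 1"
    and \<Phi>: "\<And>x. (\<Phi> has_vector_derivative A x ** \<Phi> x) (at x)"
  shows "invertible (\<Phi> t)"
proof -
  have "v = 0" if "\<Phi> t *v v = 0" for v
  proof -
    have "((\<lambda>x. \<Phi> x *v v) has_vector_derivative A x *v (\<Phi> x *v v)) (at x)" for x
      using hvd_mv[OF \<Phi> has_vector_derivative_const[of v]] by (simp add: matrix_vector_mul_assoc)
    from linear_ode_unique[OF A this that, of 0] show "v = 0" by (simp add: \<Phi>0)
  qed
  then show ?thesis
    unfolding invertible_left_inverse matrix_left_invertible_ker by blast
qed

lemma matrix_inv_mult: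
  fixes A :: "'a::{semiring_1}^'n^'n"
  assumes "invertible A"
  shows "A ** matrix_inv A = mat 1" "matrix_inv A ** A = mat 1"
proof -
  have "A ** matrix_inv A = mat 1 \<and> matrix_inv A ** A = mat 1"
    unfolding matrix_inv_def using assms unfolding invertible_def by (rule someI_ex)
  then show "A ** matrix_inv A = mat 1" "matrix_inv A ** A = mat 1" by auto
qed

lemma continuous_on_det:
  fixes M :: "'b::topological_space \<Rightarrow> 'a::{real_normed_field}^'n^'n"
  assumes "\<And>i j. continuous_on S (\<lambda>x. M x $ i $ j)"
  shows "continuous_on S (\<lambda>x. det (M x))"
  unfolding det_def by (intro continuous_on_sum continuous_on_mult continuous_on_prod continuous_on_const assms)

lemma matrix_inv_entry:
  fixes A :: "'a::field^'n^'n"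
  assumes "det A \<noteq> 0"
  shows "matrix_inv A $ k $ l = det (\<chi> i j. if j = k then (if i = l then 1 else 0) else A $ i $ j) / det A"
proof -
  have inv: "invertible A" using assms by (simp add: invertible_det_nz)
  have "A *v (matrix_inv A *v axis l 1) = axis l 1"
    by (simp add: matrix_vector_mul_assoc matrix_inv_mult[OF inv])
  then have "matrix_inv A *v axis l 1 = (\<chi> k. det (\<chi> i j. if j = k then axis l 1 $ i else A $ i $ j) / det A)"
    by (simp add: cramer[OF assms])
  moreover have "(matrix_inv A *v axis l 1) $ k = matrix_inv A $ k $ l"
    by (simp add: matrix_vector_mult_def axis_def if_distrib cong: if_cong)
  ultimately show ?thesis by (simp add: axis_def eq_commute cong: if_cong)
qed

lemma continuous_on_matrix_inv:
  fixes M :: "'b::topological_space \<Rightarrow> 'a::{real_normed_field,euclidean_space}^'n^'n"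
  assumes M: "continuous_on S M" and inv: "\<And>x. x \<in> S \<Longrightarrow> invertible (M x)"
  shows "continuous_on S (\<lambda>x. matrix_inv (M x))"
proof -
  have nz: "det (M x) \<noteq> 0" if "x \<in> S" for x using inv[OF that] by (simp add: invertible_det_nz)
  have cM: "continuous_on S (\<lambda>x. M x $ i $ j)" for i j by (intro continuous_intros M)
  have "continuous_on S (\<lambda>x. matrix_inv (M x) $ k $ l)" for k l
  proof (subst continuous_on_cong[OF refl matrix_inv_entry[OF nz]])
    show "continuous_on S (\<lambda>x. det (\<chi> i j. if j = k then (if i = l then 1 else 0) else M x $ i $ j) / det (M x))"
    proof (intro continuous_on_divide continuous_on_det ballI)
      show "continuous_on S (\<lambda>x. (\<chi> i j. if j = k then (if i = l then 1 else 0) else M x $ i $ j) $ i $ j)" for i j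
        by (cases "j = k") (auto intro: cM)
    qed (use nz cM in auto)
  qed
  then have "continuous_on S (\<lambda>x. \<chi> k l. matrix_inv (M x) $ k $ l)" by (intro continuous_on_vec_lambda)
  then show ?thesis by simp
qed

text \<open>Everything follows from \<open>N(y) - N(x) = - N(y) (M(y) - M(x)) N(x)\<close> for the
  inverse \<open>N\<close>, and from continuity of \<open>N\<close>, which Cramer's rule
  provides.\<close>

lemma has_vector_derivative_matrix_inv:
  fixes M :: "real \<Rightarrow> 'a::{real_normed_field,euclidean_space}^'n^'n"
  assumes M: "(M has_vector_derivative M') (at x)" and c: "continuous_on UNIV M" and inv: "\<And>x. invertible (M x)"
  shows "((\<lambda>x. matrix_inv (M x)) has_vector_derivative - (matrix_inv (M x) ** M' ** matrix_inv (M x))) (at x)"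
proof -
  let ?N = "\<lambda>x. matrix_inv (M x)"
  have cN: "continuous_on UNIV ?N" by (rule continuous_on_matrix_inv[OF c inv])
  interpret mm: bounded_bilinear "(**) :: 'a^'n^'n \<Rightarrow> 'a^'n^'n \<Rightarrow> 'a^'n^'n" by (rule bilinear_mm)
  let ?D = "?N x ** M' ** ?N x"
  have eq: "?N y - ?N x = - (?N y ** (M y - M x) ** ?N x)" for y
  proof -
    have "?N y ** (M y - M x) ** ?N x = ?N y ** M y ** ?N x - ?N y ** (M x ** ?N x)"
      by (simp add: mm.diff_left mm.diff_right matrix_mul_assoc)
    then show ?thesis by (simp add: matrix_inv_mult[OF inv])
  qed
  have Nx: "(?N \<longlongrightarrow> ?N x) (at x)"
    using cN by (simp add: continuous_on_eq_continuous_at isCont_def)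
  have "((\<lambda>y. (M y - M x - (y - x) *\<^sub>R M') /\<^sub>R norm (y - x)) \<longlongrightarrow> 0) (at x)"
    using M unfolding has_vector_derivative_def has_derivative_within by (simp add: diff_diff_eq divide_inverse)
  from mm.tendsto[OF mm.tendsto[OF Nx this] tendsto_const[of "?N x"]]
  have l1: "((\<lambda>y. ?N y ** ((M y - M x - (y - x) *\<^sub>R M') /\<^sub>R norm (y - x)) ** ?N x) \<longlongrightarrow> 0) (at x)"
    by (simp add: mm.zero_left mm.zero_right)
  have "((\<lambda>y. (?N y - ?N x) ** M' ** ?N x) \<longlongrightarrow> (?N x - ?N x) ** M' ** ?N x) (at x)"
    by (intro mm.tendsto tendsto_const tendsto_diff Nx)
  then have "((\<lambda>y. (?N y - ?N x) ** M' ** ?N x) \<longlongrightarrow> 0) (at x)" by (simp add: mm.zero_left)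
  then have "((\<lambda>y. norm ((?N y - ?N x) ** M' ** ?N x)) \<longlongrightarrow> 0) (at x)" by (simp add: tendsto_norm_zero_iff)
  then have "((\<lambda>y. norm (((y - x) / norm (y - x)) *\<^sub>R ((?N y - ?N x) ** M' ** ?N x))) \<longlongrightarrow> 0) (at x)"
    by (rule Lim_transform_within[where d=1]) auto
  then have l2: "((\<lambda>y. ((y - x) / norm (y - x)) *\<^sub>R ((?N y - ?N x) ** M' ** ?N x)) \<longlongrightarrow> 0) (at x)"
    by (rule tendsto_norm_zero_cancel)
  have rem: "(?N y - ?N x - (y - x) *\<^sub>R (- ?D)) /\<^sub>R norm (y - x) =
      - (?N y ** ((M y - M x - (y - x) *\<^sub>R M') /\<^sub>R norm (y - x)) ** ?N x) -
      ((y - x) / norm (y - x)) *\<^sub>R ((?N y - ?N x) ** M' ** ?N x)" for y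
  proof -
    have "- (?N y ** (M y - M x - (y - x) *\<^sub>R M') ** ?N x) = (?N y - ?N x) + (y - x) *\<^sub>R (?N y ** M' ** ?N x)"
      unfolding eq by (simp add: mm.diff_left mm.diff_right mm.scaleR_left mm.scaleR_right)
    then have "?N y - ?N x - (y - x) *\<^sub>R (- ?D) = - (?N y ** (M y - M x - (y - x) *\<^sub>R M') ** ?N x) - (y - x) *\<^sub>R ((?N y - ?N x) ** M' ** ?N x)"
      by (simp add: mm.diff_left scaleR_diff_right)
    moreover have "(- u - c *\<^sub>R v) /\<^sub>R n = - (u /\<^sub>R n) - (c / n) *\<^sub>R v" for u v :: "'a^'n^'n" and c n :: real
      by (simp add: scaleR_diff_right divide_inverse mult.commute)
    moreover have "?N y ** (d /\<^sub>R n) ** ?N x = (?N y ** d ** ?N x) /\<^sub>R n" for d n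
      by (simp only: mm.scaleR_left mm.scaleR_right)
    ultimately show ?thesis by simp
  qed
  have "((\<lambda>y. (?N y - ?N x - (y - x) *\<^sub>R (- ?D)) /\<^sub>R norm (y - x)) \<longlongrightarrow> - 0 - 0) (at x)"
    unfolding rem by (intro tendsto_diff tendsto_minus l1 l2)
  then have "((\<lambda>y. (1 / norm (y - x)) *\<^sub>R (?N y - (?N x + (y - x) *\<^sub>R (- ?D)))) \<longlongrightarrow> 0) (at x)"
    by (simp only: diff_diff_eq divide_inverse mult_1_left minus_zero diff_zero)
  then show ?thesis
    unfolding has_vector_derivative_def has_derivative_within by (intro conjI bounded_linear_scaleR_left)
qed

text \<open>Variation of constants: \<open>y\<close> is \<open>\<Phi>\<close> applied to the
  integral of \<open>\<Phi>^(-1) r\<close>.\<close>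

lemma linear_ode_inhomogeneous:
  fixes A :: "real \<Rightarrow> 'a::{real_normed_field,euclidean_space}^'n^'n"
  assumes A: "continuous_on UNIV A" and \<Phi>0: "\<Phi> 0 = mat 1"
    and \<Phi>: "\<And>x. (\<Phi> has_vector_derivative A x ** \<Phi> x) (at x)" and r: "continuous_on {0..T} r"
  obtains y where "y 0 = 0"
    "\<And>x. x \<in> {0..T} \<Longrightarrow> (y has_vector_derivative A x *v y x + r x) (at x within {0..T})"
proof -
  have inv: "invertible (\<Phi> x)" for x by (rule fundamental_matrix_invertible[OF A \<Phi>0 \<Phi>])
  have c\<Phi>: "continuous_on S \<Phi>" for S
    using \<Phi> by (intro continuous_on_vector_derivative) (blast intro: has_vector_derivative_at_within)
  define g where "g x = matrix_inv (\<Phi> x) *v r x" for x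
  have cg: "continuous_on {0..T} g" unfolding g_def
    by (intro cont_mv continuous_on_matrix_inv c\<Phi> inv r)
  define y where "y x = \<Phi> x *v integral {0..x} g" for x
  show thesis
  proof (rule that)
    show "y 0 = 0" by (simp add: y_def)
    fix x assume x: "x \<in> {0..T}"
    have "((\<lambda>x. \<Phi> x *v integral {0..x} g) has_vector_derivative \<Phi> x *v g x + (A x ** \<Phi> x) *v integral {0..x} g) (at x within {0..T})"
      by (rule hvd_mv[OF has_vector_derivative_at_within[OF \<Phi>] integral_has_vector_derivative[OF cg x]])
    moreover have "\<Phi> x *v g x = r x"
      by (simp add: g_def matrix_vector_mul_assoc matrix_inv_mult[OF inv])
    ultimately show "(y has_vector_derivative A x *v y x + r x) (at x within {0..T})"
      by (simp add: y_def[abs_def] matrix_vector_mul_assoc add.commute)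
  qed
qed

text \<open>\<open>\<Theta>\<close> solves the equation differentiated in \<open>l\<close>. Gronwall
  is applied three times, to \<open>\<phi> l\<close>, to the first difference and to the remainder;
  the forcing of each is \<open>l E\<close> times the quantity estimated before, which gains one
  power of \<open>l\<close> every time.\<close>

lemma linear_ode_parameter:
  fixes A E :: "real \<Rightarrow> complex^'n^'n" and \<phi> :: "complex \<Rightarrow> real \<Rightarrow> complex^'n"
  assumes A: "continuous_on UNIV A" and E: "continuous_on UNIV E"
    and \<Phi>0: "\<Phi> 0 = mat 1" and \<Phi>: "\<And>x. (\<Phi> has_vector_derivative A x ** \<Phi> x) (at x)"
    and \<phi>: "\<And>l x. x \<in> {0..T} \<Longrightarrow> (\<phi> l has_vector_derivative A x *v \<phi> l x + l *s (E x *v \<phi> l x)) (at x within {0..T})"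
    and \<phi>0: "\<And>l. \<phi> l 0 = v"
  obtains C \<Theta> where "C \<ge> 0" "\<Theta> 0 = 0"
    "\<And>x. x \<in> {0..T} \<Longrightarrow> (\<Theta> has_vector_derivative A x *v \<Theta> x + E x *v \<phi> 0 x) (at x within {0..T})"
    "\<And>l x. norm l \<le> 1 \<Longrightarrow> x \<in> {0..T} \<Longrightarrow> norm (\<phi> l x - \<phi> 0 x) \<le> C * norm l"
    "\<And>l x. norm l \<le> 1 \<Longrightarrow> x \<in> {0..T} \<Longrightarrow> norm (\<phi> l x - \<phi> 0 x - l *s \<Theta> x) \<le> C * (norm l)\<^sup>2"
proof -
  interpret mv: bounded_bilinear "(*v) :: complex^'n^'n \<Rightarrow> complex^'n \<Rightarrow> complex^'n" by (rule bilinear_mv)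
  have ns: "norm (l *s (x::complex^'n)) = norm l * norm x" for l x
    by (simp add: norm_vec_def norm_mult L2_set_right_distrib)
  have sv: "((\<lambda>x. l *s f x) has_vector_derivative l *s f') F" if "(f has_vector_derivative f') F" for l F f' and f :: "real \<Rightarrow> complex^'n"
    by (rule has_vector_derivative_vec) (use has_vector_derivative_vec_nth[OF that] in \<open>auto intro!: derivative_eq_intros\<close>)
  obtain KA where KA: "KA \<ge> 0" "\<And>x v. x \<in> {0..T} \<Longrightarrow> norm (A x *v v) \<le> KA * norm v"
    by (rule bounded_mv_on_compact[OF continuous_on_subset[OF A subset_UNIV] compact_Icc]) blast
  obtain KE where KE: "KE \<ge> 0" "\<And>x v. x \<in> {0..T} \<Longrightarrow> norm (E x *v v) \<le> KE * norm v"
    by (rule bounded_mv_on_compact[OF continuous_on_subset[OF E subset_UNIV] compact_Icc]) blast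
  define G where "G = exp ((2 * (KA + KE) + 1) * T)"
  have c\<phi>: "continuous_on {0..T} (\<phi> 0)"
    using continuous_on_vector_derivative[OF \<phi>] by blast
  have b\<phi>: "norm (\<phi> l x) \<le> G * norm v" if l: "norm l \<le> 1" and x: "x \<in> {0..T}" for l x
  proof -
    have "norm (\<phi> l x) \<le> exp ((2 * (KA + KE) + 1) * T) * (norm v + 0)"
    proof (rule gronwall[OF \<phi> _ _ _ _ x])
      fix x assume x: "x \<in> {0..T}"
      have "norm (A x *v \<phi> l x + l *s (E x *v \<phi> l x)) \<le> norm (A x *v \<phi> l x) + norm l * norm (E x *v \<phi> l x)"
        by (metis norm_triangle_ineq ns)
      also have "\<dots> \<le> KA * norm (\<phi> l x) + 1 * (KE * norm (\<phi> l x))"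
        using KA(2)[OF x] KE(2)[OF x] l by (intro add_mono mult_mono) auto
      finally show "norm (A x *v \<phi> l x + l *s (E x *v \<phi> l x)) \<le> (KA + KE) * norm (\<phi> l x) + 0"
        by (simp add: algebra_simps)
    qed (use KA KE \<phi>0 in auto)
    then show ?thesis by (simp add: G_def)
  qed
  have G: "G \<ge> 0" by (simp add: G_def)
  have d\<phi>: "norm (\<phi> l x - \<phi> 0 x) \<le> G * (KE * (G * norm v)) * norm l" if l: "norm l \<le> 1" and x: "x \<in> {0..T}" for l x
  proof -
    have "norm (\<phi> l x - \<phi> 0 x) \<le> exp ((2 * (KA + KE) + 1) * T) * (0 + norm l * (KE * (G * norm v)))"
    proof (rule gronwall[OF has_vector_derivative_diff[OF \<phi> \<phi>] _ _ _ _ x])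
      fix x assume x: "x \<in> {0..T}"
      have "A x *v \<phi> l x + l *s (E x *v \<phi> l x) - (A x *v \<phi> 0 x + 0 *s (E x *v \<phi> 0 x)) =
          A x *v (\<phi> l x - \<phi> 0 x) + l *s (E x *v \<phi> l x)"
        by (simp add: mv.diff_right)
      also have "norm \<dots> \<le> norm (A x *v (\<phi> l x - \<phi> 0 x)) + norm l * norm (E x *v \<phi> l x)"
        by (metis norm_triangle_ineq ns)
      also have "\<dots> \<le> (KA + KE) * norm (\<phi> l x - \<phi> 0 x) + norm l * (KE * (G * norm v))"
      proof (rule add_mono)
        show "norm (A x *v (\<phi> l x - \<phi> 0 x)) \<le> (KA + KE) * norm (\<phi> l x - \<phi> 0 x)"
          using KA(2)[OF x, of "\<phi> l x - \<phi> 0 x"] mult_nonneg_nonneg[OF KE(1) norm_ge_zero[of "\<phi> l x - \<phi> 0 x"]]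
          unfolding distrib_right by linarith
        have "norm (E x *v \<phi> l x) \<le> KE * norm (\<phi> l x)" by (rule KE(2)[OF x])
        also have "\<dots> \<le> KE * (G * norm v)" by (rule mult_left_mono[OF b\<phi>[OF l x] KE(1)])
        finally show "norm l * norm (E x *v \<phi> l x) \<le> norm l * (KE * (G * norm v))" by (rule mult_left_mono) simp
      qed
      finally show "norm (A x *v \<phi> l x + l *s (E x *v \<phi> l x) - (A x *v \<phi> 0 x + 0 *s (E x *v \<phi> 0 x))) \<le>
          (KA + KE) * norm (\<phi> l x - \<phi> 0 x) + norm l * (KE * (G * norm v))" .
    qed (use KA KE G \<phi>0 in auto)
    then show ?thesis by (simp add: G_def algebra_simps)
  qed
  obtain \<Theta> where \<Theta>: "\<Theta> 0 = 0"
    "\<And>x. x \<in> {0..T} \<Longrightarrow> (\<Theta> has_vector_derivative A x *v \<Theta> x + E x *v \<phi> 0 x) (at x within {0..T})"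
    by (rule linear_ode_inhomogeneous[OF A \<Phi>0 \<Phi>, of T "\<lambda>x. E x *v \<phi> 0 x"])
       (auto intro!: cont_mv c\<phi> continuous_on_subset[OF E])
  define C where "C = G * (KE * (G * norm v))"
  have C: "C \<ge> 0" using G KE by (simp add: C_def)
  have e\<phi>: "norm (\<phi> l x - \<phi> 0 x - l *s \<Theta> x) \<le> G * (KE * C) * (norm l)\<^sup>2" if l: "norm l \<le> 1" and x: "x \<in> {0..T}" for l x
  proof -
    have "norm (\<phi> l x - \<phi> 0 x - l *s \<Theta> x) \<le> exp ((2 * (KA + KE) + 1) * T) * (0 + norm l * (KE * (C * norm l)))"
    proof (rule gronwall[OF has_vector_derivative_diff[OF has_vector_derivative_diff[OF \<phi> \<phi>] sv[OF \<Theta>(2)]] _ _ _ _ x])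
      fix x assume x: "x \<in> {0..T}"
      have "A x *v \<phi> l x + l *s (E x *v \<phi> l x) - (A x *v \<phi> 0 x + 0 *s (E x *v \<phi> 0 x)) - l *s (A x *v \<Theta> x + E x *v \<phi> 0 x) =
          A x *v (\<phi> l x - \<phi> 0 x - l *s \<Theta> x) + l *s (E x *v (\<phi> l x - \<phi> 0 x))"
        by (simp add: mv.diff_right vector_scalar_commute vector_ssub_ldistrib vector_add_ldistrib algebra_simps)
      also have "norm \<dots> \<le> norm (A x *v (\<phi> l x - \<phi> 0 x - l *s \<Theta> x)) + norm l * norm (E x *v (\<phi> l x - \<phi> 0 x))"
        by (metis norm_triangle_ineq ns)
      also have "\<dots> \<le> (KA + KE) * norm (\<phi> l x - \<phi> 0 x - l *s \<Theta> x) + norm l * (KE * (C * norm l))"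
      proof (rule add_mono)
        show "norm (A x *v (\<phi> l x - \<phi> 0 x - l *s \<Theta> x)) \<le> (KA + KE) * norm (\<phi> l x - \<phi> 0 x - l *s \<Theta> x)"
          using KA(2)[OF x, of "\<phi> l x - \<phi> 0 x - l *s \<Theta> x"] mult_nonneg_nonneg[OF KE(1) norm_ge_zero[of "\<phi> l x - \<phi> 0 x - l *s \<Theta> x"]]
          unfolding distrib_right by linarith
        have "norm (E x *v (\<phi> l x - \<phi> 0 x)) \<le> KE * norm (\<phi> l x - \<phi> 0 x)" by (rule KE(2)[OF x])
        also have "\<dots> \<le> KE * (C * norm l)"
          using d\<phi>[OF l x] by (intro mult_left_mono KE(1)) (simp add: C_def)
        finally show "norm l * norm (E x *v (\<phi> l x - \<phi> 0 x)) \<le> norm l * (KE * (C * norm l))" by (rule mult_left_mono) simp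
      qed
      finally show "norm (A x *v \<phi> l x + l *s (E x *v \<phi> l x) - (A x *v \<phi> 0 x + 0 *s (E x *v \<phi> 0 x)) - l *s (A x *v \<Theta> x + E x *v \<phi> 0 x)) \<le>
          (KA + KE) * norm (\<phi> l x - \<phi> 0 x - l *s \<Theta> x) + norm l * (KE * (C * norm l))" .
    qed (use KA KE C \<phi>0 \<Theta>(1) in auto)
    then show ?thesis by (simp add: G_def algebra_simps power2_eq_square)
  qed
  show thesis
  proof (rule that[of "max C (G * (KE * C))" \<Theta>])
    show "norm (\<phi> l x - \<phi> 0 x) \<le> max C (G * (KE * C)) * norm l" if "norm l \<le> 1" "x \<in> {0..T}" for l x
      by (rule order_trans[OF d\<phi>[OF that]]) (auto simp: C_def[symmetric] intro: mult_right_mono)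
    show "norm (\<phi> l x - \<phi> 0 x - l *s \<Theta> x) \<le> max C (G * (KE * C)) * (norm l)\<^sup>2" if "norm l \<le> 1" "x \<in> {0..T}" for l x
      by (rule order_trans[OF e\<phi>[OF that]]) (auto intro: mult_right_mono)
  qed (use C \<Theta> in auto)
qed


section \<open>Block matrices\<close>

text \<open>A nonzero term of the Leibniz sum must fix every index whose row is a unit row, so only
  permutations of \<open>range \<iota>\<close> remain, and these correspond to permutations of the
  smaller index type.\<close>

lemma det_unit_rows:
  fixes M :: "'a::comm_ring_1^'k^'k" and \<iota> :: "'n::finite \<Rightarrow> 'k"
  assumes \<iota>: "inj \<iota>" and unit: "\<And>x y. x \<notin> range \<iota> \<Longrightarrow> M $ x $ y = (if x = y then 1 else 0)"
  shows "det M = det (\<chi> i j. M $ \<iota> i $ \<iota> j)"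
proof -
  let ?t = "\<lambda>p. of_int (sign p) * (\<Prod>x\<in>UNIV. M $ x $ p x)"
  have bij: "bij_betw \<iota> UNIV (range \<iota>)" using \<iota> by (simp add: bij_betw_def)
  have bij': "bij_betw (inv \<iota>) (range \<iota>) UNIV" using bij_betw_inv_into[OF bij] by simp
  have "det M = (\<Sum>p | p permutes UNIV. ?t p)" by (simp add: det_def)
  also have "\<dots> = (\<Sum>p | p permutes range \<iota>. ?t p)"
  proof (rule sum.mono_neutral_right)
    show "finite {p. p permutes (UNIV::'k set)}" by (simp add: finite_permutations)
    show "{p. p permutes range \<iota>} \<subseteq> {p. p permutes (UNIV::'k set)}" by (auto intro: permutes_subset)
    show "\<forall>p\<in>{p. p permutes (UNIV::'k set)} - {p. p permutes range \<iota>}. ?t p = 0"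
    proof
      fix p assume p: "p \<in> {p. p permutes (UNIV::'k set)} - {p. p permutes range \<iota>}"
      then have "\<not> p permutes range \<iota>" "p permutes UNIV" by auto
      then obtain x where x: "x \<notin> range \<iota>" "p x \<noteq> x"
        using permutes_superset[of p UNIV "range \<iota>"] by auto
      then have "M $ x $ p x = 0" by (simp add: unit)
      then have "(\<Prod>x\<in>UNIV. M $ x $ p x) = 0" by (intro prod_zero) auto
      then show "?t p = 0" by simp
    qed
  qed
  also have "\<dots> = (\<Sum>p | p permutes (UNIV::'n set). of_int (sign p) * (\<Prod>i\<in>UNIV. (\<chi> i j. M $ \<iota> i $ \<iota> j) $ i $ p i))"
  proof (rule sum.reindex_bij_witness[of _ "map_permutation UNIV \<iota>" "map_permutation (range \<iota>) (inv \<iota>)"])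
    fix p assume "p \<in> {p. p permutes range \<iota>}"
    then have p: "p permutes range \<iota>" by simp
    let ?p = "map_permutation (range \<iota>) (inv \<iota>) p"
    show "map_permutation UNIV \<iota> ?p = p"
      by (rule map_permutation_compose_inv[OF bij' p]) (auto simp: f_inv_into_f)
    show "?p \<in> {p. p permutes UNIV}" using map_permutation_permutes[OF bij' p] by simp
    have s: "sign ?p = sign p"
      by (rule sign_map_permutation) (use bij' p in \<open>auto simp: bij_betw_def\<close>)
    have "(\<Prod>x\<in>UNIV. M $ x $ p x) = (\<Prod>x\<in>range \<iota>. M $ x $ p x)"
      using p by (intro prod.mono_neutral_right) (auto simp: unit permutes_not_in)
    also have "\<dots> = (\<Prod>i\<in>UNIV. M $ \<iota> i $ p (\<iota> i))" using \<iota> by (subst prod.reindex) auto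
    also have "\<dots> = (\<Prod>i\<in>UNIV. M $ \<iota> i $ \<iota> (?p i))"
    proof (rule prod.cong[OF refl])
      fix i
      have "?p (inv \<iota> (\<iota> i)) = inv \<iota> (p (\<iota> i))"
        by (rule map_permutation_apply) (use bij' in \<open>auto simp: bij_betw_def\<close>)
      moreover have "p (\<iota> i) \<in> range \<iota>" using p permutes_in_image[OF p, of "\<iota> i"] by simp
      ultimately show "M $ \<iota> i $ p (\<iota> i) = M $ \<iota> i $ \<iota> (?p i)" using \<iota> by (simp add: f_inv_into_f)
    qed
    finally show "of_int (sign ?p) * (\<Prod>i\<in>UNIV. (\<chi> i j. M $ \<iota> i $ \<iota> j) $ i $ ?p i) = of_int (sign p) * (\<Prod>x\<in>UNIV. M $ x $ p x)"
      by (simp add: s)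
  next
    fix p assume "p \<in> {p. p permutes (UNIV::'n set)}"
    then have p: "p permutes (UNIV::'n set)" by simp
    show "map_permutation (range \<iota>) (inv \<iota>) (map_permutation UNIV \<iota> p) = p"
      by (rule map_permutation_compose_inv[OF bij p]) (use \<iota> in auto)
    show "map_permutation UNIV \<iota> p \<in> {p. p permutes range \<iota>}" using map_permutation_permutes[OF bij p] by simp
  qed
  finally show ?thesis by (simp add: det_def)
qed

definition block :: "'a^'n^'n \<Rightarrow> 'a^'m^'n \<Rightarrow> 'a^'n^'m \<Rightarrow> 'a^'m^'m \<Rightarrow> 'a^('n+'m)^('n+'m)" where
  "block P Q R S = (\<chi> x y. case x of Inl i \<Rightarrow> (case y of Inl j \<Rightarrow> P $ i $ j | Inr j \<Rightarrow> Q $ i $ j)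
      | Inr i \<Rightarrow> (case y of Inl j \<Rightarrow> R $ i $ j | Inr j \<Rightarrow> S $ i $ j))"

lemma block_nth [simp]:
  "block P Q R S $ Inl i $ Inl j = P $ i $ j" "block P Q R S $ Inl i $ Inr j' = Q $ i $ j'"
  "block P Q R S $ Inr i' $ Inl j = R $ i' $ j" "block P Q R S $ Inr i' $ Inr j' = S $ i' $ j'"
  by (simp_all add: block_def)

lemma sum_UNIV_Plus:
  fixes g :: "'a::finite + 'b::finite \<Rightarrow> 'c::comm_monoid_add"
  shows "(\<Sum>x\<in>UNIV. g x) = (\<Sum>i\<in>UNIV. g (Inl i)) + (\<Sum>j\<in>UNIV. g (Inr j))"
  by (subst UNIV_Plus_UNIV[symmetric], subst sum.Plus) auto

lemma block_mult:
  fixes P :: "'a::semiring_1^'n^'n" and S :: "'a^'m^'m"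
  shows "block P Q R S ** block P' Q' R' S' = block (P ** P' + Q ** R') (P ** Q' + Q ** S') (R ** P' + S ** R') (R ** Q' + S ** S')"
proof -
  have "(block P Q R S ** block P' Q' R' S') $ x $ y = block (P ** P' + Q ** R') (P ** Q' + Q ** S') (R ** P' + S ** R') (R ** Q' + S ** S') $ x $ y" for x y
    by (cases x; cases y) (simp_all add: matrix_matrix_mult_def sum_UNIV_Plus)
  then show ?thesis by (simp add: vec_eq_iff)
qed

text \<open>Factoring through the block diagonal matrix of \<open>P\<close> and 1 leaves two
  matrices each with unit rows in one half.\<close>

lemma det_block_lower:
  fixes P :: "'a::field^'n^'n" and S :: "'a^'m^'m"
  shows "det (block P 0 R S) = det P * det S"
proof -
  have "block P 0 R S = block P 0 0 (mat 1) ** block (mat 1) 0 R S" by (simp add: block_mult)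
  moreover have "det (block P 0 0 (mat 1) :: 'a^('n+'m)^('n+'m)) = det P"
  proof -
    have "det (block P 0 0 (mat 1) :: 'a^('n+'m)^('n+'m)) = det (\<chi> i j. (block P 0 0 (mat 1) :: 'a^('n+'m)^('n+'m)) $ Inl i $ Inl j)"
    proof (rule det_unit_rows)
      fix x y :: "'n + 'm" assume "x \<notin> range Inl"
      then show "(block P 0 0 (mat 1) :: 'a^('n+'m)^('n+'m)) $ x $ y = (if x = y then 1 else 0)"
        by (cases x; cases y) (auto simp: mat_def)
    qed simp
    then show ?thesis by simp
  qed
  moreover have "det (block (mat 1) 0 R S :: 'a^('n+'m)^('n+'m)) = det S"
  proof -
    have "det (block (mat 1) 0 R S :: 'a^('n+'m)^('n+'m)) = det (\<chi> i j. (block (mat 1) 0 R S :: 'a^('n+'m)^('n+'m)) $ Inr i $ Inr j)"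
    proof (rule det_unit_rows)
      fix x y :: "'n + 'm" assume "x \<notin> range Inr"
      then show "(block (mat 1) 0 R S :: 'a^('n+'m)^('n+'m)) $ x $ y = (if x = y then 1 else 0)"
        by (cases x; cases y) (auto simp: mat_def)
    qed simp
    then show ?thesis by simp
  qed
  ultimately show ?thesis by (simp add: det_mul)
qed

lemma det_block_upper:
  fixes P :: "'a::field^'n^'n" and S :: "'a^'m^'m"
  shows "det (block P Q 0 S) = det P * det S"
proof -
  have "(transpose (block P Q 0 S)) $ x $ y = block (transpose P) 0 (transpose Q) (transpose S) $ x $ y" for x y
    by (cases x; cases y) (simp_all add: transpose_def)
  then have "transpose (block P Q 0 S) = block (transpose P) 0 (transpose Q) (transpose S)" by (simp add: vec_eq_iff)
  then have "det (block P Q 0 S) = det (block (transpose P) 0 (transpose Q) (transpose S))" by (metis det_transpose)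
  then show ?thesis by (simp add: det_block_lower det_transpose)
qed

section \<open>Complexification and vectors in two halves\<close>

definition cvec :: "real^'n \<Rightarrow> complex^'n" where "cvec v = (\<chi> i. complex_of_real (v $ i))"

lemma cmat_nth [simp]: "cmat M $ i $ j = of_real (M $ i $ j)" by (simp add: cmat_def)
lemma cvec_nth [simp]: "cvec v $ i = of_real (v $ i)" by (simp add: cvec_def)

lemma cmat_mult: "cmat (A ** B) = cmat A ** cmat B"
  by (simp add: vec_eq_iff matrix_matrix_mult_def)

lemma cmat_mv: "cmat A *v cvec v = cvec (A *v v)"
  by (simp add: vec_eq_iff matrix_vector_mult_def)

lemma cmat_mat: "cmat (mat a) = mat (of_real a)" by (simp add: vec_eq_iff mat_def)
lemma cmat_0: "cmat 0 = 0" by (simp add: vec_eq_iff)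
lemma cmat_diff: "cmat (A - B) = cmat A - cmat B" by (simp add: vec_eq_iff)
lemma cmat_minus: "cmat (- A) = - cmat A" by (simp add: vec_eq_iff)

lemma det_cmat: "det (cmat A) = of_real (det A)"
  by (simp add: det_def)

lemma hvd_of_real:
  "(g has_vector_derivative g') F \<Longrightarrow> ((\<lambda>x. complex_of_real (g x)) has_vector_derivative of_real g') F"
  by (rule bounded_linear.has_vector_derivative[OF bounded_linear_of_real])

lemma hvd_cvec: "(v has_vector_derivative v') F \<Longrightarrow> ((\<lambda>x. cvec (v x)) has_vector_derivative cvec v') F"
  by (intro has_vector_derivative_vec) (simp add: hvd_of_real has_vector_derivative_vec_nth)

lemma hvd_cmat: "(M has_vector_derivative M') F \<Longrightarrow> ((\<lambda>x. cmat (M x)) has_vector_derivative cmat M') F"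
  by (intro has_vector_derivative_vec) (simp add: hvd_of_real has_vector_derivative_vec_nth)

lemma continuous_on_cmat: "continuous_on S M \<Longrightarrow> continuous_on S (\<lambda>x. cmat (M x))"
  unfolding cmat_def by (intro continuous_intros)

definition vjoin :: "'a^'n \<Rightarrow> 'a^'m \<Rightarrow> 'a^('n+'m)" where
  "vjoin a b = (\<chi> x. case x of Inl i \<Rightarrow> a $ i | Inr j \<Rightarrow> b $ j)"

lemma vjoin_nth [simp]: "vjoin a b $ Inl i = a $ i" "vjoin a b $ Inr j = b $ j"
  by (simp_all add: vjoin_def)

lemma vec_sum_eq_iff: "(v :: 'a^('n::finite+'m::finite)) = w \<longleftrightarrow> (\<forall>i. v $ Inl i = w $ Inl i) \<and> (\<forall>j. v $ Inr j = w $ Inr j)"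
  unfolding vec_eq_iff by (rule split_sum_all)

lemma block_eq_iff: "(M :: 'a^('n::finite+'m::finite)^('n+'m)) = N \<longleftrightarrow>
   (\<forall>i j. M $ Inl i $ Inl j = N $ Inl i $ Inl j) \<and> (\<forall>i j. M $ Inl i $ Inr j = N $ Inl i $ Inr j) \<and>
   (\<forall>i j. M $ Inr i $ Inl j = N $ Inr i $ Inl j) \<and> (\<forall>i j. M $ Inr i $ Inr j = N $ Inr i $ Inr j)"
  unfolding vec_sum_eq_iff by blast

lemma vjoin_split: "(v :: 'a^('n::finite+'m::finite)) = vjoin (\<chi> i. v $ Inl i) (\<chi> j. v $ Inr j)"
  by (simp add: vec_sum_eq_iff)

lemma block_mv:
  fixes P :: "'a::semiring_1^'n^'n" and S :: "'a^'m^'m"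
  shows "block P Q R S *v vjoin a b = vjoin (P *v a + Q *v b) (R *v a + S *v b)"
  by (simp add: vec_sum_eq_iff matrix_vector_mult_def sum_UNIV_Plus)

lemma block_add: "block P Q R S + block P' Q' R' S' = block (P + P') (Q + Q') (R + R') (S + S')"
  by (simp add: block_eq_iff)

lemma cmat_block: "cmat (block P Q R S) = block (cmat P) (cmat Q) (cmat R) (cmat S)"
  by (simp add: block_eq_iff)

lemma cvec_vjoin: "cvec (vjoin a b) = vjoin (cvec a) (cvec b)"
  by (simp add: vec_sum_eq_iff)

lemma hvd_block:
  fixes P :: "real \<Rightarrow> 'a::real_normed_vector^'n^'n" and S :: "real \<Rightarrow> 'a^'m^'m"
  assumes "(P has_vector_derivative P') F" "(Q has_vector_derivative Q') F" "(R has_vector_derivative R') F" "(S has_vector_derivative S') F"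
  shows "((\<lambda>x. block (P x) (Q x) (R x) (S x)) has_vector_derivative block P' Q' R' S') F"
proof (intro has_vector_derivative_vec)
  fix i j
  show "((\<lambda>x. block (P x) (Q x) (R x) (S x) $ i $ j) has_vector_derivative block P' Q' R' S' $ i $ j) F"
    by (cases i; cases j) (simp_all add: assms has_vector_derivative_vec_nth)
qed

lemma hvd_vjoin:
  assumes "(a has_vector_derivative a') F" "(b has_vector_derivative b') F"
  shows "((\<lambda>x. vjoin (a x) (b x)) has_vector_derivative vjoin a' b') F"
proof (intro has_vector_derivative_vec)
  fix i show "((\<lambda>x. vjoin (a x) (b x) $ i) has_vector_derivative vjoin a' b' $ i) F"
    by (cases i) (simp_all add: assms has_vector_derivative_vec_nth)
qed

lemma continuous_on_block:
  fixes P :: "'c::topological_space \<Rightarrow> 'a::real_normed_vector^'n^'n" and S :: "'c \<Rightarrow> 'a^'m^'m"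
  assumes "continuous_on X P" "continuous_on X Q" "continuous_on X R" "continuous_on X S"
  shows "continuous_on X (\<lambda>x. block (P x) (Q x) (R x) (S x))"
proof -
  have "continuous_on X (\<lambda>x. block (P x) (Q x) (R x) (S x) $ i $ j)" for i j
    by (cases i; cases j) (simp_all add: assms continuous_on_component)
  then have "continuous_on X (\<lambda>x. \<chi> i j. block (P x) (Q x) (R x) (S x) $ i $ j)" by (intro continuous_on_vec_lambda)
  then show ?thesis by simp
qed

lemma mat_commute: "mat k ** (A :: 'a::comm_semiring_1^'n^'n) = A ** mat k"
  by (simp add: vec_eq_iff matrix_matrix_mult_def mat_def if_distrib if_distribR mult.commute cong: if_cong)

lemma mat_mult_left: "mat k ** (A :: 'a::semiring_1^'m^'n) = (\<chi> i j. k * A $ i $ j)"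
  by (simp add: vec_eq_iff matrix_matrix_mult_def mat_def if_distrib if_distribR cong: if_cong)

lemma mv_axis: "(M *v axis j 1) $ i = (M $ i $ j :: 'a::semiring_1)"
  by (simp add: matrix_vector_mult_def axis_def if_distrib cong: if_cong)

lemma mat_zero: "mat 0 = (0 :: 'a::zero^'n^'n)"
  by (simp add: vec_eq_iff mat_def)

lemma matrix_vector_mult_smult: "M *v (s *s v) = s *s (M *v (v :: 'a::comm_semiring_1^'n))"
  by (simp add: vec_eq_iff matrix_vector_mult_def sum_distrib_left mult_ac)

lemma mat_mv: "mat k *v (v :: 'a::semiring_1^'n) = k *s v"
  by (simp add: vec_eq_iff matrix_vector_mult_def mat_def if_distrib if_distribR cong: if_cong)

lemma has_field_derivative_quadratic:
  fixes g :: "complex \<Rightarrow> complex"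
  assumes est: "\<And>l. norm l \<le> 1 \<Longrightarrow> norm (g (l0 + l) - g l0 - l * D) \<le> C * (norm l)\<^sup>2"
  shows "(g has_field_derivative D) (at l0)"
proof -
  have "((\<lambda>l. (g (l0 + l) - g l0) / l) \<longlongrightarrow> D) (at 0)"
  proof (rule LIM_zero_cancel, rule Lim_null_comparison)
    show "((\<lambda>l. C * norm l) \<longlongrightarrow> 0) (at (0::complex))" by (auto intro!: tendsto_eq_intros)
    have "norm ((g (l0 + l) - g l0) / l - D) \<le> C * norm l" if "l \<noteq> 0" "norm l < 1" for l
    proof -
      have "(g (l0 + l) - g l0) / l - D = (g (l0 + l) - g l0 - l * D) / l"
        using that by (simp add: field_simps)
      then have "norm ((g (l0 + l) - g l0) / l - D) \<le> C * (norm l)\<^sup>2 / norm l"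
        using est[of l] that by (simp add: norm_divide divide_right_mono)
      then show ?thesis using that by (simp add: power2_eq_square)
    qed
    then show "\<forall>\<^sub>F l in at 0. norm ((g (l0 + l) - g l0) / l - D) \<le> C * norm l"
      unfolding eventually_at by (intro exI[of _ 1]) auto
  qed
  then show ?thesis by (simp add: DERIV_def)
qed

section \<open>Products in separated variables\<close>

definition separable :: "(complex \<Rightarrow> complex \<Rightarrow> complex) \<Rightarrow> bool" where
  "separable F \<longleftrightarrow> (\<exists>K a b. (\<forall>i. a i holomorphic_on UNIV) \<and> (\<forall>i. b i holomorphic_on UNIV) \<and>
     (\<forall>w z. F w z = (\<Sum>i<(K::nat). a i w * b i z)))"

lemma separable_prod_single:
  assumes "a holomorphic_on UNIV" "b holomorphic_on UNIV"
  shows "separable (\<lambda>w z. a w * b z)"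
  unfolding separable_def
  by (rule exI[of _ 1], rule exI[of _ "\<lambda>_. a"], rule exI[of _ "\<lambda>_. b"]) (use assms in auto)

lemma separable_add:
  assumes "separable F" "separable G"
  shows "separable (\<lambda>w z. F w z + G w z)"
proof -
  obtain K a b where F: "\<And>i. a i holomorphic_on UNIV" "\<And>i. b i holomorphic_on UNIV" "\<And>w z. F w z = (\<Sum>i<(K::nat). a i w * b i z)"
    using assms(1) unfolding separable_def by metis
  obtain L c d where G: "\<And>i. c i holomorphic_on UNIV" "\<And>i. d i holomorphic_on UNIV" "\<And>w z. G w z = (\<Sum>i<(L::nat). c i w * d i z)"
    using assms(2) unfolding separable_def by metis
  have "F w z + G w z = (\<Sum>i<K + L. (if i < K then a i else c (i - K)) w * (if i < K then b i else d (i - K)) z)" for w z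
  proof -
    have "(\<Sum>i<K + L. (if i < K then a i else c (i - K)) w * (if i < K then b i else d (i - K)) z) =
      (\<Sum>i<K. (if i < K then a i else c (i - K)) w * (if i < K then b i else d (i - K)) z) +
      (\<Sum>i<L. (if K + i < K then a (K + i) else c (K + i - K)) w * (if K + i < K then b (K + i) else d (K + i - K)) z)"
      by (induction L) (simp_all add: algebra_simps)
    then show ?thesis by (simp add: F(3) G(3))
  qed
  moreover have "(if i < K then a i else c (i - K)) holomorphic_on UNIV" "(if i < K then b i else d (i - K)) holomorphic_on UNIV" for i
    using F G by auto
  ultimately show ?thesis unfolding separable_def
    by (intro exI[of _ "K + L"] exI[of _ "\<lambda>i. if i < K then a i else c (i - K)"] exI[of _ "\<lambda>i. if i < K then b i else d (i - K)"]) blast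
qed

lemma separable_sum:
  assumes "finite A" "\<And>i. i \<in> A \<Longrightarrow> separable (F i)"
  shows "separable (\<lambda>w z. \<Sum>i\<in>A. F i w z)"
  using assms
proof (induction A rule: finite_induct)
  case empty
  show ?case using separable_prod_single[of "\<lambda>_. 0" "\<lambda>_. 0"] by simp
next
  case (insert x A)
  then have "separable (\<lambda>w z. F x w z + (\<Sum>i\<in>A. F i w z))" by (intro separable_add) auto
  then show ?case using insert.hyps by simp
qed

lemma separable_mult:
  assumes "separable F" "separable G"
  shows "separable (\<lambda>w z. F w z * G w z)"
proof -
  obtain K a b where F: "\<And>i. a i holomorphic_on UNIV" "\<And>i. b i holomorphic_on UNIV" "\<And>w z. F w z = (\<Sum>i<(K::nat). a i w * b i z)"
    using assms(1) unfolding separable_def by metis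
  obtain L c d where G: "\<And>i. c i holomorphic_on UNIV" "\<And>i. d i holomorphic_on UNIV" "\<And>w z. G w z = (\<Sum>i<(L::nat). c i w * d i z)"
    using assms(2) unfolding separable_def by metis
  have "separable (\<lambda>w z. \<Sum>i<K. \<Sum>j<L. (a i w * c j w) * (b i z * d j z))"
    by (intro separable_sum separable_prod_single holomorphic_intros F G) auto
  moreover have "F w z * G w z = (\<Sum>i<K. \<Sum>j<L. (a i w * c j w) * (b i z * d j z))" for w z
    by (simp add: F(3) G(3) sum_product mult_ac)
  ultimately show ?thesis by simp
qed

lemma separable_prod:
  assumes "finite A" "\<And>i. i \<in> A \<Longrightarrow> separable (F i)"
  shows "separable (\<lambda>w z. \<Prod>i\<in>A. F i w z)"
  using assms
proof (induction A rule: finite_induct)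
  case empty
  show ?case using separable_prod_single[of "\<lambda>_. 1" "\<lambda>_. 1"] by simp
next
  case (insert x A)
  then have "separable (\<lambda>w z. F x w z * (\<Prod>i\<in>A. F i w z))" by (intro separable_mult) auto
  then show ?case using insert.hyps by simp
qed

text \<open>Each entry is a function of \<open>z\<close> plus a function of \<open>w\<close>, and
  sums and products preserve separability, so the Leibniz formula does too.\<close>

lemma separable_det:
  assumes \<kappa>: "\<kappa> holomorphic_on UNIV" and M: "\<And>i j. (\<lambda>z. M z $ i $ j) holomorphic_on UNIV"
  shows "separable (\<lambda>w z. det (M z - mat (\<kappa> w) :: complex^'m^'m))"
proof -
  have e: "separable (\<lambda>w z. M z $ i $ j - mat (\<kappa> w) $ i $ j)" for i j
  proof -
    have "(\<lambda>w. if i = j then - \<kappa> w else 0) holomorphic_on UNIV"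
      using \<kappa> by (cases "i = j") (auto intro!: holomorphic_intros)
    then have "separable (\<lambda>w z. 1 * M z $ i $ j + (if i = j then - \<kappa> w else 0) * 1)"
      using \<kappa> M by (intro separable_add separable_prod_single) (auto intro!: holomorphic_intros)
    then show ?thesis by (simp add: mat_def cong: if_cong) (cases "i = j"; simp)
  qed
  have "separable (\<lambda>w z. \<Sum>p | p permutes UNIV. (of_int (sign p) * 1) * (\<Prod>i\<in>UNIV. M z $ i $ p i - mat (\<kappa> w) $ i $ p i))"
    by (intro separable_sum separable_mult separable_prod separable_prod_single e) (auto simp: finite_permutations)
  then show ?thesis by (simp add: det_def)
qed

section \<open>The linearization about a periodic wave\<close>

locale wave =
  fixes f :: "real^'n \<Rightarrow> real^'n" and B :: "real^'n \<Rightarrow> real^'n^'n" and ubar :: "real \<Rightarrow> real^'n"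
    and um :: "real^'n" and T :: real
    and f' :: "real^'n \<Rightarrow> (real^'n) \<Rightarrow>\<^sub>L (real^'n)" and f'' :: "real^'n \<Rightarrow> (real^'n) \<Rightarrow>\<^sub>L (real^'n) \<Rightarrow>\<^sub>L (real^'n)"
    and B' :: "real^'n \<Rightarrow> (real^'n) \<Rightarrow>\<^sub>L (real^'n^'n)" and B'' :: "real^'n \<Rightarrow> (real^'n) \<Rightarrow>\<^sub>L (real^'n) \<Rightarrow>\<^sub>L (real^'n^'n)"
  assumes T_pos: "T > 0"
    and wave: "tw_solution f B um 0 UNIV ubar"
    and periodic: "\<And>x. ubar (x + T) = ubar x"
    and f': "\<And>u. (f has_derivative blinfun_apply (f' u)) (at u)"
    and f'': "\<And>u. (f' has_derivative blinfun_apply (f'' u)) (at u)" and f''_cont: "continuous_on UNIV f''"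
    and B': "\<And>u. (B has_derivative blinfun_apply (B' u)) (at u)"
    and B'': "\<And>u. (B' has_derivative blinfun_apply (B'' u)) (at u)" and B''_cont: "continuous_on UNIV B''"
    and pos: "\<And>x z. z \<in> mat_spectrum (cmat (B (ubar x))) \<Longrightarrow> Re z > 0"
begin

text \<open>\<open>du\<close> and \<open>ddu\<close> are the first two derivatives of the wave,
  \<open>dB\<close> and \<open>dA\<close> those of the coefficients along it. They are explicit
  formulas in the first and second derivatives of \<open>f\<close> and \<open>B\<close>, so that
  continuity can be read off under the \<open>C2\<close> hypothesis.\<close>

definition "Bx x = B (ubar x)"
definition "Bi x = matrix_inv (Bx x)"
definition "du x = Bi x *v (f (ubar x) - f um)"
definition "dB x = blinfun_apply (B' (ubar x)) (du x)"
definition "ddu x = Bi x *v blinfun_apply (f' (ubar x)) (du x) + (- (Bi x ** dB x ** Bi x)) *v (f (ubar x) - f um)"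
definition "A x = lin_A f B ubar x"
definition "dA x = (\<chi> i j. (blinfun_apply (blinfun_apply (f'' (ubar x)) (du x)) (axis j 1) -
    (blinfun_apply (blinfun_apply (B'' (ubar x)) (du x)) (axis j 1) *v du x + blinfun_apply (B' (ubar x)) (axis j 1) *v ddu x)) $ i)"

lemma inv_B: "invertible (Bx x)"
proof -
  have "v = 0" if "cmat (Bx x) *v v = 0" for v
  proof (rule ccontr)
    assume "v \<noteq> 0"
    then have "0 \<in> mat_spectrum (cmat (B (ubar x)))" using that by (auto simp: mat_spectrum_def Bx_def)
    from pos[OF this] show False by simp
  qed
  then have "invertible (cmat (Bx x))"
    unfolding invertible_left_inverse matrix_left_invertible_ker by blast
  then show ?thesis by (simp add: invertible_det_nz det_cmat)
qed

lemma Bi_mult: "Bx x ** Bi x = mat 1" "Bi x ** Bx x = mat 1"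
  using matrix_inv_mult[OF inv_B] by (simp_all add: Bi_def)

lemma Bi_Bx_v: "Bx x *v (Bi x *v v) = v" "Bi x *v (Bx x *v v) = v"
  by (simp_all add: matrix_vector_mul_assoc Bi_mult)

lemma Bx_du: "Bx x *v du x = f (ubar x) - f um"
  by (simp add: du_def Bi_Bx_v)

lemma ubar_deriv: "(ubar has_vector_derivative du x) (at x)"
proof -
  obtain v where v: "(ubar has_vector_derivative v) (at x)" "B (ubar x) *v v = f (ubar x) - f um"
    using wave unfolding tw_solution_def by auto
  have "v = Bi x *v (Bx x *v v)" by (simp add: Bi_Bx_v)
  also have "\<dots> = du x" using v(2) by (simp add: Bx_def du_def)
  finally show ?thesis using v(1) by simp
qed

lemma comp_deriv:
  assumes "\<And>u. (g has_derivative blinfun_apply (g' u)) (at u)"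
  shows "((\<lambda>x. g (ubar x)) has_vector_derivative blinfun_apply (g' (ubar x)) (du x)) (at x)"
  using vector_derivative_diff_chain_within[OF ubar_deriv has_derivative_at_withinI[OF assms], of x]
  by (simp add: o_def)

lemma cont_ubar: "continuous_on S ubar"
  by (rule continuous_on_vector_derivative) (blast intro: ubar_deriv has_vector_derivative_at_within)

lemma cont_comp:
  fixes g :: "real^'n \<Rightarrow> 'b::real_normed_vector"
  assumes "\<And>u. (g has_derivative g' u) (at u)"
  shows "continuous_on S (\<lambda>x. g (ubar x))"
proof -
  have "continuous_on UNIV g" using assms has_derivative_continuous_on[of UNIV g g'] by (simp add: has_derivative_at_withinI)
  then show ?thesis by (rule continuous_on_compose2[OF _ cont_ubar]) simp
qed

lemma Bx_deriv: "(Bx has_vector_derivative dB x) (at x)"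
  unfolding Bx_def[abs_def] dB_def by (rule comp_deriv[OF B'])

lemma cont_Bx: "continuous_on S Bx" unfolding Bx_def[abs_def] by (rule cont_comp[OF B'])

lemma cont_Bi: "continuous_on S Bi"
  unfolding Bi_def[abs_def] by (intro continuous_on_matrix_inv cont_Bx inv_B)

lemma Bi_deriv: "(Bi has_vector_derivative - (Bi x ** dB x ** Bi x)) (at x)"
  unfolding Bi_def[abs_def] by (rule has_vector_derivative_matrix_inv[OF Bx_deriv cont_Bx inv_B])

lemma cont_du: "continuous_on S du"
  unfolding du_def[abs_def] by (intro cont_mv cont_Bi continuous_intros cont_comp[OF f'])

lemma cont_blinfun2:
  assumes "continuous_on S g" "continuous_on S v"
  shows "continuous_on S (\<lambda>x. blinfun_apply (g x) (v x))"
  by (rule bounded_bilinear.continuous_on[OF bounded_bilinear_blinfun_apply assms])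

lemma cont_dB: "continuous_on S dB"
  unfolding dB_def[abs_def] by (intro cont_blinfun2 cont_du cont_comp[OF B''])

lemma cont_ddu: "continuous_on S ddu"
  unfolding ddu_def[abs_def]
  by (intro continuous_intros cont_mv cont_mm cont_Bi cont_dB cont_blinfun2 cont_du cont_comp[OF f''] cont_comp[OF f'])

lemma du_deriv: "(du has_vector_derivative ddu x) (at x)"
proof -
  have "((\<lambda>x. Bi x *v (f (ubar x) - f um)) has_vector_derivative
     Bi x *v (blinfun_apply (f' (ubar x)) (du x) - 0) + (- (Bi x ** dB x ** Bi x)) *v (f (ubar x) - f um)) (at x)"
    by (intro hvd_mv Bi_deriv has_vector_derivative_diff comp_deriv[OF f'] has_vector_derivative_const)
  then show ?thesis by (simp add: du_def[abs_def] ddu_def)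
qed

lemma vd_ubar: "vector_derivative ubar (at x) = du x"
  by (rule vector_derivative_at[OF ubar_deriv])

lemma A_apply: "A x *v w = blinfun_apply (f' (ubar x)) w - blinfun_apply (B' (ubar x)) w *v du x"
proof -
  interpret mv: bounded_bilinear "(*v) :: real^'n^'n \<Rightarrow> real^'n \<Rightarrow> real^'n" by (rule bilinear_mv)
  have "linear (\<lambda>v. blinfun_apply (f' (ubar x)) v - blinfun_apply (B' (ubar x)) v *v du x)"
    by (rule linearI) (simp_all add: blinfun.add_right blinfun.scaleR_right mv.add_left mv.scaleR_left scaleR_diff_right)
  moreover have "frechet_derivative f (at u) = blinfun_apply (f' u)" "frechet_derivative B (at u) = blinfun_apply (B' u)" for u
    using frechet_derivative_at[OF f'] frechet_derivative_at[OF B'] by auto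
  ultimately show ?thesis by (simp add: A_def lin_A_def vd_ubar matrix_works)
qed

lemma A_nth: "A x $ i $ j = (blinfun_apply (f' (ubar x)) (axis j 1) - blinfun_apply (B' (ubar x)) (axis j 1) *v du x) $ i"
  unfolding A_apply[symmetric] by (simp add: matrix_vector_mult_def axis_def if_distrib cong: if_cong)

lemma A_deriv: "(A has_vector_derivative dA x) (at x)"
proof (intro has_vector_derivative_vec)
  fix i j
  have ap: "((\<lambda>x. blinfun_apply (g x) v) has_vector_derivative blinfun_apply g' v) (at x)"
    if "(g has_vector_derivative g') (at x)" for g g' v
    by (rule bounded_linear.has_vector_derivative[OF bounded_bilinear.bounded_linear_left[OF bounded_bilinear_blinfun_apply] that])
  have "((\<lambda>x. blinfun_apply (f' (ubar x)) (axis j 1) - blinfun_apply (B' (ubar x)) (axis j 1) *v du x) has_vector_derivative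
     blinfun_apply (blinfun_apply (f'' (ubar x)) (du x)) (axis j 1) -
      (blinfun_apply (B' (ubar x)) (axis j 1) *v ddu x + blinfun_apply (blinfun_apply (B'' (ubar x)) (du x)) (axis j 1) *v du x)) (at x)"
    by (intro has_vector_derivative_diff hvd_mv ap comp_deriv[OF f''] comp_deriv[OF B''] du_deriv)
  from has_vector_derivative_vec_nth[OF this, of i]
  show "((\<lambda>x. A x $ i $ j) has_vector_derivative dA x $ i $ j) (at x)"
    by (simp add: A_nth dA_def add.commute)
qed

lemma cont_A: "continuous_on S A"
  by (rule continuous_on_vector_derivative) (blast intro: A_deriv has_vector_derivative_at_within)

lemma cont_comp0:
  fixes g :: "real^'n \<Rightarrow> 'b::real_normed_vector"
  shows "continuous_on UNIV g \<Longrightarrow> continuous_on S (\<lambda>x. g (ubar x))"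
  by (rule continuous_on_compose2[OF _ cont_ubar]) auto

lemma cont_dA: "continuous_on S dA"
  unfolding dA_def[abs_def]
  by (intro continuous_intros cont_mv cont_blinfun2 cont_comp0 f''_cont B''_cont cont_du cont_ddu cont_comp[OF B''])

text \<open>The profile equation differentiated in \<open>x\<close>. It says that the translation
  mode \<open>ubar'\<close> has zero flux \<open>B w' - A w\<close>.\<close>

lemma du_eq: "Bx x *v ddu x = A x *v du x"
proof -
  have "((\<lambda>x. Bx x *v du x) has_vector_derivative Bx x *v ddu x + dB x *v du x) (at x)"
    by (intro hvd_mv Bx_deriv du_deriv)
  moreover have "((\<lambda>x. f (ubar x) - f um) has_vector_derivative blinfun_apply (f' (ubar x)) (du x) - 0) (at x)"
    by (intro has_vector_derivative_diff comp_deriv[OF f'] has_vector_derivative_const)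
  ultimately have "Bx x *v ddu x + dB x *v du x = blinfun_apply (f' (ubar x)) (du x) - 0"
    unfolding Bx_du by (rule vector_derivative_unique_at)
  then show ?thesis by (simp add: A_apply dB_def algebra_simps)
qed

lemma ddu_eq: "ddu x = Bi x *v (A x *v du x)"
  by (simp add: du_eq[symmetric] Bi_Bx_v)

lemma periodic_coeff: "Bx (x + T) = Bx x" "Bi (x + T) = Bi x" "du (x + T) = du x" "A (x + T) = A x"
proof -
  show 1: "Bx (x + T) = Bx x" by (simp add: Bx_def periodic)
  then show 2: "Bi (x + T) = Bi x" by (simp add: Bi_def)
  then show 3: "du (x + T) = du x" by (simp add: du_def periodic)
  show "A (x + T) = A x" by (simp add: A_def lin_A_def vd_ubar periodic 3)
qed

text \<open>The coefficient matrix for the unknowns \<open>w\<close> and \<open>y = B w' - A w\<close>. In these coordinates the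
  eigenvalue equation reads \<open>w' = B\<^sup>-\<^sup>1 (A w + y)\<close>, \<open>y' = \<lambda> w\<close>, so that at \<open>\<lambda> = 0\<close> the second
  component is a constant of motion.\<close>
definition "CF l x = block (cmat (Bi x) ** cmat (A x)) (cmat (Bi x)) (mat l) 0"

lemma cont_CF: "continuous_on S (CF l)"
  unfolding CF_def[abs_def]
  by (intro continuous_on_block cont_mm continuous_on_cmat cont_Bi cont_A continuous_intros)

lemma CF_periodic: "CF l (x + T) = CF l x" by (simp add: CF_def periodic_coeff)

end

section \<open>The fundamental solution in flux coordinates\<close>

locale wave_evans = wave f B ubar um T f' f'' B' B''
  for f :: "real^'n \<Rightarrow> real^'n" and B ubar um T f' f'' B' B'' +
  fixes \<Psi> :: "real \<Rightarrow> complex \<Rightarrow> complex^('n+'n)^('n+'n)"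
  assumes Psi: "fundamental_solution (evans_matrix (lin_B B ubar) (lin_A f B ubar)) \<Psi>"
begin

lemma evans_block: "evans_matrix (lin_B B ubar) (lin_A f B ubar) l x =
   block 0 (mat 1) (cmat (Bi x) ** (mat l + cmat (dA x))) (cmat (Bi x) ** cmat (A x - dB x))"
proof -
  have 1: "lin_B B ubar = Bx" by (simp add: lin_B_def Bx_def fun_eq_iff)
  have 2: "lin_A f B ubar = A" by (simp add: A_def fun_eq_iff)
  show ?thesis
    unfolding 1 2 by (simp add: block_eq_iff evans_matrix_def Let_def mat_def vector_derivative_at[OF A_deriv] vector_derivative_at[OF Bx_deriv] Bi_def)
qed

text \<open>The change of unknowns from \<open>(w, w')\<close> to
  \<open>(w, B w' - A w)\<close>.\<close>

definition "Sm x = block (mat 1) 0 (- cmat (A x)) (cmat (Bx x))"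
definition "\<Phi> l x = Sm x ** \<Psi> x l ** matrix_inv (Sm 0)"

lemma inv_Sm: "invertible (Sm x)"
  using inv_B[of x] by (simp add: Sm_def invertible_det_nz det_block_lower det_cmat)

lemma \<Phi>_0: "\<Phi> l 0 = mat 1"
  using Psi by (simp add: \<Phi>_def fundamental_solution_def matrix_inv_mult[OF inv_Sm])

lemma \<Phi>_deriv: "(\<Phi> l has_vector_derivative CF l x ** \<Phi> l x) (at x)"
proof -
  interpret mm: bounded_bilinear "(**) :: complex^'n^'n \<Rightarrow> complex^'n^'n \<Rightarrow> complex^'n^'n" by (rule bilinear_mm)
  interpret mM: bounded_bilinear "(**) :: complex^('n+'n)^('n+'n) \<Rightarrow> complex^('n+'n)^('n+'n) \<Rightarrow> complex^('n+'n)^('n+'n)" by (rule bilinear_mm)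
  let ?E = "evans_matrix (lin_B B ubar) (lin_A f B ubar) l x"
  let ?S' = "block 0 0 (- cmat (dA x)) (cmat (dB x))"
  have S: "(Sm has_vector_derivative ?S') (at x)"
    unfolding Sm_def[abs_def]
    by (intro hvd_block has_vector_derivative_const has_vector_derivative_minus hvd_cmat A_deriv Bx_deriv)
  have P: "((\<lambda>y. \<Psi> y l) has_vector_derivative ?E ** \<Psi> x l) (at x)"
    using Psi by (simp add: fundamental_solution_def)
  have cB: "cmat (Bx x) ** cmat (Bi x) = mat 1" "cmat (Bi x) ** cmat (Bx x) = mat 1"
    by (simp_all add: cmat_mult[symmetric] Bi_mult cmat_mat)
  have cB': "cmat (Bx x) ** (cmat (Bi x) ** M) = M" for M :: "complex^'n^'n"
    by (simp add: matrix_mul_assoc cB)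
  \<comment> \<open>The gauge identity for the change of unknowns: the terms with \<open>A'\<close>
    and \<open>B'\<close> in the Evans matrix are produced by differentiating the flux, and here
    they cancel.\<close>
  have id: "?S' + Sm x ** ?E = CF l x ** Sm x"
    unfolding evans_block Sm_def CF_def block_mult block_add
    by (simp add: cB' cB mm.minus_left mm.minus_right mm.add_left mm.add_right mm.diff_right cmat_diff matrix_mul_assoc[symmetric])
  have "((\<lambda>y. Sm y ** \<Psi> y l ** matrix_inv (Sm 0)) has_vector_derivative
     (Sm x ** \<Psi> x l) ** 0 + (Sm x ** (?E ** \<Psi> x l) + ?S' ** \<Psi> x l) ** matrix_inv (Sm 0)) (at x)"
    by (intro hvd_mm S P has_vector_derivative_const)
  moreover have "(Sm x ** \<Psi> x l) ** 0 + (Sm x ** (?E ** \<Psi> x l) + ?S' ** \<Psi> x l) ** matrix_inv (Sm 0) = (?S' + Sm x ** ?E) ** \<Psi> x l ** matrix_inv (Sm 0)"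
    by (simp add: mM.add_left matrix_mul_assoc add.commute)
  ultimately show ?thesis
    by (simp add: \<Phi>_def[abs_def] id matrix_mul_assoc)
qed

lemma \<Phi>_mv_deriv: "((\<lambda>x. \<Phi> l x *v v) has_vector_derivative CF l x *v (\<Phi> l x *v v)) (at x)"
  using hvd_mv[OF \<Phi>_deriv[of l x] has_vector_derivative_const[of v]] by (simp add: matrix_vector_mul_assoc)

lemma \<Phi>_floquet:
  assumes v: "\<Phi> l T *v v = \<kappa> *s v"
  shows "\<Phi> l (x + T) *v v = \<kappa> *s (\<Phi> l x *v v)"
proof -
  let ?h = "\<lambda>x. \<Phi> l (x + T) *v v - \<kappa> *s (\<Phi> l x *v v)"
  have d: "(?h has_vector_derivative CF l x *v ?h x) (at x)" for x
  proof -
    have "((\<lambda>x. x + T) has_vector_derivative 1) (at x)"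
      by (auto intro!: derivative_eq_intros simp: has_vector_derivative_def)
    from vector_diff_chain_at[OF this \<Phi>_mv_deriv[of l v "x + T"]]
    have 1: "((\<lambda>x. \<Phi> l (x + T) *v v) has_vector_derivative CF l (x + T) *v (\<Phi> l (x + T) *v v)) (at x)" by (simp add: o_def)
    have 2: "((\<lambda>x. \<kappa> *s (\<Phi> l x *v v)) has_vector_derivative \<kappa> *s (CF l x *v (\<Phi> l x *v v))) (at x)"
      using hvd_mv[OF has_vector_derivative_const[of "mat \<kappa>"] \<Phi>_mv_deriv[of l v x]] by (simp add: mat_mv)
    show ?thesis
      using has_vector_derivative_diff[OF 1 2]
      by (simp add: CF_periodic matrix_vector_mult_diff_distrib matrix_vector_mult_smult)
  qed
  have h0: "?h 0 = 0" using v by (simp add: \<Phi>_0)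
  have "?h x = 0" by (rule linear_ode_unique[of "CF l" ?h 0 x, OF cont_CF d h0])
  then show ?thesis by simp
qed

text \<open>\<open>Sm\<close> is \<open>T\<close>-periodic, so over one period the change of
  unknowns is a conjugation of the monodromy matrix and commutes with subtracting a scalar
  matrix.\<close>

lemma evans_eq: "evans_function \<Psi> T k l = det (\<Phi> l T - mat (exp (\<i> * of_real k * of_real T)))"
proof -
  interpret mM: bounded_bilinear "(**) :: complex^('n+'n)^('n+'n) \<Rightarrow> complex^('n+'n)^('n+'n) \<Rightarrow> complex^('n+'n)^('n+'n)" by (rule bilinear_mm)
  let ?k = "exp (\<i> * of_real k * of_real T)"
  have "Sm T = Sm 0" using periodic_coeff[of 0] by (simp add: Sm_def)
  then have "\<Phi> l T - mat ?k = Sm 0 ** (\<Psi> T l - mat ?k) ** matrix_inv (Sm 0)"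
    by (simp add: \<Phi>_def mM.diff_left mM.diff_right mat_commute[symmetric])
       (simp add: matrix_mul_assoc[symmetric] matrix_inv_mult[OF inv_Sm])
  then have "det (\<Phi> l T - mat ?k) = det (\<Psi> T l - mat ?k) * det (Sm 0 ** matrix_inv (Sm 0))"
    by (simp add: det_mul mult_ac)
  then show ?thesis by (simp add: evans_function_def matrix_inv_mult[OF inv_Sm])
qed

lemma CF_shift: "CF (l0 + l) x *v v = CF l0 x *v v + l *s (block 0 0 (mat 1) 0 *v v)"
  by (subst (1 2 3) vjoin_split[of v]) (simp add: CF_def block_mv vec_sum_eq_iff mat_mv algebra_simps)

lemma \<Phi>_parameter:
  obtains C \<Theta> where "C \<ge> 0" "\<Theta> 0 = 0"
    "\<And>x. x \<in> {0..T} \<Longrightarrow> (\<Theta> has_vector_derivative CF l0 x *v \<Theta> x + block 0 0 (mat 1) 0 *v (\<Phi> l0 x *v v)) (at x within {0..T})"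
    "\<And>l x. norm l \<le> 1 \<Longrightarrow> x \<in> {0..T} \<Longrightarrow> norm (\<Phi> (l0 + l) x *v v - \<Phi> l0 x *v v) \<le> C * norm l"
    "\<And>l x. norm l \<le> 1 \<Longrightarrow> x \<in> {0..T} \<Longrightarrow> norm (\<Phi> (l0 + l) x *v v - \<Phi> l0 x *v v - l *s \<Theta> x) \<le> C * (norm l)\<^sup>2"
proof -
  have d: "((\<lambda>x. \<Phi> (l0 + l) x *v v) has_vector_derivative CF l0 x *v (\<Phi> (l0 + l) x *v v) + l *s (block 0 0 (mat 1) 0 *v (\<Phi> (l0 + l) x *v v))) (at x within {0..T})" for l x
  proof -
    have "((\<lambda>x. \<Phi> (l0 + l) x *v v) has_vector_derivative CF (l0 + l) x *v (\<Phi> (l0 + l) x *v v)) (at x within {0..T})"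
      by (rule has_vector_derivative_at_within[OF \<Phi>_mv_deriv])
    then show ?thesis unfolding CF_shift .
  qed
  have "\<Phi> (l0 + l) 0 *v v = v" for l by (simp add: \<Phi>_0)
  from linear_ode_parameter[where \<phi>="\<lambda>l x. \<Phi> (l0 + l) x *v v", OF cont_CF continuous_on_const \<Phi>_0[of l0] \<Phi>_deriv[of l0] d this]
  show thesis using that by (metis add.right_neutral)
qed

text \<open>The quadratic remainder estimate in \<open>\<lambda>\<close> holds about every point
  \<open>l0\<close>, and a complex derivative is all that holomorphy asks for.\<close>

lemma \<Phi>_holomorphic: "(\<lambda>l. \<Phi> l T $ i $ j) holomorphic_on UNIV"
  unfolding holomorphic_on_def
proof
  fix l0 :: complex
  obtain C \<Theta> where C: "\<And>l x. norm l \<le> 1 \<Longrightarrow> x \<in> {0..T} \<Longrightarrow> norm (\<Phi> (l0 + l) x *v axis j 1 - \<Phi> l0 x *v axis j 1 - l *s \<Theta> x) \<le> C * (norm l)\<^sup>2"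
    using \<Phi>_parameter[of l0 "axis j 1"] by metis
  have "((\<lambda>l. \<Phi> l T $ i $ j) has_field_derivative \<Theta> T $ i) (at l0)"
  proof (rule has_field_derivative_quadratic)
    fix l :: complex assume "norm l \<le> 1"
    then have "norm ((\<Phi> (l0 + l) T *v axis j 1 - \<Phi> l0 T *v axis j 1 - l *s \<Theta> T) $ i) \<le> C * (norm l)\<^sup>2"
      using C[of l T] T_pos by (meson Finite_Cartesian_Product.norm_nth_le atLeastAtMost_iff less_imp_le order_refl order_trans)
    then show "norm (\<Phi> (l0 + l) T $ i $ j - \<Phi> l0 T $ i $ j - l * \<Theta> T $ i) \<le> C * (norm l)\<^sup>2" by (simp add: mv_axis)
  qed
  then show "(\<lambda>l. \<Phi> l T $ i $ j) field_differentiable at l0 within UNIV"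
    by (auto simp: field_differentiable_def)
qed

text \<open>The Evans function with complex wave number, since Puiseux expansions need a full
  neighborhood of \<open>k = 0\<close> in the plane.\<close>

definition "Dc w z = det (\<Phi> z T - mat (exp (\<i> * w * of_real T)))"

lemma Dc_real: "evans_function \<Psi> T k l = Dc (of_real k) l" by (simp add: evans_eq Dc_def)

lemma Dc_separable: "separable Dc"
  unfolding Dc_def[abs_def] by (rule separable_det) (auto intro!: holomorphic_intros \<Phi>_holomorphic)

end

section \<open>Dependence on parameters\<close>

text \<open>The first bound is the mean value inequality for \<open>g\<close>; the second applies it
  to \<open>g\<close> minus its linear part at \<open>v\<close>, whose derivative is small because
  \<open>g'\<close> is Lipschitz on the ball.\<close>

lemma C2_bounds:
  fixes g :: "'a::euclidean_space \<Rightarrow> 'b::real_normed_vector" and g' :: "'a \<Rightarrow> 'a \<Rightarrow>\<^sub>L 'b" and g'' :: "'a \<Rightarrow> 'a \<Rightarrow>\<^sub>L 'a \<Rightarrow>\<^sub>L 'b"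
  assumes g': "\<And>u. (g has_derivative blinfun_apply (g' u)) (at u)"
    and g'': "\<And>u. (g' has_derivative blinfun_apply (g'' u)) (at u)" and c: "continuous_on UNIV g''"
  obtains C where "C \<ge> 0" "\<And>u v. norm u \<le> R \<Longrightarrow> norm v \<le> R \<Longrightarrow> norm (g u - g v) \<le> C * norm (u - v)"
    "\<And>u v. norm u \<le> R \<Longrightarrow> norm v \<le> R \<Longrightarrow> norm (g u - g v - blinfun_apply (g' v) (u - v)) \<le> C * (norm (u - v))\<^sup>2"
proof -
  let ?K = "cball (0::'a) R"
  have c': "continuous_on UNIV g'"
    using g'' has_derivative_continuous_on[of UNIV g' "\<lambda>u. blinfun_apply (g'' u)"] by (simp add: has_derivative_at_withinI)
  have "bounded (g' ` ?K)" "bounded (g'' ` ?K)"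
    using c c' by (auto intro!: compact_imp_bounded compact_continuous_image intro: continuous_on_subset)
  then obtain C1 C2 where C1: "C1 > 0" "\<And>u. u \<in> ?K \<Longrightarrow> norm (g' u) \<le> C1" and C2: "C2 > 0" "\<And>u. u \<in> ?K \<Longrightarrow> norm (g'' u) \<le> C2"
    unfolding bounded_pos by blast
  have lip': "norm (g' u - g' v) \<le> C2 * norm (u - v)" if "u \<in> ?K" "v \<in> ?K" for u v
    by (rule differentiable_bound[where S="?K" and f'="\<lambda>u. blinfun_apply (g'' u)"])
       (use C2 that in \<open>auto simp: norm_blinfun.rep_eq[symmetric] intro: has_derivative_at_withinI g''\<close>)
  have lip: "norm (g u - g v) \<le> C1 * norm (u - v)" if "u \<in> ?K" "v \<in> ?K" for u v
    by (rule differentiable_bound[where S="?K" and f'="\<lambda>u. blinfun_apply (g' u)"])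
       (use C1 that in \<open>auto simp: norm_blinfun.rep_eq[symmetric] intro: has_derivative_at_withinI g'\<close>)
  have tay: "norm (g u - g v - blinfun_apply (g' v) (u - v)) \<le> C2 * (norm (u - v))\<^sup>2" if u: "u \<in> ?K" and v: "v \<in> ?K" for u v
  proof -
    \<comment> \<open>Staying within distance \<open>norm (u - v)\<close> of \<open>v\<close> keeps
      the derivative of the difference below \<open>C2\<close> times this distance, which makes the
      remainder quadratic.\<close>
    define S where "S = ?K \<inter> cball v (norm (u - v))"
    have "norm ((\<lambda>w. g w - blinfun_apply (g' v) w) u - (\<lambda>w. g w - blinfun_apply (g' v) w) v) \<le> (C2 * norm (u - v)) * norm (u - v)"
    proof (rule differentiable_bound[where S=S and f'="\<lambda>w. blinfun_apply (g' w - g' v)"])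
      show "convex S" by (simp add: S_def convex_Int)
      fix w assume w: "w \<in> S"
      have "((\<lambda>w. g w - blinfun_apply (g' v) w) has_derivative (\<lambda>h. blinfun_apply (g' w) h - blinfun_apply (g' v) h)) (at w within S)"
        by (intro has_derivative_diff has_derivative_at_withinI[OF g'] bounded_linear_imp_has_derivative blinfun.bounded_linear_right)
      then show "((\<lambda>w. g w - blinfun_apply (g' v) w) has_derivative blinfun_apply (g' w - g' v)) (at w within S)"
        by (rule has_derivative_eq_rhs) (simp add: blinfun.diff_left fun_eq_iff)
      have "norm (g' w - g' v) \<le> C2 * norm (w - v)" using w v by (intro lip') (auto simp: S_def)
      also have "\<dots> \<le> C2 * norm (u - v)" using w C2(1) by (auto simp: S_def dist_norm norm_minus_commute intro!: mult_left_mono)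
      finally show "onorm (blinfun_apply (g' w - g' v)) \<le> C2 * norm (u - v)" by (simp add: norm_blinfun.rep_eq)
    qed (use u v in \<open>auto simp: S_def dist_norm norm_minus_commute\<close>)
    then show ?thesis by (simp add: blinfun.diff_right power2_eq_square algebra_simps)
  qed
  show thesis
  proof (rule that[of "max C1 C2"])
    fix u v :: 'a assume uv: "norm u \<le> R" "norm v \<le> R"
    show "norm (g u - g v) \<le> max C1 C2 * norm (u - v)"
      by (rule order_trans[OF lip]) (use uv in \<open>auto intro: mult_right_mono\<close>)
    show "norm (g u - g v - blinfun_apply (g' v) (u - v)) \<le> max C1 C2 * (norm (u - v))\<^sup>2"
      by (rule order_trans[OF tay]) (use uv in \<open>auto intro: mult_right_mono\<close>)
  qed (use C1 in auto)
qed

text \<open>At \<open>\<lambda> = 0\<close> the flux is a constant: \<open>Pm\<close> propagates the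
  initial value, \<open>Qm\<close> is the response to a unit flux, and \<open>zt\<close> is the
  response to the forcing \<open>ubar - um\<close>, which is
  \<open>- \<partial>u/\<partial>s\<close>.\<close>

locale wave_lin = wave f B ubar um T f' f'' B' B''
  for f :: "real^'n \<Rightarrow> real^'n" and B ubar um T f' f'' B' B'' +
  fixes Pm Qm :: "real \<Rightarrow> real^'n^'n" and zt :: "real \<Rightarrow> real^'n"
  assumes Pm_0: "Pm 0 = mat 1" and Qm_0: "Qm 0 = 0" and zt_0: "zt 0 = 0"
    and Pm_deriv: "\<And>x. (Pm has_vector_derivative (Bi x ** A x) ** Pm x) (at x)"
    and Qm_deriv: "\<And>x. (Qm has_vector_derivative (Bi x ** A x) ** Qm x + Bi x) (at x)"
    and zt_deriv: "\<And>x. x \<in> {0..T} \<Longrightarrow> (zt has_vector_derivative (Bi x ** A x) *v zt x + Bi x *v (ubar x - um)) (at x within {0..T})"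
begin

text \<open>The first-order response of the wave to a change \<open>dq\<close> of
  \<open>(um, u0, s)\<close>. A change of \<open>um\<close> acts through \<open>- f(um)\<close>
  alone, since \<open>s = 0\<close> at the base point.\<close>

definition Y :: "(real^'n) \<times> (real^'n) \<times> real \<Rightarrow> real \<Rightarrow> real^'n" where
  "Y dq x = Pm x *v fst (snd dq) - Qm x *v blinfun_apply (f' um) (fst dq) - snd (snd dq) *\<^sub>R zt x"

lemma Y_0: "Y dq 0 = fst (snd dq)"
  by (simp add: Y_def Pm_0 Qm_0 zt_0)

lemma Y_deriv:
  assumes x: "x \<in> {0..T}"
  shows "(Y dq has_vector_derivative Bi x *v (A x *v Y dq x - blinfun_apply (f' um) (fst dq) - snd (snd dq) *\<^sub>R (ubar x - um))) (at x within {0..T})"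
proof -
  interpret mv: bounded_bilinear "(*v) :: real^'n^'n \<Rightarrow> real^'n \<Rightarrow> real^'n" by (rule bilinear_mv)
  have const: "((\<lambda>x. M x *v v) has_vector_derivative M' *v v) (at x within {0..T})" if "(M has_vector_derivative M') (at x)" for M :: "real \<Rightarrow> real^'n^'n" and M' and v :: "real^'n"
    using hvd_mv[OF has_vector_derivative_at_within[OF that] has_vector_derivative_const[of v]] by simp
  have "((\<lambda>x. Pm x *v fst (snd dq) - Qm x *v blinfun_apply (f' um) (fst dq) - snd (snd dq) *\<^sub>R zt x) has_vector_derivative
     ((Bi x ** A x) ** Pm x) *v fst (snd dq) - ((Bi x ** A x) ** Qm x + Bi x) *v blinfun_apply (f' um) (fst dq)
     - snd (snd dq) *\<^sub>R ((Bi x ** A x) *v zt x + Bi x *v (ubar x - um))) (at x within {0..T})"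
    by (intro has_vector_derivative_diff const Pm_deriv Qm_deriv bounded_linear.has_vector_derivative[OF bounded_linear_scaleR_right] zt_deriv x)
  then show ?thesis
    by (simp add: Y_def[abs_def] mv.diff_right mv.add_left mv.add_right mv.scaleR_right matrix_vector_mul_assoc[symmetric] scaleR_add_right scaleR_diff_right algebra_simps)
qed

text \<open>The bounds on \<open>f\<close> and \<open>B\<close> hold only on a ball, so closeness of
  the solutions has to be proved before it can be used: the local Gronwall estimate first gives a
  difference of first order in \<open>q - q0\<close>, a second application to the difference minus
  \<open>Y\<close> then gives second order.\<close>

lemma family_estimate:
  assumes family: "tw_family f B T (um, ubar 0, 0) U"
  obtains C \<delta> where "C \<ge> 0" "\<delta> > 0"
    "\<And>q x. norm (q - (um, ubar 0, 0)) < \<delta> \<Longrightarrow> x \<in> {0..T} \<Longrightarrow> norm (U q x - ubar x - Y (q - (um, ubar 0, 0)) x) \<le> C * (norm (q - (um, ubar 0, 0)))\<^sup>2"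
    "\<And>q. norm (q - (um, ubar 0, 0)) < \<delta> \<Longrightarrow> continuous_on {0..T} (U q)"
    "\<And>q. norm (q - (um, ubar 0, 0)) < \<delta> \<Longrightarrow> tw_solution f B (fst q) (snd (snd q)) {0..T} (U q) \<and> U q 0 = fst (snd q)"
proof -
  interpret mv: bounded_bilinear "(*v) :: real^'n^'n \<Rightarrow> real^'n \<Rightarrow> real^'n" by (rule bilinear_mv)
  let ?q0 = "(um, ubar 0, 0::real)"
  obtain \<delta>0 where \<delta>0: "\<delta>0 > 0" "\<And>q. norm (q - ?q0) < \<delta>0 \<Longrightarrow> tw_solution f B (fst q) (snd (snd q)) {0..T} (U q) \<and> U q 0 = fst (snd q)"
    using family unfolding tw_family_def eventually_nhds_metric dist_norm by (auto simp: case_prod_unfold)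
  have "bounded (ubar ` {0..T})" "bounded (du ` {0..T})"
    by (intro compact_imp_bounded compact_continuous_image cont_ubar cont_du compact_Icc)+
  then obtain M1 Mdu where M1: "\<And>x. x \<in> {0..T} \<Longrightarrow> norm (ubar x) \<le> M1" and Mdu: "Mdu > 0" "\<And>x. x \<in> {0..T} \<Longrightarrow> norm (du x) \<le> Mdu"
    unfolding bounded_pos by blast
  define R where "R = max M1 (norm um) + 1"
  have R: "norm um \<le> R - 1" "\<And>x. x \<in> {0..T} \<Longrightarrow> norm (ubar x) \<le> R - 1" "R > 0"
  proof -
    show "norm um \<le> R - 1" by (simp add: R_def)
    show "norm (ubar x) \<le> R - 1" if "x \<in> {0..T}" for x using M1[OF that] by (simp add: R_def)
    show "R > 0" unfolding R_def using norm_ge_zero[of um] by linarith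
  qed
  obtain Cf where Cf: "Cf \<ge> 0" "\<And>u v. norm u \<le> R \<Longrightarrow> norm v \<le> R \<Longrightarrow> norm (f u - f v) \<le> Cf * norm (u - v)"
    "\<And>u v. norm u \<le> R \<Longrightarrow> norm v \<le> R \<Longrightarrow> norm (f u - f v - blinfun_apply (f' v) (u - v)) \<le> Cf * (norm (u - v))\<^sup>2"
    by (rule C2_bounds[OF f' f'' f''_cont, of R]) blast
  obtain CB where CB: "CB \<ge> 0" "\<And>u v. norm u \<le> R \<Longrightarrow> norm v \<le> R \<Longrightarrow> norm (B u - B v) \<le> CB * norm (u - v)"
    "\<And>u v. norm u \<le> R \<Longrightarrow> norm v \<le> R \<Longrightarrow> norm (B u - B v - blinfun_apply (B' v) (u - v)) \<le> CB * (norm (u - v))\<^sup>2"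
    by (rule C2_bounds[OF B' B'' B''_cont, of R]) blast
  obtain Km where Km: "Km > 0" "\<And>(a::real^'n^'n) b. norm (a *v b) \<le> norm a * norm b * Km"
    using mv.pos_bounded by blast
  obtain KB where KB: "KB \<ge> 0" "\<And>x v. x \<in> {0..T} \<Longrightarrow> norm (Bi x *v v) \<le> KB * norm v"
    by (rule bounded_mv_on_compact[OF cont_Bi compact_Icc]) blast
  obtain KA where KA: "KA \<ge> 0" "\<And>x v. x \<in> {0..T} \<Longrightarrow> norm (A x *v v) \<le> KA * norm v"
    by (rule bounded_mv_on_compact[OF cont_A compact_Icc]) blast
  \<comment> \<open>In the equation for the difference the unknown derivative \<open>v\<close> also
    occurs on the right, multiplied by \<open>B(U) - B(ubar)\<close>. Below \<open>\<rho>\<close>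
    its coefficient is at most 1/2, and it can be absorbed on the left;
    \<open>\<rho> \<le> 1\<close> keeps the solution in the ball of radius \<open>R\<close>.\<close>
  define \<rho> where "\<rho> = 1 / (1 + 2 * KB * (Km * CB))"
  have den: "1 + 2 * KB * (Km * CB) \<ge> 1" using KB Km CB by simp
  have \<rho>: "\<rho> > 0" "\<rho> \<le> 1" "KB * (Km * CB * \<rho>) \<le> 1 / 2"
    using den by (auto simp: \<rho>_def field_simps)
  \<comment> \<open>The factor 2 stems from the absorption. In \<open>b0\<close>, \<open>2 R\<close>
    bounds \<open>norm (U - um')\<close>, the factor of \<open>s\<close>.\<close>
  define L where "L = 2 * KB * (Cf + Km * CB * Mdu)"
  define b0 where "b0 = 2 * KB * (Cf + 2 * R)"
  have L: "L \<ge> 0" "b0 \<ge> 0" using KB Cf Km CB Mdu R by (simp_all add: L_def b0_def)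
  define E1 where "E1 = exp ((2 * L + 1) * T)"
  define Cg where "Cg = E1 * (1 + b0)"
  have Cg: "Cg \<ge> 0" using L by (simp add: Cg_def E1_def)
  define C1 where "C1 = L * Cg + b0"
  have C1: "C1 \<ge> 0" using L Cg by (simp add: C1_def)
  \<comment> \<open>One summand for each of the five terms of \<open>Rm\<close>, in the same
    order.\<close>
  define C2 where "C2 = Cf * Cg\<^sup>2 + Cf + (Cg + 1) + Km * (CB * Cg\<^sup>2) * Mdu + Km * (CB * Cg) * C1"
  have C2: "C2 \<ge> 0" using Cf Cg Km CB Mdu C1 by (simp add: C2_def)
  define C3 where "C3 = exp ((2 * (KB * KA) + 1) * T) * (KB * C2)"
  have C3: "C3 \<ge> 0" using KB C2 by (simp add: C3_def)
  obtain \<delta>1 where \<delta>1: "\<delta>1 > 0" "\<And>n. 0 \<le> n \<Longrightarrow> n < \<delta>1 \<Longrightarrow> E1 * (n\<^sup>2 + (b0 * n)\<^sup>2) < \<rho>\<^sup>2"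
  proof -
    have "((\<lambda>n. E1 * (n\<^sup>2 + (b0 * n)\<^sup>2)) \<longlongrightarrow> E1 * (0\<^sup>2 + (b0 * 0)\<^sup>2)) (nhds (0::real))"
      by (intro tendsto_intros filterlim_ident)
    then have "\<forall>\<^sub>F n in nhds (0::real). E1 * (n\<^sup>2 + (b0 * n)\<^sup>2) < \<rho>\<^sup>2"
      by (rule order_tendstoD(2)) (use \<rho> in simp)
    then obtain e where "e > 0" "\<And>n. \<bar>n\<bar> < e \<Longrightarrow> E1 * (n\<^sup>2 + (b0 * n)\<^sup>2) < \<rho>\<^sup>2"
      unfolding eventually_nhds_metric by (auto simp: dist_real_def)
    then show thesis by (intro that[of e]) auto
  qed
  define \<delta> where "\<delta> = min 1 (min \<delta>0 \<delta>1)"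
  have \<delta>: "\<delta> > 0" using \<delta>0 \<delta>1 by (simp add: \<delta>_def)
  have main: "norm (U q x - ubar x - Y (q - ?q0) x) \<le> C3 * (norm (q - ?q0))\<^sup>2 \<and> continuous_on {0..T} (U q)"
    if q: "norm (q - ?q0) < \<delta>" and x: "x \<in> {0..T}" for q x
  proof -
    obtain um' u0' s where qq: "q = (um', u0', s)" by (cases q)
    define n where "n = norm (q - ?q0)"
    have n: "0 \<le> n" "n < 1" "n < \<delta>0" "n < \<delta>1" using q by (auto simp: n_def \<delta>_def)
    have n1: "norm (um' - um) \<le> n" and n2: "norm (u0' - ubar 0) \<le> n" and n3: "\<bar>s\<bar> \<le> n"
      using norm_fst_le[of "um' - um" "(u0' - ubar 0, s)"] norm_snd_le[of "(u0' - ubar 0, s)" "um' - um"]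
        norm_fst_le[of "u0' - ubar 0" s] norm_snd_le[of s "u0' - ubar 0"]
      by (auto simp: n_def qq)
    have um': "norm um' \<le> R" using norm_triangle_sub[of um' um] n1 R(1) n by linarith
    have umR: "norm um \<le> R" using R(1) by simp
    have sol: "tw_solution f B um' s {0..T} (U q)" "U q 0 = u0'"
    proof -
      have "norm (q - ?q0) < \<delta>0" using n(3) by (simp add: n_def)
      from \<delta>0(2)[OF this] show "tw_solution f B um' s {0..T} (U q)" "U q 0 = u0'" by (simp_all add: qq)
    qed
    then obtain v where v: "\<And>x. x \<in> {0..T} \<Longrightarrow> (U q has_vector_derivative v x) (at x within {0..T})"
      "\<And>x. x \<in> {0..T} \<Longrightarrow> B (U q x) *v v x = f (U q x) - f um' - s *\<^sub>R (U q x - um')"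
      unfolding tw_solution_def by metis
    define \<Delta> where "\<Delta> x = U q x - ubar x" for x
    have \<Delta>d: "(\<Delta> has_vector_derivative v x - du x) (at x within {0..T})" if "x \<in> {0..T}" for x
      unfolding \<Delta>_def[abs_def] by (intro has_vector_derivative_diff v that has_vector_derivative_at_within[OF ubar_deriv])
    have uR: "norm (U q x) \<le> R" if "x \<in> {0..T}" "norm (\<Delta> x) \<le> \<rho>" for x
      using norm_triangle_sub[of "U q x" "ubar x"] R(2)[OF that(1)] that(2) \<rho>(2) by (simp add: \<Delta>_def)
    have ubR: "norm (ubar x) \<le> R" if "x \<in> {0..T}" for x using R(2)[OF that] by simp
    have eq1: "Bx x *v (v x - du x) = (f (U q x) - f (ubar x)) - (f um' - f um) - s *\<^sub>R (U q x - um') - (B (U q x) - B (ubar x)) *v v x"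
      if x: "x \<in> {0..T}" for x
    proof -
      have "Bx x *v (v x - du x) = B (U q x) *v v x - (B (U q x) - B (ubar x)) *v v x - Bx x *v du x"
        by (simp add: mv.diff_right mv.diff_left Bx_def)
      then show ?thesis unfolding Bx_du v(2)[OF x] by simp
    qed
    have bound: "norm (v x - du x) \<le> L * norm (\<Delta> x) + b0 * n" if x: "x \<in> {0..T}" and small: "norm (\<Delta> x) \<le> \<rho>" for x
    proof -
      define V where "V = norm (v x - du x)"
      define d where "d = norm (\<Delta> x)"
      have d0: "0 \<le> d" "0 \<le> V" by (simp_all add: d_def V_def)
      have uq: "norm (U q x) \<le> R" by (rule uR[OF x small])
      have nv: "norm (v x) \<le> V + Mdu" using norm_triangle_sub[of "v x" "du x"] Mdu(2)[OF x] by (simp add: V_def)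
      have "V = norm (Bi x *v (Bx x *v (v x - du x)))" by (simp add: Bi_Bx_v V_def)
      also have "\<dots> \<le> KB * norm (Bx x *v (v x - du x))" by (rule KB(2)[OF x])
      also have "norm (Bx x *v (v x - du x)) \<le> Cf * d + Cf * n + n * (2 * R) + CB * d * (V + Mdu) * Km"
      proof -
        have "norm (f (U q x) - f (ubar x)) \<le> Cf * d" using Cf(2)[OF uq ubR[OF x]] by (simp add: d_def \<Delta>_def)
        moreover have "norm (f um' - f um) \<le> Cf * n"
          by (rule order_trans[OF Cf(2)[OF um' umR]]) (use n1 Cf(1) in \<open>auto intro: mult_left_mono\<close>)
        moreover have "norm (s *\<^sub>R (U q x - um')) \<le> n * (2 * R)"
        proof -
          have "norm (U q x - um') \<le> 2 * R" using norm_triangle_ineq4[of "U q x" um'] uq um' by simp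
          then show ?thesis using n3 n by (auto intro!: mult_mono)
        qed
        moreover have "norm ((B (U q x) - B (ubar x)) *v v x) \<le> CB * d * (V + Mdu) * Km"
        proof -
          have "norm (B (U q x) - B (ubar x)) \<le> CB * d" using CB(2)[OF uq ubR[OF x]] by (simp add: d_def \<Delta>_def)
          then show ?thesis using Km(1) nv d0 Mdu CB(1)
            by (intro order_trans[OF Km(2)] mult_right_mono mult_mono) auto
        qed
        ultimately show ?thesis unfolding eq1[OF x]
          by (smt (verit) norm_triangle_ineq4)
      qed
      finally have V: "V \<le> KB * (Cf * d + Cf * n + n * (2 * R) + CB * d * (V + Mdu) * Km)" using KB(1) by (auto intro: mult_left_mono)
      \<comment> \<open>The absorption: this part of the right-hand side is at most half of the
        left.\<close>
      have "KB * (CB * d * V * Km) \<le> 1 / 2 * V"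
      proof -
        have "KB * (Km * CB * d) \<le> KB * (Km * CB * \<rho>)" using KB CB Km small by (intro mult_left_mono) (auto simp: d_def)
        then have "KB * (Km * CB * d) \<le> 1 / 2" using \<rho>(3) by linarith
        then have "KB * (Km * CB * d) * V \<le> 1 / 2 * V" using d0 by (intro mult_right_mono)
        then show ?thesis by (simp add: mult_ac)
      qed
      then have "V \<le> 2 * (KB * (Cf * d + Cf * n + n * (2 * R) + CB * d * Mdu * Km))" using V by (simp add: algebra_simps)
      then show ?thesis by (simp add: L_def b0_def V_def d_def algebra_simps)
    qed
    have a0: "norm (\<Delta> 0) \<le> n" using n2 sol(2) by (simp add: \<Delta>_def)
    have b0n: "0 \<le> b0 * n" using L n by simp
    have small: "exp ((2 * L + 1) * T) * (n\<^sup>2 + (b0 * n)\<^sup>2) < \<rho>\<^sup>2" using \<delta>1(2)[of n] n by (simp add: E1_def)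
    have \<Delta>\<rho>: "norm (\<Delta> x) \<le> \<rho>" and \<Delta>b: "norm (\<Delta> x) \<le> Cg * n" if x: "x \<in> {0..T}" for x
    proof -
      have "norm (\<Delta> x) < \<rho>" by (rule gronwall_local(1)[OF \<Delta>d bound L(1) b0n a0 small \<rho>(1) x])
      then show "norm (\<Delta> x) \<le> \<rho>" by simp
      have "norm (\<Delta> x) \<le> exp ((2 * L + 1) * T) * (n + b0 * n)" by (rule gronwall_local(2)[OF \<Delta>d bound L(1) b0n a0 small \<rho>(1) x])
      then show "norm (\<Delta> x) \<le> Cg * n" by (simp add: Cg_def E1_def algebra_simps)
    qed
    have vb: "norm (v x - du x) \<le> C1 * n" if x: "x \<in> {0..T}" for x
    proof -
      have "norm (v x - du x) \<le> L * norm (\<Delta> x) + b0 * n" by (rule bound[OF x \<Delta>\<rho>[OF x]])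
      also have "\<dots> \<le> L * (Cg * n) + b0 * n" using \<Delta>b[OF x] L by (intro add_right_mono mult_left_mono)
      finally show ?thesis by (simp add: C1_def algebra_simps)
    qed
    \<comment> \<open>Everything of second order: the Taylor remainders of \<open>f\<close> at the
      wave and at \<open>um\<close>, the product of \<open>s\<close> with first-order terms, the
      Taylor remainder of \<open>B\<close>, and the product of two first-order differences.\<close>
    define Rm where "Rm x = (f (U q x) - f (ubar x) - blinfun_apply (f' (ubar x)) (\<Delta> x)) - (f um' - f um - blinfun_apply (f' um) (um' - um))
       - s *\<^sub>R (\<Delta> x - (um' - um)) - (B (U q x) - B (ubar x) - blinfun_apply (B' (ubar x)) (\<Delta> x)) *v du x
       - (B (U q x) - B (ubar x)) *v (v x - du x)" for x
    have eq2: "Bx x *v (v x - du x) = A x *v \<Delta> x - blinfun_apply (f' um) (um' - um) - s *\<^sub>R (ubar x - um) + Rm x" if x: "x \<in> {0..T}" for x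
    proof -
      have "(B (U q x) - B (ubar x)) *v v x = (B (U q x) - B (ubar x)) *v du x + (B (U q x) - B (ubar x)) *v (v x - du x)"
        by (simp add: mv.diff_right)
      then show ?thesis unfolding eq1[OF x] A_apply Rm_def
        by (simp add: mv.diff_left \<Delta>_def scaleR_diff_right algebra_simps)
    qed
    have Rb: "norm (Rm x) \<le> C2 * n\<^sup>2" if x: "x \<in> {0..T}" for x
    proof -
      have uq: "norm (U q x) \<le> R" by (rule uR[OF x \<Delta>\<rho>[OF x]])
      have d2: "(norm (\<Delta> x))\<^sup>2 \<le> Cg\<^sup>2 * n\<^sup>2"
        using power_mono[OF \<Delta>b[OF x], of 2] by (simp add: power_mult_distrib)
      have "norm (f (U q x) - f (ubar x) - blinfun_apply (f' (ubar x)) (\<Delta> x)) \<le> Cf * Cg\<^sup>2 * n\<^sup>2"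
        using Cf(3)[OF uq ubR[OF x]] mult_left_mono[OF d2 Cf(1)] by (simp add: \<Delta>_def mult.assoc)
      moreover have "norm (f um' - f um - blinfun_apply (f' um) (um' - um)) \<le> Cf * n\<^sup>2"
        using Cf(3)[OF um' umR] mult_left_mono[OF power_mono[OF n1, of 2] Cf(1)] by simp
      moreover have "norm (s *\<^sub>R (\<Delta> x - (um' - um))) \<le> (Cg + 1) * n\<^sup>2"
      proof -
        have "norm (\<Delta> x - (um' - um)) \<le> Cg * n + n" using norm_triangle_ineq4[of "\<Delta> x" "um' - um"] \<Delta>b[OF x] n1 by linarith
        then have "\<bar>s\<bar> * norm (\<Delta> x - (um' - um)) \<le> n * (Cg * n + n)" using n3 n by (intro mult_mono) auto
        then have "norm (s *\<^sub>R (\<Delta> x - (um' - um))) \<le> n * (Cg * n + n)" by simp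
        also have "\<dots> = (Cg + 1) * n\<^sup>2" by (simp add: power2_eq_square algebra_simps)
        finally show ?thesis .
      qed
      moreover have "norm ((B (U q x) - B (ubar x) - blinfun_apply (B' (ubar x)) (\<Delta> x)) *v du x) \<le> Km * (CB * Cg\<^sup>2) * Mdu * n\<^sup>2"
      proof -
        have "norm (B (U q x) - B (ubar x) - blinfun_apply (B' (ubar x)) (\<Delta> x)) \<le> CB * (Cg\<^sup>2 * n\<^sup>2)"
          using CB(3)[OF uq ubR[OF x]] mult_left_mono[OF d2 CB(1)] by (simp add: \<Delta>_def)
        then have "norm (B (U q x) - B (ubar x) - blinfun_apply (B' (ubar x)) (\<Delta> x)) * norm (du x) * Km \<le> CB * (Cg\<^sup>2 * n\<^sup>2) * Mdu * Km"
          using Mdu(2)[OF x] Km(1) CB(1) by (intro mult_right_mono mult_mono) auto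
        then show ?thesis using Km(2)[of "B (U q x) - B (ubar x) - blinfun_apply (B' (ubar x)) (\<Delta> x)" "du x"] by (simp add: mult_ac)
      qed
      moreover have "norm ((B (U q x) - B (ubar x)) *v (v x - du x)) \<le> Km * (CB * Cg) * C1 * n\<^sup>2"
      proof -
        have "norm (B (U q x) - B (ubar x)) \<le> CB * (Cg * n)"
          using CB(2)[OF uq ubR[OF x]] mult_left_mono[OF \<Delta>b[OF x] CB(1)] by (simp add: \<Delta>_def)
        then have "norm (B (U q x) - B (ubar x)) * norm (v x - du x) * Km \<le> CB * (Cg * n) * (C1 * n) * Km"
          using vb[OF x] Km(1) CB(1) Cg n by (intro mult_right_mono mult_mono) auto
        then show ?thesis using Km(2)[of "B (U q x) - B (ubar x)" "v x - du x"] by (simp add: power2_eq_square mult_ac)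
      qed
      ultimately have "norm (Rm x) \<le> Cf * Cg\<^sup>2 * n\<^sup>2 + Cf * n\<^sup>2 + (Cg + 1) * n\<^sup>2 + Km * (CB * Cg\<^sup>2) * Mdu * n\<^sup>2 + Km * (CB * Cg) * C1 * n\<^sup>2"
        unfolding Rm_def by (smt (verit) norm_triangle_ineq4)
      then show ?thesis by (simp add: C2_def algebra_simps)
    qed
    define w where "w x = \<Delta> x - Y (q - ?q0) x" for x
    have wd: "(w has_vector_derivative Bi x *v (A x *v w x + Rm x)) (at x within {0..T})" if x: "x \<in> {0..T}" for x
    proof -
      have "(w has_vector_derivative (v x - du x) - Bi x *v (A x *v Y (q - ?q0) x - blinfun_apply (f' um) (um' - um) - s *\<^sub>R (ubar x - um))) (at x within {0..T})"
        using has_vector_derivative_diff[OF \<Delta>d[OF x] Y_deriv[OF x, of "q - ?q0"]] by (simp add: w_def[abs_def] qq)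
      moreover have "v x - du x = Bi x *v (Bx x *v (v x - du x))" by (simp add: Bi_Bx_v)
      then have "(v x - du x) - Bi x *v (A x *v Y (q - ?q0) x - blinfun_apply (f' um) (um' - um) - s *\<^sub>R (ubar x - um)) = Bi x *v (A x *v w x + Rm x)"
        unfolding eq2[OF x] by (simp add: mv.diff_right mv.add_right w_def)
      ultimately show ?thesis by simp
    qed
    have "norm (w x) \<le> exp ((2 * (KB * KA) + 1) * T) * (0 + KB * (C2 * n\<^sup>2))"
    proof (rule gronwall[OF wd _ _ _ _ x])
      fix x assume x: "x \<in> {0..T}"
      have "norm (A x *v w x + Rm x) \<le> KA * norm (w x) + C2 * n\<^sup>2"
        by (rule order_trans[OF norm_triangle_ineq add_mono[OF KA(2)[OF x] Rb[OF x]]])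
      then have "KB * norm (A x *v w x + Rm x) \<le> KB * (KA * norm (w x) + C2 * n\<^sup>2)" using KB(1) by (rule mult_left_mono)
      then show "norm (Bi x *v (A x *v w x + Rm x)) \<le> KB * KA * norm (w x) + KB * (C2 * n\<^sup>2)"
        using KB(2)[OF x, of "A x *v w x + Rm x"] by (simp add: algebra_simps)
    qed (use KB KA C2 n sol(2) in \<open>auto simp: w_def \<Delta>_def Y_0 qq\<close>)
    then have "norm (U q x - ubar x - Y (q - ?q0) x) \<le> C3 * n\<^sup>2"
      by (simp add: w_def \<Delta>_def C3_def mult_ac)
    moreover have "continuous_on {0..T} (U q)" by (rule continuous_on_vector_derivative[OF v(1)])
    ultimately show ?thesis by (simp add: n_def)
  qed
  show thesis
  proof (rule that[OF C3 \<delta>])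
    show "norm (U q x - ubar x - Y (q - ?q0) x) \<le> C3 * (norm (q - ?q0))\<^sup>2" if "norm (q - ?q0) < \<delta>" "x \<in> {0..T}" for q x
      using main[OF that] by simp
    show "continuous_on {0..T} (U q)" if "norm (q - ?q0) < \<delta>" for q
      using main[OF that, of 0] T_pos by simp
    show "tw_solution f B (fst q) (snd (snd q)) {0..T} (U q) \<and> U q 0 = fst (snd q)" if "norm (q - ?q0) < \<delta>" for q
      by (rule \<delta>0(2)) (use that in \<open>simp add: \<delta>_def\<close>)
  qed
qed

end

section \<open>The variations of the wave\<close>

locale wave_full = wave_evans f B ubar um T f' f'' B' B'' \<Psi> + wave_lin f B ubar um T f' f'' B' B'' Pm Qm zt
  for f :: "real^'n \<Rightarrow> real^'n" and B ubar um T f' f'' B' B'' \<Psi> Pm Qm zt +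
  assumes \<Phi>_block: "\<Phi> 0 x = block (cmat (Pm x)) (cmat (Qm x)) 0 (mat 1)"

context wave_evans
begin

definition "CR x = block (Bi x ** A x) (Bi x) 0 0"

lemma CF_0: "CF 0 x = cmat (CR x)"
  by (simp add: CF_def CR_def cmat_block cmat_mult cmat_0 mat_zero)

lemma cont_CR: "continuous_on S CR"
  unfolding CR_def[abs_def] by (intro continuous_on_block cont_mm cont_Bi cont_A continuous_intros)

lemma \<Phi>_0_entry_deriv: "((\<lambda>x. \<Phi> 0 x $ i $ j) has_vector_derivative (\<Sum>k\<in>UNIV. of_real (CR x $ i $ k) * \<Phi> 0 x $ k $ j)) (at x)"
  using has_vector_derivative_vec_nth[OF has_vector_derivative_vec_nth[OF \<Phi>_deriv[of 0 x], of i], of j]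
  by (simp add: CF_0 matrix_matrix_mult_def)

text \<open>The coefficients are real at \<open>\<lambda> = 0\<close>, so the imaginary part of each
  column solves the same equation with zero initial value.\<close>

lemma \<Phi>_0_real: "Im (\<Phi> 0 x $ i $ j) = 0"
proof -
  let ?z = "\<lambda>x. \<chi> i. Im (\<Phi> 0 x $ i $ j)"
  have d: "(?z has_vector_derivative CR x *v ?z x) (at x)" for x
  proof (rule has_vector_derivative_vec)
    fix i
    have "((\<lambda>x. Im (\<Phi> 0 x $ i $ j)) has_vector_derivative Im (\<Sum>k\<in>UNIV. of_real (CR x $ i $ k) * \<Phi> 0 x $ k $ j)) (at x)"
      by (rule bounded_linear.has_vector_derivative[OF bounded_linear_Im \<Phi>_0_entry_deriv])
    then show "((\<lambda>x. ?z x $ i) has_vector_derivative (CR x *v ?z x) $ i) (at x)"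
      by (simp add: matrix_vector_mult_def)
  qed
  have z0: "?z 0 = 0" by (simp add: \<Phi>_0 mat_def vec_eq_iff)
  have "?z x = 0" by (rule linear_ode_unique[of CR ?z 0 x, OF cont_CR d z0])
  then show ?thesis by (simp add: vec_eq_iff)
qed

lemma real_fundamental:
  obtains Pm Qm zt where "wave_full f B ubar um T f' f'' B' B'' \<Psi> Pm Qm zt"
proof -
  define R where "R x = (\<chi> i j. Re (\<Phi> 0 x $ i $ j))" for x
  have R: "\<Phi> 0 x = cmat (R x)" for x
    by (simp add: vec_eq_iff R_def complex_eq_iff \<Phi>_0_real)
  have Rd: "((\<lambda>x. R x $ i $ j) has_vector_derivative (CR x ** R x) $ i $ j) (at x)" for i j x
  proof -
    have "((\<lambda>x. Re (\<Phi> 0 x $ i $ j)) has_vector_derivative Re (\<Sum>k\<in>UNIV. of_real (CR x $ i $ k) * \<Phi> 0 x $ k $ j)) (at x)"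
      by (rule bounded_linear.has_vector_derivative[OF bounded_linear_Re \<Phi>_0_entry_deriv])
    then show ?thesis by (simp add: matrix_matrix_mult_def R_def)
  qed
  have R0: "R 0 = mat 1" by (simp add: R_def \<Phi>_0 vec_eq_iff mat_def)
  define Pm Qm where "Pm x = (\<chi> i j. R x $ Inl i $ Inl j)" and "Qm x = (\<chi> i j. R x $ Inl i $ Inr j)" for x
  \<comment> \<open>The lower half of a solution, the flux, is constant at
    \<open>\<lambda> = 0\<close>.\<close>
  have bot: "R x $ Inr i $ y = (if Inr i = y then 1 else 0)" for x i y
  proof -
    have "(CR x ** R x) $ Inr i $ y = 0" for x
      by (simp add: matrix_matrix_mult_def CR_def sum_UNIV_Plus)
    then have "((\<lambda>x. R x $ Inr i $ y) has_derivative (\<lambda>h. 0)) (at x within UNIV)" for x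
      using Rd[of "Inr i" y x] by (simp add: has_vector_derivative_def)
    then obtain c where "\<And>x. R x $ Inr i $ y = c"
      using has_derivative_zero_constant[of UNIV "\<lambda>x. R x $ Inr i $ y"] by auto
    then have "R x $ Inr i $ y = R 0 $ Inr i $ y" by simp
    then show ?thesis by (simp add: R0 mat_def)
  qed
  have blk: "R x = block (Pm x) (Qm x) 0 (mat 1)" for x
    by (simp add: block_eq_iff Pm_def Qm_def bot mat_def)
  have Pd: "(Pm has_vector_derivative (Bi x ** A x) ** Pm x) (at x)" for x
  proof (intro has_vector_derivative_vec)
    fix i j show "((\<lambda>x. Pm x $ i $ j) has_vector_derivative ((Bi x ** A x) ** Pm x) $ i $ j) (at x)"
      using Rd[of "Inl i" "Inl j" x] by (simp add: blk CR_def block_mult)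
  qed
  have Qd: "(Qm has_vector_derivative (Bi x ** A x) ** Qm x + Bi x) (at x)" for x
  proof (intro has_vector_derivative_vec)
    fix i j show "((\<lambda>x. Qm x $ i $ j) has_vector_derivative ((Bi x ** A x) ** Qm x + Bi x) $ i $ j) (at x)"
      using Rd[of "Inl i" "Inr j" x] by (simp add: blk CR_def block_mult)
  qed
  have P0: "Pm 0 = mat 1" and Q0: "Qm 0 = 0" by (simp_all add: vec_eq_iff Pm_def Qm_def R0 mat_def)
  obtain zt where zt: "zt 0 = 0" "\<And>x. x \<in> {0..T} \<Longrightarrow> (zt has_vector_derivative (Bi x ** A x) *v zt x + Bi x *v (ubar x - um)) (at x within {0..T})"
    by (rule linear_ode_inhomogeneous[of "\<lambda>x. Bi x ** A x" Pm T "\<lambda>x. Bi x *v (ubar x - um)"])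
       (auto intro!: cont_mm cont_mv cont_Bi cont_A cont_ubar continuous_intros P0 Pd)
  have lin: "wave_lin f B ubar um T f' f'' B' B'' Pm Qm zt"
    by (rule wave_lin.intro[OF wave_axioms wave_lin_axioms.intro[OF P0 Q0 zt(1) Pd Qd zt(2)]])
  have "\<Phi> 0 x = block (cmat (Pm x)) (cmat (Qm x)) 0 (mat 1)" for x
    by (simp add: R blk cmat_block cmat_0 cmat_mat)
  then have "wave_full f B ubar um T f' f'' B' B'' \<Psi> Pm Qm zt"
    by (intro wave_full.intro wave_evans_axioms lin wave_full_axioms.intro)
  then show thesis by (rule that)
qed

end

context wave_lin
begin

definition "A0 = matrix (blinfun_apply (f' um))"

lemma A0_apply: "A0 *v v = blinfun_apply (f' um) v"
  by (simp add: A0_def matrix_works bounded_linear.linear[OF blinfun.bounded_linear_right])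

lemma cont_Pm: "continuous_on S Pm"
  by (rule continuous_on_vector_derivative) (blast intro: Pm_deriv has_vector_derivative_at_within)

lemma cont_Qm: "continuous_on S Qm"
  by (rule continuous_on_vector_derivative) (blast intro: Qm_deriv has_vector_derivative_at_within)

lemma cont_zt: "continuous_on {0..T} zt"
  by (rule continuous_on_vector_derivative) (blast intro: zt_deriv)

lemma Pm_du: "Pm x *v du 0 = du x"
proof -
  interpret mv: bounded_bilinear "(*v) :: real^'n^'n \<Rightarrow> real^'n \<Rightarrow> real^'n" by (rule bilinear_mv)
  let ?z = "\<lambda>x. Pm x *v du 0 - du x"
  have d: "(?z has_vector_derivative (Bi x ** A x) *v ?z x) (at x)" for x
    using has_vector_derivative_diff[OF hvd_mv[OF Pm_deriv[of x] has_vector_derivative_const[of "du 0"]] du_deriv[of x]]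
    by (simp add: ddu_eq mv.diff_right matrix_vector_mul_assoc)
  have c: "continuous_on UNIV (\<lambda>x. Bi x ** A x)" by (intro cont_mm cont_Bi cont_A)
  have z0: "?z 0 = 0" by (simp add: Pm_0)
  have "?z x = 0" by (rule linear_ode_unique[of "\<lambda>x. Bi x ** A x" ?z 0 x, OF c d z0])
  then show ?thesis by simp
qed

definition "IP = integral {0..T} Pm"
definition "IQ = integral {0..T} Qm"

lemma integral_mv:
  fixes M :: "real \<Rightarrow> real^'n^'n"
  assumes "continuous_on {0..T} M"
  shows "((\<lambda>x. M x *v v) has_integral integral {0..T} M *v v) {0..T}"
  using has_integral_linear[OF integrable_integral[OF integrable_continuous_interval[OF assms]]
      bounded_bilinear.bounded_linear_left[OF bilinear_mv], of v]
  by (simp add: o_def)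

text \<open>\<open>Pm\<close> carries \<open>du 0\<close> to \<open>ubar'\<close>, whose integral
  over a period vanishes: the translation mode carries no mass.\<close>

lemma IP_du: "IP *v du 0 = 0"
proof -
  have "(du has_integral ubar T - ubar 0) {0..T}"
    by (rule fundamental_theorem_of_calculus) (use T_pos in \<open>auto intro: has_vector_derivative_at_within ubar_deriv\<close>)
  moreover have "ubar T = ubar 0" using periodic[of 0] by simp
  ultimately have "(du has_integral 0) {0..T}" by simp
  moreover have "(du has_integral IP *v du 0) {0..T}"
    using integral_mv[OF cont_Pm, of "du 0"] by (simp add: Pm_du IP_def)
  ultimately show ?thesis by (metis has_integral_unique)
qed

end

section \<open>Jumps over one period and the mass derivative\<close>

locale wave_family = wave_lin f B ubar um T f' f'' B' B'' Pm Qm zt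
  for f :: "real^'n \<Rightarrow> real^'n" and B ubar um T f' f'' B' B'' Pm Qm zt +
  fixes U :: "(real^'n) \<times> (real^'n) \<times> real \<Rightarrow> real \<Rightarrow> real^'n" and i1 :: 'n
  assumes family: "tw_family f B T (um, ubar 0, 0) U"
    and coordinates: "vector_derivative ubar (at 0) = axis i1 1"
begin

abbreviation "q0 \<equiv> (um, ubar 0, 0 :: real)"

lemma du_0: "du 0 = axis i1 1"
  using vd_ubar[of 0] coordinates by simp

lemma U_base:
  assumes x: "x \<in> {0..T}"
  shows "U q0 x = ubar x"
proof -
  obtain C \<delta> where "\<delta> > 0"
    "\<And>q. norm (q - q0) < \<delta> \<Longrightarrow> norm (U q x - ubar x - Y (q - q0) x) \<le> C * (norm (q - q0))\<^sup>2"
    using family_estimate[OF family] x by metis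
  from this(2)[of q0] this(1) have "U q0 x - ubar x - Y 0 x = 0" by simp
  then show ?thesis by (simp add: Y_def zero_prod_def)
qed

lemma Y_linear: "linear (\<lambda>dq. Y dq x)"
proof -
  interpret mv: bounded_bilinear "(*v) :: real^'n^'n \<Rightarrow> real^'n \<Rightarrow> real^'n" by (rule bilinear_mv)
  show ?thesis
    by (rule linearI) (simp_all add: Y_def mv.add_right mv.scaleR_right blinfun.add_right blinfun.scaleR_right algebra_simps)
qed

lemma U_has_derivative:
  assumes x: "x \<in> {0..T}"
  shows "((\<lambda>q. U q x) has_derivative (\<lambda>dq. Y dq x)) (at q0)"
proof -
  obtain C \<delta> where C: "C \<ge> 0" "\<delta> > 0"
    "\<And>q. norm (q - q0) < \<delta> \<Longrightarrow> norm (U q x - ubar x - Y (q - q0) x) \<le> C * (norm (q - q0))\<^sup>2"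
    using family_estimate[OF family] x by metis
  show ?thesis
  proof (rule has_derivativeI_sandwich[where e=\<delta> and H="\<lambda>q. C * norm (q - q0)"])
    show "bounded_linear (\<lambda>dq. Y dq x)" using Y_linear by (simp add: linear_conv_bounded_linear)
    show "norm (U q x - U q0 x - Y (q - q0) x) / norm (q - q0) \<le> C * norm (q - q0)" if "q \<noteq> q0" "dist q q0 < \<delta>" for q
      using C(3)[of q] that by (simp add: U_base[OF x] dist_norm field_simps power2_eq_square)
    have "((\<lambda>q. C * norm (q - q0)) \<longlongrightarrow> C * norm (q0 - q0)) (at q0)" by (intro tendsto_intros)
    then show "((\<lambda>q. C * norm (q - q0)) \<longlongrightarrow> 0) (at q0)" by simp
  qed (use C in auto)
qed

lemma variation_eq: "x \<in> {0..T} \<Longrightarrow> variation U q0 dq x = Y dq x"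
  using fun_cong[OF frechet_derivative_at[OF U_has_derivative[of x]], of dq] by (simp add: variation_def)

text \<open>The columns of \<open>P1\<close> are the jumps of the variations in \<open>u0\<close>.
  The column \<open>i1\<close> belongs to translation and vanishes; \<open>G\<close> has the jump of
  \<open>zt\<close> in its place and is the transversality matrix.\<close>

definition "P1 = Pm T - mat 1"
definition "G = (\<chi> i j. if j = i1 then zt T $ i else P1 $ i $ j)"

lemma transversality_eq: "transversality U q0 T i1 = det G"
proof -
  have 0: "0 \<in> {0..T}" "T \<in> {0..T}" using T_pos by auto
  have "(\<chi> i j. (if j = i1 then jump T (\<lambda>x. - variation U q0 (0, 0, 1) x) else jump T (variation U q0 (0, axis j 1, 0))) $ i) = G"
  proof -
    have v: "variation U q0 dq T = Y dq T" "variation U q0 dq 0 = fst (snd dq)" for dq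
      using variation_eq[OF 0(1), of dq] variation_eq[OF 0(2), of dq] Y_0 by auto
    have ax: "axis j (1::real) $ i = (if i = j then 1 else 0)" for i j :: 'n by (simp add: axis_def)
    show ?thesis
      unfolding jump_def v by (auto simp: vec_eq_iff G_def P1_def Y_def mv_axis ax blinfun.zero_right mat_def)
  qed
  then show ?thesis by (simp add: transversality_def)
qed

lemma P1_col: "P1 *v axis i1 1 = 0"
proof -
  interpret mv: bounded_bilinear "(*v) :: real^'n^'n \<Rightarrow> real^'n \<Rightarrow> real^'n" by (rule bilinear_mv)
  have "Pm T *v du 0 = du 0" using Pm_du[of T] periodic_coeff(3)[of 0] by simp
  then show ?thesis by (simp add: P1_def mv.diff_left du_0)
qed

text \<open>The covector \<open>\<eta>\<close> is the gradient of the integral of motion at the base point.\<close>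
lemma tangent:
  assumes qh: "quasi_hamiltonian f B 0 um (ubar 0)"
  obtains \<eta> :: "real^'n" where "\<eta> \<noteq> 0" "\<And>v. \<eta> \<bullet> (Qm T *v (A0 *v v)) = 0" "\<And>v. \<eta> \<bullet> (P1 *v v) = 0" "\<eta> \<bullet> axis i1 1 = 0"
proof -
  interpret mv: bounded_bilinear "(*v) :: real^'n^'n \<Rightarrow> real^'n \<Rightarrow> real^'n" by (rule bilinear_mv)
  obtain H where H0: "\<forall>um I u. is_interval I \<and> 0 \<in> I \<and> tw_solution f B um 0 I u \<longrightarrow> (\<forall>x\<in>I. H (um, u x) = H (um, u 0))"
    and H1: "\<exists>S (H' :: (real^'n) \<times> (real^'n) \<Rightarrow> ((real^'n) \<times> (real^'n)) \<Rightarrow>\<^sub>L real).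
       open S \<and> (um, ubar 0) \<in> S \<and> (\<forall>z\<in>S. (H has_derivative blinfun_apply (H' z)) (at z)) \<and> continuous_on S H' \<and>
       (\<exists>v. blinfun_apply (H' (um, ubar 0)) (0, v) \<noteq> 0)"
    by (rule exE[OF qh[unfolded quasi_hamiltonian_def]]) (erule conjE, rule that)
  obtain H' :: "(real^'n) \<times> (real^'n) \<Rightarrow> ((real^'n) \<times> (real^'n)) \<Rightarrow>\<^sub>L real" and v0
    where HD: "(H has_derivative blinfun_apply (H' (um, ubar 0))) (at (um, ubar 0))"
      and v0: "blinfun_apply (H' (um, ubar 0)) (0, v0) \<noteq> 0"
    using H1 by (elim exE conjE) (rule that, auto)
  have H: "H (um', u x) = H (um', u 0)" if "is_interval I" "0 \<in> I" "tw_solution f B um' 0 I u" "x \<in> I" for um' I u x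
    using H0 that by metis
  define h where "h v = blinfun_apply (H' (um, ubar 0)) (0, v)" for v
  have lin: "linear h"
  proof (rule linearI)
    show "h (a + b) = h a + h b" for a b by (simp add: h_def blinfun.add_right[symmetric])
    show "h (c *\<^sub>R a) = c *\<^sub>R h a" for c a
      using blinfun.scaleR_right[of "H' (um, ubar 0)" c "(0, a)"] by (simp add: h_def)
  qed
  define \<eta> where "\<eta> = adjoint h 1"
  have \<eta>: "\<eta> \<bullet> v = h v" for v
    using adjoint_works[OF lin, of v 1] by (simp add: \<eta>_def inner_commute)
  obtain C \<delta> where \<delta>: "\<delta> > 0" "\<And>q. norm (q - q0) < \<delta> \<Longrightarrow> tw_solution f B (fst q) (snd (snd q)) {0..T} (U q) \<and> U q 0 = fst (snd q)"
    by (rule family_estimate[OF family]) blast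
  have ubT: "ubar T = ubar 0" using periodic[of 0] by simp
  \<comment> \<open>For \<open>s = 0\<close> the value of \<open>H\<close> is the same at
    \<open>x = 0\<close> and \<open>x = T\<close>. Differentiated along a curve of parameters at the
    common base point \<open>ubar T = ubar 0\<close>, the contributions through \<open>um\<close>
    cancel and only the gradient in \<open>u\<close>, applied to the jump, remains.\<close>
  have key: "h (Y (v, w, 0) T - w) = 0" for v w
  proof -
    let ?q = "\<lambda>t::real. (um + t *\<^sub>R v, ubar 0 + t *\<^sub>R w, 0::real)"
    have q: "(?q has_vector_derivative (v, w, 0)) (at 0)"
    proof -
      have "((\<lambda>t. q0 + t *\<^sub>R (v, w, 0)) has_vector_derivative 0 + (v, w, 0)) (at (0::real))"
        by (intro has_vector_derivative_add has_vector_derivative_const)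
           (auto intro!: derivative_eq_intros simp: has_vector_derivative_def)
      then show ?thesis by (simp add: plus_prod_def)
    qed
    have "((\<lambda>q. U q T) has_derivative (\<lambda>dq. Y dq T)) (at (?q 0))" using U_has_derivative[of T] T_pos by simp
    from vector_derivative_diff_chain_within[OF q has_derivative_at_withinI[OF this]]
    have UT: "((\<lambda>t. U (?q t) T) has_vector_derivative Y (v, w, 0) T) (at 0)" by (simp add: o_def)
    have HD1: "(H has_derivative blinfun_apply (H' (um, ubar 0))) (at ((\<lambda>t. (um + t *\<^sub>R v, U (?q t) T)) 0))"
      using HD T_pos by (simp add: U_base ubT)
    have a: "((\<lambda>t. um + t *\<^sub>R v) has_vector_derivative v) (at 0)"
      by (auto intro!: derivative_eq_intros simp: has_vector_derivative_def)
    have b: "((\<lambda>t. ubar 0 + t *\<^sub>R w) has_vector_derivative w) (at 0)"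
      by (auto intro!: derivative_eq_intros simp: has_vector_derivative_def)
    have 1: "((\<lambda>t. H (um + t *\<^sub>R v, U (?q t) T)) has_vector_derivative blinfun_apply (H' (um, ubar 0)) (v, Y (v, w, 0) T)) (at 0)"
      using vector_derivative_diff_chain_within[OF has_vector_derivative_Pair[OF a UT] has_derivative_at_withinI[OF HD1]] by (simp add: o_def)
    have HD2: "(H has_derivative blinfun_apply (H' (um, ubar 0))) (at ((\<lambda>t. (um + t *\<^sub>R v, ubar 0 + t *\<^sub>R w)) 0))"
      using HD by simp
    have 2: "((\<lambda>t. H (um + t *\<^sub>R v, ubar 0 + t *\<^sub>R w)) has_vector_derivative blinfun_apply (H' (um, ubar 0)) (v, w)) (at 0)"
      using vector_derivative_diff_chain_within[OF has_vector_derivative_Pair[OF a b] has_derivative_at_withinI[OF HD2]] by (simp add: o_def)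
    have D: "((\<lambda>t. H (um + t *\<^sub>R v, U (?q t) T) - H (um + t *\<^sub>R v, ubar 0 + t *\<^sub>R w)) has_real_derivative
        blinfun_apply (H' (um, ubar 0)) (v, Y (v, w, 0) T) - blinfun_apply (H' (um, ubar 0)) (v, w)) (at 0)"
      using has_vector_derivative_diff[OF 1 2] by (simp add: has_real_derivative_iff_has_vector_derivative)
    have zero: "H (um + t *\<^sub>R v, U (?q t) T) - H (um + t *\<^sub>R v, ubar 0 + t *\<^sub>R w) = 0" if t: "norm (t *\<^sub>R (v, w, 0::real)) < \<delta>" for t
    proof -
      have "tw_solution f B (um + t *\<^sub>R v) 0 {0..T} (U (?q t)) \<and> U (?q t) 0 = ubar 0 + t *\<^sub>R w"
        using \<delta>(2)[of "?q t"] t by simp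
      then show ?thesis using H[of "{0..T}" "um + t *\<^sub>R v" "U (?q t)" T] T_pos by (simp add: is_interval_cc)
    qed
    define e where "e = \<delta> / (norm (v, w, 0::real) + 1)"
    have e: "e > 0" using \<delta>(1) by (simp add: e_def add_nonneg_pos)
    have "blinfun_apply (H' (um, ubar 0)) (v, Y (v, w, 0) T) - blinfun_apply (H' (um, ubar 0)) (v, w) = 0"
    proof (rule DERIV_local_const[OF D e], intro allI impI)
      fix t :: real assume "\<bar>0 - t\<bar> < e"
      then have "\<bar>t\<bar> * (norm (v, w, 0::real) + 1) < \<delta>" by (simp add: e_def pos_less_divide_eq add_nonneg_pos)
      moreover have "\<bar>t\<bar> * norm (v, w, 0::real) \<le> \<bar>t\<bar> * (norm (v, w, 0::real) + 1)" by (intro mult_left_mono) auto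
      ultimately have "norm (t *\<^sub>R (v, w, 0::real)) < \<delta>" unfolding norm_scaleR by linarith
      then show "H (um + 0 *\<^sub>R v, U (?q 0) T) - H (um + 0 *\<^sub>R v, ubar 0 + 0 *\<^sub>R w) =
          H (um + t *\<^sub>R v, U (?q t) T) - H (um + t *\<^sub>R v, ubar 0 + t *\<^sub>R w)"
        using zero[of t] zero[of 0] \<delta>(1) by simp
    qed
    then show ?thesis by (simp add: h_def blinfun.diff_right[symmetric])
  qed
  show thesis
  proof (rule that[of \<eta>])
    show "\<eta> \<noteq> 0" using \<eta>[of v0] v0 by (auto simp: h_def)
    show "\<eta> \<bullet> (Qm T *v (A0 *v v)) = 0" for v
      using key[of v 0] by (simp add: Y_def \<eta> A0_apply linear_neg[OF lin])
    show "\<eta> \<bullet> (P1 *v v) = 0" for v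
      using key[of 0 v] by (simp add: Y_def \<eta> P1_def blinfun.zero_right mv.diff_left)
    \<comment> \<open>\<open>H\<close> is constant along the wave itself, so its gradient
      annihilates the wave direction.\<close>
    have "((\<lambda>x. H (um, ubar x)) has_vector_derivative blinfun_apply (H' (um, ubar 0)) (0, du 0)) (at 0)"
    proof -
      have "(H has_derivative blinfun_apply (H' (um, ubar 0))) (at ((\<lambda>x. (um, ubar x)) 0))" using HD by simp
      from vector_derivative_diff_chain_within[OF has_vector_derivative_Pair[OF has_vector_derivative_const ubar_deriv[of 0]] has_derivative_at_withinI[OF this]]
      show ?thesis by (simp add: o_def)
    qed
    then have "((\<lambda>x. H (um, ubar x)) has_real_derivative h (du 0)) (at 0)"
      by (simp add: has_real_derivative_iff_has_vector_derivative h_def)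
    moreover have "H (um, ubar x) = H (um, ubar 0)" for x
      by (rule H[of UNIV]) (use wave in auto)
    ultimately have "h (du 0) = 0"
      using DERIV_local_const[of "\<lambda>x. H (um, ubar x)" "h (du 0)" 0 1] zero_less_one by metis
    then show "\<eta> \<bullet> axis i1 1 = 0" by (simp add: \<eta> du_0)
  qed
qed

text \<open>\<open>\<eta>\<close> annihilates the range of \<open>P1\<close>, but not
  \<open>zt T\<close>, as \<open>G\<close> is invertible. Hence whenever \<open>\<eta>\<close>
  annihilates \<open>G v\<close>, the coordinate \<open>i1\<close> of \<open>v\<close> vanishes, and
  on such vectors \<open>G\<close> and \<open>P1\<close> agree. This applies to the preimages of the
  columns of \<open>Qm T ** A0\<close> and of \<open>axis i1 1\<close>. The matrix
  \<open>\<Xi>\<close> gives the changes of \<open>u0\<close> that restore periodicity after a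
  change of \<open>um\<close>, with no change of \<open>s\<close> to first order.\<close>

lemma correction:
  assumes qh: "quasi_hamiltonian f B 0 um (ubar 0)" and G: "det G \<noteq> 0"
  obtains \<Xi> \<xi> where "\<And>j. \<Xi> $ i1 $ j = 0" "\<xi> $ i1 = 0" "P1 ** \<Xi> = Qm T ** A0" "P1 *v \<xi> = axis i1 1"
    "\<Xi> = matrix_inv G ** (Qm T ** A0)"
proof -
  obtain \<eta> where \<eta>: "\<eta> \<noteq> 0" "\<And>v. \<eta> \<bullet> (Qm T *v (A0 *v v)) = 0" "\<And>v. \<eta> \<bullet> (P1 *v v) = 0" "\<eta> \<bullet> axis i1 1 = 0"
    by (rule tangent[OF qh]) blast
  have inv: "invertible G" using G by (simp add: invertible_det_nz)
  have Gv: "G *v v = (v $ i1) *\<^sub>R zt T + P1 *v (v - (v $ i1) *\<^sub>R axis i1 1)" for v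
  proof -
    have "(G *v v) $ i = (v $ i1) * zt T $ i + (P1 *v (v - (v $ i1) *\<^sub>R axis i1 1)) $ i" for i
    proof -
      have "(G *v v) $ i = (\<Sum>j\<in>UNIV. (if j = i1 then zt T $ i * v $ i1 else 0) + P1 $ i $ j * (v - (v $ i1) *\<^sub>R axis i1 1) $ j)"
        unfolding matrix_vector_mult_def by (auto intro!: sum.cong simp: G_def axis_def)
      then show ?thesis by (simp add: sum.distrib matrix_vector_mult_def mult.commute)
    qed
    then show ?thesis by (simp add: vec_eq_iff)
  qed
  have \<eta>z: "\<eta> \<bullet> zt T \<noteq> 0"
  proof
    assume "\<eta> \<bullet> zt T = 0"
    then have "\<eta> \<bullet> (G *v v) = 0" for v by (simp add: Gv inner_add_right \<eta>(3))
    from this[of "matrix_inv G *v \<eta>"] have "\<eta> \<bullet> \<eta> = 0"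
      by (simp add: matrix_vector_mul_assoc matrix_inv_mult[OF inv])
    then show False using \<eta>(1) by simp
  qed
  have row0: "v $ i1 = 0" if "\<eta> \<bullet> (G *v v) = 0" for v
    using that \<eta>z by (simp add: Gv inner_add_right \<eta>(3))
  have GP: "G *v v = P1 *v v" if "v $ i1 = 0" for v using Gv[of v] that by simp
  define \<Xi> \<xi> where "\<Xi> = matrix_inv G ** (Qm T ** A0)" and "\<xi> = matrix_inv G *v axis i1 1"
  have G\<Xi>: "G *v (\<Xi> *v v) = Qm T *v (A0 *v v)" for v
    by (simp add: \<Xi>_def matrix_vector_mul_assoc matrix_mul_assoc matrix_inv_mult[OF inv])
  have G\<xi>: "G *v \<xi> = axis i1 1" by (simp add: \<xi>_def matrix_vector_mul_assoc matrix_inv_mult[OF inv])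
  have \<Xi>0: "(\<Xi> *v v) $ i1 = 0" for v by (rule row0) (simp add: G\<Xi> \<eta>)
  have \<xi>0: "\<xi> $ i1 = 0" by (rule row0) (simp add: G\<xi> \<eta>)
  show thesis
  proof (rule that[of \<Xi> \<xi>])
    show "\<Xi> $ i1 $ j = 0" for j using \<Xi>0[of "axis j 1"] by (simp add: mv_axis)
    show "\<xi> $ i1 = 0" by (rule \<xi>0)
    show "P1 *v \<xi> = axis i1 1" using GP[OF \<xi>0] G\<xi> by simp
    have "(P1 ** \<Xi>) *v v = (Qm T ** A0) *v v" for v
      using GP[OF \<Xi>0, of v] G\<Xi>[of v] by (simp add: matrix_vector_mul_assoc)
    then show "P1 ** \<Xi> = Qm T ** A0" by (simp add: matrix_eq)
  qed (rule \<Xi>_def)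
qed

text \<open>On the surface the jump vanishes, so to first order \<open>G\<close> applied to the
  change of \<open>(u0, s)\<close> equals \<open>Qm T ** A0\<close> applied to the change
  \<open>h\<close> of \<open>um\<close>, and inverting \<open>G\<close> gives
  \<open>\<Xi> *v h\<close>. As \<open>\<phi>\<close> is only known to be continuous, the quadratic
  error in the full parameter change must first be bounded through \<open>h\<close>.\<close>

lemma mass_jacobian:
  assumes qh: "quasi_hamiltonian f B 0 um (ubar 0)" and G: "det G \<noteq> 0"
    and surface: "periodic_surface U q0 T i1 \<phi>"
    and \<Xi>: "\<And>j. \<Xi> $ i1 $ j = 0" "\<Xi> = matrix_inv G ** (Qm T ** A0)"
  shows "jacobian (mass U T \<phi> (ubar 0 $ i1)) (at um) = IP ** \<Xi> - IQ ** A0"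
proof -
  interpret mv: bounded_bilinear "(*v) :: real^'n^'n \<Rightarrow> real^'n \<Rightarrow> real^'n" by (rule bilinear_mv)
  let ?a = "ubar 0 $ i1"
  have inv: "invertible G" using G by (simp add: invertible_det_nz)
  have \<phi>0: "\<phi> (um, ?a) = (ubar 0, 0)" and \<phi>c: "isCont \<phi> (um, ?a)"
    and \<phi>e: "\<forall>\<^sub>F (um', a) in nhds (um, ?a). fst (\<phi> (um', a)) $ i1 = a \<and> U (um', \<phi> (um', a)) T = fst (\<phi> (um', a))"
    using surface by (simp_all add: periodic_surface_def)
  obtain C \<delta> where C: "C \<ge> 0" "\<delta> > 0"
    "\<And>q x. norm (q - q0) < \<delta> \<Longrightarrow> x \<in> {0..T} \<Longrightarrow> norm (U q x - ubar x - Y (q - q0) x) \<le> C * (norm (q - q0))\<^sup>2"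
    "\<And>q. norm (q - q0) < \<delta> \<Longrightarrow> continuous_on {0..T} (U q)"
    using family_estimate[OF family] by metis
  obtain KP where KP: "KP \<ge> 0" "\<And>x v. x \<in> {0..T} \<Longrightarrow> norm (Pm x *v v) \<le> KP * norm v"
    by (rule bounded_mv_on_compact[OF cont_Pm compact_Icc]) blast
  have "bounded (zt ` {0..T})" by (intro compact_imp_bounded compact_continuous_image cont_zt compact_Icc)
  then obtain Kz where Kz: "Kz > 0" "\<And>x. x \<in> {0..T} \<Longrightarrow> norm (zt x) \<le> Kz" unfolding bounded_pos by blast
  obtain KG where KG: "KG > 0" "\<And>v. norm (matrix_inv G *v v) \<le> norm v * KG"
    using bounded_linear.pos_bounded[OF matrix_vector_mul_bounded_linear[of "matrix_inv G"]] by blast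
  obtain K\<Xi> where K\<Xi>: "K\<Xi> > 0" "\<And>v. norm (\<Xi> *v v) \<le> norm v * K\<Xi>"
    using bounded_linear.pos_bounded[OF matrix_vector_mul_bounded_linear[of \<Xi>]] by blast
  have cont: "((\<lambda>um'. (um', \<phi> (um', ?a))) \<longlongrightarrow> q0) (at um)"
  proof -
    have "((\<lambda>um'. (um', ?a)) \<longlongrightarrow> (um, ?a)) (at um)" by (intro tendsto_intros)
    then have "((\<lambda>um'. \<phi> (um', ?a)) \<longlongrightarrow> \<phi> (um, ?a)) (at um)" using \<phi>c by (rule isCont_tendsto_compose[rotated])
    then show ?thesis unfolding \<phi>0 by (intro tendsto_Pair tendsto_ident_at) simp
  qed
  define C1 where "C1 = real CARD('n) * (KG * C)"
  define n where "n = real CARD('n)"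
  have n: "n \<ge> 1" by (simp add: n_def Suc_le_eq)
  define \<epsilon> where "\<epsilon> = min \<delta> (1 / (4 * (n * KG * C + 1)))"
  have C1: "n * KG * C \<ge> 0" using n KG C by simp
  have \<epsilon>: "\<epsilon> > 0" using C C1 by (simp add: \<epsilon>_def)
  define M where "M = 2 * (1 + 2 * K\<Xi>)"
  define C2 where "C2 = KG * C * M\<^sup>2"
  have C2: "C2 \<ge> 0" using KG C by (simp add: C2_def)
  define C3 where "C3 = C * M\<^sup>2 + KP * (n * C2) + C2 * Kz"
  let ?m = "mass U T \<phi> ?a"
  let ?N = "IP ** \<Xi> - IQ ** A0"
  have m0: "?m um = integral {0..T} ubar"
    unfolding mass_def \<phi>0 by (rule integral_cong) (rule U_base)
  have est: "norm (?m um' - ?m um - ?N *v (um' - um)) \<le> C3 * T * (norm (um' - um))\<^sup>2"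
    if q: "norm ((um', \<phi> (um', ?a)) - q0) < \<epsilon>" and per: "fst (\<phi> (um', ?a)) $ i1 = ?a" "U (um', \<phi> (um', ?a)) T = fst (\<phi> (um', ?a))" for um'
  proof -
    obtain u0' s where \<phi>': "\<phi> (um', ?a) = (u0', s)" by (cases "\<phi> (um', ?a)")
    define q where "q = (um', u0', s)"
    define h d where "h = um' - um" and "d = u0' - ubar 0"
    have qd: "q - q0 = (h, d, s)" by (simp add: q_def h_def d_def)
    define r where "r = norm (q - q0)"
    have r: "0 \<le> r" "r < \<delta>" "r * (4 * (n * KG * C + 1)) \<le> 1"
    proof -
      have "r < \<epsilon>" using q by (simp add: r_def q_def \<phi>')
      then have "r < 1 / (4 * (n * KG * C + 1))" "r < \<delta>" by (simp_all add: \<epsilon>_def)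
      then show "r < \<delta>" "r * (4 * (n * KG * C + 1)) \<le> 1" using C1 by (simp_all add: pos_less_divide_eq)
    qed (simp add: r_def)
    have d1: "d $ i1 = 0" using per(1) by (simp add: d_def \<phi>')
    have T: "T \<in> {0..T}" using T_pos by simp
    have ubT: "ubar T = ubar 0" using periodic[of 0] by simp
    \<comment> \<open>One vector for both unknowns: \<open>d\<close> has no component along
      \<open>i1\<close>, so this slot is free for \<open>- s\<close>, matching the column
      \<open>zt T\<close> of \<open>G\<close>.\<close>
    define \<zeta> where "\<zeta> = d - s *\<^sub>R axis i1 1"
    have \<zeta>i: "\<zeta> $ i1 = - s" by (simp add: \<zeta>_def d1 axis_def)
    have G\<zeta>: "G *v \<zeta> = P1 *v d - s *\<^sub>R zt T"
    proof -
      have "(G *v \<zeta>) $ i = (\<Sum>j\<in>UNIV. (if j = i1 then - s * zt T $ i else 0) + P1 $ i $ j * d $ j)" for i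
        unfolding matrix_vector_mult_def by (auto intro!: sum.cong simp: G_def axis_def \<zeta>_def d1)
      then show ?thesis by (simp add: vec_eq_iff sum.distrib matrix_vector_mult_def)
    qed
    have "norm (U q T - ubar T - Y (q - q0) T) \<le> C * r\<^sup>2" using C(3)[of q T] r T by (simp add: r_def)
    moreover have "U q T - ubar T - Y (q - q0) T = - (G *v \<zeta> - Qm T *v (A0 *v h))"
      using per(2) by (simp add: q_def[symmetric] \<phi>' ubT qd Y_def A0_apply G\<zeta> P1_def mv.diff_left d_def)
    ultimately have "norm (G *v \<zeta> - Qm T *v (A0 *v h)) \<le> C * r\<^sup>2" by (simp only: norm_minus_cancel)
    then have "norm (G *v \<zeta> - Qm T *v (A0 *v h)) * KG \<le> C * r\<^sup>2 * KG" using KG by (intro mult_right_mono) auto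
    moreover have "matrix_inv G *v (G *v \<zeta> - Qm T *v (A0 *v h)) = \<zeta> - \<Xi> *v h"
      by (simp add: mv.diff_right matrix_vector_mul_assoc matrix_inv_mult[OF inv] \<Xi>(2) matrix_mul_assoc)
    ultimately have z1: "norm (\<zeta> - \<Xi> *v h) \<le> KG * C * r\<^sup>2"
      using KG(2)[of "G *v \<zeta> - Qm T *v (A0 *v h)"] by (simp add: mult_ac)
    have \<Xi>h: "(\<Xi> *v h) $ i1 = 0" by (simp add: matrix_vector_mult_def \<Xi>(1))
    have s: "\<bar>s\<bar> \<le> norm (\<zeta> - \<Xi> *v h)"
      using component_le_norm_cart[of "\<zeta> - \<Xi> *v h" i1] by (simp add: \<zeta>i \<Xi>h)
    have dle: "norm (d - \<Xi> *v h) \<le> norm (\<zeta> - \<Xi> *v h)"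
    proof (rule norm_le_componentwise_cart)
      show "norm ((d - \<Xi> *v h) $ i) \<le> norm ((\<zeta> - \<Xi> *v h) $ i)" for i
        by (cases "i = i1") (simp_all add: \<zeta>_def axis_def d1 \<Xi>h)
    qed
    \<comment> \<open>From continuity to a Lipschitz bound: by the choice of
      \<open>\<epsilon>\<close> the quadratic error is at most \<open>r / 2\<close> and can be
      absorbed.\<close>
    have rle: "r \<le> M * norm h"
    proof -
      have "r \<le> norm h + (norm d + \<bar>s\<bar>)"
        unfolding r_def qd using norm_Pair_le[of h "(d, s)"] norm_Pair_le[of d s] by simp
      also have "norm d \<le> norm (\<Xi> *v h) + norm (d - \<Xi> *v h)" using norm_triangle_ineq[of "\<Xi> *v h" "d - \<Xi> *v h"] by simp
      finally have "r \<le> norm h + norm h * K\<Xi> + 2 * (KG * C * r\<^sup>2)" using K\<Xi>(2)[of h] dle s z1 by linarith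
      moreover have "2 * (KG * C * r\<^sup>2) \<le> r / 2"
      proof -
        have "r * (4 * (KG * C)) \<le> r * (4 * (n * KG * C + 1))"
          using n KG C r mult_right_mono[OF n, of "KG * C"] by (intro mult_left_mono) (auto simp: mult_ac)
        then have "r * (4 * (KG * C)) \<le> 1" using r by linarith
        then have "r * (r * (4 * (KG * C))) \<le> r * 1" using r by (intro mult_left_mono)
        then show ?thesis by (simp add: power2_eq_square mult_ac)
      qed
      moreover have "r \<le> 2 * a" if "r \<le> a + b" "b \<le> r / 2" for a b using that by linarith
      ultimately have "r \<le> 2 * (norm h + norm h * K\<Xi>)" by blast
      also have "\<dots> \<le> M * norm h" using K\<Xi> by (simp add: M_def algebra_simps)
      finally show ?thesis .
    qed
    have r2: "r\<^sup>2 \<le> M\<^sup>2 * (norm h)\<^sup>2" using power_mono[OF rle r(1), of 2] by (simp add: power_mult_distrib)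
    have z2: "norm (\<zeta> - \<Xi> *v h) \<le> C2 * (norm h)\<^sup>2"
      using z1 mult_left_mono[OF r2, of "KG * C"] KG C by (simp add: C2_def mult_ac)
    have pw: "norm (U q x - ubar x - (Pm x *v (\<Xi> *v h) - Qm x *v (A0 *v h))) \<le> C3 * (norm h)\<^sup>2" if x: "x \<in> {0..T}" for x
    proof -
      have "U q x - ubar x - (Pm x *v (\<Xi> *v h) - Qm x *v (A0 *v h)) = (U q x - ubar x - Y (q - q0) x) + Pm x *v (d - \<Xi> *v h) - s *\<^sub>R zt x"
        by (simp add: qd Y_def A0_apply mv.diff_right)
      moreover have "norm (U q x - ubar x - Y (q - q0) x) \<le> C * (M\<^sup>2 * (norm h)\<^sup>2)"
        using C(3)[of q x] r x mult_left_mono[OF r2 C(1)] by (simp add: r_def)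
      moreover have "norm (Pm x *v (d - \<Xi> *v h)) \<le> KP * (n * C2) * (norm h)\<^sup>2"
      proof -
        have "norm (d - \<Xi> *v h) \<le> n * C2 * (norm h)\<^sup>2"
          using dle z2 mult_right_mono[OF n, of "C2 * (norm h)\<^sup>2"] C2 by (simp add: mult_ac)
        then show ?thesis using KP(2)[OF x, of "d - \<Xi> *v h"] mult_left_mono[of "norm (d - \<Xi> *v h)" "n * C2 * (norm h)\<^sup>2" KP] KP(1)
          by (simp add: mult_ac)
      qed
      moreover have "norm (s *\<^sub>R zt x) \<le> C2 * (norm h)\<^sup>2 * Kz"
        using s z2 Kz(1) Kz(2)[OF x] C2 by (auto intro!: mult_mono)
      ultimately show ?thesis
        unfolding C3_def by (smt (verit) norm_triangle_ineq norm_triangle_ineq4 distrib_right mult.assoc mult.commute)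
    qed
    have iN: "((\<lambda>x. Pm x *v (\<Xi> *v h) - Qm x *v (A0 *v h)) has_integral ?N *v h) {0..T}"
      using has_integral_diff[OF integral_mv[OF cont_Pm, of "\<Xi> *v h"] integral_mv[OF cont_Qm, of "A0 *v h"]]
      by (simp add: IP_def IQ_def mv.diff_left matrix_vector_mul_assoc)
    have cU: "continuous_on {0..T} (U q)" by (rule C(4)) (use r in \<open>simp add: r_def\<close>)
    have "?m um' - ?m um - ?N *v h = integral {0..T} (\<lambda>x. U q x - ubar x - (Pm x *v (\<Xi> *v h) - Qm x *v (A0 *v h)))"
    proof -
      have "((\<lambda>x. U q x - ubar x - (Pm x *v (\<Xi> *v h) - Qm x *v (A0 *v h))) has_integral
         integral {0..T} (U q) - integral {0..T} ubar - ?N *v h) {0..T}"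
        by (intro has_integral_diff iN integrable_integral integrable_continuous_interval cU cont_ubar)
      then show ?thesis unfolding m0 by (simp add: mass_def \<phi>' q_def integral_unique)
    qed
    also have "norm \<dots> \<le> C3 * (norm h)\<^sup>2 * (T - 0)"
      by (rule integral_bound) (use T_pos in \<open>auto intro!: continuous_intros cU cont_ubar cont_mv cont_Pm cont_Qm pw\<close>)
    finally show ?thesis by (simp add: h_def mult_ac)
  qed
  have ev: "\<forall>\<^sub>F um' in at um. norm (?m um' - ?m um - ?N *v (um' - um)) \<le> C3 * T * (norm (um' - um))\<^sup>2"
  proof -
    have 1: "\<forall>\<^sub>F um' in at um. norm ((um', \<phi> (um', ?a)) - q0) < \<epsilon>"
      using tendstoD[OF cont \<epsilon>] by (simp add: dist_norm)
    have "((\<lambda>um'. (um', ?a)) \<longlongrightarrow> (um, ?a)) (at um)" by (intro tendsto_intros)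
    from eventually_compose_filterlim[OF \<phi>e this]
    have 2: "\<forall>\<^sub>F um' in at um. fst (\<phi> (um', ?a)) $ i1 = ?a \<and> U (um', \<phi> (um', ?a)) T = fst (\<phi> (um', ?a))" by simp
    show ?thesis using 1 2 by eventually_elim (rule est; simp)
  qed
  have "(?m has_derivative (*v) ?N) (at um)"
  proof -
    obtain e where e: "e > 0" "\<And>um'. um' \<noteq> um \<Longrightarrow> dist um' um < e \<Longrightarrow> norm (?m um' - ?m um - ?N *v (um' - um)) \<le> C3 * T * (norm (um' - um))\<^sup>2"
      using ev unfolding eventually_at by auto
    show ?thesis
    proof (rule has_derivativeI_sandwich[where e=e and H="\<lambda>um'. C3 * T * norm (um' - um)"])
      show "bounded_linear ((*v) ?N)" by (rule matrix_vector_mul_bounded_linear)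
      show "norm (?m um' - ?m um - ?N *v (um' - um)) / norm (um' - um) \<le> C3 * T * norm (um' - um)" if "um' \<noteq> um" "dist um' um < e" for um'
        using e(2)[OF that] that by (simp add: field_simps power2_eq_square)
      have "((\<lambda>q. C3 * T * norm (q - um)) \<longlongrightarrow> C3 * T * norm (um - um)) (at um)" by (intro tendsto_intros)
      then show "((\<lambda>q. C3 * T * norm (q - um)) \<longlongrightarrow> 0) (at um)" by simp
    qed (use e in auto)
  qed
  then have "frechet_derivative ?m (at um) = (*v) ?N" by (metis frechet_derivative_at)
  then show ?thesis by (simp add: jacobian_def)
qed

end

section \<open>Nontriviality of the Evans function\<close>

lemma mat_spectrum_iff_det: "z \<in> mat_spectrum M \<longleftrightarrow> det (M - mat z) = 0"
proof -
  have "(M - mat z) *v v = 0 \<longleftrightarrow> M *v v = z *s v" for v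
    by (simp add: matrix_vector_mult_diff_rdistrib mat_mv)
  moreover have "det (M - mat z) \<noteq> 0 \<longleftrightarrow> (\<forall>v. (M - mat z) *v v = 0 \<longrightarrow> v = 0)"
    by (simp only: invertible_det_nz[symmetric] invertible_left_inverse matrix_left_invertible_ker)
  ultimately show ?thesis by (auto simp: mat_spectrum_def)
qed

lemma mat_spectrum_transpose: "mat_spectrum (transpose M) = mat_spectrum M"
proof -
  have "det (transpose M - mat z) = det (M - mat z)" for z
  proof -
    have "transpose M - mat z = transpose (M - mat z)" by (simp add: transpose_def vec_eq_iff mat_def)
    then show ?thesis by (simp only: det_transpose)
  qed
  then show ?thesis by (auto simp: mat_spectrum_iff_det)
qed

text \<open>The vector \<open>p(K) l\<close>, evaluated by Horner's scheme.\<close>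

definition matrix_poly_act :: "complex^'m^'m \<Rightarrow> complex^'m \<Rightarrow> complex poly \<Rightarrow> complex^'m" where
  "matrix_poly_act K l p = fold_coeffs (\<lambda>c w. c *s l + K *v w) p 0"

lemma matrix_poly_act_0: "matrix_poly_act K l 0 = 0"
  by (simp add: matrix_poly_act_def)

lemma matrix_poly_act_pCons: "matrix_poly_act K l (pCons c p) = c *s l + K *v matrix_poly_act K l p"
  by (cases "c = 0 \<and> p = 0") (auto simp: matrix_poly_act_def fold_coeffs_pCons_eq)

lemma matrix_poly_act_add: "matrix_poly_act K l (p + q) = matrix_poly_act K l p + matrix_poly_act K l q"
  by (induction p q rule: poly_induct2)
     (simp_all add: matrix_poly_act_0 matrix_poly_act_pCons matrix_vector_right_distrib vector_sadd_rdistrib add_ac)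

lemma matrix_poly_act_smult: "matrix_poly_act K l (smult c p) = c *s matrix_poly_act K l p"
  by (induction p)
     (simp_all add: matrix_poly_act_0 matrix_poly_act_pCons matrix_vector_mult_smult vector_add_ldistrib vector_smult_assoc)

lemma matrix_poly_act_root:
  "matrix_poly_act K l ([:- \<mu>, 1:] * q) = K *v matrix_poly_act K l q - \<mu> *s matrix_poly_act K l q"
proof -
  have "[:- \<mu>, 1:] * q = smult (- \<mu>) q + pCons 0 q" by simp
  then show ?thesis
    by (simp only: matrix_poly_act_add matrix_poly_act_smult matrix_poly_act_pCons) (simp add: vec_eq_iff)
qed

lemma matrix_poly_act_shift:
  "matrix_poly_act K (K *v l - \<mu> *s l) q = K *v matrix_poly_act K l q - \<mu> *s matrix_poly_act K l q"
proof (induction q)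
  case 0
  show ?case by (simp add: matrix_poly_act_0)
next
  case (pCons c q)
  show ?case
    unfolding matrix_poly_act_pCons pCons.IH
    by (simp add: matrix_vector_right_distrib matrix_vector_mult_diff_distrib matrix_vector_mult_smult
        vector_ssub_ldistrib vector_add_ldistrib vector_smult_assoc mult.commute algebra_simps)
qed

text \<open>More iterates \<open>K^i l\<close> than the real dimension are linearly dependent, and
  real coefficients are enough for a nonzero polynomial. Coinciding iterates are separated off
  because dependence is a property of the set of iterates.\<close>

lemma matrix_annihilating_poly:
  fixes K :: "complex^'m^'m"
  obtains p where "p \<noteq> 0" "matrix_poly_act K l p = 0"
proof -
  let ?k = "\<lambda>i. ((*v) K ^^ i) l"
  obtain S a where S: "finite S" "(\<Sum>i\<in>S. complex_of_real (a i) *s ?k i) = 0" "\<exists>i\<in>S. a i \<noteq> (0 :: real)"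
  proof (cases "inj ?k")
    case False
    then obtain i j where "i \<noteq> j" "?k i = ?k j" by (auto simp: inj_on_def)
    then show thesis
      by (intro that[of "{i, j}" "\<lambda>m. if m = i then 1 else - 1"]) (auto simp: vec_eq_iff)
  next
    case True
    let ?N = "DIM(complex^'m) + 1"
    have "card (?k ` {..<?N}) = ?N" using True by (simp add: card_image inj_on_subset)
    then have "dependent (?k ` {..<?N})" by (intro dependent_biggerset) auto
    then obtain u where u: "\<exists>v\<in>?k ` {..<?N}. u v \<noteq> 0" "(\<Sum>v\<in>?k ` {..<?N}. u v *\<^sub>R v) = 0"
      using dependent_finite[of "?k ` {..<?N}"] by auto
    have "(\<Sum>i<?N. complex_of_real (u (?k i)) *s ?k i) = (\<Sum>i<?N. u (?k i) *\<^sub>R ?k i)"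
      by (intro sum.cong refl) (simp add: vec_eq_iff scaleR_conv_of_real[where 'a=complex])
    also have "\<dots> = (\<Sum>v\<in>?k ` {..<?N}. u v *\<^sub>R v)"
      by (subst sum.reindex) (use True in \<open>auto intro: inj_on_subset\<close>)
    finally show thesis using u by (intro that[of "{..<?N}" "\<lambda>i. u (?k i)"]) auto
  qed
  have mono: "matrix_poly_act K l (monom c i) = c *s ?k i" for c i
    by (induction i)
       (simp_all add: monom_0 monom_Suc matrix_poly_act_pCons matrix_poly_act_0 matrix_vector_mult_smult)
  define p where "p = (\<Sum>i\<in>S. monom (complex_of_real (a i)) i)"
  have "matrix_poly_act K l (\<Sum>i\<in>F. monom (complex_of_real (a i)) i) = (\<Sum>i\<in>F. of_real (a i) *s ?k i)" if "finite F" for F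
    using that by (induction F rule: finite_induct) (simp_all add: matrix_poly_act_0 matrix_poly_act_add mono)
  then have "matrix_poly_act K l p = 0" using S by (simp add: p_def)
  moreover obtain i where "i \<in> S" "a i \<noteq> 0" using S(3) by auto
  then have "coeff p i \<noteq> 0" using S(1) by (simp add: p_def coeff_sum)
  then have "p \<noteq> 0" by auto
  ultimately show thesis using that by blast
qed

text \<open>Induction on the degree of a polynomial annihilating \<open>l\<close>. Splitting off a
  root \<open>\<mu>\<close> either replaces \<open>l\<close> by \<open>(K - \<mu>) l\<close>, or, if
  \<open>\<mu>\<close> is not an eigenvalue, the factor can be cancelled.\<close>

lemma generalized_eigenspace_induct:
  fixes K :: "complex^'m^'m"
  assumes 0: "P 0" and step: "\<And>\<mu> l. \<mu> \<in> mat_spectrum K \<Longrightarrow> P (K *v l - \<mu> *s l) \<Longrightarrow> P l"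
  shows "P l"
proof -
  let ?act = "matrix_poly_act K"
  have "P l" if "p \<noteq> 0" "?act l p = 0" "degree p = d" for p l d
    using that
  proof (induction d arbitrary: p l)
    case 0
    then obtain c where "p = [:c:]" "c \<noteq> 0" by (metis degree_0_id pCons_0_0)
    then have "l = 0" using 0 by (simp add: matrix_poly_act_pCons matrix_poly_act_0)
    then show ?case using assms(1) by simp
  next
    case (Suc d)
    obtain \<mu> where "poly p \<mu> = 0"
      using alg_closed_imp_poly_has_root[of p] Suc.prems by auto
    then obtain q where q: "p = [:- \<mu>, 1:] * q" by (auto simp: poly_eq_0_iff_dvd)
    have q1: "q \<noteq> 0" using Suc.prems(1) q by auto
    have "degree p = Suc (degree q)" unfolding q using q1 by (subst degree_mult_eq) auto
    then have q0: "q \<noteq> 0" "degree q = d" using Suc.prems q1 by auto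
    have k: "K *v ?act l q - \<mu> *s ?act l q = 0" using Suc.prems(2) by (simp only: q matrix_poly_act_root)
    show ?case
    proof (cases "\<mu> \<in> mat_spectrum K")
      case True
      have "P (K *v l - \<mu> *s l)" by (rule Suc.IH[OF q0(1) _ q0(2)]) (simp only: matrix_poly_act_shift k)
      then show ?thesis by (rule step[OF True])
    next
      case False
      then have "?act l q = 0" using k by (auto simp: mat_spectrum_def)
      then show ?thesis by (rule Suc.IH[OF q0(1) _ q0(2)])
    qed
  qed
  moreover obtain p where "p \<noteq> 0" "?act l p = 0" by (rule matrix_annihilating_poly[of K l]) blast
  ultimately show ?thesis by blast
qed

section \<open>Periodic functions and nearly hyperbolic equations\<close>

lemma periodic_multiple:
  fixes h :: "real \<Rightarrow> 'a"
  assumes h: "\<And>x. h (x + T) = h x"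
  shows "h (x + of_nat k * T) = h x"
proof (induction k)
  case (Suc k)
  have "x + of_nat (Suc k) * T = (x + of_nat k * T) + T" by (simp add: algebra_simps)
  then show ?case using h[of "x + of_nat k * T"] Suc by (simp add: add.assoc)
qed simp

lemma periodic_representative:
  fixes h :: "real \<Rightarrow> 'a"
  assumes T: "T > 0" and h: "\<And>x. h (x + T) = h x"
  obtains x' where "x' \<in> {0..T}" "h x' = h x"
proof -
  note mult = periodic_multiple[of h T, OF h]
  define k where "k = \<lfloor>x / T\<rfloor>"
  define x' where "x' = x - of_int k * T"
  have "x' \<in> {0..T}"
  proof -
    have "of_int k \<le> x / T" "x / T \<le> of_int k + 1" by (simp_all add: k_def)
    then show ?thesis using T by (simp add: x'_def field_simps)
  qed
  moreover have "h x' = h x"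
  proof (cases "k \<ge> 0")
    case True
    then have "x = x' + of_nat (nat k) * T" by (simp add: x'_def)
    then show ?thesis using mult[of x' "nat k"] by simp
  next
    case False
    then have "x' = x + of_nat (nat (- k)) * T" by (simp add: x'_def)
    then show ?thesis using mult[of x "nat (- k)"] by simp
  qed
  ultimately show thesis by (rule that)
qed

text \<open>Duhamel's formula over a time window of length \<open>S\<close>, started on the side
  from which the equation contracts: the bound \<open>K\<close> at its far end decays exponentially
  and the forcing contributes at most \<open>\<delta> / \<bar>Re \<mu>\<bar>\<close>. Positive real
  part is reduced to negative by reversing time.\<close>

lemma hyperbolic_scalar_estimate:
  fixes g g' :: "real \<Rightarrow> complex"
  assumes g: "\<And>s. (g has_vector_derivative g' s) (at s)" and K: "\<And>s. norm (g s) \<le> K"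
    and \<delta>: "\<And>s. \<bar>s\<bar> \<le> R + S \<Longrightarrow> norm (g' s - \<mu> * g s) \<le> \<delta>"
    and \<mu>: "Re \<mu> \<noteq> 0" and S: "S > 0" and t: "\<bar>t\<bar> \<le> R"
  shows "norm (g t) \<le> K * exp (- \<bar>Re \<mu>\<bar> * S) + \<delta> / \<bar>Re \<mu>\<bar>"
proof -
  have neg: "norm (g t) \<le> K * exp (- \<bar>Re \<mu>\<bar> * S) + \<delta> / \<bar>Re \<mu>\<bar>"
    if g: "\<And>s. (g has_vector_derivative g' s) (at s)" and K: "\<And>s. norm (g s) \<le> K"
    and \<delta>: "\<And>s. \<bar>s\<bar> \<le> R + S \<Longrightarrow> norm (g' s - \<mu> * g s) \<le> \<delta>"
    and \<mu>: "Re \<mu> < 0" and t: "\<bar>t\<bar> \<le> R" for g g' :: "real \<Rightarrow> complex" and \<mu> t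
  proof -
    define h where "h = - Re \<mu>"
    have h: "h > 0" "Re \<mu> = - h" "\<bar>Re \<mu>\<bar> = h" using \<mu> by (auto simp: h_def)
    have \<delta>0: "\<delta> \<ge> 0" using \<delta>[of 0] t S by (smt (verit) norm_ge_zero)
    \<comment> \<open>\<open>\<phi>\<close> is \<open>g\<close> with the integrating factor,
      normalized at \<open>t\<close>; the increments of \<open>\<psi>\<close> dominate those of
      \<open>\<phi>\<close>.\<close>
    define \<phi> where "\<phi> s = exp (- \<mu> * of_real (s - t)) * g s" for s
    define \<psi> where "\<psi> s = \<delta> / h * exp (h * (s - t))" for s
    have e: "((\<lambda>s. exp (- \<mu> * of_real (s - t))) has_vector_derivative - \<mu> * exp (- \<mu> * of_real (s - t))) (at s)" for s
    proof -
      have "((\<lambda>z. exp (- \<mu> * (z - of_real t))) has_field_derivative - \<mu> * exp (- \<mu> * (of_real s - of_real t))) (at (of_real s))"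
        by (auto intro!: derivative_eq_intros)
      from has_vector_derivative_real_field[OF this] show ?thesis by simp
    qed
    have \<phi>d: "(\<phi> has_vector_derivative exp (- \<mu> * of_real (s - t)) * (g' s - \<mu> * g s)) (at s)" for s
      unfolding \<phi>_def[abs_def]
      using has_vector_derivative_mult[OF e[of s] g[of s]] by (simp add: algebra_simps)
    have \<psi>d: "(\<psi> has_vector_derivative \<delta> * exp (h * (s - t))) (at s)" for s
    proof -
      have "(\<psi> has_real_derivative \<delta> * exp (h * (s - t))) (at s)"
        unfolding \<psi>_def[abs_def] using h by (auto intro!: derivative_eq_intros)
      then show ?thesis by (simp add: has_real_derivative_iff_has_vector_derivative)
    qed
    have "norm (\<phi> t - \<phi> (t - S)) \<le> \<psi> t - \<psi> (t - S)"
    proof (rule differentiable_bound_general[where f'="\<lambda>s. exp (- \<mu> * of_real (s - t)) * (g' s - \<mu> * g s)" and \<phi>'="\<lambda>s. \<delta> * exp (h * (s - t))"])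
      show "t - S < t" using S by simp
      show "continuous_on {t - S..t} \<phi>" "continuous_on {t - S..t} \<psi>"
        by (rule continuous_on_vector_derivative[OF has_vector_derivative_at_within[OF \<phi>d]])
           (rule continuous_on_vector_derivative[OF has_vector_derivative_at_within[OF \<psi>d]])
      show "(\<phi> has_vector_derivative exp (- \<mu> * of_real (s - t)) * (g' s - \<mu> * g s)) (at s)" for s by (rule \<phi>d)
      show "(\<psi> has_vector_derivative \<delta> * exp (h * (s - t))) (at s)" for s by (rule \<psi>d)
      fix s assume s: "t - S < s" "s < t"
      have "norm (g' s - \<mu> * g s) \<le> \<delta>" by (rule \<delta>) (use s t in linarith)
      then show "norm (exp (- \<mu> * of_real (s - t)) * (g' s - \<mu> * g s)) \<le> \<delta> * exp (h * (s - t))"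
        by (simp add: norm_mult h mult.commute mult_left_mono)
    qed
    moreover have "\<phi> t = g t" by (simp add: \<phi>_def)
    moreover have "norm (\<phi> (t - S)) \<le> K * exp (- h * S)"
      using K[of "t - S"] by (simp add: \<phi>_def norm_mult h mult.commute mult_left_mono)
    moreover have "\<psi> (t - S) \<ge> 0" "\<psi> t = \<delta> / h" using \<delta>0 h by (simp_all add: \<psi>_def)
    moreover have "norm (\<phi> t) \<le> norm (\<phi> (t - S)) + norm (\<phi> t - \<phi> (t - S))" using norm_triangle_ineq[of "\<phi> (t - S)" "\<phi> t - \<phi> (t - S)"] by simp
    ultimately show ?thesis unfolding h(3) by simp
  qed
  show ?thesis
  proof (cases "Re \<mu> < 0")
    case True
    then show ?thesis by (intro neg[OF g K \<delta> _ t])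
  next
    case False
    have "norm ((\<lambda>s. g (- s)) (- t)) \<le> K * exp (- \<bar>Re (- \<mu>)\<bar> * S) + \<delta> / \<bar>Re (- \<mu>)\<bar>"
    proof (rule neg[where g="\<lambda>s. g (- s)" and g'="\<lambda>s. - g' (- s)" and \<mu>="- \<mu>" and t="- t"])
      show "((\<lambda>s. g (- s)) has_vector_derivative - g' (- s)) (at s)" for s
      proof -
        have "(uminus has_vector_derivative - 1) (at s)"
          by (auto intro!: derivative_eq_intros simp: has_vector_derivative_def)
        from vector_diff_chain_at[OF this g[of "- s"]] show ?thesis by (simp add: o_def)
      qed
      show "norm (- g' (- s) - - \<mu> * g (- s)) \<le> \<delta>" if "\<bar>s\<bar> \<le> R + S" for s
        using \<delta>[of "- s"] that by (simp add: norm_minus_commute)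
    qed (use K t \<mu> False in auto)
    then show ?thesis by simp
  qed
qed

text \<open>The limit equation \<open>V' = J V\<close> has no bounded solution other than zero. To avoid extracting a
  limit, each coordinate along a generalized left eigenvector of \<open>J\<close> is estimated separately.\<close>
lemma hyperbolic_blowup:
  fixes J :: "complex^'m^'m" and V V' :: "nat \<Rightarrow> real \<Rightarrow> complex^'m"
  assumes hyp: "\<And>\<mu>. \<mu> \<in> mat_spectrum J \<Longrightarrow> Re \<mu> \<noteq> 0"
    and V: "\<And>n t. (V n has_vector_derivative V' n t) (at t)" and bound: "\<And>n t. norm (V n t) \<le> 1"
    and approx: "\<And>R \<epsilon>. \<epsilon> > 0 \<Longrightarrow> \<forall>\<^sub>F n in sequentially. \<forall>t. \<bar>t\<bar> \<le> R \<longrightarrow> norm (V' n t - J *v V n t) \<le> \<epsilon>"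
  shows "(\<lambda>n. V n 0) \<longlonglongrightarrow> 0"
proof -
  define dot :: "complex^'m \<Rightarrow> complex^'m \<Rightarrow> complex" where "dot l v = (\<Sum>i\<in>UNIV. l $ i * v $ i)" for l v
  \<comment> \<open>The coordinate along \<open>l\<close> tends to 0 uniformly on bounded intervals.
    The uniformity is needed because in the induction this coordinate becomes the forcing of the
    next one on a longer interval.\<close>
  define P where "P l \<longleftrightarrow> (\<forall>R \<epsilon>. \<epsilon> > 0 \<longrightarrow> (\<forall>\<^sub>F n in sequentially. \<forall>t. \<bar>t\<bar> \<le> R \<longrightarrow> norm (dot l (V n t)) \<le> \<epsilon>))" for l
  have dot_le: "norm (dot l v) \<le> (\<Sum>i\<in>UNIV. norm (l $ i)) * norm v" for l v
  proof -
    have "norm (dot l v) \<le> (\<Sum>i\<in>UNIV. norm (l $ i) * norm (v $ i))"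
      unfolding dot_def by (rule order_trans[OF norm_sum]) (simp add: norm_mult)
    also have "\<dots> \<le> (\<Sum>i\<in>UNIV. norm (l $ i) * norm v)"
      by (intro sum_mono mult_left_mono Finite_Cartesian_Product.norm_nth_le) auto
    finally show ?thesis by (simp add: sum_distrib_right)
  qed
  have dot_sub: "dot l (v - w) = dot l v - dot l w" "dot (l - l') v = dot l v - dot l' v" "dot (c *s l) v = c * dot l v" for l l' v w c
    by (simp_all add: dot_def algebra_simps sum_subtractf sum_distrib_left)
  have dot_J: "dot l (J *v v) = dot (transpose J *v l) v" for l v
    unfolding dot_def matrix_vector_mult_def transpose_def
    by (simp add: sum_distrib_left sum_distrib_right mult_ac) (rule sum.swap)
  have "P l" for l
  proof (rule generalized_eigenspace_induct[where K="transpose J" and P=P])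
    show "P 0" by (simp add: P_def dot_def)
    fix \<mu> l assume \<mu>: "\<mu> \<in> mat_spectrum (transpose J)" and IH: "P (transpose J *v l - \<mu> *s l)"
    have re: "Re \<mu> \<noteq> 0" using \<mu> hyp by (simp add: mat_spectrum_transpose)
    define K where "K = (\<Sum>i\<in>UNIV. norm (l $ i))"
    have K: "K \<ge> 0" by (simp add: K_def sum_nonneg)
    show "P l"
      unfolding P_def
    proof (intro allI impI)
      fix R \<epsilon> :: real assume \<epsilon>: "\<epsilon> > 0"
      define d where "d = \<bar>Re \<mu>\<bar>"
      have d: "d > 0" using re by (simp add: d_def)
      have lim: "((\<lambda>S. K * exp (- d * S)) \<longlongrightarrow> 0) at_top" using d by real_asymp
      have "\<forall>\<^sub>F S in at_top. K * exp (- d * S) < \<epsilon> / 2" by (rule order_tendstoD(2)[OF lim]) (use \<epsilon> in simp)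
      moreover have "\<forall>\<^sub>F S in at_top. S > (0::real)" by (rule eventually_gt_at_top)
      ultimately have "\<forall>\<^sub>F S in at_top. K * exp (- d * S) < \<epsilon> / 2 \<and> S > 0" by (rule eventually_conj)
      then obtain S where S: "K * exp (- d * S) < \<epsilon> / 2" "S > 0"
        using eventually_happens[of _ "at_top :: real filter"] by auto
      \<comment> \<open>The forcing consists of \<open>K \<epsilon>1\<close> from the approximate
        equation and \<open>\<epsilon>1\<close> from the coordinate already treated; divided by
        \<open>d\<close> they amount to \<open>\<epsilon> / 2\<close>, and \<open>S\<close> makes
        the other term smaller than \<open>\<epsilon> / 2\<close>.\<close>
      define \<epsilon>1 where "\<epsilon>1 = (\<epsilon> * d / 2) / (K + 1)"
      have \<epsilon>1: "\<epsilon>1 > 0" "(K + 1) * \<epsilon>1 / d = \<epsilon> / 2"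
      proof -
        have K1: "K + 1 > 0" using K by linarith
        then show "\<epsilon>1 > 0" using \<epsilon> d by (simp add: \<epsilon>1_def)
        have K1': "K + 1 \<noteq> 0" using K1 by simp
        have "(K + 1) * \<epsilon>1 = \<epsilon> * d / 2"
        proof -
          have "c * (a / c) = a" if "c \<noteq> 0" for a c :: real using that by simp
          then show ?thesis unfolding \<epsilon>1_def using K1' by blast
        qed
        then show "(K + 1) * \<epsilon>1 / d = \<epsilon> / 2" using d by simp
      qed
      have "\<forall>\<^sub>F n in sequentially. \<forall>t. \<bar>t\<bar> \<le> R + S \<longrightarrow> norm (V' n t - J *v V n t) \<le> \<epsilon>1"
        by (rule approx[OF \<epsilon>1(1)])
      moreover have "\<forall>\<^sub>F n in sequentially. \<forall>t. \<bar>t\<bar> \<le> R + S \<longrightarrow> norm (dot (transpose J *v l - \<mu> *s l) (V n t)) \<le> \<epsilon>1"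
        using IH \<epsilon>1(1) unfolding P_def by blast
      ultimately show "\<forall>\<^sub>F n in sequentially. \<forall>t. \<bar>t\<bar> \<le> R \<longrightarrow> norm (dot l (V n t)) \<le> \<epsilon>"
      proof (eventually_elim, intro allI impI)
        fix n t assume a: "\<forall>t. \<bar>t\<bar> \<le> R + S \<longrightarrow> norm (V' n t - J *v V n t) \<le> \<epsilon>1"
          and b: "\<forall>t. \<bar>t\<bar> \<le> R + S \<longrightarrow> norm (dot (transpose J *v l - \<mu> *s l) (V n t)) \<le> \<epsilon>1" and t: "\<bar>t\<bar> \<le> R"
        have "norm ((\<lambda>s. dot l (V n s)) t) \<le> K * exp (- \<bar>Re \<mu>\<bar> * S) + (K + 1) * \<epsilon>1 / \<bar>Re \<mu>\<bar>"
        proof (rule hyperbolic_scalar_estimate[OF _ _ _ re S(2) t])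
          show "((\<lambda>s. dot l (V n s)) has_vector_derivative dot l (V' n s)) (at s)" for s
            unfolding dot_def
            by (intro has_vector_derivative_sum bounded_linear.has_vector_derivative[OF bounded_linear_mult_right] has_vector_derivative_vec_nth V)
          show "norm (dot l (V n s)) \<le> K" for s
            using dot_le[of l "V n s"] bound[of n s] mult_left_mono[OF bound[of n s] K] by (simp add: K_def)
          fix s assume s: "\<bar>s\<bar> \<le> R + S"
          have "dot l (V' n s) - \<mu> * dot l (V n s) = dot l (V' n s - J *v V n s) + dot (transpose J *v l - \<mu> *s l) (V n s)"
            by (simp add: dot_sub dot_J)
          moreover have "norm (dot l (V' n s - J *v V n s)) \<le> K * \<epsilon>1"
            using dot_le[of l "V' n s - J *v V n s"] mult_left_mono[OF a[rule_format, OF s] K] by (simp add: K_def)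
          moreover have "norm (dot (transpose J *v l - \<mu> *s l) (V n s)) \<le> \<epsilon>1" using b s by blast
          ultimately have "norm (dot l (V' n s) - \<mu> * dot l (V n s)) \<le> K * \<epsilon>1 + \<epsilon>1"
            by (smt (verit) norm_triangle_ineq)
          then show "norm (dot l (V' n s) - \<mu> * dot l (V n s)) \<le> (K + 1) * \<epsilon>1" by (simp add: algebra_simps)
        qed
        then show "norm (dot l (V n t)) \<le> \<epsilon>" using S(1) \<epsilon>1(2) by (simp add: d_def)
      qed
    qed
  qed
  note P = this
  have "(\<lambda>n. V n 0 $ i) \<longlonglongrightarrow> 0" for i
  proof (rule tendstoI)
    fix e :: real assume "e > 0"
    then have "\<forall>\<^sub>F n in sequentially. \<forall>t. \<bar>t\<bar> \<le> 0 \<longrightarrow> norm (dot (axis i 1) (V n t)) \<le> e / 2"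
      using P[of "axis i 1"] unfolding P_def by (meson half_gt_zero)
    then show "\<forall>\<^sub>F n in sequentially. dist (V n 0 $ i) 0 < e"
    proof eventually_elim
      case (elim n)
      have "dot (axis i 1) (V n 0) = V n 0 $ i"
        by (simp add: dot_def axis_def if_distrib[of "\<lambda>x. x * _"] cong: if_cong)
      then show ?case using elim \<open>e > 0\<close> by auto
    qed
  qed
  then show ?thesis by (intro vec_tendstoI) simp
qed

context wave_evans
begin

text \<open>Otherwise there is a periodic solution for every \<open>\<lambda> = \<Lambda>\<^sup>2\<close>. In the variables \<open>(w, y / \<Lambda>)\<close>, on
  the length scale \<open>1 / \<Lambda>\<close> and centred at its maximum, it solves a perturbation of the equation with
  constant matrix \<open>((0, B\<^sup>-\<^sup>1), (1, 0))\<close>, whose eigenvalues \<open>\<mu>\<close> satisfy \<open>1 / \<mu>\<^sup>2 \<in> \<sigma>(B)\<close> and so are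
  never imaginary.\<close>
lemma Dc_nontrivial: "\<exists>z. Dc 0 z \<noteq> 0"
proof (rule ccontr)
  assume "\<not> (\<exists>z. Dc 0 z \<noteq> 0)"
  then have zero: "det (\<Phi> z T - mat 1) = 0" for z by (simp add: Dc_def)
  define \<Lambda> where "\<Lambda> n = real (Suc n)" for n
  have \<Lambda>: "\<Lambda> n \<ge> 1" for n by (simp add: \<Lambda>_def)
  have \<Lambda>0: "complex_of_real (\<Lambda> n) \<noteq> 0" for n using \<Lambda>[of n] by auto
  define lam where "lam n = complex_of_real (\<Lambda> n) * of_real (\<Lambda> n)" for n
  have "\<exists>v. v \<noteq> 0 \<and> \<Phi> (lam n) T *v v = v" for n
    using zero[of "lam n"] mat_spectrum_iff_det[of 1 "\<Phi> (lam n) T"] by (auto simp: mat_spectrum_def)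
  then obtain v where v: "\<And>n. v n \<noteq> 0" "\<And>n. \<Phi> (lam n) T *v v n = v n" by metis
  define z where "z n x = \<Phi> (lam n) x *v v n" for n x
  have zd: "(z n has_vector_derivative CF (lam n) x *v z n x) (at x)" for n x
    unfolding z_def[abs_def] by (rule \<Phi>_mv_deriv)
  have per: "z n (x + T) = z n x" for n x
    using \<Phi>_floquet[of "lam n" "v n" 1 x] v(2)[of n] by (simp add: z_def)
  \<comment> \<open>Scaling the flux by \<open>1 / \<Lambda>\<close> balances the two couplings:
    both off-diagonal blocks become of order \<open>\<Lambda>\<close>, whereas \<open>A\<close>
    stays of order one.\<close>
  define Dm where "Dm n = block (mat 1 :: complex^'n^'n) 0 0 (mat (1 / complex_of_real (\<Lambda> n)) :: complex^'n^'n)" for n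
  define g where "g n x = Dm n *v z n x" for n x
  define J0 where "J0 x = block 0 (cmat (Bi x)) (mat 1) 0" for x
  define E where "E x = block (cmat (Bi x) ** cmat (A x)) 0 0 (0 :: complex^'n^'n)" for x
  have gd: "(g n has_vector_derivative \<Lambda> n *\<^sub>R (J0 x *v g n x) + E x *v g n x) (at x)" for n x
  proof -
    have "(g n has_vector_derivative Dm n *v (CF (lam n) x *v z n x)) (at x)"
      unfolding g_def[abs_def] using hvd_mv[OF has_vector_derivative_const[of "Dm n"] zd[of n x]] by simp
    moreover have "Dm n *v (CF (lam n) x *v z n x) = \<Lambda> n *\<^sub>R (J0 x *v g n x) + E x *v g n x"
    proof -
      obtain a b where z: "z n x = vjoin a b" using vjoin_split by blast
      show ?thesis
        unfolding g_def z
        by (simp add: Dm_def CF_def J0_def E_def block_mv mat_mv matrix_vector_mult_smult matrix_vector_mul_assoc[symmetric])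
           (use \<Lambda>0[of n] in \<open>simp add: vec_sum_eq_iff scaleR_conv_of_real[where 'a=complex] lam_def\<close>)
    qed
    ultimately show ?thesis by simp
  qed
  have cg: "continuous_on S (g n)" for S n
    by (rule continuous_on_vector_derivative) (blast intro: gd has_vector_derivative_at_within)
  have gper: "g n (x + T) = g n x" for n x by (simp add: g_def per)
  have "\<exists>x\<in>{0..T}. \<forall>y\<in>{0..T}. norm (g n y) \<le> norm (g n x)" for n
    using T_pos by (intro continuous_attains_sup continuous_intros cg) auto
  then obtain xm where xm: "\<And>n. xm n \<in> {0..T}" "\<And>n y. y \<in> {0..T} \<Longrightarrow> norm (g n y) \<le> norm (g n (xm n))" by metis
  have gmax: "norm (g n y) \<le> norm (g n (xm n))" for n y
  proof -
    obtain y' where "y' \<in> {0..T}" "g n y' = g n y" by (rule periodic_representative[of T "g n" y, OF T_pos gper])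
    then show ?thesis using xm(2)[of y' n] by simp
  qed
  have gpos: "norm (g n (xm n)) > 0" for n
  proof -
    have "g n 0 \<noteq> 0"
    proof
      assume "g n 0 = 0"
      then have "z n 0 = 0"
        unfolding g_def by (subst (asm) vjoin_split[of "z n 0"])
          (use \<Lambda>0[of n] in \<open>simp add: Dm_def block_mv mat_mv vec_sum_eq_iff\<close>)
      then show False using v(1)[of n] by (simp add: z_def \<Phi>_0)
    qed
    then show ?thesis using gmax[of n 0] by (smt (verit) zero_less_norm_iff)
  qed
  \<comment> \<open>A subsequence along which the maximum points converge allows the coefficient
    matrix to be frozen at \<open>xs\<close>.\<close>
  obtain xs r where xs: "xs \<in> {0..T}" and r: "strict_mono r" and lim: "(xm \<circ> r) \<longlonglongrightarrow> xs"
    using compact_imp_seq_compact[OF compact_Icc[of 0 T]] xm(1) unfolding seq_compact_def by metis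
  \<comment> \<open>Centering and normalizing at the maximum bounds \<open>V\<close> by 1 and gives
    it norm 1 at \<open>t = 0\<close>, which contradicts convergence to 0.\<close>
  define V where "V n t = (1 / norm (g (r n) (xm (r n)))) *\<^sub>R g (r n) (xm (r n) + t / \<Lambda> (r n))" for n t
  define X where "X n t = xm (r n) + t / \<Lambda> (r n)" for n t
  define V' where "V' n t = J0 (X n t) *v V n t + (1 / \<Lambda> (r n)) *\<^sub>R (E (X n t) *v V n t)" for n t
  have Vb: "norm (V n t) \<le> 1" for n t
    using gmax[of "r n" "xm (r n) + t / \<Lambda> (r n)"] gpos[of "r n"] by (simp add: V_def field_simps)
  have V0: "norm (V n 0) = 1" for n using gpos[of "r n"] by (simp add: V_def)
  have Vd: "(V n has_vector_derivative V' n t) (at t)" for n t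
  proof -
    have "\<Lambda> (r n) \<noteq> 0" using \<Lambda>[of "r n"] by linarith
    then have "((\<lambda>t. xm (r n) + t / \<Lambda> (r n)) has_vector_derivative 1 / \<Lambda> (r n)) (at t)"
      by (auto intro!: derivative_eq_intros simp: has_vector_derivative_def)
    from vector_diff_chain_at[OF this gd]
    have "((\<lambda>t. g (r n) (X n t)) has_vector_derivative
        (1 / \<Lambda> (r n)) *\<^sub>R (\<Lambda> (r n) *\<^sub>R (J0 (X n t) *v g (r n) (X n t)) + E (X n t) *v g (r n) (X n t))) (at t)"
      by (simp add: o_def X_def)
    note bounded_linear.has_vector_derivative[OF bounded_linear_scaleR_right[of "1 / norm (g (r n) (xm (r n)))"] this]
    moreover have "M *v (c *\<^sub>R b) = c *\<^sub>R (M *v b)" for M :: "complex^('n+'n)^('n+'n)" and c b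
      by (rule bounded_bilinear.scaleR_right[OF bilinear_mv])
    ultimately show ?thesis
      using \<Lambda>[of "r n"] by (simp add: V_def[abs_def] V'_def X_def scaleR_add_right mult.commute)
  qed
  have cJ: "continuous_on UNIV J0"
    unfolding J0_def[abs_def] by (intro continuous_on_block continuous_on_cmat cont_Bi continuous_intros)
  have cE: "continuous_on S E" for S
    unfolding E_def[abs_def] by (intro continuous_on_block cont_mm continuous_on_cmat cont_Bi cont_A continuous_intros)
  obtain Km where Km: "Km > 0" "\<And>(a::complex^('n+'n)^('n+'n)) b. norm (a *v b) \<le> norm a * norm b * Km"
    using bounded_bilinear.pos_bounded[OF bilinear_mv] by blast
  have "(\<lambda>n. V n 0) \<longlonglongrightarrow> 0"
  proof (rule hyperbolic_blowup[where J="J0 xs", OF _ Vd Vb])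
    show "Re \<mu> \<noteq> 0" if \<mu>: "\<mu> \<in> mat_spectrum (J0 xs)" for \<mu>
    proof
      assume re: "Re \<mu> = 0"
      obtain u where u: "u \<noteq> 0" "J0 xs *v u = \<mu> *s u" using \<mu> by (auto simp: mat_spectrum_def)
      obtain a b where ab: "u = vjoin a b" using vjoin_split by blast
      have "vjoin (cmat (Bi xs) *v b) a = \<mu> *s vjoin a b" using u(2) by (simp add: ab J0_def block_mv)
      then have eq: "cmat (Bi xs) *v b = \<mu> *s a" "a = \<mu> *s b" by (simp_all add: vec_sum_eq_iff) (simp_all add: vec_eq_iff)
      have b0: "b \<noteq> 0" using u(1) eq(2) by (auto simp: ab vec_sum_eq_iff)
      have "b = cmat (Bx xs) *v (cmat (Bi xs) *v b)"
        by (simp add: matrix_vector_mul_assoc cmat_mult[symmetric] Bi_mult cmat_mat)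
      also have "\<dots> = (\<mu> * \<mu>) *s (cmat (Bx xs) *v b)"
        unfolding eq by (simp add: vec_eq_iff matrix_vector_mult_def sum_distrib_left mult_ac)
      finally have b: "b = (\<mu> * \<mu>) *s (cmat (Bx xs) *v b)" .
      have \<mu>0: "\<mu> \<noteq> 0" using b b0 by auto
      have "cmat (Bx xs) *v b = (1 / (\<mu> * \<mu>)) *s b"
        by (subst (2) b) (use \<mu>0 in \<open>simp add: vec_eq_iff\<close>)
      then have "1 / (\<mu> * \<mu>) \<in> mat_spectrum (cmat (B (ubar xs)))" using b0 by (auto simp: mat_spectrum_def Bx_def)
      from pos[OF this] have "Re (1 / (\<mu> * \<mu>)) > 0" .
      moreover have "\<mu> = \<i> * of_real (Im \<mu>)" using re by (simp add: complex_eq_iff)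
      then have "\<mu> * \<mu> = of_real (- (Im \<mu> * Im \<mu>))" by (metis (no_types, lifting) i_squared mult.assoc mult.left_commute mult_minus1 of_real_minus of_real_mult)
      then have "Re (1 / (\<mu> * \<mu>)) = 1 / (- (Im \<mu> * Im \<mu>))" by (metis Re_complex_of_real of_real_1 of_real_divide)
      ultimately show False by (simp add: zero_less_divide_iff not_less)
    qed
    fix R \<epsilon> :: real assume \<epsilon>: "\<epsilon> > 0"
    obtain KE where KE: "KE \<ge> 0" "\<And>x u. x \<in> {- \<bar>R\<bar>..T + \<bar>R\<bar>} \<Longrightarrow> norm (E x *v u) \<le> KE * norm u"
      by (rule bounded_mv_on_compact[OF cE compact_Icc]) blast
    obtain \<eta> where \<eta>: "\<eta> > 0" "\<And>x. dist x xs < \<eta> \<Longrightarrow> dist (J0 x) (J0 xs) < \<epsilon> / (2 * Km)"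
      using cJ \<epsilon> Km(1) unfolding continuous_on_iff by (metis UNIV_I divide_pos_pos mult_pos_pos zero_less_numeral)
    have lim\<Lambda>: "((\<lambda>n. c / \<Lambda> (r n)) \<longlonglongrightarrow> 0)" for c
    proof -
      have "filterlim (\<lambda>n. \<Lambda> (r n)) at_top sequentially"
        unfolding \<Lambda>_def
        by (intro filterlim_compose[OF filterlim_real_sequentially] filterlim_compose[OF filterlim_Suc] filterlim_subseq r)
      then show ?thesis by (intro tendsto_divide_0[OF tendsto_const] filterlim_at_top_imp_at_infinity)
    qed
    have "\<forall>\<^sub>F n in sequentially. dist (xm (r n)) xs < \<eta> / 2" using tendstoD[OF lim, of "\<eta> / 2"] \<eta>(1) by (simp add: o_def)
    moreover have "\<forall>\<^sub>F n in sequentially. \<bar>R\<bar> / \<Lambda> (r n) < \<eta> / 2" using \<eta>(1) by (intro order_tendstoD(2)[OF lim\<Lambda>]) simp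
    moreover have "\<forall>\<^sub>F n in sequentially. KE / \<Lambda> (r n) < \<epsilon> / 2" using \<epsilon> by (intro order_tendstoD(2)[OF lim\<Lambda>]) simp
    ultimately show "\<forall>\<^sub>F n in sequentially. \<forall>t. \<bar>t\<bar> \<le> R \<longrightarrow> norm (V' n t - J0 xs *v V n t) \<le> \<epsilon>"
    proof (eventually_elim, intro allI impI)
      fix n t assume h: "dist (xm (r n)) xs < \<eta> / 2" "\<bar>R\<bar> / \<Lambda> (r n) < \<eta> / 2" "KE / \<Lambda> (r n) < \<epsilon> / 2" and t: "\<bar>t\<bar> \<le> R"
      have L: "\<Lambda> (r n) \<ge> 1" by (rule \<Lambda>)
      have tl: "\<bar>t / \<Lambda> (r n)\<bar> \<le> \<bar>R\<bar> / \<Lambda> (r n)" using t L by (simp add: divide_right_mono)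
      have "\<bar>R\<bar> / \<Lambda> (r n) \<le> \<bar>R\<bar>" using L mult_left_mono[of 1 "\<Lambda> (r n)" "\<bar>R\<bar>"] by (simp add: field_simps)
      then have X: "X n t \<in> {- \<bar>R\<bar>..T + \<bar>R\<bar>}"
        using tl xm(1)[of "r n"] unfolding X_def atLeastAtMost_iff by linarith
      have "dist (X n t) xs < \<eta>" using h tl unfolding X_def dist_real_def by linarith
      then have J: "norm (J0 (X n t) - J0 xs) \<le> \<epsilon> / (2 * Km)" using \<eta>(2) by (fastforce simp: dist_norm)
      have "V' n t - J0 xs *v V n t = (J0 (X n t) - J0 xs) *v V n t + (1 / \<Lambda> (r n)) *\<^sub>R (E (X n t) *v V n t)"
        by (simp add: V'_def matrix_vector_mult_diff_rdistrib)
      moreover have "norm ((J0 (X n t) - J0 xs) *v V n t) \<le> \<epsilon> / 2"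
      proof -
        have "norm ((J0 (X n t) - J0 xs) *v V n t) \<le> norm (J0 (X n t) - J0 xs) * norm (V n t) * Km" by (rule Km(2))
        also have "\<dots> \<le> \<epsilon> / (2 * Km) * 1 * Km" using J Vb[of n t] Km(1) \<epsilon> by (intro mult_right_mono mult_mono) auto
        also have "\<dots> = \<epsilon> / 2" using Km(1) by simp
        finally show ?thesis .
      qed
      moreover have "norm ((1 / \<Lambda> (r n)) *\<^sub>R (E (X n t) *v V n t)) \<le> \<epsilon> / 2"
      proof -
        have "norm (E (X n t) *v V n t) \<le> KE" using KE(2)[OF X, of "V n t"] mult_left_mono[OF Vb[of n t] KE(1)] by simp
        then have "norm ((1 / \<Lambda> (r n)) *\<^sub>R (E (X n t) *v V n t)) \<le> KE / \<Lambda> (r n)" using L by (simp add: divide_right_mono)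
        then show ?thesis using h(3) by linarith
      qed
      ultimately show "norm (V' n t - J0 xs *v V n t) \<le> \<epsilon>"
        by (smt (verit) norm_triangle_ineq field_sum_of_halves)
    qed
  qed
  then have "(\<lambda>n. norm (V n 0)) \<longlonglongrightarrow> 0" using tendsto_norm by fastforce
  then show False by (simp add: V0 LIMSEQ_const_iff)
qed

end

section \<open>The low-frequency limit\<close>

text \<open>The correction of a single column: adding \<open>ocol k w\<close> to a matrix adds
  \<open>w\<close> to its column \<open>k\<close>.\<close>

definition ocol :: "'n \<Rightarrow> 'a::zero^'m \<Rightarrow> 'a^'n^'m" where
  "ocol k w = (\<chi> i j. if j = k then w $ i else 0)"

lemma mm_ocol: "(M :: 'a::semiring_1^'m^'l) ** ocol k w = ocol k (M *v w)"
  by (simp add: ocol_def vec_eq_iff matrix_matrix_mult_def matrix_vector_mult_def)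

lemma ocol_mm: "(ocol k w ** (M :: 'a::semiring_1^'l^'n)) $ i $ j = w $ i * M $ k $ j"
  by (simp add: ocol_def matrix_matrix_mult_def if_distrib[of "\<lambda>x. x * _"] cong: if_cong)

lemma ocol_mm_0: "(\<And>j. M $ k $ j = 0) \<Longrightarrow> ocol k w ** (M :: 'a::semiring_1^'l^'n) = 0"
  by (simp add: vec_eq_iff ocol_mm)

lemma ocol_add: "ocol k v + ocol k w = ocol k (v + (w :: 'a::monoid_add^'n))"
  by (simp add: ocol_def vec_eq_iff)

lemma det_mat_ocol: "det (mat 1 + ocol k w :: 'a::field^'n^'n) = 1 + w $ k"
proof -
  have "mat 1 + ocol k w = (\<chi> i j. if j = k then (mat 1 *v (axis k 1 + w)) $ i else mat 1 $ i $ j)"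
    by (simp only: matrix_vector_mul_lid) (auto simp: vec_eq_iff ocol_def mat_def axis_def)
  then show ?thesis by (simp only: cramer_lemma) (simp add: axis_def)
qed

lemma det_replace_column:
  fixes M M' :: "'a::field^'n^'n"
  assumes "\<And>i j. j \<noteq> k \<Longrightarrow> M $ i $ j = M' $ i $ j" "\<And>i. M $ i $ k = b * M' $ i $ k"
  shows "det M = b * det M'"
proof -
  have "M = (\<chi> i j. if j = k then (M' *v axis k b) $ i else M' $ i $ j)"
    using assms by (auto simp: vec_eq_iff matrix_vector_mult_def axis_def if_distrib[of "\<lambda>x. _ * x"] mult.commute cong: if_cong)
  then have "det M = axis k b $ k * det M'" by (simp only: cramer_lemma)
  then show ?thesis by simp
qed

lemma det_scale_rows_columns:
  fixes M :: "'a::comm_ring_1^'n^'n"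
  shows "det (\<chi> x y. r x * M $ x $ y * c y) = prod r UNIV * det M * prod c UNIV"
proof -
  let ?D = "\<lambda>r. (\<chi> x y. if x = y then r x else 0) :: 'a^'n^'n"
  have "(\<chi> x y. r x * M $ x $ y * c y) = ?D r ** M ** ?D c"
    by (simp add: vec_eq_iff matrix_matrix_mult_def if_distrib[of "\<lambda>x. x * _"] if_distrib[of "\<lambda>x. _ * x"] cong: if_cong)
  moreover have "det (?D r) = prod r UNIV" for r by (subst det_diagonal) auto
  ultimately show ?thesis by (simp add: det_mul)
qed

lemma det_uminus: "det (- M :: 'a::comm_ring_1^'n^'n) = (- 1) ^ CARD('n) * det M"
proof -
  have "- M = (\<chi> i. (- 1) *s M $ i)" by (simp add: vec_eq_iff)
  then show ?thesis using det_rows_mul[of "\<lambda>_. - 1" "\<lambda>i. M $ i"] by simp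
qed

text \<open>Two column operations reduce the matrix to block triangular form. The first clears column \<open>k\<close>
  by means of \<open>\<xi>\<close> and \<open>c\<close>, the second clears the block \<open>Q\<close> by means of \<open>\<Xi>\<close>; it is here that the
  vanishing of row \<open>k\<close> of \<open>\<Xi>\<close> and \<open>\<xi>\<close>, that is, the integral of motion, is needed.\<close>
lemma det_limit_matrix:
  fixes P Q IP IQ A0 \<Xi> :: "complex^'n^'n"
  assumes \<Xi>: "\<And>j. \<Xi> $ k $ j = 0" "P ** \<Xi> = Q ** A0" and \<xi>: "\<xi> $ k = 0" "P *v \<xi> = axis k 1"
  shows "det (block (P + ocol k (b *s (z - Q *v c) - t *s axis k 1)) Q (mat b ** IP + ocol k w) (mat b ** IQ - mat t)) * det (- A0)
    = det (P + ocol k (b *s z)) * det (mat b ** (IP ** \<Xi> - IQ ** A0) + mat t ** A0)"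
proof -
  interpret mm: bounded_bilinear "(**) :: complex^'n^'n \<Rightarrow> complex^'n^'n \<Rightarrow> complex^'n^'n" by (rule bilinear_mm)
  define v where "v = b *s (z - Q *v c) - t *s axis k 1"
  let ?X = "block (P + ocol k v) Q (mat b ** IP + ocol k w) (mat b ** IQ - mat t)"
  \<comment> \<open>The two column operations as right factors. \<open>?E1\<close> has determinant 1
    since \<open>\<xi> $ k = 0\<close>, and \<open>?E2\<close> contributes
    \<open>det (- A0)\<close>.\<close>
  let ?E1 = "block (mat 1 + ocol k (t *s \<xi>)) 0 (ocol k (b *s c)) (mat 1) :: complex^('n+'n)^('n+'n)"
  let ?E2 = "block (mat 1) \<Xi> 0 (- A0) :: complex^('n+'n)^('n+'n)"
  have oo: "ocol k v ** ocol k (t *s \<xi>) = 0" for v :: "complex^'n" by (rule ocol_mm_0) (simp add: ocol_def \<xi>)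
  have ov: "(M + ocol k v) *v \<xi> = M *v \<xi>" for M :: "complex^'n^'n" and v :: "complex^'n"
  proof -
    have "ocol k v *v \<xi> = 0"
      by (simp add: vec_eq_iff ocol_def matrix_vector_mult_def if_distrib[of "\<lambda>x. x * _"] \<xi> cong: if_cong)
    then show ?thesis by (simp add: matrix_vector_mult_add_rdistrib)
  qed
  have TL: "(P + ocol k v) ** (mat 1 + ocol k (t *s \<xi>)) + Q ** ocol k (b *s c) = P + ocol k (b *s z)"
  proof -
    have "(P + ocol k v) ** (mat 1 + ocol k (t *s \<xi>)) + Q ** ocol k (b *s c)
      = P + (ocol k v + ocol k (t *s axis k 1) + ocol k (b *s (Q *v c)))"
      by (simp add: mm.add_left mm.add_right mm_ocol matrix_vector_mult_smult ov \<xi> add_ac)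
    also have "ocol k v + ocol k (t *s axis k 1) + ocol k (b *s (Q *v c)) = ocol k (b *s z)"
      unfolding ocol_add by (rule arg_cong[of _ _ "ocol k"]) (simp add: v_def vec_eq_iff algebra_simps)
    finally show ?thesis .
  qed
  define BL where "BL = (mat b ** IP + ocol k w) ** (mat 1 + ocol k (t *s \<xi>)) + (mat b ** IQ - mat t) ** ocol k (b *s c)"
  have "BL ** \<Xi> = mat b ** IP ** \<Xi>"
    by (simp add: BL_def mm.add_left mm.add_right oo mm_ocol ocol_mm_0[OF \<Xi>(1)])
  then have BR: "BL ** \<Xi> + (mat b ** IQ - mat t) ** (- A0) = mat b ** (IP ** \<Xi> - IQ ** A0) + mat t ** A0"
    by (simp add: mm.minus_right mm.diff_left mm.diff_right matrix_mul_assoc)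
  have TR: "(P + ocol k (b *s z)) ** \<Xi> + Q ** (- A0) = 0"
    by (simp add: mm.add_left mm.minus_right \<Xi>(2) ocol_mm_0[OF \<Xi>(1)])
  have "?X ** ?E1 ** ?E2 = block (P + ocol k (b *s z)) 0 BL (mat b ** (IP ** \<Xi> - IQ ** A0) + mat t ** A0)"
    by (simp add: block_mult TL BL_def[symmetric] TR BR)
  then have "det (?X ** ?E1 ** ?E2) = det (P + ocol k (b *s z)) * det (mat b ** (IP ** \<Xi> - IQ ** A0) + mat t ** A0)"
    by (simp only: det_block_lower)
  then show ?thesis unfolding v_def by (simp add: det_mul det_block_lower det_block_upper det_mat_ocol \<xi>)
qed

lemma difference_quotient_scaled:
  fixes g :: "complex \<Rightarrow> complex"
  assumes "(g has_field_derivative D) (at 0)"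
  shows "((\<lambda>\<epsilon>. (g (\<epsilon> * b) - g 0) / \<epsilon>) \<longlongrightarrow> b * D) (at 0)"
proof -
  have "((\<lambda>\<epsilon>. g (\<epsilon> * b)) has_field_derivative D * b) (at 0)"
    by (rule DERIV_chain2[where g="\<lambda>\<epsilon>. \<epsilon> * b"]) (use assms in \<open>auto intro!: derivative_eq_intros\<close>)
  then show ?thesis by (simp add: DERIV_def mult.commute)
qed

section \<open>Low-frequency expansion of the monodromy matrix\<close>

locale wave_all = wave_full f B ubar um T f' f'' B' B'' \<Psi> Pm Qm zt + wave_family f B ubar um T f' f'' B' B'' Pm Qm zt U i1
  for f :: "real^'n \<Rightarrow> real^'n" and B ubar um T f' f'' B' B'' \<Psi> Pm Qm zt U and i1 :: 'n
begin

lemma \<Phi>_du: "\<Phi> 0 x *v axis (Inl i1) 1 = cvec (vjoin (du x) 0)"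
proof -
  have "Pm x $ i $ i1 = du x $ i" for i using Pm_du[of x] by (simp add: du_0 mv_axis[symmetric])
  then show ?thesis by (simp add: vec_sum_eq_iff mv_axis \<Phi>_block)
qed

lemma CF_cvec: "CF 0 x *v cvec (vjoin a b) = cvec (vjoin ((Bi x ** A x) *v a + Bi x *v b) 0)"
  by (simp add: CF_0 cmat_mv CR_def block_mv)

text \<open>\<open>\<Theta>\<close> is the derivative in \<open>\<lambda>\<close> at 0. Because
  \<open>y' = \<lambda> w\<close>, its lower half is the integral of the upper half of the
  unperturbed solution; this is how integrals over the period, and thus the mass, enter.\<close>

lemma column_derivative:
  obtains C \<Theta> where "C \<ge> 0" "\<Theta> 0 = 0"
    "\<And>x. x \<in> {0..T} \<Longrightarrow> (\<Theta> has_vector_derivative CF 0 x *v \<Theta> x + block 0 0 (mat 1) 0 *v (\<Phi> 0 x *v v)) (at x within {0..T})"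
    "\<And>l x. norm l \<le> 1 \<Longrightarrow> x \<in> {0..T} \<Longrightarrow> norm (\<Phi> l x *v v - \<Phi> 0 x *v v - l *s \<Theta> x) \<le> C * (norm l)\<^sup>2"
    "\<And>y. ((\<lambda>l. (\<Phi> l T *v v) $ y) has_field_derivative \<Theta> T $ y) (at 0)"
    "\<And>i. ((\<lambda>x. (\<Phi> 0 x *v v) $ Inl i) has_integral \<Theta> T $ Inr i) {0..T}"
proof -
  obtain C \<Theta> where C: "C \<ge> 0" "\<Theta> 0 = 0"
    "\<And>x. x \<in> {0..T} \<Longrightarrow> (\<Theta> has_vector_derivative CF 0 x *v \<Theta> x + block 0 0 (mat 1) 0 *v (\<Phi> 0 x *v v)) (at x within {0..T})"
    "\<And>l x. norm l \<le> 1 \<Longrightarrow> x \<in> {0..T} \<Longrightarrow> norm (\<Phi> (0 + l) x *v v - \<Phi> 0 x *v v - l *s \<Theta> x) \<le> C * (norm l)\<^sup>2"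
    using \<Phi>_parameter[of 0 v] by metis
  have "((\<lambda>l. (\<Phi> l T *v v) $ y) has_field_derivative \<Theta> T $ y) (at 0)" for y
  proof (rule has_field_derivative_quadratic)
    fix l :: complex assume "norm l \<le> 1"
    then have "norm ((\<Phi> (0 + l) T *v v - \<Phi> 0 T *v v - l *s \<Theta> T) $ y) \<le> C * (norm l)\<^sup>2"
      using C(4)[of l T] T_pos by (meson Finite_Cartesian_Product.norm_nth_le atLeastAtMost_iff less_imp_le order_refl order_trans)
    then show "norm ((\<Phi> (0 + l) T *v v) $ y - (\<Phi> 0 T *v v) $ y - l * \<Theta> T $ y) \<le> C * (norm l)\<^sup>2" by simp
  qed
  moreover have "((\<lambda>x. (\<Phi> 0 x *v v) $ Inl i) has_integral \<Theta> T $ Inr i - \<Theta> 0 $ Inr i) {0..T}" for i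
  proof (rule fundamental_theorem_of_calculus)
    fix x assume x: "x \<in> {0..T}"
    have "(CF 0 x *v \<Theta> x + block 0 0 (mat 1) 0 *v (\<Phi> 0 x *v v)) $ Inr i = (\<Phi> 0 x *v v) $ Inl i"
      by (subst vjoin_split[of "\<Theta> x"], subst (1) vjoin_split[of "\<Phi> 0 x *v v"]) (simp add: CF_def block_mv mat_zero)
    then show "((\<lambda>x. \<Theta> x $ Inr i) has_vector_derivative (\<Phi> 0 x *v v) $ Inl i) (at x within {0..T})"
      using has_vector_derivative_vec_nth[OF C(3)[OF x], of "Inr i"] by simp
  qed (use T_pos in simp)
  ultimately show thesis using that[OF C(1-3)] C(2,4) by simp
qed

text \<open>Differentiating the translation column in \<open>\<lambda>\<close>, the flux integrates
  \<open>ubar'\<close> to \<open>ubar - ubar 0\<close>. This is the forcing of \<open>zt\<close> up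
  to the constant \<open>ubar 0 - um\<close>, for which \<open>Qm\<close> accounts, so the variation
  in \<open>s\<close> appears in the column of the translation mode.\<close>

lemma wave_column:
  assumes \<Theta>0: "\<Theta> 0 = 0"
    and \<Theta>: "\<And>x. x \<in> {0..T} \<Longrightarrow> (\<Theta> has_vector_derivative CF 0 x *v \<Theta> x + block 0 0 (mat 1) 0 *v (\<Phi> 0 x *v axis (Inl i1) 1)) (at x within {0..T})"
    and x: "x \<in> {0..T}"
  shows "\<Theta> x = cvec (vjoin (zt x - Qm x *v (ubar 0 - um)) (ubar x - ubar 0))"
proof -
  interpret mv: bounded_bilinear "(*v) :: real^'n^'n \<Rightarrow> real^'n \<Rightarrow> real^'n" by (rule bilinear_mv)
  interpret mV: bounded_bilinear "(*v) :: complex^('n+'n)^('n+'n) \<Rightarrow> complex^('n+'n) \<Rightarrow> complex^('n+'n)" by (rule bilinear_mv)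
  define h where "h x = cvec (vjoin (zt x - Qm x *v (ubar 0 - um)) (ubar x - ubar 0))" for x
  have d: "((\<lambda>x. \<Theta> x - h x) has_vector_derivative CF 0 x *v (\<Theta> x - h x)) (at x within {0..T})" if x: "x \<in> {0..T}" for x
  proof -
    have "((\<lambda>x. zt x - Qm x *v (ubar 0 - um)) has_vector_derivative
       ((Bi x ** A x) *v zt x + Bi x *v (ubar x - um)) - ((Bi x ** A x) ** Qm x + Bi x) *v (ubar 0 - um)) (at x within {0..T})"
      using hvd_mv[OF has_vector_derivative_at_within[OF Qm_deriv[of x]] has_vector_derivative_const[of "ubar 0 - um"], of "{0..T}"]
      by (intro has_vector_derivative_diff zt_deriv[OF x]) simp
    moreover have "((\<lambda>x. ubar x - ubar 0) has_vector_derivative du x - 0) (at x within {0..T})"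
      by (intro has_vector_derivative_diff has_vector_derivative_at_within[OF ubar_deriv] has_vector_derivative_const)
    ultimately have "(h has_vector_derivative cvec (vjoin (((Bi x ** A x) *v zt x + Bi x *v (ubar x - um)) - ((Bi x ** A x) ** Qm x + Bi x) *v (ubar 0 - um)) (du x - 0))) (at x within {0..T})"
      unfolding h_def[abs_def] by (intro hvd_cvec hvd_vjoin)
    moreover have "((Bi x ** A x) *v zt x + Bi x *v (ubar x - um)) - ((Bi x ** A x) ** Qm x + Bi x) *v (ubar 0 - um)
      = (Bi x ** A x) *v (zt x - Qm x *v (ubar 0 - um)) + Bi x *v (ubar x - ubar 0)"
      by (simp add: mv.add_left mv.diff_right matrix_vector_mul_assoc)
    moreover have bl: "block 0 0 (mat 1) 0 *v cvec (vjoin (du x) 0) = cvec (vjoin 0 (du x))"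
      by (simp add: cvec_vjoin block_mv) (simp add: vec_sum_eq_iff)
    have "CF 0 x *v h x + block 0 0 (mat 1) 0 *v (\<Phi> 0 x *v axis (Inl i1) 1) =
        cvec (vjoin ((Bi x ** A x) *v (zt x - Qm x *v (ubar 0 - um)) + Bi x *v (ubar x - ubar 0)) (du x - 0))"
      unfolding h_def CF_cvec \<Phi>_du bl by (simp add: vec_sum_eq_iff)
    ultimately have "(h has_vector_derivative CF 0 x *v h x + block 0 0 (mat 1) 0 *v (\<Phi> 0 x *v axis (Inl i1) 1)) (at x within {0..T})"
      by (simp only:)
    from has_vector_derivative_diff[OF \<Theta>[OF x] this]
    show ?thesis by (simp add: mV.diff_right)
  qed
  have z0: "\<Theta> 0 - h 0 = 0" by (simp add: \<Theta>0 h_def zt_0 Qm_0 vec_sum_eq_iff)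
  have "\<Theta> x - h x = 0"
    by (rule linear_ode_unique_right[of T "CF 0" "\<lambda>x. \<Theta> x - h x" x, OF cont_CF d z0 x])
  then show ?thesis by (simp add: h_def)
qed

lemma IP_entry: "((\<lambda>x. complex_of_real (Pm x $ i $ j)) has_integral of_real (IP $ i $ j)) {0..T}"
  and IQ_entry: "((\<lambda>x. complex_of_real (Qm x $ i $ j)) has_integral of_real (IQ $ i $ j)) {0..T}"
proof -
  have "((\<lambda>x. complex_of_real (M x $ i $ j)) has_integral of_real (integral {0..T} M $ i $ j)) {0..T}"
    if "continuous_on {0..T} M" for M :: "real \<Rightarrow> real^'n^'n"
  proof -
    have b: "bounded_linear (\<lambda>v::real^'n. complex_of_real (v $ i))"
      by (rule bounded_linear_compose[OF bounded_linear_of_real bounded_linear_vec_nth])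
    show ?thesis using has_integral_linear[OF integral_mv[OF that, of "axis j 1"] b] by (simp add: o_def mv_axis)
  qed
  then show "((\<lambda>x. complex_of_real (Pm x $ i $ j)) has_integral of_real (IP $ i $ j)) {0..T}"
    "((\<lambda>x. complex_of_real (Qm x $ i $ j)) has_integral of_real (IQ $ i $ j)) {0..T}"
    by (simp_all add: IP_def IQ_def cont_Pm cont_Qm)
qed

text \<open>The flux produced by the translation column is \<open>\<lambda>\<close> times the
  integral of its upper half, and at \<open>\<lambda> = 0\<close> this is the integral of
  \<open>ubar'\<close>, which vanishes. The expansion therefore starts with
  \<open>\<lambda>^2\<close>; the coefficient drops out of the determinant in
  \<open>det_limit_matrix\<close>.\<close>

lemma second_order:
  obtains w where "\<And>i. ((\<lambda>\<epsilon>. (\<Phi> (\<epsilon> * b) T *v axis (Inl i1) 1) $ Inr i / \<epsilon>\<^sup>2) \<longlongrightarrow> w $ i) (at 0)"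
proof -
  obtain C \<Theta> where C: "C \<ge> 0" and \<Theta>0: "\<Theta> 0 = 0" and \<Theta>: "\<And>x. x \<in> {0..T} \<Longrightarrow> (\<Theta> has_vector_derivative CF 0 x *v \<Theta> x + block 0 0 (mat 1) 0 *v (\<Phi> 0 x *v axis (Inl i1) 1)) (at x within {0..T})"
    and est: "\<And>l x. norm l \<le> 1 \<Longrightarrow> x \<in> {0..T} \<Longrightarrow> norm (\<Phi> l x *v axis (Inl i1) 1 - \<Phi> 0 x *v axis (Inl i1) 1 - l *s \<Theta> x) \<le> C * (norm l)\<^sup>2"
    by (rule column_derivative[of "axis (Inl i1) 1"]) blast
  let ?v = "axis (Inl i1) 1 :: complex^('n+'n)"
  define w where "w i = integral {0..T} (\<lambda>x. \<Theta> x $ Inl i)" for i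
  have c\<Theta>: "continuous_on {0..T} \<Theta>" by (rule continuous_on_vector_derivative[OF \<Theta>])
  have cn: "continuous_on {0..T} (\<lambda>x. g x $ Inl i)" if "continuous_on {0..T} g" for g :: "real \<Rightarrow> complex^('n+'n)" and i
    using continuous_on_compose2[OF linear_continuous_on[OF bounded_linear_vec_nth] that] by blast
  have c\<Phi>: "continuous_on {0..T} (\<lambda>x. \<Phi> l x *v ?v)" for l
    by (intro cont_mv continuous_on_const continuous_on_vector_derivative[OF has_vector_derivative_at_within[OF \<Phi>_deriv]])
  have FTC: "((\<lambda>x. l * (\<Phi> l x *v ?v) $ Inl i) has_integral (\<Phi> l T *v ?v) $ Inr i - (\<Phi> l 0 *v ?v) $ Inr i) {0..T}" for l i
  proof (rule fundamental_theorem_of_calculus)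
    fix x assume "x \<in> {0..T}"
    have "((\<lambda>x. \<Phi> l x *v ?v) has_vector_derivative CF l x *v (\<Phi> l x *v ?v)) (at x within {0..T})"
      by (rule has_vector_derivative_at_within[OF \<Phi>_mv_deriv])
    moreover have "(CF l x *v (\<Phi> l x *v ?v)) $ Inr i = l * (\<Phi> l x *v ?v) $ Inl i"
      by (subst (1) vjoin_split[of "\<Phi> l x *v ?v"]) (simp add: CF_def block_mv mat_mv)
    ultimately show "((\<lambda>x. (\<Phi> l x *v ?v) $ Inr i) has_vector_derivative l * (\<Phi> l x *v ?v) $ Inl i) (at x within {0..T})"
      using has_vector_derivative_vec_nth[of "\<lambda>x. \<Phi> l x *v ?v" "CF l x *v (\<Phi> l x *v ?v)" "at x within {0..T}" "Inr i"] by simp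
  qed (use T_pos in simp)
  have du0: "((\<lambda>x. (\<Phi> 0 x *v ?v) $ Inl i) has_integral 0) {0..T}" for i
  proof -
    have "((\<lambda>x. complex_of_real ((Pm x *v du 0) $ i)) has_integral of_real ((IP *v du 0) $ i)) {0..T}"
      using has_integral_linear[OF integral_mv[OF cont_Pm, of "du 0"] bounded_linear_compose[OF bounded_linear_of_real bounded_linear_vec_nth[of i]]]
      by (simp add: o_def IP_def)
    then show ?thesis by (simp add: \<Phi>_du IP_du Pm_du)
  qed
  have main: "norm ((\<Phi> l T *v ?v) $ Inr i - l * (l * w i)) \<le> norm l * (C * (norm l)\<^sup>2 * (T - 0))" if l: "norm l \<le> 1" for l i
  proof -
    let ?I = "integral {0..T} (\<lambda>x. (\<Phi> l x *v ?v - \<Phi> 0 x *v ?v - l *s \<Theta> x) $ Inl i)"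
    have "((\<lambda>x. (\<Phi> l x *v ?v) $ Inl i - (\<Phi> 0 x *v ?v) $ Inl i - l * \<Theta> x $ Inl i) has_integral
        integral {0..T} (\<lambda>x. (\<Phi> l x *v ?v) $ Inl i) - 0 - l * w i) {0..T}"
      unfolding w_def by (intro has_integral_diff du0 has_integral_mult_right integrable_integral integrable_continuous_interval cn c\<Phi> c\<Theta>)
    then have I: "?I = integral {0..T} (\<lambda>x. (\<Phi> l x *v ?v) $ Inl i) - l * w i" by (simp add: integral_unique)
    have "norm ?I \<le> C * (norm l)\<^sup>2 * (T - 0)"
    proof (rule integral_bound)
      show "norm ((\<Phi> l x *v ?v - \<Phi> 0 x *v ?v - l *s \<Theta> x) $ Inl i) \<le> C * (norm l)\<^sup>2" if "x \<in> {0..T}" for x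
        using est[OF l that] by (meson Finite_Cartesian_Product.norm_nth_le order_trans)
      have "(\<lambda>x. (\<Phi> l x *v ?v - \<Phi> 0 x *v ?v - l *s \<Theta> x) $ Inl i) = (\<lambda>x. (\<Phi> l x *v ?v) $ Inl i - (\<Phi> 0 x *v ?v) $ Inl i - l * \<Theta> x $ Inl i)"
        by (simp add: fun_eq_iff)
      then show "continuous_on {0..T} (\<lambda>x. (\<Phi> l x *v ?v - \<Phi> 0 x *v ?v - l *s \<Theta> x) $ Inl i)"
        by (simp only:) (intro continuous_intros cn c\<Phi> c\<Theta>)
    qed (use T_pos in simp)
    moreover have "(\<Phi> l T *v ?v) $ Inr i = l * integral {0..T} (\<lambda>x. (\<Phi> l x *v ?v) $ Inl i)"
      using integral_unique[OF FTC[of l i]] by (simp add: \<Phi>_0 mv_axis axis_def)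
    then have "(\<Phi> l T *v ?v) $ Inr i - l * (l * w i) = l * ?I" unfolding I by (simp add: algebra_simps)
    ultimately show ?thesis by (simp add: norm_mult mult_left_mono)
  qed
  have "((\<lambda>\<epsilon>. (\<Phi> (\<epsilon> * b) T *v ?v) $ Inr i / \<epsilon>\<^sup>2) \<longlongrightarrow> b\<^sup>2 * w i) (at 0)" for i
  proof (rule LIM_zero_cancel, rule Lim_null_comparison)
    show "((\<lambda>\<epsilon>. (norm b)^3 * C * T * norm \<epsilon>) \<longlongrightarrow> 0) (at (0::complex))" by (auto intro!: tendsto_eq_intros)
    have "((\<lambda>\<epsilon>. norm (\<epsilon> * b)) \<longlongrightarrow> 0) (at (0::complex))" by (auto intro!: tendsto_eq_intros)
    then have "\<forall>\<^sub>F \<epsilon> in at 0. norm (\<epsilon> * b) < 1" by (rule order_tendstoD) simp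
    moreover have "\<forall>\<^sub>F \<epsilon> in at (0::complex). \<epsilon> \<noteq> 0" by (rule eventually_neq_at_within)
    ultimately show "\<forall>\<^sub>F \<epsilon> in at 0. norm ((\<Phi> (\<epsilon> * b) T *v ?v) $ Inr i / \<epsilon>\<^sup>2 - b\<^sup>2 * w i) \<le> (norm b)^3 * C * T * norm \<epsilon>"
    proof eventually_elim
      case (elim \<epsilon>)
      have "(\<Phi> (\<epsilon> * b) T *v ?v) $ Inr i / \<epsilon>\<^sup>2 - b\<^sup>2 * w i = ((\<Phi> (\<epsilon> * b) T *v ?v) $ Inr i - (\<epsilon> * b) * ((\<epsilon> * b) * w i)) / \<epsilon>\<^sup>2"
        using elim by (simp add: field_simps power2_eq_square)
      then have "norm ((\<Phi> (\<epsilon> * b) T *v ?v) $ Inr i / \<epsilon>\<^sup>2 - b\<^sup>2 * w i) \<le> (norm (\<epsilon> * b) * (C * (norm (\<epsilon> * b))\<^sup>2 * (T - 0))) / (norm \<epsilon>)\<^sup>2"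
        using main[of "\<epsilon> * b" i] elim by (simp add: norm_divide norm_power divide_right_mono)
      also have "\<dots> = (norm b)^3 * C * T * norm \<epsilon>"
        using elim by (simp add: norm_mult field_simps power2_eq_square power3_eq_cube)
      finally show ?case .
    qed
  qed
  then show thesis using that[of "\<chi> i. b\<^sup>2 * w i"] by simp
qed

text \<open>The lower rows of \<open>M(\<lambda>) - \<kappa>\<close> and the column belonging to the derivative of the wave are of
  first order in \<open>\<epsilon>\<close>; dividing them by \<open>\<epsilon>\<close> leaves a matrix with a finite limit.\<close>
theorem evans_limit:
  assumes \<Xi>: "\<And>j. \<Xi> $ i1 $ j = 0" "P1 ** \<Xi> = Qm T ** A0" and \<xi>: "\<xi> $ i1 = 0" "P1 *v \<xi> = axis i1 1"
    and A0: "det A0 \<noteq> 0"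
  shows "((\<lambda>\<epsilon>. Dc (\<epsilon> * a) (\<epsilon> * b) / \<epsilon> ^ (CARD('n) + 1)) \<longlongrightarrow>
     of_real (det G) / det (- cmat A0) * b * det (mat b ** cmat (IP ** \<Xi> - IQ ** A0) + mat (\<i> * a * of_real T) ** cmat A0)) (at 0)"
proof -
  define \<kappa> where "\<kappa> \<epsilon> = exp (\<i> * (\<epsilon> * a) * of_real T)" for \<epsilon> :: complex
  define t where "t = \<i> * a * of_real T"
  define M where "M \<epsilon> = \<Phi> (\<epsilon> * b) T - mat (\<kappa> \<epsilon>)" for \<epsilon>
  define r :: "complex \<Rightarrow> 'n + 'n \<Rightarrow> complex" where "r \<epsilon> x = (case x of Inl _ \<Rightarrow> 1 | Inr _ \<Rightarrow> 1 / \<epsilon>)" for \<epsilon> x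
  define c :: "complex \<Rightarrow> 'n + 'n \<Rightarrow> complex" where "c \<epsilon> y = (if y = Inl i1 then 1 / \<epsilon> else 1)" for \<epsilon> y
  define X where "X \<epsilon> = (\<chi> x y. r \<epsilon> x * M \<epsilon> $ x $ y * c \<epsilon> y)" for \<epsilon>
  obtain w where w: "\<And>i. ((\<lambda>\<epsilon>. (\<Phi> (\<epsilon> * b) T *v axis (Inl i1) 1) $ Inr i / \<epsilon>\<^sup>2) \<longlongrightarrow> w $ i) (at 0)"
    by (rule second_order[of b]) blast
  have kd: "((\<lambda>\<epsilon>. (1 - \<kappa> \<epsilon>) / \<epsilon>) \<longlongrightarrow> - t) (at 0)"
  proof -
    have "((\<lambda>\<epsilon>. 1 - \<kappa> \<epsilon>) has_field_derivative - t) (at 0)"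
      unfolding \<kappa>_def t_def by (auto intro!: derivative_eq_intros)
    then show ?thesis by (simp add: DERIV_def \<kappa>_def)
  qed
  have k0: "(\<kappa> \<longlongrightarrow> 1) (at 0)"
  proof -
    have "isCont \<kappa> 0" unfolding \<kappa>_def by (intro continuous_intros)
    then show ?thesis by (simp add: isCont_def \<kappa>_def)
  qed
  have \<Phi>0: "((\<lambda>\<epsilon>. \<Phi> (\<epsilon> * b) T $ x $ y) \<longlongrightarrow> \<Phi> 0 T $ x $ y) (at 0)" for x y
  proof -
    have "continuous_on UNIV (\<lambda>\<epsilon>. \<Phi> (\<epsilon> * b) T $ x $ y)"
      by (rule continuous_on_compose2[OF holomorphic_on_imp_continuous_on[OF \<Phi>_holomorphic]]) (auto intro!: continuous_intros)
    then have "isCont (\<lambda>\<epsilon>. \<Phi> (\<epsilon> * b) T $ x $ y) 0" by (simp add: continuous_on_eq_continuous_at)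
    then show ?thesis by (simp add: isCont_def)
  qed
  \<comment> \<open>Column \<open>Inl i1\<close> holds the first-order terms of the translation
    column, with \<open>- t\<close> from the Floquet multiplier on the diagonal; the lower rows hold
    the integrals of \<open>Pm\<close> and \<open>Qm\<close>.\<close>
  define X0 where "X0 = block (cmat P1 + ocol i1 (b *s (cvec (zt T) - cmat (Qm T) *v cvec (ubar 0 - um)) - t *s axis i1 1)) (cmat (Qm T))
      (mat b ** cmat IP + ocol i1 w) (mat b ** cmat IQ - mat t)"
  have P1i: "P1 $ i $ i1 = 0" for i using P1_col mv_axis[of P1 i1 i] by simp
  have IPi: "IP $ i $ i1 = 0" for i using IP_du mv_axis[of IP i1 i] by (simp add: du_0)
  have quot: "((\<lambda>\<epsilon>. M \<epsilon> $ x $ y / \<epsilon>) \<longlongrightarrow> b * d - (if x = y then t else 0)) (at 0)"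
    if D: "((\<lambda>l. (\<Phi> l T *v axis y 1) $ x) has_field_derivative d) (at 0)" and 0: "\<Phi> 0 T $ x $ y = (if x = y then 1 else 0)" for x y d
  proof -
    have "((\<lambda>\<epsilon>. (\<Phi> (\<epsilon> * b) T $ x $ y - \<Phi> 0 T $ x $ y) / \<epsilon> + (if x = y then (1 - \<kappa> \<epsilon>) / \<epsilon> else 0)) \<longlongrightarrow> b * d + (if x = y then - t else 0)) (at 0)"
      using difference_quotient_scaled[OF D, of b] kd by (intro tendsto_add) (auto simp: mv_axis)
    moreover have "(\<Phi> (\<epsilon> * b) T $ x $ y - \<Phi> 0 T $ x $ y) / \<epsilon> + (if x = y then (1 - \<kappa> \<epsilon>) / \<epsilon> else 0) = M \<epsilon> $ x $ y / \<epsilon>" for \<epsilon>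
      by (simp add: M_def mat_def 0 diff_divide_distrib)
    ultimately have "((\<lambda>\<epsilon>. M \<epsilon> $ x $ y / \<epsilon>) \<longlongrightarrow> b * d + (if x = y then - t else 0)) (at 0)" by (simp only:)
    then show ?thesis by (cases "x = y") auto
  qed
  have lim: "((\<lambda>\<epsilon>. X \<epsilon> $ x $ y) \<longlongrightarrow> X0 $ x $ y) (at 0)" for x y
  proof (cases x)
    case x: (Inl i)
    show ?thesis
    proof (cases "y = Inl i1")
      case True
      obtain \<Theta> where \<Theta>: "\<Theta> 0 = 0" "\<And>x. x \<in> {0..T} \<Longrightarrow> (\<Theta> has_vector_derivative CF 0 x *v \<Theta> x + block 0 0 (mat 1) 0 *v (\<Phi> 0 x *v axis (Inl i1) 1)) (at x within {0..T})"
        "\<And>y. ((\<lambda>l. (\<Phi> l T *v axis (Inl i1) 1) $ y) has_field_derivative \<Theta> T $ y) (at 0)"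
        by (rule column_derivative[of "axis (Inl i1) 1"]) blast
      have "\<Theta> T = cvec (vjoin (zt T - Qm T *v (ubar 0 - um)) (ubar T - ubar 0))"
        by (rule wave_column[OF \<Theta>(1,2)]) (use T_pos in auto)
      then have \<Theta>T: "\<Theta> T $ Inl i = (cvec (zt T) - cmat (Qm T) *v cvec (ubar 0 - um)) $ i" by (simp add: cmat_mv)
      have "\<Phi> 0 T $ Inl i $ Inl i1 = (if Inl i = (Inl i1 :: 'n + 'n) then 1 else 0)"
        using P1i[of i] by (auto simp: \<Phi>_block P1_def mat_def split: if_splits)
      from quot[OF \<Theta>(3) this]
      show ?thesis by (auto simp: x True X_def r_def c_def X0_def \<Theta>T ocol_def P1i axis_def right_diff_distrib)
    next
      case False
      have "((\<lambda>\<epsilon>. M \<epsilon> $ Inl i $ y) \<longlongrightarrow> \<Phi> 0 T $ Inl i $ y - mat 1 $ Inl i $ y) (at 0)"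
        unfolding M_def using \<Phi>0[of "Inl i" y] k0 by (auto simp: mat_def intro!: tendsto_diff)
      moreover have "\<Phi> 0 T $ Inl i $ y - mat 1 $ Inl i $ y = X0 $ Inl i $ y"
        using False by (cases y) (auto simp: X0_def \<Phi>_block P1_def mat_def ocol_def)
      ultimately show ?thesis using False by (simp add: x X_def r_def c_def)
    qed
  next
    case x: (Inr i)
    show ?thesis
    proof (cases "y = Inl i1")
      case True
      \<comment> \<open>Here both scalings act, and the entry stays bounded only because the
        translation mode produces no flux of first order.\<close>
      have "X \<epsilon> $ x $ y = (\<Phi> (\<epsilon> * b) T *v axis (Inl i1) 1) $ Inr i / \<epsilon>\<^sup>2" for \<epsilon>
        by (simp add: x True X_def r_def c_def M_def mat_def mv_axis power2_eq_square)
      moreover have "X0 $ x $ y = w $ i" by (simp add: x True X0_def ocol_def mat_mult_left IPi)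
      ultimately show ?thesis using w[of i] by simp
    next
      case False
      obtain \<Theta> where \<Theta>: "\<And>x. ((\<lambda>l. (\<Phi> l T *v axis y 1) $ x) has_field_derivative \<Theta> T $ x) (at 0)"
        "\<And>i. ((\<lambda>x. (\<Phi> 0 x *v axis y 1) $ Inl i) has_integral \<Theta> T $ Inr i) {0..T}"
        by (rule column_derivative[of "axis y 1"]) blast
      have "\<Phi> 0 T $ Inr i $ y = (if Inr i = y then 1 else 0)" by (cases y) (auto simp: \<Phi>_block mat_def)
      note q = quot[OF \<Theta>(1) this]
      have "b * \<Theta> T $ Inr i - (if Inr i = y then t else 0) = X0 $ Inr i $ y"
      proof (cases y)
        case (Inl j)
        then have "\<Theta> T $ Inr i = of_real (IP $ i $ j)"
          using has_integral_unique[OF \<Theta>(2)[of i], of "of_real (IP $ i $ j)"] IP_entry[of i j] by (simp add: mv_axis \<Phi>_block)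
        then show ?thesis using False Inl by (simp add: X0_def ocol_def mat_mult_left)
      next
        case (Inr j)
        then have "\<Theta> T $ Inr i = of_real (IQ $ i $ j)"
          using has_integral_unique[OF \<Theta>(2)[of i], of "of_real (IQ $ i $ j)"] IQ_entry[of i j] by (simp add: mv_axis \<Phi>_block)
        moreover have "mat t $ i $ j = (if i = j then t else 0)" by (simp add: mat_def)
        ultimately show ?thesis using Inr by (simp add: X0_def mat_mult_left)
      qed
      then show ?thesis using q False by (simp add: x X_def r_def c_def)
    qed
  qed
  have "(X \<longlongrightarrow> X0) (at 0)" by (intro vec_tendstoI lim)
  moreover have "isCont (det :: complex^('n+'n)^('n+'n) \<Rightarrow> complex) X0"
  proof -
    have "continuous_on UNIV (\<lambda>M :: complex^('n+'n)^('n+'n). det M)" by (intro continuous_on_det continuous_intros)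
    then show ?thesis by (simp add: continuous_on_eq_continuous_at)
  qed
  ultimately have detlim: "((\<lambda>\<epsilon>. det (X \<epsilon>)) \<longlongrightarrow> det X0) (at 0)" by (rule isCont_tendsto_compose[rotated])
  have "det (X \<epsilon>) = Dc (\<epsilon> * a) (\<epsilon> * b) / \<epsilon> ^ (CARD('n) + 1)" for \<epsilon>
  proof -
    have "prod (r \<epsilon>) UNIV = (1 / \<epsilon>) ^ CARD('n)"
      by (subst UNIV_Plus_UNIV[symmetric], subst prod.Plus) (auto simp: r_def o_def)
    moreover have "prod (c \<epsilon>) UNIV = 1 / \<epsilon>" by (simp add: c_def[abs_def] prod.delta)
    ultimately show ?thesis
      unfolding X_def det_scale_rows_columns by (simp add: Dc_def M_def \<kappa>_def power_one_over field_simps)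
  qed
  moreover have "det X0 = of_real (det G) / det (- cmat A0) * b * det (mat b ** cmat (IP ** \<Xi> - IQ ** A0) + mat t ** cmat A0)"
  proof -
    have nz: "det (- cmat A0) \<noteq> 0"
      using A0 by (simp add: cmat_minus[symmetric] det_cmat det_uminus)
    have c\<xi>: "cmat P1 *v cvec \<xi> = axis i1 1" using \<xi>(2) by (simp add: cmat_mv vec_eq_iff axis_def)
    have "det X0 * det (- cmat A0) = det (cmat P1 + ocol i1 (b *s cvec (zt T))) *
        det (mat b ** (cmat IP ** cmat \<Xi> - cmat IQ ** cmat A0) + mat t ** cmat A0)"
      unfolding X0_def
      by (rule det_limit_matrix[where \<xi>="cvec \<xi>"]) (use \<Xi> \<xi> c\<xi> in \<open>auto simp: cmat_mult[symmetric]\<close>)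
    moreover have "det (cmat P1 + ocol i1 (b *s cvec (zt T))) = b * det (cmat G)"
      by (rule det_replace_column[where k=i1]) (auto simp: ocol_def G_def P1i)
    ultimately show ?thesis using nz by (simp add: det_cmat cmat_mult[symmetric] cmat_diff[symmetric] field_simps)
  qed
  ultimately show ?thesis using detlim by (simp add: t_def)
qed

end

section \<open>Spectrum on Lebesgue spaces\<close>

lemma quasi_periodic_bounded:
  fixes q :: "real \<Rightarrow> 'a::real_normed_vector"
  assumes T: "T > 0" and q: "\<And>x. norm (q (x + T)) = norm (q x)" and c: "continuous_on UNIV q"
  obtains K where "K \<ge> 0" "\<And>x. norm (q x) \<le> K"
proof -
  have "bounded (q ` {0..T})"
    by (intro compact_imp_bounded compact_continuous_image continuous_on_subset[OF c] compact_Icc) auto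
  then obtain K where K: "K > 0" "\<And>x. x \<in> {0..T} \<Longrightarrow> norm (q x) \<le> K" unfolding bounded_pos by blast
  have "norm (q x) \<le> K" for x
  proof -
    obtain x' where "x' \<in> {0..T}" "norm (q x') = norm (q x)"
      by (rule periodic_representative[of T "\<lambda>x. norm (q x)" x]) (use T q in auto)
    then show ?thesis using K(2)[of x'] by simp
  qed
  then show thesis using K(1) that[of K] by simp
qed

lemma periodic_integral:
  fixes h :: "real \<Rightarrow> real"
  assumes T: "T > 0" and h: "\<And>x. h (x + T) = h x" and c: "continuous_on UNIV h"
  shows "(h has_integral of_nat N * integral {0..T} h) {0..of_nat N * T}"
proof (induction N)
  case 0
  show ?case by (simp add: has_integral_refl)
next
  case (Suc N)
  note mult = periodic_multiple[of h T, OF h]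
  have "h \<circ> (+) (of_nat N * T) = h" using mult[of _ N] by (simp add: fun_eq_iff add.commute)
  moreover have "(h has_integral integral {0..T} h) {0..T}"
    by (intro integrable_integral integrable_continuous_interval continuous_on_subset[OF c]) simp
  ultimately have "(h has_integral integral {0..T} h) {of_nat N * T..of_nat (Suc N) * T}"
    using has_integral_shift_Icc_real[of h "of_nat N * T" "integral {0..T} h" 0 T] by (simp add: algebra_simps)
  then have "(h has_integral of_nat N * integral {0..T} h + integral {0..T} h) {0..of_nat (Suc N) * T}"
    by (intro has_integral_combine[OF _ _ Suc.IH]) (use T in \<open>auto simp: algebra_simps\<close>)
  then show ?case by (simp add: algebra_simps)
qed

section \<open>Cutoff functions\<close>

lemma positive_part_power_deriv:
  "((\<lambda>t::real. (max 0 t) ^ Suc (Suc n)) has_real_derivative (of_nat (Suc (Suc n)) * (max 0 t) ^ Suc n)) (at t)"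
proof -
  consider "t > 0" | "t < 0" | "t = 0" by linarith
  then show ?thesis
  proof cases
    case 1
    have "((\<lambda>t::real. t ^ Suc (Suc n)) has_real_derivative (of_nat (Suc (Suc n)) * (max 0 t) ^ Suc n)) (at t)"
      using 1 DERIV_pow[of "Suc (Suc n)" t] by (simp add: max_def)
    then show ?thesis
      by (rule has_field_derivative_transform_within_open[of _ _ _ "{0<..}"]) (use 1 in \<open>auto simp: max_def\<close>)
  next
    case 2
    have "((\<lambda>t::real. 0) has_real_derivative (of_nat (Suc (Suc n)) * (max 0 t) ^ Suc n)) (at t)"
      using 2 by (simp add: max_def)
    then show ?thesis
      by (rule has_field_derivative_transform_within_open[of _ _ _ "{..<0}"]) (use 2 in \<open>auto simp: max_def\<close>)
  next
    case 3
    have "((\<lambda>h::real. (max 0 h) ^ Suc (Suc n) / h) \<longlongrightarrow> 0) (at 0)"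
    proof (rule Lim_null_comparison)
      show "\<forall>\<^sub>F h::real in at 0. norm ((max 0 h) ^ Suc (Suc n) / h) \<le> \<bar>h\<bar> ^ Suc n"
      proof (intro always_eventually allI)
        fix h :: real
        show "norm ((max 0 h) ^ Suc (Suc n) / h) \<le> \<bar>h\<bar> ^ Suc n"
        proof (cases "h > 0")
          case False
          then have "(max 0 h) ^ Suc (Suc n) / h = 0" by (simp add: max_absorb1)
          then show ?thesis by (simp only: norm_zero zero_le_power_abs)
        qed (simp add: max_absorb2)
      qed
      have "((\<lambda>h::real. \<bar>h\<bar> ^ Suc n) \<longlongrightarrow> \<bar>0\<bar> ^ Suc n) (at 0)" by (intro tendsto_intros)
      then show "((\<lambda>h::real. \<bar>h\<bar> ^ Suc n) \<longlongrightarrow> 0) (at 0)" by simp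
    qed
    then show ?thesis using 3 by (simp add: DERIV_def)
  qed
qed

text \<open>The exponent 3 makes the cutoff twice continuously differentiable across
  \<open>\<bar>x\<bar> = R\<close>, so that truncated waves have continuous second derivatives;
  \<open>bump1\<close> and \<open>bump2\<close> are the derivatives.\<close>

definition bump :: "real \<Rightarrow> real \<Rightarrow> real" where "bump R x = (max 0 (1 - (x / R)\<^sup>2)) ^ 3"
definition bump1 :: "real \<Rightarrow> real \<Rightarrow> real" where "bump1 R x = 3 * (max 0 (1 - (x / R)\<^sup>2))\<^sup>2 * (- (2 * x / R\<^sup>2))"
definition bump2 :: "real \<Rightarrow> real \<Rightarrow> real" where
  "bump2 R x = 6 * max 0 (1 - (x / R)\<^sup>2) * (2 * x / R\<^sup>2)\<^sup>2 - 6 * (max 0 (1 - (x / R)\<^sup>2))\<^sup>2 / R\<^sup>2"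

lemma bump_deriv: "R \<noteq> 0 \<Longrightarrow> (bump R has_real_derivative bump1 R x) (at x)"
  and bump1_deriv: "R \<noteq> 0 \<Longrightarrow> (bump1 R has_real_derivative bump2 R x) (at x)"
proof -
  assume R: "R \<noteq> 0"
  have u: "((\<lambda>x. 1 - (x / R)\<^sup>2) has_real_derivative - (2 * x / R\<^sup>2)) (at x)"
    using R by (auto intro!: derivative_eq_intros simp: power2_eq_square)
  from DERIV_chain2[OF positive_part_power_deriv[of 1] u]
  show "(bump R has_real_derivative bump1 R x) (at x)"
    by (simp add: bump_def[abs_def] bump1_def numeral_3_eq_3 power2_eq_square)
  have "((\<lambda>x. (max 0 (1 - (x / R)\<^sup>2))\<^sup>2) has_real_derivative 2 * max 0 (1 - (x / R)\<^sup>2) * - (2 * x / R\<^sup>2)) (at x)"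
    using DERIV_chain2[OF positive_part_power_deriv[of 0] u] by (simp add: numeral_2_eq_2)
  moreover have "((\<lambda>x. - (2 * x / R\<^sup>2)) has_real_derivative - (2 / R\<^sup>2)) (at x)"
  proof -
    have e: "(\<lambda>x. - (2 * x / R\<^sup>2)) = (*) (- (2 / R\<^sup>2))" by (simp add: fun_eq_iff)
    show ?thesis unfolding e by (rule DERIV_cmult_Id)
  qed
  ultimately have "((\<lambda>x. 3 * ((max 0 (1 - (x / R)\<^sup>2))\<^sup>2 * (- (2 * x / R\<^sup>2)))) has_real_derivative
     3 * ((2 * max 0 (1 - (x / R)\<^sup>2) * - (2 * x / R\<^sup>2)) * (- (2 * x / R\<^sup>2)) + (- (2 / R\<^sup>2)) * (max 0 (1 - (x / R)\<^sup>2))\<^sup>2)) (at x)"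
    by (intro DERIV_cmult DERIV_mult)
  then show "(bump1 R has_real_derivative bump2 R x) (at x)"
    by (simp add: bump1_def[abs_def] bump2_def power2_eq_square algebra_simps)
qed

lemma bump_outside: "R > 0 \<Longrightarrow> \<bar>x\<bar> \<ge> R \<Longrightarrow> bump R x = 0 \<and> bump1 R x = 0 \<and> bump2 R x = 0"
proof -
  assume R: "R > 0" "\<bar>x\<bar> \<ge> R"
  have "1 \<le> \<bar>x\<bar> / R" using R by simp
  then have "1 \<le> (x / R)\<^sup>2" by (metis abs_divide abs_of_pos R(1) one_le_power power2_abs)
  then have "max 0 (1 - (x / R)\<^sup>2) = 0" by simp
  then show ?thesis by (simp add: bump_def bump1_def bump2_def)
qed

text \<open>The second derivative is of order \<open>1 / R^2\<close> with constant
  \<open>6 4 + 6 = 30\<close>; for \<open>R \<ge> 1\<close> this is weakened to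
  \<open>1 / R\<close>, so that both derivatives obey bounds of the same form.\<close>

lemma bump_bounds:
  assumes R: "R \<ge> 1"
  shows "\<bar>bump R x\<bar> \<le> 1" "\<bar>bump1 R x\<bar> \<le> 6 / R" "\<bar>bump2 R x\<bar> \<le> 30 / R"
proof -
  show "\<bar>bump R x\<bar> \<le> 1"
    unfolding bump_def by (simp add: power_le_one abs_le_iff)
  show "\<bar>bump1 R x\<bar> \<le> 6 / R"
  proof (cases "\<bar>x\<bar> < R")
    case True
    let ?s = "max 0 (1 - (x / R)\<^sup>2)"
    have s: "0 \<le> ?s\<^sup>2" "?s\<^sup>2 \<le> 1" by (simp_all add: power_le_one)
    have "\<bar>2 * x / R\<^sup>2\<bar> \<le> 2 * R / R\<^sup>2" using True R by (simp add: abs_mult divide_right_mono)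
    also have "\<dots> = 2 / R" using R by (simp add: power2_eq_square)
    finally have d: "\<bar>2 * x / R\<^sup>2\<bar> \<le> 2 / R" .
    have "\<bar>bump1 R x\<bar> = 3 * ?s\<^sup>2 * \<bar>2 * x / R\<^sup>2\<bar>" unfolding bump1_def abs_mult abs_minus_cancel using s by simp
    also have "\<dots> \<le> 3 * 1 * (2 / R)" using s d by (intro mult_mono) auto
    finally show ?thesis by simp
  qed (use bump_outside[of R x] R in auto)
  show "\<bar>bump2 R x\<bar> \<le> 30 / R"
  proof (cases "\<bar>x\<bar> < R")
    case True
    let ?s = "max 0 (1 - (x / R)\<^sup>2)"
    have s: "0 \<le> ?s" "?s \<le> 1" "0 \<le> ?s\<^sup>2" "?s\<^sup>2 \<le> 1" by (simp_all add: power_le_one)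
    have "\<bar>2 * x / R\<^sup>2\<bar> \<le> 2 * R / R\<^sup>2" using True R by (simp add: abs_mult divide_right_mono)
    also have "\<dots> = 2 / R" using R by (simp add: power2_eq_square)
    finally have d: "(2 * x / R\<^sup>2)\<^sup>2 \<le> (2 / R)\<^sup>2" by (rule abs_le_square_iff[THEN iffD1, OF order_trans]) (use R in simp)
    have "\<bar>bump2 R x\<bar> \<le> \<bar>6 * ?s * (2 * x / R\<^sup>2)\<^sup>2\<bar> + \<bar>6 * ?s\<^sup>2 / R\<^sup>2\<bar>" unfolding bump2_def by (rule abs_triangle_ineq4)
    also have "\<bar>6 * ?s * (2 * x / R\<^sup>2)\<^sup>2\<bar> = 6 * ?s * (2 * x / R\<^sup>2)\<^sup>2" using s by simp
    also have "\<bar>6 * ?s\<^sup>2 / R\<^sup>2\<bar> = 6 * ?s\<^sup>2 / R\<^sup>2" using s by simp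
    also have "6 * ?s * (2 * x / R\<^sup>2)\<^sup>2 \<le> 6 * 1 * (2 / R)\<^sup>2" using s d by (intro mult_mono) auto
    also have "6 * ?s\<^sup>2 / R\<^sup>2 \<le> 6 * 1 / R\<^sup>2" using s by (intro divide_right_mono mult_left_mono) auto
    also have "6 * 1 * (2 / R)\<^sup>2 + 6 * 1 / R\<^sup>2 = 30 / R / R" by (simp add: power2_eq_square)
    also have "\<dots> \<le> 30 / R / 1" using R by (intro divide_left_mono) auto
    finally show ?thesis by simp
  qed (use bump_outside[of R x] R in auto)
qed

text \<open>On the inner half the base is at least 3/4, and \<open>27/64\<close> is its
  cube.\<close>

lemma bump_inner: "R > 0 \<Longrightarrow> \<bar>x\<bar> \<le> R / 2 \<Longrightarrow> bump R x \<ge> 27 / 64"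
proof -
  assume R: "R > 0" "\<bar>x\<bar> \<le> R / 2"
  have "\<bar>x / R\<bar> \<le> 1 / 2" using R by (simp add: field_simps)
  then have "(x / R)\<^sup>2 \<le> (1 / 2)\<^sup>2" by (metis abs_le_square_iff abs_of_pos half_gt_zero zero_less_one)
  also have "(1 / 2 :: real)\<^sup>2 = 1 / 4" by (simp add: power2_eq_square)
  finally have "3 / 4 \<le> max 0 (1 - (x / R)\<^sup>2)" unfolding le_max_iff_disj by linarith
  then have "(3 / 4) ^ 3 \<le> bump R x" unfolding bump_def by (rule power_mono) simp
  then show ?thesis by (simp add: power3_eq_cube)
qed

lemma continuous_vanishing_bounded:
  fixes g :: "real \<Rightarrow> 'a::real_normed_vector"
  assumes c: "continuous_on UNIV g" and z: "\<And>x. \<bar>x\<bar> > R \<Longrightarrow> g x = 0"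
  obtains K where "K \<ge> 0" "\<And>x. norm (g x) \<le> K"
proof -
  have "bounded (g ` {- R..R})"
    by (intro compact_imp_bounded compact_continuous_image continuous_on_subset[OF c] compact_Icc) auto
  then obtain K where K: "K > 0" "\<And>x. x \<in> {- R..R} \<Longrightarrow> norm (g x) \<le> K" unfolding bounded_pos by blast
  have "norm (g x) \<le> K" for x
    using K(1) K(2)[of x] z[of x] by (cases "\<bar>x\<bar> > R") (auto simp: not_less abs_le_iff)
  then show thesis using K(1) that[of K] by simp
qed

lemma powr_integrable_compact_support:
  fixes g :: "real \<Rightarrow> complex^'n"
  assumes c: "continuous_on UNIV g" and z: "\<And>x. \<bar>x\<bar> > R \<Longrightarrow> g x = 0" and P: "P > 0"
  shows "integrable lborel (\<lambda>x. norm (g x) powr P)"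
proof -
  obtain K where K: "K \<ge> 0" "\<And>x. norm (g x) \<le> K" using continuous_vanishing_bounded[OF c z] by metis
  have [measurable]: "g \<in> borel_measurable borel" by (rule borel_measurable_continuous_onI[OF c])
  show ?thesis
  proof (rule Bochner_Integration.integrable_bound[where f="\<lambda>x. K powr P * indicator {- R..R} x"])
    show "integrable lborel (\<lambda>x. K powr P * indicator {- R..R} x :: real)"
      using emeasure_bounded_finite[of "{- R..R}"] by (intro integrable_mult_right integrable_real_indicator) auto
    show "AE x in lborel. norm (norm (g x) powr P) \<le> norm (K powr P * indicator {- R..R} x :: real)"
    proof (intro AE_I2)
      fix x show "norm (norm (g x) powr P) \<le> norm (K powr P * indicator {- R..R} x :: real)"
        using K(2)[of x] z[of x] P by (cases "\<bar>x\<bar> > R") (auto simp: indicator_def intro!: powr_mono2)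
    qed
  qed simp
qed

lemma enn2real_ge_1: "1 \<le> p \<Longrightarrow> p \<noteq> \<infinity> \<Longrightarrow> 1 \<le> enn2real p"
  using enn2real_mono[of 1 p] by (simp add: less_top)

lemma Lp_compact_support:
  fixes g :: "real \<Rightarrow> complex^'n"
  assumes c: "continuous_on UNIV g" and z: "\<And>x. \<bar>x\<bar> > R \<Longrightarrow> g x = 0" and p: "1 \<le> p"
  shows "g \<in> Lp p"
proof (cases "p = \<infinity>")
  case True
  obtain K where "\<And>x. norm (g x) \<le> K" using continuous_vanishing_bounded[OF c z] by metis
  then show ?thesis using True borel_measurable_continuous_onI[OF c] by (auto simp: Lp_def)
next
  case False
  have "enn2real p > 0" using enn2real_ge_1[OF p False] by linarith
  then show ?thesis
    using False borel_measurable_continuous_onI[OF c] powr_integrable_compact_support[OF c z] by (auto simp: Lp_def)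
qed

text \<open>Here \<open>w\<close> is a Bloch wave, \<open>v N\<close> a truncation of it to a window of length of order \<open>N\<close>, and
  \<open>u N\<close> its image under \<open>L - \<lambda>\<close>. The integral of \<open>\<bar>v N\<bar>\<^sup>p\<close> is at least of order \<open>N\<close>, that of
  \<open>\<bar>u N\<bar>\<^sup>p\<close> at most of order \<open>N\<^sup>1\<^sup>-\<^sup>p\<close>.\<close>
lemma Lp_norm_truncation:
  fixes w :: "real \<Rightarrow> complex^'n" and v u :: "nat \<Rightarrow> real \<Rightarrow> complex^'n"
  assumes T: "T > 0" and p: "1 \<le> p"
    and w: "continuous_on UNIV w" "\<And>x. norm (w (x + T)) = norm (w x)" "w x0 \<noteq> 0" "x0 \<in> {0..T}"
    and R: "\<And>N. R N = 2 * real (Suc N) * T"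
    and v: "\<And>N. continuous_on UNIV (v N)" "\<And>N x. \<bar>x\<bar> > R N \<Longrightarrow> v N x = 0"
      "\<And>N x. \<bar>x\<bar> \<le> R N / 2 \<Longrightarrow> c * norm (w x) \<le> norm (v N x)"
    and u: "\<And>N. continuous_on UNIV (u N)" "\<And>N x. \<bar>x\<bar> > R N \<Longrightarrow> u N x = 0"
      "\<And>N x. R N \<ge> 1 \<Longrightarrow> norm (u N x) \<le> C1 / R N"
    and c: "c > 0" and le: "\<And>N. R N \<ge> 1 \<Longrightarrow> Lp_norm p (v N) \<le> C * Lp_norm p (u N)"
  shows False
proof -
  \<comment> \<open>\<open>C\<close> and \<open>C1\<close> carry no sign, and positive majorants
    allow the inequalities to be multiplied and raised to powers.\<close>
  define C2 where "C2 = max C 1"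
  define C3 where "C3 = max C1 1"
  have C2: "C2 > 0" "C \<le> C2" and C3: "C3 > 0" "C1 \<le> C3" by (auto simp: C2_def C3_def)
  have u': "norm (u N x) \<le> C3 / R N" if "R N \<ge> 1" for N x
    using u(3)[OF that, of x] C3(2) that by (meson divide_right_mono order_trans zero_le_one)
  have RN: "R N \<ge> 1" if "real N > 1 / (2 * T)" for N using that T by (simp add: R field_simps)
  have meas[measurable]: "v N \<in> borel_measurable borel" "u N \<in> borel_measurable borel" for N
    by (rule borel_measurable_continuous_onI[OF v(1)] borel_measurable_continuous_onI[OF u(1)])+
  show False
  proof (cases "p = \<infinity>")
    case True
    have low: "c * norm (w x0) \<le> Lp_norm p (v N)" if N: "N \<ge> 1" for N
    proof -
      have x0: "\<bar>x0\<bar> \<le> R N / 2"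
      proof -
        have "T \<le> real (Suc N) * T" using mult_right_mono[of 1 "real (Suc N)" T] T by simp
        then have "x0 \<le> real (Suc N) * T" "0 \<le> x0" using w(4) order_trans[of x0 T] by auto
        moreover have "R N / 2 = real (Suc N) * T" by (simp add: R)
        ultimately show ?thesis by linarith
      qed
      define e where "e = esssup lborel (\<lambda>x. ereal (norm (v N x)))"
      obtain K where "\<And>x. norm (v N x) \<le> K" using continuous_vanishing_bounded[OF v(1) v(2)] by metis
      then have eK: "e \<le> ereal K" unfolding e_def by (intro esssup_I AE_I2) auto
      \<comment> \<open>By continuity a value above the essential supremum would be exceeded nearly
        on a whole interval, a set of positive measure.\<close>
      have ev: "ereal (norm (v N x0)) \<le> e"
      proof (rule ccontr)
        assume "\<not> ?thesis"
        then have lt: "e < ereal (norm (v N x0))" by simp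
        then obtain b where b: "e < ereal b" "b < norm (v N x0)"
          using ereal_dense2 ereal_less(2) by (metis less_ereal.simps(1) ereal_dense3 less_trans)
        have "open ((\<lambda>x. norm (v N x)) -` {b<..})"
          by (rule open_vimage) (auto intro!: continuous_intros v(1))
        then obtain d where d: "d > 0" "\<And>x. dist x x0 < d \<Longrightarrow> b < norm (v N x)"
          using b(2) unfolding open_dist by (metis greaterThan_iff vimageD vimageI)
        have "{x0 - d<..<x0 + d} \<subseteq> {x \<in> space lborel. ereal (norm (v N x)) > e}"
        proof
          fix x assume "x \<in> {x0 - d<..<x0 + d}"
          then have "dist x x0 < d" by (auto simp: dist_real_def)
          then have "ereal b < ereal (norm (v N x))" using d(2) by simp
          then show "x \<in> {x \<in> space lborel. ereal (norm (v N x)) > e}" using b(1) by (simp add: less_trans)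
        qed
        then have "emeasure lborel {x0 - d<..<x0 + d} \<le> emeasure lborel {x \<in> space lborel. ereal (norm (v N x)) > e}"
          by (intro emeasure_mono) auto
        also have "\<dots> = 0" unfolding e_def by (rule esssup_zero_measure)
        finally show False using d(1) by simp
      qed
      have "ereal (c * norm (w x0)) \<le> e" using v(3)[OF x0] ev by (meson ereal_less_eq(3) order_trans)
      then have "c * norm (w x0) \<le> real_of_ereal e" using eK by (cases e) auto
      then show ?thesis by (simp add: Lp_norm_def True e_def)
    qed
    have up: "Lp_norm p (u N) \<le> C3 / R N" "0 \<le> Lp_norm p (u N)" if N: "R N \<ge> 1" for N
    proof -
      have a: "esssup lborel (\<lambda>x. ereal (norm (u N x))) \<le> ereal (C3 / R N)"
        using u'[OF N] by (intro esssup_I AE_I2) auto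
      have b: "esssup lborel (\<lambda>x::real. ereal 0) \<le> esssup lborel (\<lambda>x. ereal (norm (u N x)))"
        by (intro esssup_mono) auto
      have "esssup lborel (\<lambda>x::real. ereal 0) = 0" by (subst esssup_const) (auto simp: zero_ereal_def)
      then show "Lp_norm p (u N) \<le> C3 / R N" "0 \<le> Lp_norm p (u N)"
        using a b True by (cases "esssup lborel (\<lambda>x. ereal (norm (u N x)))"; auto simp: Lp_norm_def zero_ereal_def)+
    qed
    have cw: "c * norm (w x0) > 0" using c w(3) by simp
    obtain N where N: "real N > 1 / (2 * T) + C2 * C3 / (c * norm (w x0) * (2 * T))" using reals_Archimedean2 by blast
    have pos: "C2 * C3 / (c * norm (w x0) * (2 * T)) \<ge> 0" using C2 C3 cw T by simp
    have pos': "1 / (2 * T) > 0" using T by simp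
    have "R N \<ge> 1" using N pos RN[of N] by linarith
    moreover have "N \<ge> 1" using N pos pos' by (cases N) auto
    ultimately have N1: "R N \<ge> 1" "N \<ge> 1" by auto
    have "c * norm (w x0) \<le> C * Lp_norm p (u N)" using low[OF N1(2)] le[OF N1(1)] by linarith
    also have "\<dots> \<le> C2 * (C3 / R N)" using up[OF N1(1)] C2 C3 by (intro mult_mono) auto
    finally have "c * norm (w x0) * R N \<le> C2 * C3" using N1 by (simp add: field_simps)
    moreover have "c * norm (w x0) * (2 * real N * T) \<le> c * norm (w x0) * R N"
      using cw T by (intro mult_left_mono) (auto simp: R)
    ultimately have "c * norm (w x0) * (2 * real N * T) \<le> C2 * C3" by linarith
    then have "real N \<le> C2 * C3 / (c * norm (w x0) * (2 * T))" using cw T by (simp add: field_simps)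
    moreover have "1 / (2 * T) > 0" using T by simp
    ultimately show False using N by linarith
  next
    case False
    define P where "P = enn2real p"
    have P: "P \<ge> 1" using enn2real_ge_1[OF p False] by (simp add: P_def)
    define h where "h x = (c * norm (w x)) powr P" for x
    have hc: "continuous_on S h" for S
      unfolding h_def using P
      by (intro continuous_on_powr' continuous_intros continuous_on_subset[OF w(1)]) (auto simp: c less_imp_le)
    have hper: "h (x + T) = h x" for x by (simp add: h_def w(2))
    have m: "integral {0..T} h > 0"
    proof -
      have "integral {0..T} h \<ge> 0" by (intro integral_nonneg integrable_continuous_interval hc) (simp add: h_def)
      moreover have "integral {0..T} h \<noteq> 0"
      proof
        assume "integral {0..T} h = 0"
        then have "h x0 = 0"
          using integral_eq_0_iff[OF hc[of "{0..T}"] T] w(4) by (auto simp: h_def)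
        then show False using c w(3) by (simp add: h_def)
      qed
      ultimately show ?thesis by simp
    qed
    have low: "real N * integral {0..T} h \<le> (LINT x|lborel. norm (v N x) powr P)" if N: "N \<ge> 1" for N
    proof -
      have "real N * integral {0..T} h = integral {0..real N * T} h"
        using periodic_integral[OF T hper hc, of N] by (simp add: integral_unique)
      also have "\<dots> = (LINT x : {0..real N * T} | lborel. h x)"
        by (rule set_borel_integral_eq_integral(2)[symmetric]) (rule borel_integrable_atLeastAtMost'[OF hc])
      also have "\<dots> \<le> (LINT x|lborel. norm (v N x) powr P)"
        unfolding set_lebesgue_integral_def
      proof (rule integral_mono)
        show "integrable lborel (\<lambda>x. indicator {0..real N * T} x *\<^sub>R h x)"
          using borel_integrable_atLeastAtMost'[OF hc, of 0 "real N * T"] by (simp add: set_integrable_def)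
        show "integrable lborel (\<lambda>x. norm (v N x) powr P)"
          by (rule powr_integrable_compact_support[OF v(1) v(2)]) (use P in auto)
        fix x
        have "c * norm (w x) \<le> norm (v N x)" if "x \<in> {0..real N * T}"
          by (rule v(3)) (use that T in \<open>auto simp: R algebra_simps\<close>)
        then show "indicator {0..real N * T} x *\<^sub>R h x \<le> norm (v N x) powr P"
          using c P by (auto simp: indicator_def h_def intro!: powr_mono2)
      qed
      finally show ?thesis .
    qed
    have up: "(LINT x|lborel. norm (u N x) powr P) \<le> (C3 / R N) powr P * (2 * R N)" if N: "R N \<ge> 1" for N
    proof -
      have "(LINT x|lborel. norm (u N x) powr P) \<le> (LINT x|lborel. (C3 / R N) powr P * indicator {- R N..R N} x)"
      proof (rule integral_mono)
        show "integrable lborel (\<lambda>x. norm (u N x) powr P)"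
          by (rule powr_integrable_compact_support[OF u(1) u(2)]) (use P in auto)
        show "integrable lborel (\<lambda>x. (C3 / R N) powr P * indicator {- R N..R N} x)"
          using emeasure_bounded_finite[of "{- R N..R N}"] by (intro integrable_mult_right integrable_real_indicator) auto
        fix x show "norm (u N x) powr P \<le> (C3 / R N) powr P * indicator {- R N..R N} x"
          using u'[OF N, of x] u(2)[of N x] P by (cases "\<bar>x\<bar> > R N") (auto simp: indicator_def intro!: powr_mono2)
      qed
      also have "\<dots> = (C3 / R N) powr P * (2 * R N)" using N by simp
      finally show ?thesis .
    qed
    \<comment> \<open>After raising to the power \<open>P\<close> the left side grows linearly in
      \<open>N\<close>, while the right side is a constant times \<open>R^(1 - P)\<close>, which is
      bounded since \<open>P \<ge> 1\<close>.\<close>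
    have key: "real N * integral {0..T} h \<le> 2 * (C2 * C3) powr P" if N: "N \<ge> 1" "R N \<ge> 1" for N
    proof -
      let ?a = "LINT x|lborel. norm (v N x) powr P" and ?b = "LINT x|lborel. norm (u N x) powr P"
      have ab: "?a \<ge> 0" "?b \<ge> 0" by (intro integral_nonneg_AE AE_I2; simp)+
      have "?a powr (1 / P) \<le> C * ?b powr (1 / P)" using le[OF N(2)] False by (simp add: Lp_norm_def P_def)
      also have "\<dots> \<le> C2 * ?b powr (1 / P)" using C2 by (intro mult_right_mono) auto
      finally have "(?a powr (1 / P)) powr P \<le> (C2 * ?b powr (1 / P)) powr P" using P by (intro powr_mono2) auto
      then have "?a \<le> C2 powr P * ?b" using P ab C2 by (simp add: powr_powr powr_mult)
      also have "\<dots> \<le> C2 powr P * ((C3 / R N) powr P * (2 * R N))" using up[OF N(2)] by (intro mult_left_mono) auto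
      also have "\<dots> = 2 * (C2 * C3) powr P * (R N * R N powr (- P))"
        using C2 C3 N(2) by (simp add: powr_mult powr_divide powr_minus field_simps)
      also have "R N * R N powr (- P) = R N powr (1 - P)" using N(2) by (simp add: powr_diff powr_minus field_simps)
      also have "R N powr (1 - P) \<le> R N powr 0" using N(2) P by (intro powr_mono) auto
      also have "R N powr 0 = 1" using N(2) by simp
      finally have "?a \<le> 2 * (C2 * C3) powr P" by (simp add: mult_left_mono)
      then show ?thesis using low[OF N(1)] by linarith
    qed
    obtain N where N: "real N > 1 / (2 * T) + 2 * (C2 * C3) powr P / integral {0..T} h" using reals_Archimedean2 by blast
    have pos: "2 * (C2 * C3) powr P / integral {0..T} h \<ge> 0" "1 / (2 * T) > 0" using m T by simp_all
    have N1: "R N \<ge> 1" using N pos RN[of N] by linarith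
    have "N \<ge> 1" using N pos by (cases N) auto
    from key[OF this N1] have "real N \<le> 2 * (C2 * C3) powr P / integral {0..T} h" using m by (simp add: field_simps)
    then show False using N pos by linarith
  qed
qed

section \<open>Bloch waves and the spectrum\<close>

lemma norm_smult: "norm (c *s v) = norm c * norm (v :: complex^'n)"
  by (simp add: norm_vec_def norm_mult L2_set_right_distrib)

context wave_evans
begin

text \<open>An eigenvector of the monodromy matrix for a multiplier of modulus 1 continues to a
  solution on the line that is periodic up to this multiplier, so its norm is periodic.\<close>

lemma bloch_wave:
  assumes D: "Dc (of_real k) l = 0"
  obtains w y \<kappa> x0 where "norm \<kappa> = 1" "x0 \<in> {0..T}" "w x0 \<noteq> 0"
    "\<And>x. w (x + T) = \<kappa> *s w x" "\<And>x. y (x + T) = \<kappa> *s y x"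
    "\<And>x. (w has_vector_derivative cmat (Bi x) *v (cmat (A x) *v w x + y x)) (at x)"
    "\<And>x. (y has_vector_derivative l *s w x) (at x)"
proof -
  let ?\<kappa> = "exp (\<i> * of_real k * of_real T)"
  have n\<kappa>: "norm ?\<kappa> = 1" by (simp add: norm_exp_eq_Re)
  obtain v where v: "v \<noteq> 0" "\<Phi> l T *v v = ?\<kappa> *s v"
    using D mat_spectrum_iff_det[of ?\<kappa> "\<Phi> l T"] by (auto simp: Dc_def mat_spectrum_def)
  define z where "z x = \<Phi> l x *v v" for x
  have zd: "(z has_vector_derivative CF l x *v z x) (at x)" for x
    unfolding z_def[abs_def] by (rule \<Phi>_mv_deriv)
  have per: "z (x + T) = ?\<kappa> *s z x" for x
    unfolding z_def by (rule \<Phi>_floquet[OF v(2)])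
  define w y where "w x = (\<chi> i. z x $ Inl i)" and "y x = (\<chi> i. z x $ Inr i)" for x
  have zs: "z x = vjoin (w x) (y x)" for x unfolding w_def y_def by (rule vjoin_split)
  have zd': "(z has_vector_derivative vjoin (cmat (Bi x) *v (cmat (A x) *v w x + y x)) (l *s w x)) (at x)" for x
    using zd[of x] by (simp add: zs[of x] CF_def block_mv mat_mv matrix_vector_mul_assoc[symmetric] matrix_vector_right_distrib)
  have wd: "(w has_vector_derivative cmat (Bi x) *v (cmat (A x) *v w x + y x)) (at x)" for x
  proof (rule has_vector_derivative_vec)
    fix i show "((\<lambda>x. w x $ i) has_vector_derivative (cmat (Bi x) *v (cmat (A x) *v w x + y x)) $ i) (at x)"
      using has_vector_derivative_vec_nth[OF zd', of "Inl i" x] by (simp add: w_def)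
  qed
  have yd: "(y has_vector_derivative l *s w x) (at x)" for x
  proof (rule has_vector_derivative_vec)
    fix i show "((\<lambda>x. y x $ i) has_vector_derivative (l *s w x) $ i) (at x)"
      using has_vector_derivative_vec_nth[OF zd', of "Inr i" x] by (simp add: y_def)
  qed
  have wper: "w (x + T) = ?\<kappa> *s w x" and yper: "y (x + T) = ?\<kappa> *s y x" for x
    by (simp_all add: w_def y_def per vec_eq_iff)
  \<comment> \<open>If \<open>w\<close> vanished identically, its equation would leave
    \<open>B^(-1) y = 0\<close>, and the whole solution would vanish at 0.\<close>
  have "\<exists>x0. w x0 \<noteq> 0"
  proof (rule ccontr)
    assume "\<not> (\<exists>x0. w x0 \<noteq> 0)"
    then have w0: "w x = 0" for x by simp
    then have "w = (\<lambda>x. 0)" by (simp add: fun_eq_iff)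
    then have "cmat (Bi 0) *v y 0 = 0"
      using wd[of 0] vector_derivative_unique_at[OF has_vector_derivative_const[of 0] wd[of 0, unfolded \<open>w = (\<lambda>x. 0)\<close>]] by (simp add: w0)
    then have "cmat (Bx 0) *v (cmat (Bi 0) *v y 0) = 0" by simp
    then have "y 0 = 0" by (simp add: matrix_vector_mul_assoc cmat_mult[symmetric] Bi_mult cmat_mat)
    then have "z 0 = 0" by (simp add: zs w0 vec_sum_eq_iff)
    then show False using v(1) by (simp add: z_def \<Phi>_0)
  qed
  then obtain x1 where x1: "w x1 \<noteq> 0" by blast
  have nw: "norm (w (x + T)) = norm (w x)" for x
    unfolding wper using norm_smult[of ?\<kappa> "w x"] n\<kappa> by simp
  obtain x0 where "x0 \<in> {0..T}" "norm (w x0) = norm (w x1)"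
    by (rule periodic_representative[of T "\<lambda>x. norm (w x)" x1]) (use T_pos nw in auto)
  then show thesis using that[OF n\<kappa> _ _ wper yper wd yd, of x0] x1 by (metis norm_eq_zero)
qed

text \<open>The a priori estimate contained in \<open>L_resolvent_set\<close> is what fails:
  \<open>L - l\<close> applied to the truncated Bloch wave leaves only terms with derivatives of the
  cutoff, which become negligible against the wave as the window grows.\<close>

lemma L_spectrum_contains:
  assumes D: "Dc (of_real k) l = 0" and p: "1 \<le> p"
  shows "l \<in> L_spectrum p (lin_B B ubar) (lin_A f B ubar)"
proof (rule ccontr)
  assume "l \<notin> L_spectrum p (lin_B B ubar) (lin_A f B ubar)"
  moreover have eqB: "lin_B B ubar = Bx" and eqA: "lin_A f B ubar = A" by (simp_all add: lin_B_def Bx_def A_def fun_eq_iff)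
  ultimately obtain C where "\<forall>(v, w) \<in> L_graph p Bx A. Lp_norm p v \<le> C * Lp_norm p (\<lambda>x. w x - l *s v x)"
    unfolding L_spectrum_def L_resolvent_set_def by auto
  then have C: "Lp_norm p v \<le> C * Lp_norm p (\<lambda>x. g x - l *s v x)" if "(v, g) \<in> L_graph p Bx A" for v g
    using that by blast
  obtain w y \<kappa> x0 where \<kappa>: "norm \<kappa> = 1" and x0: "x0 \<in> {0..T}" "w x0 \<noteq> 0"
    and wper: "\<And>x. w (x + T) = \<kappa> *s w x" and yper: "\<And>x. y (x + T) = \<kappa> *s y x"
    and wd: "\<And>x. (w has_vector_derivative cmat (Bi x) *v (cmat (A x) *v w x + y x)) (at x)"
    and yd: "\<And>x. (y has_vector_derivative l *s w x) (at x)"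
    by (rule bloch_wave[OF D]) blast
  let ?Bx = "\<lambda>x. cmat (Bx x)" and ?A = "\<lambda>x. cmat (A x)" and ?Bi = "\<lambda>x. cmat (Bi x)"
  define w1 where "w1 x = ?Bi x *v (?A x *v w x + y x)" for x
  define w2 where "w2 x = ?Bi x *v (?A x *v w1 x + cmat (dA x) *v w x + l *s w x) + cmat (- (Bi x ** dB x ** Bi x)) *v (?A x *v w x + y x)" for x
  have wd: "(w has_vector_derivative w1 x) (at x)" for x using wd by (simp add: w1_def)
  have w1d: "(w1 has_vector_derivative w2 x) (at x)" for x
    unfolding w1_def[abs_def] w2_def
    by (intro hvd_mv hvd_cmat Bi_deriv has_vector_derivative_add A_deriv wd[unfolded w1_def] yd)
  have cw: "continuous_on S w" "continuous_on S w1" "continuous_on S y" for S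
    by (rule continuous_on_vector_derivative, blast intro: wd w1d yd has_vector_derivative_at_within)+
  have c_smult: "continuous_on S (\<lambda>x. a *s q x)" if "continuous_on S q" for S a and q :: "real \<Rightarrow> complex^'n"
    using cont_mv[OF continuous_on_const[of S "mat a"] that] by (simp add: mat_mv)
  have cw2: "continuous_on S w2" for S
    unfolding w2_def[abs_def]
    by (intro continuous_intros cont_mv continuous_on_cmat cont_Bi cont_A cont_dA cont_mm cont_dB cw c_smult)
  have Bw1: "?Bx x *v w1 x = ?A x *v w x + y x" for x
    by (simp add: w1_def matrix_vector_mul_assoc cmat_mult[symmetric] Bi_mult cmat_mat)
  \<comment> \<open>\<open>q1\<close> and \<open>q2\<close> are the coefficients of the first and
    second derivative of the cutoff in \<open>(L - l)\<close> of the truncated wave; they inherit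
    the Floquet multiplier and are therefore bounded.\<close>
  define q1 where "q1 x = y x + cmat (dB x) *v w x + ?Bx x *v w1 x" for x
  define q2 where "q2 x = ?Bx x *v w x" for x
  have cq: "continuous_on S q1" "continuous_on S q2" for S
    unfolding q1_def[abs_def] q2_def[abs_def]
    by (intro continuous_intros cont_mv continuous_on_cmat cont_Bx cont_dB cw)+
  have dBper: "dB (x + T) = dB x" for x by (simp add: dB_def periodic periodic_coeff)
  have w1per: "w1 (x + T) = \<kappa> *s w1 x" for x
    by (simp add: w1_def wper yper periodic_coeff matrix_vector_mult_smult matrix_vector_right_distrib vector_add_ldistrib)
  have nq: "norm (q1 (x + T)) = norm (q1 x)" "norm (q2 (x + T)) = norm (q2 x)" "norm (w (x + T)) = norm (w x)" for x
  proof -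
    have "q1 (x + T) = \<kappa> *s q1 x" "q2 (x + T) = \<kappa> *s q2 x"
      by (simp_all add: q1_def q2_def wper yper w1per dBper periodic_coeff matrix_vector_mult_smult matrix_vector_right_distrib vector_add_ldistrib)
    then show "norm (q1 (x + T)) = norm (q1 x)" "norm (q2 (x + T)) = norm (q2 x)" "norm (w (x + T)) = norm (w x)"
      using norm_smult[of \<kappa>] \<kappa> wper by simp_all
  qed
  obtain K1 where K1: "K1 \<ge> 0" "\<And>x. norm (q1 x) \<le> K1" by (rule quasi_periodic_bounded[OF T_pos nq(1) cq(1)]) blast
  obtain K2 where K2: "K2 \<ge> 0" "\<And>x. norm (q2 x) \<le> K2" by (rule quasi_periodic_bounded[OF T_pos nq(2) cq(2)]) blast
  define R where "R N = 2 * real (Suc N) * T" for N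
  define v where "v N x = bump (R N) x *\<^sub>R w x" for N x
  define v1 where "v1 N x = bump (R N) x *\<^sub>R w1 x + bump1 (R N) x *\<^sub>R w x" for N x
  define v2 where "v2 N x = (bump (R N) x *\<^sub>R w2 x + bump1 (R N) x *\<^sub>R w1 x) + (bump1 (R N) x *\<^sub>R w1 x + bump2 (R N) x *\<^sub>R w x)" for N x
  define g where "g N x = (bump (R N) x *\<^sub>R (l *s w x) + bump1 (R N) x *\<^sub>R y x)
     + (bump1 (R N) x *\<^sub>R (?Bx x *v w1 x + cmat (dB x) *v w x) + bump2 (R N) x *\<^sub>R (?Bx x *v w x))" for N x
  define u where "u N x = g N x - l *s v N x" for N x
  have cb: "continuous_on S (bump R)" "continuous_on S (bump1 R)" "continuous_on S (bump2 R)" for S R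
    unfolding bump_def[abs_def] bump1_def[abs_def] bump2_def[abs_def] divide_inverse by (intro continuous_intros)+
  have cont: "continuous_on S (v N)" "continuous_on S (v1 N)" "continuous_on S (v2 N)" "continuous_on S (g N)" "continuous_on S (u N)" for S N
    unfolding v_def[abs_def] v1_def[abs_def] v2_def[abs_def] g_def[abs_def] u_def[abs_def]
    by (intro continuous_intros cb cw cw2 c_smult cont_mv continuous_on_cmat cont_Bx cont_dB)+
  have out: "v N x = 0 \<and> v1 N x = 0 \<and> v2 N x = 0 \<and> g N x = 0 \<and> u N x = 0" if "\<bar>x\<bar> > R N" "R N > 0" for N x
    using bump_outside[of "R N" x] that by (simp add: v_def v1_def v2_def g_def u_def)
  have Rpos: "R N > 0" for N using T_pos by (simp add: R_def)
  have graph: "(v N, g N) \<in> L_graph p Bx A" if N: "R N > 0" for N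
  proof -
    have R0: "R N \<noteq> 0" using N by simp
    have vd: "(v N has_vector_derivative v1 N x) (at x)" for x
      unfolding v_def[abs_def] v1_def by (intro has_vector_derivative_scaleR bump_deriv[OF R0] wd)
    have v1d: "(v1 N has_vector_derivative v2 N x) (at x)" for x
      unfolding v1_def[abs_def] v2_def
      by (intro has_vector_derivative_add has_vector_derivative_scaleR bump_deriv[OF R0] bump1_deriv[OF R0] wd w1d)
    \<comment> \<open>Through \<open>B w' - A w = y\<close> the flux of the truncated wave needs
      just one derivative of the cutoff; differentiating it gives \<open>g\<close>.\<close>
    have flux: "?Bx x *v v1 N x - ?A x *v v N x = bump (R N) x *\<^sub>R y x + bump1 (R N) x *\<^sub>R (?Bx x *v w x)" for x
      using Bw1[of x] by (simp add: v_def v1_def matrix_vector_right_distrib bounded_bilinear.scaleR_right[OF bilinear_mv] scaleR_add_right)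
    have gd: "((\<lambda>x. ?Bx x *v v1 N x - ?A x *v v N x) has_vector_derivative g N x) (at x)" for x
      unfolding flux g_def
      by (intro has_vector_derivative_add has_vector_derivative_scaleR bump_deriv[OF R0] bump1_deriv[OF R0] yd hvd_mv hvd_cmat Bx_deriv wd)
    have FTC: "x \<le> x' \<Longrightarrow> (h' has_integral h x' - h x) {x..x'}"
      if "\<And>x. (h has_vector_derivative h' x) (at x)" for h h' :: "real \<Rightarrow> complex^'n" and x x'
      by (rule fundamental_theorem_of_calculus) (auto intro: has_vector_derivative_at_within that)
    have Lp: "v N \<in> Lp p" "v1 N \<in> Lp p" "v2 N \<in> Lp p" "g N \<in> Lp p"
      using out N by (auto intro!: Lp_compact_support[OF _ _ p, where R="R N"] cont)
    show ?thesis
      unfolding L_graph_def mem_Collect_eq case_prod_conv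
      using Lp vd FTC[OF v1d] FTC[OF gd] by blast
  qed
  have ueq: "u N x = bump1 (R N) x *\<^sub>R q1 x + bump2 (R N) x *\<^sub>R q2 x" for N x
  proof -
    have "l *s (bump (R N) x *\<^sub>R w x) = bump (R N) x *\<^sub>R (l *s w x)" by (simp add: vec_eq_iff)
    then show ?thesis by (simp add: u_def g_def v_def q1_def q2_def scaleR_add_right add_ac)
  qed
  show False
  proof (rule Lp_norm_truncation[OF T_pos p cw(1) nq(3) x0(2,1), where R=R and v=v and u=u and c="27/64" and ?C1.0="6 * K1 + 30 * K2" and C=C])
    show "R N = 2 * real (Suc N) * T" for N by (simp add: R_def)
    show "v N x = 0" "u N x = 0" if "\<bar>x\<bar> > R N" for N x
      using out[OF that Rpos] by auto
    show "27 / 64 * norm (w x) \<le> norm (v N x)" if "\<bar>x\<bar> \<le> R N / 2" for N x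
    proof -
      have "27 / 64 \<le> \<bar>bump (R N) x\<bar>" using bump_inner[OF Rpos that] by linarith
      then show ?thesis unfolding v_def norm_scaleR by (rule mult_right_mono) simp
    qed
    show "norm (u N x) \<le> (6 * K1 + 30 * K2) / R N" if "R N \<ge> 1" for N x
    proof -
      have "norm (u N x) \<le> \<bar>bump1 (R N) x\<bar> * norm (q1 x) + \<bar>bump2 (R N) x\<bar> * norm (q2 x)"
        unfolding ueq by (rule order_trans[OF norm_triangle_ineq]) simp
      also have "\<dots> \<le> 6 / R N * K1 + 30 / R N * K2"
        using bump_bounds(2,3)[OF that, of x] K1 K2 that by (intro add_mono mult_mono) auto
      finally show ?thesis by (simp add: add_divide_distrib)
    qed
    show "Lp_norm p (v N) \<le> C * Lp_norm p (u N)" if "R N \<ge> 1" for N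
      using C[OF graph[of N]] that by (simp add: u_def[abs_def])
  qed (use cont in auto)
qed

end

section \<open>Curves of spectrum\<close>

lemma det_mat: "det (mat a :: 'a::comm_ring_1^'n^'n) = a ^ CARD('n)"
  by (subst det_diagonal) (auto simp: mat_def)

lemma matrix_add_rdistrib: "(M + M') ** L = M ** L + M' ** (L :: 'a::semiring_1^'m^'n)"
  by (simp add: matrix_matrix_mult_def vec_eq_iff sum.distrib distrib_right)

text \<open>The homogenized characteristic polynomial; for \<open>t = 0\<close> it reduces to a
  power of \<open>\<mu>\<close>.\<close>

lemma det_pencil:
  assumes "eigenvalue_list (M :: complex^'n^'n) \<alpha>"
  shows "det (mat \<mu> + mat t ** M) = (\<Prod>j\<in>UNIV. \<mu> + t * \<alpha> j)"
proof (cases "t = 0")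
  case True
  then show ?thesis by (simp add: mat_zero det_mat)
next
  case False
  have "mat \<mu> + mat t ** M = mat (- t) ** (mat (\<mu> / (- t)) - M)"
    using False by (auto simp: vec_eq_iff mat_mult_left) (auto simp: mat_def right_diff_distrib)
  then have "det (mat \<mu> + mat t ** M) = (\<Prod>j\<in>(UNIV :: 'n set). - t) * (\<Prod>j\<in>UNIV. \<mu> / (- t) - \<alpha> j)"
    using assms by (simp only: det_mul det_mat eigenvalue_list_def prod_constant)
  also have "\<dots> = (\<Prod>j\<in>UNIV. - t * (\<mu> / (- t) - \<alpha> j))" by (simp only: prod.distrib)
  also have "\<dots> = (\<Prod>j\<in>UNIV. \<mu> + t * \<alpha> j)" using False by (intro prod.cong refl) (simp add: field_simps)
  finally show ?thesis .
qed

text \<open>In the Leibniz sum every permutation except the identity moves an index and contributes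
  a degree below \<open>n\<close>. The characteristic polynomial is therefore monic of degree
  \<open>n\<close>, and its roots can be indexed by the finite type.\<close>

lemma eigenvalue_list_exists: "\<exists>\<alpha>. eigenvalue_list (M :: complex^'n^'n) \<alpha>"
proof -
  define X :: "complex poly^'n^'n" where "X = (\<chi> i j. if i = j then [:- M $ i $ j, 1:] else [:- M $ i $ j:])"
  define p where "p = det X"
  let ?n = "CARD('n)"
  have eval: "poly p z = det (mat z - M)" for z
    unfolding p_def det_def poly_sum poly_mult poly_prod
    by (intro sum.cong refl arg_cong2[where f="(*)"] prod.cong) (auto simp: X_def mat_def)
  have deg: "degree (\<Prod>i\<in>UNIV. X $ i $ \<sigma> i) \<le> card {i. \<sigma> i = i}" for \<sigma>
  proof -
    have "degree (\<Prod>i\<in>UNIV. X $ i $ \<sigma> i) \<le> (\<Sum>i\<in>UNIV. degree (X $ i $ \<sigma> i))"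
      using degree_prod_sum_le[of UNIV "\<lambda>i. X $ i $ \<sigma> i"] by (simp add: o_def)
    also have "\<dots> \<le> (\<Sum>i\<in>UNIV. if \<sigma> i = i then 1 else 0)" by (intro sum_mono) (auto simp: X_def)
    also have "\<dots> = card {i. \<sigma> i = i}" by (simp add: sum.If_cases)
    finally show ?thesis .
  qed
  have card_le: "card {i. \<sigma> i = i} \<le> ?n" for \<sigma> :: "'n \<Rightarrow> 'n" by (rule card_mono) auto
  have signdeg: "degree (of_int (sign \<sigma>) * (\<Prod>i\<in>UNIV. X $ i $ \<sigma> i)) \<le> card {i. \<sigma> i = i}" for \<sigma>
    using deg[of \<sigma>] by (auto simp: sign_def)
  have dp: "degree p \<le> ?n"
    unfolding p_def det_def by (intro degree_sum_le) (auto intro: order_trans[OF signdeg card_le] simp: finite_permutations)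
  have diag: "coeff (\<Prod>i\<in>UNIV. X $ i $ i) ?n = 1"
  proof -
    have "X $ i $ i = [:- M $ i $ i, 1:]" for i by (simp add: X_def)
    moreover have "degree (\<Prod>i\<in>(UNIV :: 'n set). [:- M $ i $ i, 1:]) = ?n"
      by (subst degree_prod_eq_sum_degree) auto
    moreover have "lead_coeff (\<Prod>i\<in>(UNIV :: 'n set). [:- M $ i $ i, 1:]) = 1" by (simp add: lead_coeff_prod)
    ultimately show ?thesis by simp
  qed
  have off: "coeff (of_int (sign \<sigma>) * (\<Prod>i\<in>UNIV. X $ i $ \<sigma> i)) ?n = (if \<sigma> = id then 1 else 0)" for \<sigma>
  proof (cases "\<sigma> = id")
    case False
    then obtain i where "\<sigma> i \<noteq> i" by (auto simp: fun_eq_iff)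
    then have "{i. \<sigma> i = i} \<subset> UNIV" by auto
    then have "card {i. \<sigma> i = i} < ?n" by (rule psubset_card_mono[rotated]) simp
    then show ?thesis using signdeg[of \<sigma>] False by (simp add: coeff_eq_0)
  qed (simp add: diag sign_id)
  have cp: "coeff p ?n = 1"
    unfolding p_def det_def coeff_sum off
    by (subst sum.delta) (auto simp: finite_permutations permutes_id)
  then have "p \<noteq> 0" "degree p = ?n" using dp le_degree[of p ?n] by auto
  then obtain R where R: "size R = ?n" "p = smult (lead_coeff p) (\<Prod>x\<in>#R. [:- x, 1:])"
    using alg_closed_imp_factorization[of p] by auto
  obtain xs where xs: "R = mset xs" using ex_mset by metis
  obtain h where h: "bij_betw h (UNIV :: 'n set) {0..<?n}" using ex_bij_betw_finite_nat[of "UNIV :: 'n set"] by auto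
  have "det (mat z - M) = (\<Prod>j\<in>UNIV. z - xs ! h j)" for z
  proof -
    have "det (mat z - M) = (\<Prod>x\<in>#R. z - x)"
      unfolding eval[symmetric] by (subst R(2)) (simp add: cp[unfolded \<open>degree p = ?n\<close>[symmetric]] poly_prod_mset image_mset.compositionality o_def)
    also have "\<dots> = prod_list (map (\<lambda>x. z - x) xs)" unfolding xs by (simp flip: prod_mset_prod_list)
    also have "\<dots> = (\<Prod>i\<in>{0..<?n}. z - xs ! i)" using R(1) by (simp add: prod.list_conv_set_nth xs)
    also have "\<dots> = (\<Prod>j\<in>UNIV. z - xs ! h j)" by (rule prod.reindex_bij_betw[OF h, symmetric])
    finally show ?thesis .
  qed
  then show ?thesis unfolding eigenvalue_list_def by (intro exI[of _ "\<lambda>j. xs ! h j"]) simp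
qed

lemma eigenvalue_list_0:
  assumes "eigenvalue_list (M :: complex^'n^'n) \<alpha>"
  shows "det M = 0 \<longleftrightarrow> (\<exists>j. \<alpha> j = 0)"
proof -
  have "det (- M) = (\<Prod>j\<in>UNIV. - \<alpha> j)" using assms[unfolded eigenvalue_list_def, rule_format, of 0] by (simp add: mat_zero)
  then have "det M = 0 \<longleftrightarrow> (\<Prod>j\<in>UNIV. - \<alpha> j) = 0" by (metis det_uminus mult_eq_0_iff power_eq_0_iff neg_equal_0_iff_equal zero_neq_one)
  then show ?thesis by simp
qed

lemma consists_of_curves_reindex:
  assumes h: "inj_on h I" and c: "consists_of_curves D (h ` I) c"
  shows "consists_of_curves D I (\<lambda>i. c (h i))"
proof -
  have "card {j \<in> h ` I. c j k = l} = card {i \<in> I. c (h i) k = l}" for k l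
  proof -
    have "{j \<in> h ` I. c j k = l} = h ` {i \<in> I. c (h i) k = l}" by auto
    then show ?thesis using h by (simp add: card_image inj_on_def)
  qed
  then show ?thesis using c by (simp add: consists_of_curves_def)
qed

text \<open>For \<open>k\<close> of the same sign as \<open>Re s\<close> the linear part of the
  curve lies in the right half-plane, and near 0 the error is at most half its real part in
  size.\<close>

lemma unstable_slope:
  assumes c: "consists_of_curves D J c" and j: "j \<in> J"
    and o: "(\<lambda>k. c j k - s * of_real k) \<in> o[at 0](\<lambda>k. of_real k)" and s: "Re s \<noteq> 0"
  shows "\<exists>k z. D k z = 0 \<and> Re z > 0"
proof -
  have c0: "c j 0 = 0" and "\<exists>\<epsilon>>0. continuous_on {-\<epsilon><..<\<epsilon>} (c j)"
    using c j by (auto simp: consists_of_curves_def)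
  then obtain e where "e > 0" "continuous_on {-e<..<e} (c j)" by blast
  then have "isCont (c j) 0" by (simp add: continuous_on_eq_continuous_at)
  then have lim: "(c j \<longlongrightarrow> 0) (at 0)" by (simp add: isCont_def c0)
  have "\<exists>\<epsilon>>0. \<exists>\<delta>>0. \<forall>k l. \<bar>k\<bar> < \<epsilon> \<and> norm l < \<delta> \<longrightarrow>
        (D k l = 0 \<longleftrightarrow> (\<exists>j\<in>J. c j k = l)) \<and> (D k l = 0 \<longrightarrow> zorder (D k) l = int (card {j\<in>J. c j k = l}))"
    using c unfolding consists_of_curves_def by (rule conjunct2)
  then obtain \<epsilon> \<delta> where \<epsilon>12: "\<epsilon> > 0" "\<delta> > 0" and Z: "\<forall>k l. \<bar>k\<bar> < \<epsilon> \<and> norm l < \<delta> \<longrightarrow>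
        (D k l = 0 \<longleftrightarrow> (\<exists>j\<in>J. c j k = l)) \<and> (D k l = 0 \<longrightarrow> zorder (D k) l = int (card {j\<in>J. c j k = l}))"
    by (elim exE conjE) (rule that)
  have \<epsilon>3: "D k l = 0 \<longleftrightarrow> (\<exists>j\<in>J. c j k = l)" if "\<bar>k\<bar> < \<epsilon>" "norm l < \<delta>" for k l
    using Z[rule_format, OF conjI[OF that]] by (rule conjunct1)
  note \<epsilon> = \<epsilon>12 \<epsilon>3
  have "\<forall>\<^sub>F k in at 0. norm (c j k) < \<delta>" using tendstoD[OF lim \<epsilon>(2)] by simp
  moreover have "\<forall>\<^sub>F k in at 0. norm (c j k - s * of_real k) \<le> \<bar>Re s\<bar> / 2 * norm (complex_of_real k)"
    by (rule landau_o.smallD[OF o]) (use s in simp)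
  moreover have "\<forall>\<^sub>F k in at (0::real). \<bar>k\<bar> < \<epsilon>" using \<epsilon>(1) by (auto simp: eventually_at intro!: exI[of _ \<epsilon>])
  ultimately have "\<forall>\<^sub>F k in at (0::real). \<bar>k\<bar> < \<epsilon> \<and> norm (c j k) < \<delta> \<and> norm (c j k - s * of_real k) \<le> \<bar>Re s\<bar> / 2 * \<bar>k\<bar>"
    by eventually_elim simp
  then obtain d where d: "d > 0" "\<And>k. k \<noteq> 0 \<Longrightarrow> \<bar>k\<bar> < d \<Longrightarrow> \<bar>k\<bar> < \<epsilon> \<and> norm (c j k) < \<delta> \<and> norm (c j k - s * of_real k) \<le> \<bar>Re s\<bar> / 2 * \<bar>k\<bar>"
    unfolding eventually_at by (auto simp: dist_real_def)
  define k where "k = sgn (Re s) * (d / 2)"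
  have k: "k \<noteq> 0" "\<bar>k\<bar> = d / 2" "Re s * k = \<bar>Re s\<bar> * (d / 2)" using s d(1) by (auto simp: k_def abs_mult sgn_if)
  have est: "\<bar>k\<bar> < \<epsilon>" "norm (c j k) < \<delta>" "norm (c j k - s * of_real k) \<le> \<bar>Re s\<bar> / 2 * \<bar>k\<bar>"
  proof -
    have "\<bar>k\<bar> < \<epsilon> \<and> norm (c j k) < \<delta> \<and> norm (c j k - s * of_real k) \<le> \<bar>Re s\<bar> / 2 * \<bar>k\<bar>"
      by (rule d(2)) (use k d(1) in auto)
    then show "\<bar>k\<bar> < \<epsilon>" "norm (c j k) < \<delta>" "norm (c j k - s * of_real k) \<le> \<bar>Re s\<bar> / 2 * \<bar>k\<bar>" by blast+
  qed
  have "D k (c j k) = 0" using \<epsilon>(3)[OF est(1,2)] j by blast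
  moreover have "Re (c j k) > 0"
  proof -
    have "\<bar>Re (c j k - s * of_real k)\<bar> \<le> \<bar>Re s\<bar> / 2 * \<bar>k\<bar>" using abs_Re_le_cmod order_trans est(3) by blast
    moreover have "Re (c j k - s * of_real k) = Re (c j k) - \<bar>Re s\<bar> * (d / 2)" using k(3) by simp
    moreover have "\<bar>Re s\<bar> / 2 * \<bar>k\<bar> < \<bar>Re s\<bar> * (d / 2)" using s d(1) k(2) by simp
    ultimately show ?thesis by linarith
  qed
  ultimately show ?thesis by blast
qed

lemma prod_option:
  fixes g :: "'n::finite option \<Rightarrow> 'a::comm_monoid_mult"
  shows "(\<Prod>i\<in>insert None (Some ` S). g i) = g None * (\<Prod>j\<in>S. g (Some j))"
  by (subst prod.insert) (auto simp: prod.reindex)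

theorem corollary6p2:
  fixes f :: "real^'n \<Rightarrow> real^'n"
    and B :: "real^'n \<Rightarrow> real^'n^'n"
    and ubar :: "real \<Rightarrow> real^'n"
    and um u0 :: "real^'n"
    and T :: real
    and i1 :: 'n
    and U :: "(real^'n) \<times> (real^'n) \<times> real \<Rightarrow> real \<Rightarrow> real^'n"
    and \<phi> :: "(real^'n) \<times> real \<Rightarrow> (real^'n) \<times> real"
    and \<Psi> :: "real \<Rightarrow> complex \<Rightarrow> complex^('n+'n)^('n+'n)"
    and D :: "real \<Rightarrow> complex \<Rightarrow> complex"
    and N :: "real^'n^'n"
    and p :: ennreal
  assumes T_pos: "T > 0"
    and wave: "tw_solution f B um 0 UNIV ubar"
    and periodic: "\<And>x. ubar (x + T) = ubar x"
    and nonconstant: "\<exists>x y. ubar x \<noteq> ubar y"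
    and u0: "ubar 0 = u0"
    and coordinates: "vector_derivative ubar (at 0) = axis i1 1"
    and family: "tw_family f B T (um, u0, 0) U"
    and surface: "periodic_surface U (um, u0, 0) T i1 \<phi>"
    and N_def: "N = jacobian (mass U T \<phi> (u0 $ i1)) (at um)"
    and Psi: "fundamental_solution (evans_matrix (lin_B B ubar) (lin_A f B ubar)) \<Psi>"
    and D_def: "D = evans_function \<Psi> T"
    and p: "1 \<le> p"
    and i: "C2 f" "C2 B"
    and ii: "\<And>x z. z \<in> mat_spectrum (cmat (B (ubar x))) \<Longrightarrow> Re z > 0"
    and iii: "invertible (jacobian f (at um))"
    and iv: "transversality U (um, u0, 0) T i1 \<noteq> 0"
    and v: "quasi_hamiltonian f B 0 um u0"
  shows
    "(det N \<noteq> 0 \<longrightarrow>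
        (\<forall>\<alpha>. eigenvalue_list (cmat (jacobian f (at um) ** matrix_inv N)) \<alpha> \<longrightarrow>
          (\<exists>lam0 lam.
             consists_of_curves D (UNIV :: 'n option set) (case_option lam0 lam) \<and>
             Cinf_curve lam0 \<and>
             lam0 \<in> o[at 0](\<lambda>k. of_real k) \<and>
             (\<forall>j. C1_curve (lam j) \<and>
                  ((\<forall>i. i \<noteq> j \<longrightarrow> \<alpha> i \<noteq> \<alpha> j) \<longrightarrow> Cinf_curve (lam j)) \<and>
                  (\<lambda>k. lam j k - (- \<i> * \<alpha> j * of_real k * of_real T)) \<in> o[at 0](\<lambda>k. of_real k)))) \<and>
        (weakly_spectrally_stable p f B ubar \<longrightarrow>
           mat_spectrum (cmat (jacobian f (at um) ** matrix_inv N)) \<subseteq> \<real>))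
     \<and>
     (det N = 0 \<longrightarrow>
        (\<forall>\<beta>. eigenvalue_list (cmat (N ** matrix_inv (jacobian f (at um)))) \<beta> \<longrightarrow>
          (\<exists>lam0 lam (m::nat) mu.
             consists_of_curves D (insert None (Some ` {j. \<beta> j \<noteq> 0}) <+> {..<m})
               (case_sum (case_option lam0 lam) mu) \<and>
             Cinf_curve lam0 \<and>
             lam0 \<in> o[at 0](\<lambda>k. of_real k) \<and>
             (\<forall>j. \<beta> j \<noteq> 0 \<longrightarrow>
                  C1_curve (lam j) \<and>
                  ((\<forall>i. i \<noteq> j \<longrightarrow> \<beta> i \<noteq> \<beta> j) \<longrightarrow> Cinf_curve (lam j)) \<and>
                  (\<lambda>k. lam j k - (- \<i> * inverse (\<beta> j) * of_real k * of_real T))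
                    \<in> o[at 0](\<lambda>k. of_real k)) \<and>
             m \<ge> card {j. \<beta> j = 0} \<and>
             (\<forall>l<m. fractional_power_curve (mu l)))) \<and>
        \<not> weakly_spectrally_stable p f B ubar)"
proof -
  obtain f' f'' where f: "\<And>u. (f has_derivative blinfun_apply (f' u)) (at u)"
    "\<And>u. (f' has_derivative blinfun_apply (f'' u)) (at u)" "continuous_on UNIV f''"
    using i(1) unfolding C2_def by blast
  obtain B' B'' where B: "\<And>u. (B has_derivative blinfun_apply (B' u)) (at u)"
    "\<And>u. (B' has_derivative blinfun_apply (B'' u)) (at u)" "continuous_on UNIV B''"
    using i(2) unfolding C2_def by blast
  interpret wave_evans f B ubar um T f' f'' B' B'' \<Psi>
    by unfold_locales (use T_pos wave periodic f B ii Psi in auto)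
  obtain Pm Qm zt where "wave_full f B ubar um T f' f'' B' B'' \<Psi> Pm Qm zt" by (rule real_fundamental)
  then interpret wave_full f B ubar um T f' f'' B' B'' \<Psi> Pm Qm zt .
  interpret wave_all f B ubar um T f' f'' B' B'' \<Psi> Pm Qm zt U i1
    by unfold_locales (use family coordinates u0 in auto)
  have "det G \<noteq> 0" using iv transversality_eq u0 by simp
  note G = this
  have qh: "quasi_hamiltonian f B 0 um (ubar 0)" using v u0 by simp
  obtain \<Xi> \<xi> where \<Xi>: "\<And>j. \<Xi> $ i1 $ j = 0" "P1 ** \<Xi> = Qm T ** A0" "\<Xi> = matrix_inv G ** (Qm T ** A0)"
    and \<xi>: "\<xi> $ i1 = 0" "P1 *v \<xi> = axis i1 1"
    by (rule correction[OF qh G]) blast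
  have jf: "jacobian f (at um) = A0"
    using frechet_derivative_at[OF f(1)[of um]] by (simp add: jacobian_def A0_def)
  have NE: "N = IP ** \<Xi> - IQ ** A0"
    unfolding N_def u0[symmetric] by (rule mass_jacobian[OF qh G _ \<Xi>(1,3)]) (use surface u0 in simp)
  have A0: "det A0 \<noteq> 0" using iii by (simp add: jf invertible_det_nz)
  have DD: "D = (\<lambda>k. Dc (of_real k))" by (simp add: fun_eq_iff D_def Dc_real)
  obtain K a b where ab: "\<And>i. a i holomorphic_on UNIV" "\<And>i. b i holomorphic_on UNIV" "\<And>w z. Dc w z = (\<Sum>i<(K::nat). a i w * b i z)"
    using Dc_separable unfolding separable_def by blast
  interpret analytic_family a b K Dc
    by unfold_locales (use ab Dc_nontrivial in auto)
  define c where "c = of_real (det G) / det (- cmat A0)"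
  have c: "c \<noteq> 0" using G A0 by (simp add: c_def det_uminus det_cmat)
  let ?n = "CARD('n)"
  define t where "t = \<i> * of_real T"
  have t: "t \<noteq> 0" using T_pos by (simp add: t_def)
  \<comment> \<open>The case \<open>a = 1\<close>, \<open>b = \<mu>\<close> of
    \<open>evans_limit\<close>: the line \<open>\<lambda> = k \<mu>\<close>.\<close>
  have lim: "((\<lambda>k. Dc k (k * \<mu>) / k ^ (?n + 1)) \<longlongrightarrow> c * \<mu> * det (mat \<mu> ** cmat N + mat t ** cmat A0)) (at 0)" for \<mu>
    using evans_limit[OF \<Xi>(1,2) \<xi> A0, of 1 \<mu>] by (simp add: c_def NE t_def)
  \<comment> \<open>The case \<open>a = 0\<close>, \<open>b = 1\<close>: a nonzero mass determinant
    fixes the order of the zero at \<open>k = 0\<close> as \<open>n + 1\<close>.\<close>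
  have lim0: "((\<lambda>z. Dc 0 z / z ^ (?n + 1)) \<longlongrightarrow> c * of_real (det N)) (at 0)"
    using evans_limit[OF \<Xi>(1,2) \<xi> A0, of 0 1] by (simp add: c_def NE mat_zero det_cmat)
  have unstable: "\<not> weakly_spectrally_stable p f B ubar" if "Dc (of_real k) z = 0" "Re z > 0" for k z
    using L_spectrum_contains[OF that(1) p] that(2) by (force simp: weakly_spectrally_stable_def)
  have part_a: "\<exists>lam0 lam.
             consists_of_curves D (UNIV :: 'n option set) (case_option lam0 lam) \<and>
             Cinf_curve lam0 \<and>
             lam0 \<in> o[at 0](\<lambda>k. of_real k) \<and>
             (\<forall>j. C1_curve (lam j) \<and>
                  ((\<forall>i. i \<noteq> j \<longrightarrow> \<alpha> i \<noteq> \<alpha> j) \<longrightarrow> Cinf_curve (lam j)) \<and>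
                  (\<lambda>k. lam j k - (- \<i> * \<alpha> j * of_real k * of_real T)) \<in> o[at 0](\<lambda>k. of_real k))"
    if N: "det N \<noteq> 0" and \<alpha>: "eigenvalue_list (cmat (A0 ** matrix_inv N)) \<alpha>" for \<alpha>
  proof -
    have inv: "invertible N" using N by (simp add: invertible_det_nz)
    have "det (A0 ** matrix_inv N) * det N \<noteq> 0"
      using A0 by (simp add: det_mul[symmetric] matrix_mul_assoc[symmetric] matrix_inv_mult[OF inv])
    then have "det (cmat (A0 ** matrix_inv N)) \<noteq> 0" by (simp add: det_cmat)
    then have \<alpha>0: "\<alpha> j \<noteq> 0" for j using eigenvalue_list_0[OF \<alpha>] by blast
    define s where "s i = (case i of None \<Rightarrow> 0 | Some j \<Rightarrow> - (t * \<alpha> j))" for i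
    have lim': "((\<lambda>k. Dc k (k * \<mu>) / k ^ (?n + 1)) \<longlongrightarrow> (c * of_real (det N)) * (\<Prod>i\<in>(UNIV :: 'n option set). \<mu> - s i)) (at 0)" for \<mu>
    proof -
      have "mat \<mu> ** cmat N + mat t ** cmat A0 = (mat \<mu> + mat t ** cmat (A0 ** matrix_inv N)) ** cmat N"
        by (simp add: matrix_add_rdistrib matrix_mul_assoc[symmetric] cmat_mult[symmetric] matrix_inv_mult[OF inv])
      then have "det (mat \<mu> ** cmat N + mat t ** cmat A0) = (\<Prod>j\<in>UNIV. \<mu> + t * \<alpha> j) * of_real (det N)"
        by (simp add: det_mul det_pencil[OF \<alpha>] det_cmat)
      moreover have "(\<Prod>i\<in>(UNIV :: 'n option set). \<mu> - s i) = \<mu> * (\<Prod>j\<in>UNIV. \<mu> + t * \<alpha> j)"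
        unfolding UNIV_option_conv prod_option by (simp add: s_def)
      ultimately show ?thesis using lim[of \<mu>] by (simp add: mult_ac)
    qed
    have C: "c * complex_of_real (det N) \<noteq> 0" using c N by simp
    show ?thesis
    proof (rule curves_of_zeros[OF finite C lim' lim0])
      fix cc :: "'n option \<Rightarrow> real \<Rightarrow> complex" and mu and m :: nat
      assume cc: "consists_of_curves (\<lambda>k. Dc (of_real k)) ((UNIV :: 'n option set) <+> {..<m}) (case_sum cc mu)"
        "\<And>i. i \<in> (UNIV :: 'n option set) \<Longrightarrow> C1_curve (cc i)"
        "\<And>i. i \<in> (UNIV :: 'n option set) \<Longrightarrow> (\<lambda>k. cc i k - s i * of_real k) \<in> o[at 0](\<lambda>k. of_real k)"
        "\<And>i. i \<in> (UNIV :: 'n option set) \<Longrightarrow> (\<And>i'. i' \<in> UNIV \<Longrightarrow> i' \<noteq> i \<Longrightarrow> s i' \<noteq> s i) \<Longrightarrow> Cinf_curve (cc i)"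
        "?n + 1 \<le> card (UNIV :: 'n option set) + m"
        "c * complex_of_real (det N) \<noteq> 0 \<Longrightarrow> card (UNIV :: 'n option set) + m = ?n + 1"
        "\<And>l. l < m \<Longrightarrow> fractional_power_curve (mu l)"
        "m > 0 \<Longrightarrow> \<exists>k z. Dc (of_real k) z = 0 \<and> Re z > 0"
      have "card (UNIV :: 'n option set) = ?n + 1" by (simp add: UNIV_option_conv card_image)
      \<comment> \<open>The \<open>n + 1\<close> zeros present at \<open>k = 0\<close> are used up
        by the \<open>n + 1\<close> slopes, so nothing steep remains.\<close>
      then have m: "m = 0" using cc(6)[OF C] by simp
      have "consists_of_curves D (Inl ` (UNIV :: 'n option set)) (case_sum cc mu)"
        using cc(1) by (simp add: m DD Plus_def)
      then have "consists_of_curves D UNIV (\<lambda>i. case_sum cc mu (Inl i))" by (rule consists_of_curves_reindex[rotated]) simp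
      moreover have "(\<lambda>i. case_sum cc mu (Inl i)) = case_option (cc None) (\<lambda>j. cc (Some j))"
        by (auto simp: fun_eq_iff split: option.split)
      ultimately have 1: "consists_of_curves D UNIV (case_option (cc None) (\<lambda>j. cc (Some j)))" by (rule back_subst)
      have 2: "Cinf_curve (cc None)"
      proof (rule cc(4)[OF UNIV_I])
        fix i' :: "'n option" assume "i' \<noteq> None"
        then show "s i' \<noteq> s None" using t \<alpha>0 by (cases i') (auto simp: s_def)
    qed
    have 3: "cc None \<in> o[at 0](\<lambda>k. of_real k)" using cc(3)[of None] by (simp add: s_def)
    have 4: "Cinf_curve (cc (Some j))" if "\<forall>i. i \<noteq> j \<longrightarrow> \<alpha> i \<noteq> \<alpha> j" for j
    proof (rule cc(4)[OF UNIV_I])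
      fix i' assume "i' \<noteq> Some j"
      then show "s i' \<noteq> s (Some j)" using t \<alpha>0 that by (cases i') (auto simp: s_def)
    qed
    have 5: "(\<lambda>k. cc (Some j) k - (- \<i> * \<alpha> j * of_real k * of_real T)) \<in> o[at 0](\<lambda>k. of_real k)" for j
      using cc(3)[of "Some j"] by (simp add: s_def t_def mult_ac)
    show ?thesis using 1 2 3 4 5 cc(2)[OF UNIV_I] by blast
    qed
  qed
  have part_a': "mat_spectrum (cmat (A0 ** matrix_inv N)) \<subseteq> \<real>"
    if N: "det N \<noteq> 0" and st: "weakly_spectrally_stable p f B ubar"
  proof
    fix z assume z: "z \<in> mat_spectrum (cmat (A0 ** matrix_inv N))"
    obtain \<alpha> where \<alpha>: "eigenvalue_list (cmat (A0 ** matrix_inv N)) \<alpha>" using eigenvalue_list_exists by blast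
    have "det (cmat (A0 ** matrix_inv N) - mat z) = 0" using z by (simp only: mat_spectrum_iff_det)
    then have "det (- (cmat (A0 ** matrix_inv N) - mat z)) = 0" by (simp only: det_uminus mult_zero_right)
    then have "det (mat z - cmat (A0 ** matrix_inv N)) = 0" by simp
    then obtain j where j: "z = \<alpha> j" using \<alpha> by (auto simp: eigenvalue_list_def)
    obtain lam0 lam where lam: "consists_of_curves D (UNIV :: 'n option set) (case_option lam0 lam)"
      "\<And>j. (\<lambda>k. lam j k - (- \<i> * \<alpha> j * of_real k * of_real T)) \<in> o[at 0](\<lambda>k. of_real k)"
      using part_a[OF N \<alpha>] by blast
    show "z \<in> \<real>"
    proof (rule ccontr)
      assume "z \<notin> \<real>"
      then have "Im (\<alpha> j) \<noteq> 0" using j by (simp add: complex_is_Real_iff)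
      \<comment> \<open>The factor \<open>- \<i>\<close> turns an imaginary part of the eigenvalue
        into a real part of the slope.\<close>
      then have "Re (- \<i> * \<alpha> j * of_real T) \<noteq> 0" using T_pos by simp
      moreover have "(\<lambda>k. case_option lam0 lam (Some j) k - (- \<i> * \<alpha> j * of_real T) * of_real k) \<in> o[at 0](\<lambda>k. of_real k)"
        using lam(2)[of j] by (simp add: mult_ac)
      ultimately obtain k w where "D k w = 0" "Re w > 0" using unstable_slope[OF lam(1), of "Some j"] by blast
      then show False using unstable[of k w] st by (simp add: DD)
    qed
  qed
  have part_b: "(\<exists>lam0 lam (m::nat) mu.
             consists_of_curves D (insert None (Some ` {j. \<beta> j \<noteq> 0}) <+> {..<m})
               (case_sum (case_option lam0 lam) mu) \<and>
             Cinf_curve lam0 \<and>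
             lam0 \<in> o[at 0](\<lambda>k. of_real k) \<and>
             (\<forall>j. \<beta> j \<noteq> 0 \<longrightarrow>
                  C1_curve (lam j) \<and>
                  ((\<forall>i. i \<noteq> j \<longrightarrow> \<beta> i \<noteq> \<beta> j) \<longrightarrow> Cinf_curve (lam j)) \<and>
                  (\<lambda>k. lam j k - (- \<i> * inverse (\<beta> j) * of_real k * of_real T))
                    \<in> o[at 0](\<lambda>k. of_real k)) \<and>
             m \<ge> card {j. \<beta> j = 0} \<and>
             (\<forall>l<m. fractional_power_curve (mu l))) \<and>
      (card {j. \<beta> j = 0} > 0 \<longrightarrow> \<not> weakly_spectrally_stable p f B ubar)"
    if \<beta>: "eigenvalue_list (cmat (N ** matrix_inv A0)) \<beta>" for \<beta>
  proof -
    have inv: "invertible A0" using A0 by (simp add: invertible_det_nz)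
    let ?S = "{j. \<beta> j \<noteq> 0}" and ?Z = "{j. \<beta> j = 0}"
    let ?I = "insert None (Some ` ?S) :: 'n option set"
    define s where "s i = (case i of None \<Rightarrow> 0 | Some j \<Rightarrow> - (t * inverse (\<beta> j)))" for i
    \<comment> \<open>Each vanishing \<open>\<beta> j\<close> contributes the constant
      \<open>t\<close> instead of a linear factor in \<open>\<mu>\<close>; the missing degree is
      what forces steep branches.\<close>
    define C where "C = c * of_real (det A0) * t ^ card ?Z * (\<Prod>j\<in>?S. \<beta> j)"
    have C: "C \<noteq> 0" using c A0 t by (simp add: C_def)
    have lim': "((\<lambda>k. Dc k (k * \<mu>) / k ^ (?n + 1)) \<longlongrightarrow> C * (\<Prod>i\<in>?I. \<mu> - s i)) (at 0)" for \<mu>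
    proof -
      have "mat \<mu> ** cmat N + mat t ** cmat A0 = (mat t + mat \<mu> ** cmat (N ** matrix_inv A0)) ** cmat A0"
        by (simp add: matrix_add_rdistrib matrix_mul_assoc[symmetric] cmat_mult[symmetric] matrix_inv_mult[OF inv])
      then have "det (mat \<mu> ** cmat N + mat t ** cmat A0) = (\<Prod>j\<in>UNIV. t + \<mu> * \<beta> j) * of_real (det A0)"
        by (simp add: det_mul det_pencil[OF \<beta>] det_cmat)
      moreover have "(\<Prod>j\<in>UNIV. t + \<mu> * \<beta> j) = (\<Prod>j\<in>?S. t + \<mu> * \<beta> j) * (\<Prod>j\<in>?Z. t + \<mu> * \<beta> j)"
        by (subst prod.union_disjoint[symmetric]) (auto intro!: prod.cong)
      moreover have "(\<Prod>j\<in>?Z. t + \<mu> * \<beta> j) = t ^ card ?Z" by simp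
      moreover have "(\<Prod>j\<in>?S. t + \<mu> * \<beta> j) = (\<Prod>j\<in>?S. \<beta> j) * (\<Prod>j\<in>?S. \<mu> - s (Some j))"
        unfolding prod.distrib[symmetric] by (intro prod.cong refl) (simp add: s_def field_simps)
      moreover have "(\<Prod>i\<in>?I. \<mu> - s i) = \<mu> * (\<Prod>j\<in>?S. \<mu> - s (Some j))"
        unfolding prod_option by (simp add: s_def)
      ultimately show ?thesis using lim[of \<mu>] by (simp add: C_def mult_ac)
    qed
    show ?thesis
    proof (rule curves_of_zeros[OF finite C lim' lim0])
      fix cc :: "'n option \<Rightarrow> real \<Rightarrow> complex" and mu and m :: nat
      assume cc: "consists_of_curves (\<lambda>k. Dc (of_real k)) (?I <+> {..<m}) (case_sum cc mu)"
        "\<And>i. i \<in> ?I \<Longrightarrow> C1_curve (cc i)"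
        "\<And>i. i \<in> ?I \<Longrightarrow> (\<lambda>k. cc i k - s i * of_real k) \<in> o[at 0](\<lambda>k. of_real k)"
        "\<And>i. i \<in> ?I \<Longrightarrow> (\<And>i'. i' \<in> ?I \<Longrightarrow> i' \<noteq> i \<Longrightarrow> s i' \<noteq> s i) \<Longrightarrow> Cinf_curve (cc i)"
        "?n + 1 \<le> card ?I + m"
        "c * complex_of_real (det N) \<noteq> 0 \<Longrightarrow> card ?I + m = ?n + 1"
        "\<And>l. l < m \<Longrightarrow> fractional_power_curve (mu l)"
        "m > 0 \<Longrightarrow> \<exists>k z. Dc (of_real k) z = 0 \<and> Re z > 0"
      have eq: "case_option (cc None) (\<lambda>j. cc (Some j)) = cc"
        by (auto simp: fun_eq_iff split: option.split)
      have 1: "consists_of_curves D (?I <+> {..<m}) (case_sum (case_option (cc None) (\<lambda>j. cc (Some j))) mu)"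
        unfolding eq DD by (rule cc(1))
      have 2: "Cinf_curve (cc None)"
        by (rule cc(4)) (use t in \<open>auto simp: s_def\<close>)
      have 3: "cc None \<in> o[at 0](\<lambda>k. of_real k)" using cc(3)[of None] by (simp add: s_def)
      have 4: "Cinf_curve (cc (Some j))" if "\<beta> j \<noteq> 0" "\<forall>i. i \<noteq> j \<longrightarrow> \<beta> i \<noteq> \<beta> j" for j
        by (rule cc(4)) (use that t in \<open>auto simp: s_def\<close>)
      have 5: "(\<lambda>k. cc (Some j) k - (- \<i> * inverse (\<beta> j) * of_real k * of_real T)) \<in> o[at 0](\<lambda>k. of_real k)" if "\<beta> j \<noteq> 0" for j
        using cc(3)[of "Some j"] that by (simp add: s_def t_def mult_ac)
      have "card ?I = card ?S + 1" by (simp add: card_image)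
      moreover have "card ?S + card ?Z = ?n"
        by (subst card_Un_disjoint[symmetric]) (auto intro!: arg_cong[where f=card])
      \<comment> \<open>At least \<open>n + 1\<close> branches exist, and only
        \<open>1 + card ?S\<close> of them are regular.\<close>
      ultimately have 6: "card ?Z \<le> m" using cc(5) by linarith
      have 7: "\<not> weakly_spectrally_stable p f B ubar" if "card ?Z > 0"
        using cc(8) unstable order_less_le_trans[OF that 6] by blast
      have 8: "C1_curve (cc (Some j))" if "\<beta> j \<noteq> 0" for j using cc(2)[of "Some j"] that by simp
      show ?thesis using 1 2 3 4 5 6 7 8 cc(7) by blast
    qed
  qed
  have part_b': "\<not> weakly_spectrally_stable p f B ubar" if N: "det N = 0"
  proof -
    obtain \<beta> where \<beta>: "eigenvalue_list (cmat (N ** matrix_inv A0)) \<beta>" using eigenvalue_list_exists by blast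
    have "det (cmat (N ** matrix_inv A0)) = 0" using N by (simp add: det_cmat det_mul)
    then obtain j where "\<beta> j = 0" using eigenvalue_list_0[OF \<beta>] by blast
    then have "card {j. \<beta> j = 0} > 0" by (auto simp: card_gt_0_iff)
    then show ?thesis using part_b[OF \<beta>] by blast
  qed
  show ?thesis
    unfolding jf
    by (intro conjI impI allI; (erule (1) part_a | erule (1) part_a' | rule conjunct1[OF part_b] | erule part_b'); assumption?)
qed

end
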